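(* Let $d$ and $h$ be positive integers. There is a randomized oracle $\mathcal O$ which, given $\varepsilon \in (0,1/2)$ and query access (in the bounded-degree query model) to a finite graph $G=(V,E)$ with maximum degree at most $d$, provides query access to a function $f:V \to 2^V$ (on query $v\in V$ it returns $f(v)$), such that, with $k = O\left(\frac{d^5 \cdot h^{O(h)} \cdot \log(d/\varepsilon)}{\varepsilon^3}\right)$, the following hold: \begin{enumerate} \item For all $v \in V$, $v \in f(v)$. \item For all $v \in V$ and all $w \in f(v)$, $f(v) = f(w)$. \item If the treewidth of $G$ is at most $h$, then with probability at least $9/10$ (over the oracle's random bits), $|\{(v,w) \in E: f(v) \ne f(w)\}| \le \varepsilon|V|$. \item For all $v \in V$, $|f(v)| \le k$. \item To answer a single query to the oracle, $\mathcal O$ makes $O(dk^{4h+7})$ queries to the input graph, and its processing time is $\tilde O(k^{4h+O(1)} \cdot \log Q)$, where $Q$ is the number of previous queries to the oracle. \item The partition described by $f$ is a function of $G$ and the random bits of the oracle only, and does not depend on the queries made to the oracle. \end{enumerate}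
   Context: Bounded-degree query model: the vertices of the input graph $G=(V,E)$ have degree at most $d$; an algorithm accesses $G$ only via queries: for $v\in V$ it can obtain $\deg(v)$, and for $1\le j\le \deg(v)$ it can obtain the label of the $j$-th neighbor of $v$; each query costs constant time. A tree decomposition of $G$ is a pair $(\mathcal X,\mathcal T)$ where $\mathcal X=(X_1,\dots,X_m)$ are subsets of $V$ and $\mathcal T$ is a forest on these nodes such that every vertex lies in some $X_i$, every edge has both endpoints in some $X_i$, and for each vertex $v$ the nodes containing $v$ form a connected subgraph of $\mathcal T$; its width is $\max_i|X_i|-1$, and the treewidth of $G$ is the minimum width over all tree decompositions. *)

theory Defs
  imports "HOL-Probability.Probability"
begin

section \<open>Graphs and treewidth\<close>

definition fin_graph :: "'a set \<Rightarrow> 'a set set \<Rightarrow> bool" where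
  "fin_graph V E \<longleftrightarrow> finite V \<and> E \<subseteq> {{v, w} | v w. v \<in> V \<and> w \<in> V \<and> v \<noteq> w}"

definition neighbors :: "'a set set \<Rightarrow> 'a \<Rightarrow> 'a set" where
  "neighbors E v = {w. {v, w} \<in> E}"

definition max_degree_le :: "'a set \<Rightarrow> 'a set set \<Rightarrow> nat \<Rightarrow> bool" where
  "max_degree_le V E d \<longleftrightarrow> (\<forall>v\<in>V. card (neighbors E v) \<le> d)"

definition is_cycle :: "'a set set \<Rightarrow> 'a list \<Rightarrow> bool" where
  "is_cycle T p \<longleftrightarrow> length p \<ge> 3 \<and> distinct p \<and>
     (\<forall>i<length p. {p ! i, p ! (Suc i mod length p)} \<in> T)"

definition forest :: "'a set \<Rightarrow> 'a set set \<Rightarrow> bool" where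
  "forest N T \<longleftrightarrow> fin_graph N T \<and> (\<nexists>p. is_cycle T p)"

definition induces_connected :: "'a set set \<Rightarrow> 'a set \<Rightarrow> bool" where
  "induces_connected T N \<longleftrightarrow>
     (\<forall>i\<in>N. \<forall>j\<in>N. (i, j) \<in> {(a, b). a \<in> N \<and> b \<in> N \<and> {a, b} \<in> T}\<^sup>*)"

text \<open>The nodes of the forest are the positions in the list of bags, so that equal bags
  at different positions are different nodes.\<close>

definition tree_decomposition ::
    "'a set \<Rightarrow> 'a set set \<Rightarrow> 'a set list \<Rightarrow> nat set set \<Rightarrow> bool" where
  "tree_decomposition V E Xs T \<longleftrightarrow>
     Xs \<noteq> [] \<and> (\<forall>X\<in>set Xs. X \<subseteq> V) \<and> forest {..<length Xs} T \<and>
     (\<forall>v\<in>V. \<exists>X\<in>set Xs. v \<in> X) \<and>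
     (\<forall>e\<in>E. \<exists>X\<in>set Xs. e \<subseteq> X) \<and>
     (\<forall>v\<in>V. induces_connected T {i. i < length Xs \<and> v \<in> Xs ! i})"

text \<open>Integer-valued: the empty graph has treewidth \<open>-1\<close>.\<close>

definition width :: "'a set list \<Rightarrow> int" where
  "width Xs = int (Max (card ` set Xs)) - 1"

definition treewidth :: "'a set \<Rightarrow> 'a set set \<Rightarrow> int" where
  "treewidth V E = Min {width Xs | Xs T. tree_decomposition V E Xs T}"

text \<open>The minimum in \<open>treewidth\<close> ranges over a finite nonempty set.\<close>

lemma finite_widths:
  assumes "finite V"
  shows "finite {width Xs | Xs T. tree_decomposition V E Xs T}"
proof (rule finite_subset)
  show "{width Xs | Xs T. tree_decomposition V E Xs T} \<subseteq> {-1 .. int (card V)}"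
  proof
    fix w assume "w \<in> {width Xs | Xs T. tree_decomposition V E Xs T}"
    then obtain Xs T where w: "w = width Xs" and td: "tree_decomposition V E Xs T" by auto
    have "Max (card ` set Xs) \<in> card ` set Xs"
      using td by (intro Max_in) (auto simp: tree_decomposition_def)
    then obtain X where "X \<in> set Xs" "Max (card ` set Xs) = card X" by auto
    moreover have "card X \<le> card V"
      using td \<open>X \<in> set Xs\<close> assms by (intro card_mono) (auto simp: tree_decomposition_def)
    ultimately show "w \<in> {-1 .. int (card V)}" by (simp add: w width_def)
  qed
qed simp

lemma tree_decomposition_single_bag:
  assumes "fin_graph V E"
  shows "tree_decomposition V E [V] {}"
proof -
  have "\<not> is_cycle {} p" for p :: "nat list"
    by (cases p) (auto simp: is_cycle_def)
  then show ?thesis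
    using assms
    by (auto simp: tree_decomposition_def forest_def fin_graph_def induces_connected_def)
qed

lemma treewidth_le_iff:
  assumes "fin_graph V E"
  shows "treewidth V E \<le> w \<longleftrightarrow> (\<exists>Xs T. tree_decomposition V E Xs T \<and> width Xs \<le> w)"
proof -
  have "finite V" using assms by (simp add: fin_graph_def)
  moreover have "width [V] \<in> {width Xs | Xs T. tree_decomposition V E Xs T}"
    using tree_decomposition_single_bag[OF assms] by blast
  ultimately show ?thesis
    unfolding treewidth_def by (subst Min_le_iff[OF finite_widths]) auto
qed


section \<open>The bounded-degree query model\<close>

text \<open>Vertices are labelled by natural numbers. A graph is accessed through neighbor lists;
  the order of each list is arbitrary.\<close>

definition neighbor_lists :: "nat set \<Rightarrow> nat set set \<Rightarrow> (nat \<Rightarrow> nat list) \<Rightarrow> bool" where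
  "neighbor_lists V E nbr \<longleftrightarrow> (\<forall>v\<in>V. distinct (nbr v) \<and> set (nbr v) = neighbors E v)"

text \<open>
  Algorithms are programs of a unit-cost random access machine whose memory cells hold natural
  numbers and whose arithmetic is addition and truncated subtraction.

  \<^item> \<open>Degree a b\<close> and \<open>Neighbor a b c\<close> are the queries to the graph: the degree of the vertex
    in cell \<open>b\<close>, and its neighbor whose index (counted from 1) is in cell \<open>c\<close>.
  \<^item> \<open>JumpEps a b l\<close> is the access to the real parameter \<open>\<epsilon>\<close>: it compares \<open>\<epsilon> * x\<close> with \<open>y\<close>
    for the numbers \<open>x\<close>, \<open>y\<close> in cells \<open>a\<close>, \<open>b\<close>.
  \<^item> \<open>Coin a b\<close> flips the coin whose name is in cell \<open>b\<close>. Each coin can be flipped only once in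
    the lifetime of the machine, so a random bit that is needed again has to be kept in memory.
    The names only serve to speak of the outcome as a function of the random bits.
  \<^item> \<open>Emit a\<close> adds the vertex in cell \<open>a\<close> to the answer.

  Querying a nonexistent vertex or neighbor, flipping a coin twice and leaving the program
  without \<open>Halt\<close> are errors (\<open>None\<close>).
\<close>

datatype instr =
    Const nat nat
  | Add nat nat nat
  | Sub nat nat nat
  | Load nat nat
  | Store nat nat
  | JumpLe nat nat nat
  | JumpEps nat nat nat
  | Degree nat nat
  | Neighbor nat nat nat
  | Coin nat nat
  | Emit nat
  | Halt

type_synonym program = "instr list"

record env =
  eps :: real
  verts :: "nat set"
  nbrs :: "nat \<Rightarrow> nat list"
  coins :: "nat \<Rightarrow> bool"

text \<open>The part of the state that persists between queries to the oracle.\<close>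

record store =
  mem :: "nat \<Rightarrow> nat"
  flipped :: "nat set"

record config = store +
  pc :: nat
  probes :: nat
  answer :: "nat set"

definition next_pc :: "config \<Rightarrow> config" where
  "next_pc s = s\<lparr>pc := Suc (pc s)\<rparr>"

definition put :: "nat \<Rightarrow> nat \<Rightarrow> config \<Rightarrow> config" where
  "put a x s = next_pc (s\<lparr>mem := (mem s)(a := x)\<rparr>)"

definition goto_if :: "bool \<Rightarrow> nat \<Rightarrow> config \<Rightarrow> config" where
  "goto_if b l s = (if b then s\<lparr>pc := l\<rparr> else next_pc s)"

definition count_probe :: "config \<Rightarrow> config" where
  "count_probe s = s\<lparr>probes := Suc (probes s)\<rparr>"

fun exec :: "env \<Rightarrow> instr \<Rightarrow> config \<Rightarrow> config option" where
  "exec I (Const a n) s = Some (put a n s)"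
| "exec I (Add a b c) s = Some (put a (mem s b + mem s c) s)"
| "exec I (Sub a b c) s = Some (put a (mem s b - mem s c) s)"
| "exec I (Load a b) s = Some (put a (mem s (mem s b)) s)"
| "exec I (Store a b) s = Some (put (mem s a) (mem s b) s)"
| "exec I (JumpLe a b l) s = Some (goto_if (mem s a \<le> mem s b) l s)"
| "exec I (JumpEps a b l) s = Some (goto_if (eps I * real (mem s a) \<le> real (mem s b)) l s)"
| "exec I (Degree a b) s =
     (let v = mem s b in
      if v \<in> verts I then Some (count_probe (put a (length (nbrs I v)) s)) else None)"
| "exec I (Neighbor a b c) s =
     (let v = mem s b; j = mem s c in
      if v \<in> verts I \<and> 1 \<le> j \<and> j \<le> length (nbrs I v)
      then Some (count_probe (put a (nbrs I v ! (j - 1)) s)) else None)"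
| "exec I (Coin a b) s =
     (let x = mem s b in
      if x \<in> flipped s then None
      else Some (put a (of_bool (coins I x)) (s\<lparr>flipped := insert x (flipped s)\<rparr>)))"
| "exec I (Emit a) s = Some (next_pc (s\<lparr>answer := insert (mem s a) (answer s)\<rparr>))"
| "exec I Halt s = None"

definition step :: "env \<Rightarrow> program \<Rightarrow> config \<Rightarrow> config option" where
  "step I P s = (if pc s < length P then exec I (P ! pc s) s else None)"

definition halted :: "program \<Rightarrow> config \<Rightarrow> bool" where
  "halted P s \<longleftrightarrow> pc s < length P \<and> P ! pc s = Halt"

fun run :: "env \<Rightarrow> program \<Rightarrow> nat \<Rightarrow> config \<Rightarrow> config option" where
  "run I P 0 s = Some s"
| "run I P (Suc t) s = Option.bind (step I P s) (run I P t)"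

text \<open>A query \<open>v\<close> to the oracle is placed in cell 0.\<close>

definition start :: "store \<Rightarrow> nat \<Rightarrow> config" where
  "start st v = \<lparr>mem = (mem st)(0 := v), flipped = flipped st, pc = 0, probes = 0, answer = {}\<rparr>"

definition fresh_store :: store where
  "fresh_store = \<lparr>mem = (\<lambda>_. 0), flipped = {}\<rparr>"

text \<open>\<open>answers I P st v st' S q t\<close>: in state \<open>st\<close>, the oracle answers the query \<open>v\<close> with the
  set \<open>S\<close>, making \<open>q\<close> queries to the graph in \<open>t\<close> steps, and is then in state \<open>st'\<close>.\<close>

definition answers ::
    "env \<Rightarrow> program \<Rightarrow> store \<Rightarrow> nat \<Rightarrow> store \<Rightarrow> nat set \<Rightarrow> nat \<Rightarrow> nat \<Rightarrow> bool" where
  "answers I P st v st' S q t \<longleftrightarrow>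
     (\<exists>s. run I P t (start st v) = Some s \<and> halted P s \<and>
          st' = store.truncate s \<and> S = answer s \<and> q = probes s)"

text \<open>\<open>after_queries I P Q st\<close>: \<open>st\<close> is the state after some sequence of \<open>Q\<close> queries.\<close>

inductive after_queries :: "env \<Rightarrow> program \<Rightarrow> nat \<Rightarrow> store \<Rightarrow> bool" for I P where
  "after_queries I P 0 fresh_store"
| "after_queries I P Q st \<Longrightarrow> v \<in> verts I \<Longrightarrow> answers I P st v st' S q t \<Longrightarrow>
     after_queries I P (Suc Q) st'"


section \<open>Random bits and partitions\<close>

definition coin_space :: "(nat \<Rightarrow> bool) measure" where
  "coin_space = Pi\<^sub>M UNIV (\<lambda>_. measure_pmf (bernoulli_pmf (1/2)))"

definition cut_edges :: "'a set set \<Rightarrow> ('a \<Rightarrow> 'b) \<Rightarrow> 'a set set" where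
  "cut_edges E f = {{v, w} | v w. {v, w} \<in> E \<and> f v \<noteq> f w}"

end

(* Every vertex w chooses a connected set S(w) containing w that is isolated: it has at most K vertices,
   at most t = 2h+1 neighbours, and at most |S(w)| / Delta boundary edges; S(w) = {w} if there is none.
   Vertices draw random ranks of L bits, the owner of v is the vertex w of lowest rank with v in S(w),
   and a part consists of the vertices with a common owner.

   Few vertices lack an isolated set: a sweep along an elimination order of a chordal completion finds a
   separator of O(h |V| / K) vertices whose removal leaves pieces with at most K vertices and t
   neighbours. An edge between parts is a boundary edge of the set of an owner, so it is charged to the
   members of that set. A vertex x is charged by the sets through x that are not covered by those of
   lower rank. Among any connected sets through x with at most t neighbours, (t+1)! have the same
   union, so in expectation only O((t+1)! L) sets are uncovered, and the harmonic sum over the ranks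
   yields the factor L.

   The isolated sets of a vertex are enumerated by breadth-first searches in which the at most t
   positions that must not be expanded are guessed, in B^t ways with B = K + t. As v lies in S(w), v is
   reached from w and w from v in this manner, which gives k^(2t+O(1)) queries to the graph. *)

theory Submission
  imports Defs
begin

section \<open>Connected sets and a covering lemma\<close>

text \<open>The bound \<open>t\<close> on the neighbours serves twice. A search from a vertex of a
  connected set finds the set once it is told at which positions to stop, so few neighbours make the
  isolated sets through a vertex enumerable. The same bound tames the overlaps: the sets through a
  vertex have a small subcover, so at most \<open>(t+1)! K\<close> of them exist, and this number
  fixes how many different ranks are required. Ranks of \<open>L\<close> bits may coincide; vertex
  labels break the ties. The value \<open>2h+1\<close> is the size of a clique of at most
  \<open>h\<close> unprocessed vertices plus one older bag of at most \<open>h+1\<close>. Among its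
  isolated sets a vertex must choose one in a way that ignores the order of neighbour lists and the
  history of queries, so that the partition is a function of the graph and the coins. The largest
  binary encoding is used. \<open>L\<close> must satisfy \<open>(t+1)! K \<le> 2 ^ L\<close>. The
  machine only adds and subtracts, and taking \<open>L\<close> proportional to
  \<open>1/\<epsilon>\<close> avoids computing a logarithm; then \<open>\<Delta>\<close> grows like
  \<open>L/\<epsilon>\<close> and \<open>K\<close> like \<open>\<Delta>/\<epsilon>\<close>, which is
  the third power of \<open>1/\<epsilon>\<close>.\<close>

definition nbd :: "'a set set \<Rightarrow> 'a set \<Rightarrow> 'a set" where
  "nbd E S = {w. w \<notin> S \<and> (\<exists>u\<in>S. {u, w} \<in> E)}"

definition adj_in :: "'a set set \<Rightarrow> 'a set \<Rightarrow> ('a \<times> 'a) set" where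
  "adj_in E S = {(a, b). a \<in> S \<and> b \<in> S \<and> {a, b} \<in> E}"

definition comp_of :: "'a set set \<Rightarrow> 'a set \<Rightarrow> 'a \<Rightarrow> 'a set" where
  "comp_of E S x = {z. (x, z) \<in> (adj_in E S)\<^sup>*}"

lemma induces_connected_adj_in:
  "induces_connected E S \<longleftrightarrow> (\<forall>i\<in>S. \<forall>j\<in>S. (i, j) \<in> (adj_in E S)\<^sup>*)"
  by (simp add: induces_connected_def adj_in_def)

lemma sym_adj_in: "sym (adj_in E S)"
  by (auto simp: sym_def adj_in_def insert_commute)

lemma comp_of_self [simp]: "x \<in> comp_of E S x"
  by (simp add: comp_of_def)

lemma comp_of_subset:
  assumes "x \<in> S" shows "comp_of E S x \<subseteq> S"
proof
  fix z assume "z \<in> comp_of E S x"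
  then have "(x, z) \<in> (adj_in E S)\<^sup>*" by (simp add: comp_of_def)
  then show "z \<in> S" using assms by (induction rule: rtrancl_induct) (auto simp: adj_in_def)
qed

lemma comp_of_step:
  assumes "u \<in> comp_of E S x" "u \<in> S" "w \<in> S" "{u, w} \<in> E"
  shows "w \<in> comp_of E S x"
  using assms unfolding comp_of_def by (auto simp: adj_in_def intro: rtrancl_into_rtrancl)

text \<open>A walk in \<open>S\<close> that starts at \<open>x\<close> meets only vertices of the
  component, so it is also a walk in the relation restricted to the component.\<close>

lemma comp_of_connected: "induces_connected E (comp_of E S x)"
proof -
  let ?C = "comp_of E S x"
  have reach: "(x, a) \<in> (adj_in E ?C)\<^sup>*" if "(x, a) \<in> (adj_in E S)\<^sup>*" for a
    using that
  proof (induction rule: rtrancl_induct)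
    case (step y z)
    then have "y \<in> ?C" "z \<in> ?C" by (auto simp: comp_of_def)
    with step show ?case by (auto simp: adj_in_def intro: rtrancl_into_rtrancl)
  qed simp
  have symr: "sym ((adj_in E ?C)\<^sup>*)" by (rule sym_rtrancl[OF sym_adj_in])
  show ?thesis unfolding induces_connected_adj_in
  proof (intro ballI)
    fix a b assume "a \<in> ?C" "b \<in> ?C"
    then have "(x, a) \<in> (adj_in E ?C)\<^sup>*" "(x, b) \<in> (adj_in E ?C)\<^sup>*"
      using reach by (auto simp: comp_of_def)
    then show "(a, b) \<in> (adj_in E ?C)\<^sup>*" using symD[OF symr] by (meson rtrancl_trans)
  qed
qed

lemma comp_of_sym:
  assumes "y \<in> comp_of E S x" shows "comp_of E S y = comp_of E S x"
proof -
  have xy: "(x, y) \<in> (adj_in E S)\<^sup>*" using assms by (simp add: comp_of_def)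
  then have "(y, x) \<in> (adj_in E S)\<^sup>*" using symD[OF sym_rtrancl[OF sym_adj_in]] by metis
  with xy show ?thesis by (auto simp: comp_of_def intro: rtrancl_trans)
qed

lemma nbd_comp_of: "nbd E (comp_of E S x) \<inter> S = {}" if "x \<in> S"
  using comp_of_step[of _ E S x] comp_of_subset[OF that, of E] by (auto simp: nbd_def)

text \<open>The witness is the vertex at which a walk inside \<open>S'\<close> leaves \<open>S\<close> for the last time.\<close>

lemma last_exit:
  assumes "induces_connected E S'" "x \<in> S'" "x \<in> S" "z \<in> S'" "z \<notin> S"
  shows "\<exists>y \<in> nbd E S \<inter> S'. z \<in> comp_of {e \<in> E. e \<inter> S = {}} (S' - S) y"
proof -
  let ?r = "adj_in {e \<in> E. e \<inter> S = {}} (S' - S)"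
  have "(x, z) \<in> (adj_in E S')\<^sup>*" using assms by (auto simp: induces_connected_adj_in)
  then have "z \<notin> S \<longrightarrow> (\<exists>y \<in> nbd E S \<inter> S'. (y, z) \<in> ?r\<^sup>*)"
  proof (induction rule: rtrancl_induct)
    case base
    then show ?case using assms by simp
  next
    case (step y z)
    show ?case
    proof
      assume z: "z \<notin> S"
      have yz: "y \<in> S'" "z \<in> S'" "{y, z} \<in> E" using step(2) by (auto simp: adj_in_def)
      show "\<exists>y \<in> nbd E S \<inter> S'. (y, z) \<in> ?r\<^sup>*"
      proof (cases "y \<in> S")
        case True
        then have "z \<in> nbd E S \<inter> S'" using yz z by (auto simp: nbd_def)
        then show ?thesis by blast
      next
        case False
        then have "(y, z) \<in> ?r" using yz z by (auto simp: adj_in_def)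
        then show ?thesis using step.IH False by (meson rtrancl_into_rtrancl)
      qed
    qed
  qed
  then show ?thesis using assms by (auto simp: comp_of_def)
qed

text \<open>Induction on \<open>t\<close>: fix one of the sets, \<open>S i0\<close>. A set that is not contained in it passes through one of
  the at most \<open>t\<close> vertices in \<open>nbd E (S i0)\<close>. Outside \<open>S i0\<close>, the components of these sets at this vertex
  have one neighbour less.\<close>

lemma small_subcover:
  fixes S :: "'i \<Rightarrow> 'a set"
  assumes "finite I"
    and "\<And>i. i \<in> I \<Longrightarrow> finite (S i) \<and> x \<in> S i \<and> induces_connected E (S i) \<and>
           finite (nbd E (S i)) \<and> card (nbd E (S i)) \<le> t"
  shows "\<exists>J\<subseteq>I. card J \<le> fact (Suc t) \<and> (\<Union>i\<in>I. S i) \<subseteq> (\<Union>i\<in>J. S i)"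
  using assms
proof (induction t arbitrary: E x S I)
  case 0
  show ?case
  proof (cases "I = {}")
    case False
    then obtain i0 where i0: "i0 \<in> I" by blast
    have "S i \<subseteq> S i0" if i: "i \<in> I" for i
    proof (rule ccontr)
      assume "\<not> S i \<subseteq> S i0"
      then obtain z where "z \<in> S i" "z \<notin> S i0" by blast
      with last_exit[of E "S i" x "S i0" z] 0(2)[OF i] 0(2)[OF i0] show False by auto
    qed
    then show ?thesis using i0 by (intro exI[of _ "{i0}"]) auto
  qed simp
next
  case (Suc t)
  show ?case
  proof (cases "I = {}")
    case False
    \<comment> \<open>The set chosen has the largest cardinality, so that no other set can contain
      it properly.\<close>
    obtain i0 where i0: "i0 \<in> I" and suc_max: "\<And>i. i \<in> I \<Longrightarrow> card (S i) \<le> card (S i0)"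
    proof -
      have "Max ((\<lambda>i. card (S i)) ` I) \<in> (\<lambda>i. card (S i)) ` I"
        using False Suc.prems(1) by (intro Max_in) auto
      then obtain i where "i \<in> I" "card (S i) = Max ((\<lambda>i. card (S i)) ` I)" by auto
      then show ?thesis using Suc.prems(1) by (intro that[of i]) auto
    qed
    let ?N = "nbd E (S i0)" and ?E = "{e \<in> E. e \<inter> S i0 = {}}"
    define C where "C = (\<lambda>y i. comp_of ?E (S i - S i0) y)"
    have ex: "\<exists>J\<subseteq>{i \<in> I. y \<in> S i}. card J \<le> fact (Suc t) \<and>
                (\<Union>i\<in>{i \<in> I. y \<in> S i}. C y i) \<subseteq> (\<Union>i\<in>J. C y i)"
      if y: "y \<in> ?N" for y
    proof (rule Suc.IH[of "{i \<in> I. y \<in> S i}" "C y" y ?E])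
      show "finite {i \<in> I. y \<in> S i}" using Suc.prems(1) by simp
    next
      fix i assume "i \<in> {i \<in> I. y \<in> S i}"
      then have i: "i \<in> I" "y \<in> S i" by auto
      have y0: "y \<notin> S i0" using y by (simp add: nbd_def)
      have CS: "C y i \<subseteq> S i - S i0" unfolding C_def using i y0 by (intro comp_of_subset) auto
      have fin: "finite (C y i)" using CS Suc.prems(2)[OF i(1)] finite_subset by blast
      \<comment> \<open>Passing to a component inside \<open>S i - S i0\<close> creates no
        neighbours: edges that meet \<open>S i0\<close> are deleted in \<open>?E\<close>, and
        vertices of \<open>S i - S i0\<close> next to the component belong to it.\<close>
      have sub: "nbd ?E (C y i) \<subseteq> nbd E (S i) - S i0"
      proof
        fix w assume w: "w \<in> nbd ?E (C y i)"
        then obtain u where u: "u \<in> C y i" "{u, w} \<in> ?E" "w \<notin> C y i" by (auto simp: nbd_def)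
        have "w \<notin> S i"
        proof
          assume "w \<in> S i"
          then have "w \<in> C y i" using u CS unfolding C_def by (auto intro: comp_of_step[of u])
          then show False using u by simp
        qed
        then show "w \<in> nbd E (S i) - S i0" using u CS by (auto simp: nbd_def)
      qed
      \<comment> \<open>The neighbour that is lost. \<open>S i\<close> reaches outside
        \<open>S i0\<close> and is not larger, hence misses a vertex of \<open>S i0\<close>; a walk
        inside \<open>S i0\<close> from \<open>x\<close> to that vertex leaves \<open>S i\<close>
        through a neighbour of \<open>S i\<close>.\<close>
      have "nbd E (S i) \<inter> S i0 \<noteq> {}"
      proof -
        have "\<not> S i0 \<subseteq> S i"
        proof
          assume "S i0 \<subseteq> S i"
          then have "S i0 \<subset> S i" using i y0 by blast
          then have "card (S i0) < card (S i)"
            using Suc.prems(2)[OF i(1)] by (intro psubset_card_mono) auto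
          then show False using suc_max[OF i(1)] by simp
        qed
        then obtain z where "z \<in> S i0" "z \<notin> S i" by blast
        with last_exit[of E "S i0" x "S i" z] Suc.prems(2)[OF i(1)] Suc.prems(2)[OF i0]
        show ?thesis by auto
      qed
      then have "nbd E (S i) - S i0 \<subset> nbd E (S i)" by blast
      then have "card (nbd E (S i) - S i0) < card (nbd E (S i))"
        using Suc.prems(2)[OF i(1)] by (intro psubset_card_mono) auto
      moreover have "card (nbd ?E (C y i)) \<le> card (nbd E (S i) - S i0)"
        using sub Suc.prems(2)[OF i(1)] by (intro card_mono) auto
      moreover have "finite (nbd ?E (C y i))"
        using sub Suc.prems(2)[OF i(1)] by (meson finite_Diff finite_subset)
      moreover have "induces_connected ?E (C y i)"
        unfolding C_def by (rule comp_of_connected)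
      ultimately show "finite (C y i) \<and> y \<in> C y i \<and> induces_connected ?E (C y i) \<and>
           finite (nbd ?E (C y i)) \<and> card (nbd ?E (C y i)) \<le> t"
        using fin Suc.prems(2)[OF i(1)] by (auto simp: C_def)
    qed
    then have "\<forall>y\<in>?N. \<exists>J. J\<subseteq>{i \<in> I. y \<in> S i} \<and> card J \<le> fact (Suc t) \<and>
                (\<Union>i\<in>{i \<in> I. y \<in> S i}. C y i) \<subseteq> (\<Union>i\<in>J. C y i)" by blast
    from bchoice[OF this] obtain J where J': "\<forall>y\<in>?N. J y\<subseteq>{i \<in> I. y \<in> S i} \<and>
        card (J y) \<le> fact (Suc t) \<and> (\<Union>i\<in>{i \<in> I. y \<in> S i}. C y i) \<subseteq> (\<Union>i\<in>J y. C y i)" ..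
    note J = bspec[OF J']
    have fN: "finite ?N" "card ?N \<le> Suc t" using Suc.prems(2)[OF i0] by auto
    let ?J = "insert i0 (\<Union>y\<in>?N. J y)"
    have "card (\<Union>y\<in>?N. J y) \<le> (\<Sum>y\<in>?N. card (J y))" using fN by (intro card_UN_le)
    also have "\<dots> \<le> (\<Sum>y\<in>?N. fact (Suc t))" using J by (intro sum_mono) auto
    also have "\<dots> \<le> Suc t * fact (Suc t)"
      using mult_le_mono1[OF fN(2), of "fact (Suc t)"] by (simp del: fact_Suc)
    finally have "card ?J \<le> Suc (Suc t * fact (Suc t))"
      by (cases "finite (\<Union>y\<in>?N. J y)") (auto simp: card_insert_if simp del: fact_Suc)
    \<comment> \<open>The recurrence behind the factorial:
      \<open>(t+1) * (t+1)! + 1 \<le> (t+2)!\<close>, one family for each neighbour of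
      \<open>S i0\<close> and \<open>S i0\<close> itself.\<close>
    also have "\<dots> \<le> fact (Suc (Suc t))"
      using fact_ge_1[of "Suc t", where ?'a = nat] by (simp del: fact_Suc add: fact_Suc[of "Suc t"])
    finally have "card ?J \<le> fact (Suc (Suc t))" .
    moreover have "?J \<subseteq> I" using i0 J by auto
    moreover have "(\<Union>i\<in>I. S i) \<subseteq> (\<Union>i\<in>?J. S i)"
    proof
      fix z assume "z \<in> (\<Union>i\<in>I. S i)"
      then obtain i where i: "i \<in> I" "z \<in> S i" by blast
      show "z \<in> (\<Union>i\<in>?J. S i)"
      proof (cases "z \<in> S i0")
        case False
        then obtain y where y: "y \<in> ?N" "y \<in> S i" "z \<in> C y i"
          using last_exit[of E "S i" x "S i0" z] Suc.prems(2)[OF i(1)] Suc.prems(2)[OF i0] i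
          unfolding C_def by auto
        then obtain j where j: "j \<in> J y" "z \<in> C y j" using J[OF y(1)] i by blast
        have "y \<in> S j - S i0" using J[OF y(1)] j y by (auto simp: nbd_def)
        then have "z \<in> S j" using comp_of_subset[of y "S j - S i0" ?E] j by (auto simp: C_def)
        then show ?thesis using j y by blast
      qed simp
    qed
    ultimately show ?thesis by blast
  qed simp
qed

section \<open>Separators in graphs of bounded treewidth\<close>

lemma forest_leaf:
  assumes fin: "finite M" and ne: "M \<noteq> {}" and loop: "\<And>i. {i, i} \<notin> T"
    and acyc: "\<nexists>p. is_cycle T p"
  shows "\<exists>l\<in>M. \<forall>i\<in>M. \<forall>j\<in>M. {l, i} \<in> T \<longrightarrow> {l, j} \<in> T \<longrightarrow> i = j"
proof (rule ccontr)
  assume "\<not> ?thesis"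
  then have two: "\<exists>i\<in>M. \<exists>j\<in>M. {l, i} \<in> T \<and> {l, j} \<in> T \<and> i \<noteq> j" if "l \<in> M" for l
    using that by blast
  define path where "path = (\<lambda>p. p \<noteq> [] \<and> distinct p \<and> set p \<subseteq> M \<and>
      (\<forall>i. Suc i < length p \<longrightarrow> {p ! i, p ! Suc i} \<in> T))"
  obtain m where m: "m \<in> M" using ne by blast
  have p1: "path [m]" using m by (simp add: path_def)
  have bound: "length p \<le> card M" if "path p" for p
    using that fin distinct_card[of p] card_mono[of M "set p"] by (simp add: path_def)
  \<comment> \<open>On a longest path, every neighbour in \<open>M\<close> of the first vertex lies
    on the path. If no vertex were a leaf, one of these neighbours would differ from the second
    vertex and close a cycle.\<close>
  have "\<exists>p. path p \<and> (\<forall>q. path q \<longrightarrow> length q \<le> length p)"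
    using ex_has_greatest_nat[of path "[m]" length "Suc (card M)"] p1 bound by (simp add: le_imp_less_Suc)
  then obtain p where p: "path p" and suc_max: "\<And>q. path q \<Longrightarrow> length q \<le> length p" by blast
  obtain x ps where xps: "p = x # ps" using p by (cases p) (auto simp: path_def)
  have xM: "x \<in> M" using p xps by (simp add: path_def)
  have inp: "a \<in> set ps" if a: "a \<in> M" "{x, a} \<in> T" for a
  proof (rule ccontr)
    assume n: "a \<notin> set ps"
    have "a \<noteq> x" using a loop by auto
    then have "path (a # p)"
      using p n a unfolding path_def xps by (auto simp: nth_Cons insert_commute split: nat.splits)
    then show False using suc_max by fastforce
  qed
  obtain a where a: "a \<in> M" "{x, a} \<in> T" "ps = [] \<or> a \<noteq> hd ps"
    using two[OF xM] by metis
  from inp[OF a(1,2)] obtain i where i: "i < length ps" "ps ! i = a" by (auto simp: in_set_conv_nth)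
  have i0: "i \<noteq> 0"
  proof
    assume "i = 0"
    with i a(3) show False by (cases ps) auto
  qed
  \<comment> \<open>The prefix of the path that ends in \<open>a\<close>, which has index
    \<open>i + 1\<close> in \<open>p\<close>. The prefix has at least three vertices because
    \<open>i\<close> is not 0.\<close>
  have "is_cycle T (take (Suc (Suc i)) p)"
    unfolding is_cycle_def
  proof (intro conjI allI impI)
    have len: "length (take (Suc (Suc i)) p) = Suc (Suc i)" using i by (simp add: xps)
    show "3 \<le> length (take (Suc (Suc i)) p)" using i0 unfolding len by simp
    show "distinct (take (Suc (Suc i)) p)" using p by (simp add: path_def)
    fix j assume "j < length (take (Suc (Suc i)) p)"
    then have j: "j \<le> Suc i" using len by simp
    show "{take (Suc (Suc i)) p ! j, take (Suc (Suc i)) p ! (Suc j mod length (take (Suc (Suc i)) p))} \<in> T"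
    proof (cases "j = Suc i")
      case True
      then show ?thesis using a i unfolding len by (simp add: xps insert_commute)
    next
      case False
      then have "Suc j < length p" using j i by (simp add: xps)
      then show ?thesis using p j False unfolding len by (simp add: path_def)
    qed
  qed
  then show False using acyc by blast
qed

text \<open>A perfect elimination order: \<open>H\<close> is a chordal completion, and the later
  \<open>H\<close>-neighbours of every vertex form a clique.\<close>

definition later :: "'a set set \<Rightarrow> 'a \<Rightarrow> 'a list \<Rightarrow> 'a set" where
  "later H v vs = {w \<in> set vs. {v, w} \<in> H}"

definition clique :: "'a set set \<Rightarrow> 'a set \<Rightarrow> bool" where
  "clique H U \<longleftrightarrow> (\<forall>a\<in>U. \<forall>b\<in>U. a \<noteq> b \<longrightarrow> {a, b} \<in> H)"

fun elim_order :: "nat \<Rightarrow> 'a set set \<Rightarrow> 'a list \<Rightarrow> bool" where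
  "elim_order h H [] \<longleftrightarrow> True"
| "elim_order h H (v # vs) \<longleftrightarrow> v \<notin> set vs \<and> card (later H v vs) \<le> h \<and>
     clique H (later H v vs) \<and> elim_order h H vs"

lemma elim_order_cong:
  assumes "\<And>a b. a \<in> set vs \<Longrightarrow> b \<in> set vs \<Longrightarrow> {a, b} \<in> H \<longleftrightarrow> {a, b} \<in> H'"
  shows "elim_order h H vs \<longleftrightarrow> elim_order h H' vs"
  using assms
proof (induction vs)
  case (Cons v vs)
  have "later H v vs = later H' v vs" using Cons.prems by (auto simp: later_def)
  moreover have "clique H (later H' v vs) \<longleftrightarrow> clique H' (later H' v vs)"
    using Cons.prems unfolding clique_def later_def by auto
  ultimately show ?case using Cons by auto
qed simp

text \<open>Vertices whose \<open>H\<close>-neighbours all lie in one clique \<open>X\<close> of at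
  most \<open>h + 1\<close> vertices may be eliminated before everything else: the later neighbours
  form a subset of \<open>X\<close> without the vertex itself, hence a clique of size at most
  \<open>h\<close>.\<close>

lemma elim_order_append:
  assumes "elim_order h H vs" "distinct ps" "set ps \<inter> set vs = {}"
    and X: "finite X" "card X \<le> Suc h" "clique H X"
    and ps: "set ps \<subseteq> X" "\<And>a w. a \<in> set ps \<Longrightarrow> {a, w} \<in> H \<Longrightarrow> w \<in> X"
    and loop: "\<And>a. {a, a} \<notin> H"
  shows "elim_order h H (ps @ vs)"
  using assms(2,3) ps
proof (induction ps)
  case Nil
  then show ?case using assms(1) by simp
next
  case (Cons a ps)
  have sub: "later H a (ps @ vs) \<subseteq> X - {a}"
    using Cons.prems loop by (auto simp: later_def)
  have "card (later H a (ps @ vs)) \<le> card (X - {a})" using sub X by (intro card_mono) auto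
  also have "\<dots> \<le> h" using X Cons.prems by simp
  finally have "card (later H a (ps @ vs)) \<le> h" .
  moreover have "clique H (later H a (ps @ vs))"
    using X(3) sub unfolding clique_def by blast
  ultimately show ?case using Cons by auto
qed

text \<open>The chordal completion that belongs to a tree decomposition: every bag is made a
  clique.\<close>

definition co_bag :: "'i set \<Rightarrow> ('i \<Rightarrow> 'a set) \<Rightarrow> 'a set set" where
  "co_bag M X = {{a, b} | a b. a \<noteq> b \<and> (\<exists>i\<in>M. a \<in> X i \<and> b \<in> X i)}"

lemma co_bag_iff: "{a, b} \<in> co_bag M X \<longleftrightarrow> a \<noteq> b \<and> (\<exists>i\<in>M. a \<in> X i \<and> b \<in> X i)"
  unfolding co_bag_def by (auto simp: doubleton_eq_iff)

text \<open>Induction on the number of nodes, removing a leaf \<open>l\<close>. The vertices that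
  occur only in \<open>X l\<close> are eliminated first. The others in \<open>X l\<close> also occur
  in the bag of the unique neighbour of \<open>l\<close>, so adjacency among them is unaffected by
  the removal.\<close>

lemma elim_order_of_bags:
  fixes X :: "nat \<Rightarrow> 'a set"
  assumes "finite M" "\<And>i. {i, i} \<notin> T" "\<nexists>p. is_cycle T p"
    and "\<And>i. i \<in> M \<Longrightarrow> finite (X i) \<and> card (X i) \<le> Suc h"
    and "\<And>v. induces_connected T {i \<in> M. v \<in> X i}"
  shows "\<exists>vs. set vs = (\<Union>i\<in>M. X i) \<and> elim_order h (co_bag M X) vs"
  using assms(1,4,5)
proof (induction "card M" arbitrary: M)
  case 0
  then show ?case by (intro exI[of _ "[]"]) auto
next
  case (Suc m)
  obtain l where l: "l \<in> M" and leaf: "\<And>i j. i \<in> M \<Longrightarrow> j \<in> M \<Longrightarrow> {l, i} \<in> T \<Longrightarrow> {l, j} \<in> T \<Longrightarrow> i = j"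
    using forest_leaf[OF Suc.prems(1) _ assms(2,3)] Suc.hyps(2) by fastforce
  let ?M = "M - {l}"
  \<comment> \<open>A walk from \<open>l\<close> to \<open>i\<close> through nodes that contain
    \<open>v\<close> begins with a step to a neighbour of \<open>l\<close>.\<close>
  have up: "\<exists>p\<in>?M. {l, p} \<in> T \<and> v \<in> X p" if "i \<in> ?M" "v \<in> X i" "v \<in> X l" for i v
  proof -
    have "(l, i) \<in> (adj_in T {i \<in> M. v \<in> X i})\<^sup>*"
      using Suc.prems(3)[of v] that l by (auto simp: induces_connected_adj_in)
    then show ?thesis
    proof (cases rule: converse_rtranclE)
      case base
      then show ?thesis using that by simp
    next
      case (step j)
      then show ?thesis using assms(2)[of l] by (auto simp: adj_in_def)
    qed
  qed
  have conn: "induces_connected T {i \<in> ?M. v \<in> X i}" for v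
    unfolding induces_connected_adj_in
  proof (intro ballI)
    fix i j assume i: "i \<in> {i \<in> ?M. v \<in> X i}" and j: "j \<in> {i \<in> ?M. v \<in> X i}"
    let ?r = "adj_in T {i \<in> ?M. v \<in> X i}"
    have "(i, j) \<in> (adj_in T {i \<in> M. v \<in> X i})\<^sup>*"
      using Suc.prems(3)[of v] i j by (auto simp: induces_connected_adj_in)
    \<comment> \<open>A walk enters and leaves the leaf by the same neighbour, so visits to
      \<open>l\<close> can be cut out. While the walk stands at \<open>l\<close>, the invariant
      speaks of that neighbour instead.\<close>
    then have "(j \<noteq> l \<longrightarrow> (i, j) \<in> ?r\<^sup>*) \<and> (j = l \<longrightarrow> (\<forall>p\<in>M. {l, p} \<in> T \<longrightarrow> (i, p) \<in> ?r\<^sup>*))"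
    proof (induction rule: rtrancl_induct)
      case base
      then show ?case using i by simp
    next
      case (step y z)
      have yz: "y \<in> M" "z \<in> M" "v \<in> X y" "v \<in> X z" "{y, z} \<in> T"
        using step(2) by (auto simp: adj_in_def)
      then have ne: "y \<noteq> z" using assms(2) by auto
      consider "z = l" | "y = l" | "y \<noteq> l" "z \<noteq> l" by blast
      then show ?case
      proof cases
        case 1
        then have "p = y" if "p \<in> M" "{l, p} \<in> T" for p
          using leaf[OF that(1) yz(1) that(2)] yz by (simp add: insert_commute)
        then show ?thesis using step.IH 1 ne by blast
      next
        case 2
        then show ?thesis using step.IH yz ne by auto
      next
        case 3
        then have "(y, z) \<in> ?r" using yz by (auto simp: adj_in_def)
        then show ?thesis using step.IH 3 by (auto intro: rtrancl_into_rtrancl)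
      qed
    qed
    then show "(i, j) \<in> ?r\<^sup>*" using j by auto
  qed
  have "m = card ?M" using Suc.hyps(2) Suc.prems(1) l by simp
  from Suc.hyps(1)[OF this] Suc.prems conn
  obtain vs where vs: "set vs = (\<Union>i\<in>?M. X i)" "elim_order h (co_bag ?M X) vs" by auto
  have "{a, b} \<in> co_bag ?M X \<longleftrightarrow> {a, b} \<in> co_bag M X" if ab: "a \<in> set vs" "b \<in> set vs" for a b
  proof
    assume "{a, b} \<in> co_bag M X"
    then obtain i where i: "a \<noteq> b" "i \<in> M" "a \<in> X i" "b \<in> X i" by (auto simp: co_bag_iff)
    show "{a, b} \<in> co_bag ?M X"
    proof (cases "i = l")
      case True
      obtain p q where "p \<in> ?M" "{l, p} \<in> T" "a \<in> X p" "q \<in> ?M" "{l, q} \<in> T" "b \<in> X q"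
        using up ab i True vs(1) by (metis UN_E)
      moreover from this have "p = q" using leaf by blast
      ultimately show ?thesis using i by (auto simp: co_bag_iff)
    qed (use i in \<open>auto simp: co_bag_iff\<close>)
  qed (auto simp: co_bag_iff)
  then have vs2: "elim_order h (co_bag M X) vs" using vs(2) elim_order_cong by blast
  have "finite (X l - set vs)" using Suc.prems l by auto
  then obtain ps where ps: "set ps = X l - set vs" "distinct ps"
    using finite_distinct_list by blast
  have "elim_order h (co_bag M X) (ps @ vs)"
  proof (rule elim_order_append[OF vs2 ps(2), where X = "X l"])
    show "clique (co_bag M X) (X l)" using l by (auto simp: clique_def co_bag_iff)
    fix a w assume "a \<in> set ps" "{a, w} \<in> co_bag M X"
    then show "w \<in> X l" using ps vs by (auto simp: co_bag_iff)
  next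
    show "{a, a} \<notin> co_bag M X" for a using co_bag_iff[of a a M X] by blast
  qed (use ps Suc.prems l in auto)
  moreover have "set (ps @ vs) = (\<Union>i\<in>M. X i)" using ps vs l by auto
  ultimately show ?case by blast
qed

lemma treewidth_elim_order:
  assumes G: "fin_graph V E" and tw: "treewidth V E \<le> int h"
  shows "\<exists>H vs. E \<subseteq> H \<and> set vs = V \<and> elim_order h H vs"
proof -
  obtain Xs T where td: "tree_decomposition V E Xs T" and w: "width Xs \<le> int h"
    using tw treewidth_le_iff[OF G] by blast
  let ?M = "{..<length Xs}" and ?X = "\<lambda>i. Xs ! i"
  have XV: "X \<subseteq> V" if "X \<in> set Xs" for X using td that by (auto simp: tree_decomposition_def)
  have finV: "finite V" using G by (simp add: fin_graph_def)
  have cardX: "card X \<le> Suc h" if "X \<in> set Xs" for X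
  proof -
    have "card X \<le> Max (card ` set Xs)" using that by simp
    then show ?thesis using w by (simp add: width_def)
  qed
  have V: "(\<Union>i\<in>?M. ?X i) = V"
    using td XV unfolding tree_decomposition_def by (fastforce simp: in_set_conv_nth)
  have "\<exists>vs. set vs = (\<Union>i\<in>?M. ?X i) \<and> elim_order h (co_bag ?M ?X) vs"
  proof (rule elim_order_of_bags)
    show "{i, i} \<notin> T" for i
      using td by (auto simp: tree_decomposition_def forest_def fin_graph_def doubleton_eq_iff)
    show "\<nexists>p. is_cycle T p" using td by (simp add: tree_decomposition_def forest_def)
    show "finite (?X i) \<and> card (?X i) \<le> Suc h" if "i \<in> ?M" for i
      using that XV cardX finV finite_subset[of "Xs ! i" V] by auto
    show "induces_connected T {i \<in> ?M. v \<in> ?X i}" for v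
    proof (cases "v \<in> V")
      case True
      then show ?thesis using td by (simp add: tree_decomposition_def)
    next
      case False
      then have "{i \<in> ?M. v \<in> ?X i} = {}" using V by auto
      then show ?thesis unfolding induces_connected_def by blast
    qed
  qed simp
  moreover have "E \<subseteq> co_bag ?M ?X"
  proof
    fix e assume e: "e \<in> E"
    then obtain a b where ab: "e = {a, b}" "a \<noteq> b" using G by (auto simp: fin_graph_def)
    moreover obtain X where "X \<in> set Xs" "e \<subseteq> X" using td e by (auto simp: tree_decomposition_def)
    ultimately show "e \<in> co_bag ?M ?X" by (auto simp: co_bag_iff in_set_conv_nth)
  qed
  ultimately show ?thesis using V by metis
qed

text \<open>\<open>elim_inv\<close> describes a sweep along an elimination order. \<open>vs\<close> is still to be processed, \<open>R\<close> is
  the separator chosen so far with \<open>q\<close> cuts, and the processed part outside \<open>R\<close> consists of finished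
  pieces (\<open>done_piece\<close>) and of pending pieces \<open>P c\<close>. A pending piece has its remaining neighbours in
  the clique \<open>Q c\<close> of unprocessed vertices and in \<open>D c\<close>, which is empty or the bag of one cut below.
  In the last conjunct, a cut with \<open>card (P c) \<ge> K\<close> pays for itself and for one nonempty \<open>D c\<close>, and
  a cut that merges two nonempty sets \<open>D c\<close> is paid for by the one that disappears.\<close>

definition done_piece :: "'a set set \<Rightarrow> nat \<Rightarrow> nat \<Rightarrow> 'a set \<Rightarrow> 'a set \<Rightarrow> 'a \<Rightarrow> bool" where
  "done_piece E K t R A x \<longleftrightarrow>
     (\<exists>F. x \<in> F \<and> F \<subseteq> A - R \<and> card F \<le> K \<and> nbd E F \<subseteq> R \<and> card (nbd E F) \<le> t)"

definition elim_inv where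
  "elim_inv V E H h K vs R C P D Q q \<longleftrightarrow>
     R \<subseteq> V \<and> finite C \<and> C \<subseteq> V - set vs \<and>
     (\<forall>c\<in>C. P c \<subseteq> V - set vs - R \<and> card (P c) \<le> K \<and> D c \<subseteq> R \<and> card (D c) \<le> Suc h \<and>
        Q c \<subseteq> set vs \<and> card (Q c) \<le> h \<and> clique H (Q c) \<and> nbd E (P c) \<subseteq> Q c \<union> D c) \<and>
     (\<forall>x\<in>R \<inter> set vs. \<exists>c\<in>C. x \<in> Q c \<and> x \<in> D c) \<and>
     (\<forall>x\<in>R - set vs. \<forall>y\<in>set vs - R. {x, y} \<in> E \<longrightarrow> (\<exists>c\<in>C. x \<in> D c \<and> y \<in> Q c)) \<and>
     (\<forall>x\<in>V - set vs - R. (\<exists>c\<in>C. x \<in> P c) \<or> done_piece E K (2 * h + 1) R (V - set vs) x) \<and>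
     card R \<le> Suc h * q \<and>
     K * (q + card {c \<in> C. D c \<noteq> {}}) + 2 * (\<Sum>c\<in>C. card (P c)) \<le> 2 * card (V - set vs)"

section \<open>The sweep along an elimination order\<close>

lemma done_piece_mono:
  assumes "done_piece E K t R A x" "R \<subseteq> R'" "A \<subseteq> A'" "(R' - R) \<inter> A = {}"
  shows "done_piece E K t R' A' x"
proof -
  obtain F where F: "x \<in> F" "F \<subseteq> A - R" "card F \<le> K" "nbd E F \<subseteq> R" "card (nbd E F) \<le> t"
    using assms(1) unfolding done_piece_def by (elim exE conjE)
  have "F \<subseteq> A' - R'" "nbd E F \<subseteq> R'" using F assms(2-4) by blast+
  then show ?thesis using F unfolding done_piece_def by (intro exI[of _ F]) simp
qed

lemma sweep_arith_merge:
  fixes a b s s' n :: nat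
  assumes "a \<le> b" "b + 2 * s \<le> 2 * n" "s' \<le> Suc s"
  shows "a + 2 * s' \<le> 2 * Suc n"
  using assms by presburger

text \<open>The potential pays for a cut. Here \<open>a\<close> and \<open>b\<close> count the
  nonempty sets \<open>D c\<close> of the items that contain the current vertex in
  \<open>Q c\<close> and of the remaining ones; \<open>s\<close> and \<open>s0\<close> are the sizes
  of their pending pieces. A cut adds \<open>2 * K\<close>, for \<open>q\<close> and for the new
  bag. Either two nonempty sets disappear, or at least \<open>K\<close> pending vertices do, each
  with weight 2.\<close>

lemma sweep_arith_cut:
  fixes a b s s0 n K q :: nat
  assumes "K * (q + (a + b)) + 2 * (s + s0) \<le> 2 * n" "2 \<le> a \<or> K \<le> s"
  shows "K * (Suc q + Suc b) + 2 * s0 \<le> 2 * Suc n"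
proof (cases "2 \<le> a")
  case True
  then have "K * (Suc q + Suc b) \<le> K * (q + (a + b))" by (intro mult_le_mono2) linarith
  then show ?thesis using assms(1) unfolding mult_Suc_right distrib_left by simp
next
  case False
  then have "K \<le> s" using assms by simp
  moreover have "K * (Suc q + Suc b) = K * (q + b) + 2 * K" by (simp add: algebra_simps)
  moreover have "K * (q + b) \<le> K * (q + (a + b))" by (intro mult_le_mono2) linarith
  moreover have "x + 2 * s0 \<le> 2 * Suc n"
    if "K \<le> s" "x = y + 2 * K" "y \<le> z" "z + 2 * (s + s0) \<le> 2 * n" for x y z :: nat
    using that by presburger
  ultimately show ?thesis using assms(1) by blast
qed

text \<open>Processing \<open>v\<close> joins all pending pieces with \<open>v\<close> in
  \<open>Q c\<close>, and \<open>v\<close> itself unless it is already in \<open>R\<close>. The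
  result stays pending, with the later neighbours of \<open>v\<close> as its clique, if it is small
  and involves at most one bag. Otherwise \<open>v\<close> and its later neighbours join the
  separator; each of the old pieces is then surrounded by \<open>R\<close> and is finished
  separately.\<close>

lemma elim_sweep:
  assumes fin: "finite V" and EV: "\<And>a b. {a, b} \<in> E \<Longrightarrow> a \<in> V \<and> b \<in> V" and EH: "E \<subseteq> H"
    and "set vs \<subseteq> V" "elim_order h H vs" "elim_inv V E H h K vs R C P D Q q"
  shows "\<exists>R C P D Q q. elim_inv V E H h K [] R C P D Q q"
  using assms(4-6)
proof (induction vs arbitrary: R C P D Q q)
  case Nil
  then show ?case by blast
next
  case (Cons v vs)
  note inv = Cons.prems(3)[unfolded elim_inv_def]
  define A where "A = V - set (v # vs)"
  have v: "v \<in> V" "v \<notin> set vs" "v \<notin> A" using Cons.prems by (auto simp: A_def)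
  have A': "V - set vs = insert v A" using v by (auto simp: A_def)
  have finA: "finite A" using fin by (simp add: A_def)
  let ?U = "later H v vs"
  have U: "?U \<subseteq> set vs" "card ?U \<le> h" "clique H ?U" "v \<notin> ?U" "finite ?U"
    using Cons.prems v by (auto simp: later_def)
  define Ch where "Ch = {c \<in> C. v \<in> Q c}"
  define C0 where "C0 = C - Ch"
  have vC: "v \<notin> C" using inv by auto
  have RV: "R \<subseteq> V" and finC: "finite C" and CA: "C \<subseteq> A"
    and item: "\<And>c. c \<in> C \<Longrightarrow> P c \<subseteq> A - R \<and> card (P c) \<le> K \<and> D c \<subseteq> R \<and> card (D c) \<le> Suc h \<and>
        Q c \<subseteq> insert v (set vs) \<and> card (Q c) \<le> h \<and> clique H (Q c) \<and> nbd E (P c) \<subseteq> Q c \<union> D c"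
    and Rvs: "\<And>x. x \<in> R \<Longrightarrow> x \<in> insert v (set vs) \<Longrightarrow> \<exists>c\<in>C. x \<in> Q c \<and> x \<in> D c"
    and RA: "\<And>x y. x \<in> R \<Longrightarrow> x \<notin> insert v (set vs) \<Longrightarrow> y \<in> insert v (set vs) \<Longrightarrow> y \<notin> R \<Longrightarrow>
        {x, y} \<in> E \<Longrightarrow> \<exists>c\<in>C. x \<in> D c \<and> y \<in> Q c"
    and piece: "\<And>x. x \<in> A - R \<Longrightarrow> (\<exists>c\<in>C. x \<in> P c) \<or> done_piece E K (2 * h + 1) R A x"
    and cR: "card R \<le> Suc h * q"
    and pot: "K * (q + card {c \<in> C. D c \<noteq> {}}) + 2 * (\<Sum>c\<in>C. card (P c)) \<le> 2 * card A"
    using inv unfolding A_def by (auto simp only: list.set(2) Diff_iff Int_iff)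
  have finR: "finite R" using RV fin finite_subset by blast
  have finPD: "finite (P c)" "finite (D c)" if "c \<in> C" for c
    using item[OF that] finA finR by (meson finite_subset finite_Diff)+
  have finCh: "finite Ch" "finite C0" "Ch \<subseteq> C" "C0 \<subseteq> C" "C = Ch \<union> C0" "Ch \<inter> C0 = {}"
    using finC by (auto simp: Ch_def C0_def)
  \<comment> \<open>\<open>Q c\<close> is a clique of \<open>H\<close>; once it contains
    \<open>v\<close>, its other members are later neighbours of \<open>v\<close>.\<close>
  have QU: "Q c \<subseteq> insert v ?U" if "c \<in> Ch" for c
  proof
    fix y assume y: "y \<in> Q c"
    have c: "c \<in> C" "v \<in> Q c" using that by (auto simp: Ch_def)
    show "y \<in> insert v ?U"
      using item[OF c(1)] c(2) y unfolding clique_def later_def by auto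
  qed
  have Q0: "Q c \<subseteq> set vs" if "c \<in> C0" for c
    using that item[of c] unfolding C0_def Ch_def by auto
  have vU: "y \<in> ?U" if "{v, y} \<in> E" "y \<in> set vs" for y
    using that EH by (auto simp: later_def)
  define Pn where "Pn = (\<Union>c\<in>Ch. P c) \<union> ({v} - R)"
  define Dn where "Dn = (\<Union>c\<in>Ch. D c)"
  have sumC: "(\<Sum>c\<in>C. f c) = (\<Sum>c\<in>Ch. f c) + (\<Sum>c\<in>C0. f c)" for f :: "_ \<Rightarrow> nat"
    using finCh by (metis sum.union_disjoint)
  have cardC: "card {c \<in> C. D c \<noteq> {}} = card {c \<in> Ch. D c \<noteq> {}} + card {c \<in> C0. D c \<noteq> {}}"
  proof -
    have "{c \<in> C. D c \<noteq> {}} = {c \<in> Ch. D c \<noteq> {}} \<union> {c \<in> C0. D c \<noteq> {}}" using finCh(5) by blast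
    then show ?thesis using finCh by (auto intro!: card_Un_disjoint)
  qed
  have PnA: "Pn \<subseteq> insert v A - R" using item finCh(3) unfolding Pn_def by blast
  have cardPn: "card Pn \<le> Suc (\<Sum>c\<in>Ch. card (P c))"
  proof -
    have "card Pn \<le> card (\<Union>c\<in>Ch. P c) + card ({v} - R)" unfolding Pn_def by (rule card_Un_le)
    also have "card (\<Union>c\<in>Ch. P c) \<le> (\<Sum>c\<in>Ch. card (P c))" using finCh by (intro card_UN_le)
    also have "card ({v} - R) \<le> 1" using card_mono[of "{v}" "{v} - R"] by auto
    finally show ?thesis by simp
  qed
  have cardA: "card (insert v A) = Suc (card A)" using finA v by simp
  have vs': "set vs \<subseteq> V" "elim_order h H vs" using Cons.prems by auto
  show ?case
  \<comment> \<open>The second condition keeps \<open>D v\<close> within one bag: the union of two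
    bags could have more than \<open>h + 1\<close> vertices.\<close>
  proof (cases "card Pn \<le> K \<and> card {c \<in> Ch. D c \<noteq> {}} \<le> 1")
    case True
    have Dn: "card Dn \<le> Suc h" "card {c \<in> C0. D c \<noteq> {}} + of_bool (Dn \<noteq> {}) \<le> card {c \<in> C. D c \<noteq> {}}"
    proof -
      show "card Dn \<le> Suc h"
      proof (cases "{c \<in> Ch. D c \<noteq> {}} = {}")
        case True
        then have "Dn = {}" by (auto simp: Dn_def)
        then show ?thesis by simp
      next
        case False
        then obtain c where c: "c \<in> Ch" "D c \<noteq> {}" by auto
        have "c' = c" if "c' \<in> Ch" "D c' \<noteq> {}" for c'
          using True c that finCh(1) card_le_Suc0_iff_eq[of "{c \<in> Ch. D c \<noteq> {}}"] by auto
        then have "Dn \<subseteq> D c" unfolding Dn_def by fastforce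
        then show ?thesis using item c finCh(3) finPD card_mono[of "D c" Dn]
          by (metis (no_types, lifting) le_trans subsetD)
      qed
      have "1 \<le> card {c \<in> Ch. D c \<noteq> {}}" if "Dn \<noteq> {}"
      proof -
        have "{c \<in> Ch. D c \<noteq> {}} \<noteq> {}" using that by (auto simp: Dn_def)
        then show ?thesis using finCh(1) by (simp add: Suc_le_eq card_gt_0_iff)
      qed
      then show "card {c \<in> C0. D c \<noteq> {}} + of_bool (Dn \<noteq> {}) \<le> card {c \<in> C. D c \<noteq> {}}"
        unfolding cardC by auto
    qed
    have nbdPn: "nbd E Pn \<subseteq> ?U \<union> Dn"
    proof
      fix w assume "w \<in> nbd E Pn"
      then obtain u where w: "w \<notin> Pn" and u: "u \<in> Pn" "{u, w} \<in> E" by (auto simp: nbd_def)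
      have vR: "v \<in> Dn" if "v \<in> R"
        using Rvs[OF that] unfolding Dn_def Ch_def by auto
      show "w \<in> ?U \<union> Dn"
      proof (cases "u = v \<and> v \<notin> R")
        case False
        then obtain c where c: "c \<in> Ch" "u \<in> P c" using u by (auto simp: Pn_def)
        then have "w \<in> nbd E (P c)" using w u by (auto simp: Pn_def nbd_def)
        then have "w \<in> Q c \<union> D c" using item[of c] c finCh(3) by blast
        then show ?thesis using QU[OF c(1)] c w vR unfolding Dn_def Pn_def by blast
      next
        case True
        have wV: "w \<in> V" using EV u by blast
        have wv: "w \<noteq> v" using w u True by auto
        consider "w \<in> set vs" | "w \<in> A" "w \<in> R" | "w \<in> A" "w \<notin> R"
          using wV wv by (auto simp: A_def)
        then show ?thesis
        proof cases
          case 1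
          then show ?thesis using vU u True by auto
        next
          case 2
          then obtain c where "c \<in> C" "w \<in> D c" "v \<in> Q c"
            using RA[of w v] True u wv by (auto simp: A_def insert_commute)
          then show ?thesis by (auto simp: Dn_def Ch_def)
        next
          \<comment> \<open>A processed vertex next to \<open>v\<close> outside the separator is not
            in a finished piece, since \<open>v\<close> would be a neighbour of that piece outside
            \<open>R\<close>. It is in a pending piece whose clique contains \<open>v\<close>, and
            this piece has been absorbed in \<open>Pn\<close>.\<close>
          case 3
          have wv_E: "{w, v} \<in> E" using u True by (simp add: insert_commute)
          from piece[of w] 3 consider c where "c \<in> C" "w \<in> P c" | "done_piece E K (2 * h + 1) R A w"
            by blast
          then show ?thesis
          proof cases
            case 1
            have "v \<notin> P c" using item[OF 1(1)] v by blast
            then have "v \<in> nbd E (P c)" using wv_E 1 by (auto simp: nbd_def)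
            then have "v \<in> Q c" using item[OF 1(1)] True by blast
            then show ?thesis using 1 w by (auto simp: Pn_def Ch_def)
          next
            case 2
            then obtain F where F: "w \<in> F" "F \<subseteq> A - R" "nbd E F \<subseteq> R" by (auto simp: done_piece_def)
            then have "v \<in> nbd E F" using wv_E v by (auto simp: nbd_def)
            then show ?thesis using F True by blast
          qed
        qed
      qed
    qed
    let ?C = "insert v C0" and ?P = "P(v := Pn)" and ?D = "D(v := Dn)" and ?Q = "Q(v := ?U)"
    have vC0: "v \<notin> C0" using vC finCh by auto
    have "elim_inv V E H h K vs R ?C ?P ?D ?Q q"
      unfolding elim_inv_def A'
    proof (intro conjI)
      show "\<forall>c\<in>?C. ?P c \<subseteq> insert v A - R \<and> card (?P c) \<le> K \<and> ?D c \<subseteq> R \<and> card (?D c) \<le> Suc h \<and>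
        ?Q c \<subseteq> set vs \<and> card (?Q c) \<le> h \<and> clique H (?Q c) \<and> nbd E (?P c) \<subseteq> ?Q c \<union> ?D c"
      proof
        fix c assume "c \<in> ?C"
        then consider "c = v" | "c \<in> C0" "c \<noteq> v" using vC0 by auto
        then show "?P c \<subseteq> insert v A - R \<and> card (?P c) \<le> K \<and> ?D c \<subseteq> R \<and> card (?D c) \<le> Suc h \<and>
          ?Q c \<subseteq> set vs \<and> card (?Q c) \<le> h \<and> clique H (?Q c) \<and> nbd E (?P c) \<subseteq> ?Q c \<union> ?D c"
        proof cases
          case 1
          have "Dn \<subseteq> R" using item finCh(3) by (auto simp: Dn_def)
          then show ?thesis using 1 PnA True Dn U nbdPn by simp
        next
          case 2
          then show ?thesis using item[of c] Q0[of c] finCh(4) by auto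
        qed
      qed
      show "\<forall>x\<in>R \<inter> set vs. \<exists>c\<in>?C. x \<in> ?Q c \<and> x \<in> ?D c"
      proof
        fix x assume x: "x \<in> R \<inter> set vs"
        then obtain c where c: "c \<in> C" "x \<in> Q c" "x \<in> D c" using Rvs by blast
        show "\<exists>c\<in>?C. x \<in> ?Q c \<and> x \<in> ?D c"
        proof (cases "c \<in> Ch")
          case True
          then show ?thesis using c QU[OF True] x v(2) by (intro bexI[of _ v]) (auto simp: Dn_def)
        next
          case False
          then show ?thesis using c vC by (intro bexI[of _ c]) (auto simp: C0_def)
        qed
      qed
      show "\<forall>x\<in>R - set vs. \<forall>y\<in>set vs - R. {x, y} \<in> E \<longrightarrow> (\<exists>c\<in>?C. x \<in> ?D c \<and> y \<in> ?Q c)"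
      proof (intro ballI impI)
        fix x y assume x: "x \<in> R - set vs" and y: "y \<in> set vs - R" and xy: "{x, y} \<in> E"
        show "\<exists>c\<in>?C. x \<in> ?D c \<and> y \<in> ?Q c"
        proof (cases "x = v")
          case True
          obtain c where "c \<in> C" "v \<in> Q c" "v \<in> D c" using Rvs[of v] x True by auto
          then have "v \<in> Dn" by (auto simp: Dn_def Ch_def)
          then show ?thesis using vU[of y] xy y True by (intro bexI[of _ v]) auto
        next
          case False
          then obtain c where c: "c \<in> C" "x \<in> D c" "y \<in> Q c" using RA[of x y] x y xy by auto
          show ?thesis
          proof (cases "c \<in> Ch")
            case True
            then show ?thesis using c QU[OF True] y v(2) by (intro bexI[of _ v]) (auto simp: Dn_def)
          next
            case False
            then show ?thesis using c vC by (intro bexI[of _ c]) (auto simp: C0_def)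
          qed
        qed
      qed
      show "\<forall>x\<in>insert v A - R. (\<exists>c\<in>?C. x \<in> ?P c) \<or> done_piece E K (2 * h + 1) R (insert v A) x"
      proof
        fix x assume x: "x \<in> insert v A - R"
        show "(\<exists>c\<in>?C. x \<in> ?P c) \<or> done_piece E K (2 * h + 1) R (insert v A) x"
        proof (cases "x \<in> Pn")
          case False
          then have "x \<in> A - R" using x by (auto simp: Pn_def)
          from piece[OF this] show ?thesis
          proof
            assume "\<exists>c\<in>C. x \<in> P c"
            then obtain c where "c \<in> C" "x \<in> P c" by blast
            moreover from this False have "c \<in> C0" by (auto simp: Pn_def C0_def)
            ultimately show ?thesis using vC by auto
          qed (use done_piece_mono[of E K "2 * h + 1" R A x R "insert v A"] in auto)
        qed simp
      qed
      show "card R \<le> Suc h * q" by (rule cR)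
      have "{c \<in> ?C. ?D c \<noteq> {}} = {c \<in> C0. D c \<noteq> {}} \<union> (if Dn \<noteq> {} then {v} else {})"
        using vC0 by auto
      then have "card {c \<in> ?C. ?D c \<noteq> {}} \<le> card {c \<in> C0. D c \<noteq> {}} + of_bool (Dn \<noteq> {})"
        using finCh by (auto simp: card_insert_if)
      then have 1: "K * (q + card {c \<in> ?C. ?D c \<noteq> {}}) \<le> K * (q + card {c \<in> C. D c \<noteq> {}})"
        using Dn(2) by (intro mult_le_mono2) linarith
      have "(\<Sum>c\<in>?C. card (?P c)) = card Pn + (\<Sum>c\<in>C0. card (?P c))" using finCh vC0 by simp
      also have "(\<Sum>c\<in>C0. card (?P c)) = (\<Sum>c\<in>C0. card (P c))" using vC0 by (intro sum.cong) auto
      finally have "(\<Sum>c\<in>?C. card (?P c)) \<le> Suc (\<Sum>c\<in>C. card (P c))" using cardPn sumC[of "\<lambda>c. card (P c)"] by simp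
      then show "K * (q + card {c \<in> ?C. ?D c \<noteq> {}}) + 2 * (\<Sum>c\<in>?C. card (?P c)) \<le> 2 * card (insert v A)"
        unfolding cardA by (rule sweep_arith_merge[OF 1 pot])
    qed (use RV finCh CA v A' in \<open>auto simp: A_def\<close>)
    from Cons.IH[OF vs' this] show ?thesis .
  next
    case False
    let ?B = "insert v ?U" and ?C = "insert v C0"
    \<comment> \<open>After the cut nothing is pending at \<open>v\<close>. The empty piece with the
      bag as its \<open>D v\<close> records which separator vertices may still touch the unprocessed
      part beyond the later neighbours of \<open>v\<close>.\<close>
    let ?P = "P(v := {})" and ?D = "D(v := ?B)" and ?Q = "Q(v := ?U)" and ?R = "R \<union> ?B"
    have vC0: "v \<notin> C0" using vC finCh by auto
    \<comment> \<open>The new separator vertices were unprocessed so far, hence old pieces remain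
      disjoint from the separator.\<close>
    have newA: "(?R - R) \<inter> A = {}" using v U by (auto simp: A_def)
    have cardB: "card ?B \<le> Suc h" using U by simp
    have "elim_inv V E H h K vs ?R ?C ?P ?D ?Q (Suc q)"
      unfolding elim_inv_def A'
    proof (intro conjI)
      show "\<forall>c\<in>?C. ?P c \<subseteq> insert v A - ?R \<and> card (?P c) \<le> K \<and> ?D c \<subseteq> ?R \<and> card (?D c) \<le> Suc h \<and>
        ?Q c \<subseteq> set vs \<and> card (?Q c) \<le> h \<and> clique H (?Q c) \<and> nbd E (?P c) \<subseteq> ?Q c \<union> ?D c"
      proof
        fix c assume "c \<in> ?C"
        then consider "c = v" | "c \<in> C0" "c \<noteq> v" using vC0 by auto
        then show "?P c \<subseteq> insert v A - ?R \<and> card (?P c) \<le> K \<and> ?D c \<subseteq> ?R \<and> card (?D c) \<le> Suc h \<and>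
          ?Q c \<subseteq> set vs \<and> card (?Q c) \<le> h \<and> clique H (?Q c) \<and> nbd E (?P c) \<subseteq> ?Q c \<union> ?D c"
        proof cases
          case 1
          then show ?thesis using cardB U by (auto simp: nbd_def)
        next
          case 2
          have "P c \<inter> ?R = {}" using item[of c] newA 2 finCh(4) by blast
          then show ?thesis using 2 item[of c] Q0[of c] finCh(4) by auto
        qed
      qed
      show "\<forall>x\<in>?R \<inter> set vs. \<exists>c\<in>?C. x \<in> ?Q c \<and> x \<in> ?D c"
      proof
        fix x assume x: "x \<in> ?R \<inter> set vs"
        show "\<exists>c\<in>?C. x \<in> ?Q c \<and> x \<in> ?D c"
        proof (cases "x \<in> ?U")
          case False
          then have "x \<in> R" using x v by auto
          then obtain c where c: "c \<in> C" "x \<in> Q c" "x \<in> D c" using Rvs[of x] x by blast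
          have "c \<notin> Ch" using QU[of c] c False x v(2) by auto
          then show ?thesis using c vC by (intro bexI[of _ c]) (auto simp: C0_def)
        qed auto
      qed
      show "\<forall>x\<in>?R - set vs. \<forall>y\<in>set vs - ?R. {x, y} \<in> E \<longrightarrow> (\<exists>c\<in>?C. x \<in> ?D c \<and> y \<in> ?Q c)"
      proof (intro ballI impI)
        fix x y assume x: "x \<in> ?R - set vs" and y: "y \<in> set vs - ?R" and xy: "{x, y} \<in> E"
        have xv: "x \<noteq> v" using vU[of y] xy y by auto
        then have "x \<in> R" using x U by auto
        then obtain c where c: "c \<in> C" "x \<in> D c" "y \<in> Q c" using RA[of x y] x y xy xv by auto
        have "c \<notin> Ch" using QU[of c] c y by auto
        then show "\<exists>c\<in>?C. x \<in> ?D c \<and> y \<in> ?Q c"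
          using c vC by (intro bexI[of _ c]) (auto simp: C0_def)
      qed
      show "\<forall>x\<in>insert v A - ?R. (\<exists>c\<in>?C. x \<in> ?P c) \<or> done_piece E K (2 * h + 1) ?R (insert v A) x"
      proof
        fix x assume "x \<in> insert v A - ?R"
        then have x: "x \<in> A - R" by auto
        from piece[OF this] show "(\<exists>c\<in>?C. x \<in> ?P c) \<or> done_piece E K (2 * h + 1) ?R (insert v A) x"
        proof
          assume "\<exists>c\<in>C. x \<in> P c"
          then obtain c where c: "c \<in> C" "x \<in> P c" by blast
          show ?thesis
          proof (cases "c \<in> Ch")
            case True
            have "nbd E (P c) \<subseteq> Q c \<union> D c" using item[OF c(1)] by blast
            moreover have "finite (Q c \<union> D c)" using item[OF c(1)] finPD[OF c(1)]
              by (meson finite_Un finite_subset finite_insert finite_set)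
            ultimately have "card (nbd E (P c)) \<le> card (Q c \<union> D c)" by (intro card_mono)
            also have "\<dots> \<le> card (Q c) + card (D c)" by (rule card_Un_le)
            \<comment> \<open>At most \<open>h\<close> neighbours in the clique and
              \<open>h + 1\<close> in the bag.\<close>
            also have "\<dots> \<le> 2 * h + 1" using item[OF c(1)] by linarith
            finally have "card (nbd E (P c)) \<le> 2 * h + 1" .
            moreover have "nbd E (P c) \<subseteq> ?R" using item[OF c(1)] QU[OF True] by blast
            moreover have "P c \<subseteq> insert v A - ?R" using item[OF c(1)] newA by blast
            ultimately show ?thesis using c item[OF c(1)] unfolding done_piece_def by blast
          next
            case False
            then show ?thesis using c vC by (intro disjI1 bexI[of _ c]) (auto simp: C0_def)
          qed
        next
          assume "done_piece E K (2 * h + 1) R A x"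
          from done_piece_mono[OF this, of ?R "insert v A"] newA show ?thesis by auto
        qed
      qed
      have "card ?R \<le> card R + card ?B" by (rule card_Un_le)
      then show "card ?R \<le> Suc h * Suc q" using cR cardB by simp
      have "{c \<in> ?C. ?D c \<noteq> {}} = insert v {c \<in> C0. D c \<noteq> {}}" using vC0 by auto
      then have 1: "card {c \<in> ?C. ?D c \<noteq> {}} = Suc (card {c \<in> C0. D c \<noteq> {}})"
        using finCh vC0 by simp
      have "(\<Sum>c\<in>?C. card (?P c)) = (\<Sum>c\<in>C0. card (?P c))" using finCh vC0 by simp
      also have "\<dots> = (\<Sum>c\<in>C0. card (P c))" using vC0 by (intro sum.cong) auto
      finally have 2: "(\<Sum>c\<in>?C. card (?P c)) = (\<Sum>c\<in>C0. card (P c))" .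
      let ?a = "card {c \<in> Ch. D c \<noteq> {}}" and ?b = "card {c \<in> C0. D c \<noteq> {}}"
      let ?s = "\<Sum>c\<in>Ch. card (P c)" and ?z = "\<Sum>c\<in>C0. card (P c)"
      have pot': "K * (q + (?a + ?b)) + 2 * (?s + ?z) \<le> 2 * card A"
        using pot unfolding cardC sumC[of "\<lambda>c. card (P c)"] .
      have "K * (Suc q + Suc ?b) + 2 * ?z \<le> 2 * Suc (card A)"
      proof (rule sweep_arith_cut[OF pot'])
        show "2 \<le> ?a \<or> K \<le> ?s" using False cardPn by (cases "card Pn \<le> K") auto
      qed
      then show "K * (Suc q + card {c \<in> ?C. ?D c \<noteq> {}}) + 2 * (\<Sum>c\<in>?C. card (?P c)) \<le> 2 * card (insert v A)"
        unfolding 1 2 cardA .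
      show "?R \<subseteq> V" using RV v U Cons.prems(1) by auto
    qed (use finCh CA v A' in \<open>auto simp: A_def\<close>)
    from Cons.IH[OF vs' this] show ?thesis .
  qed
qed

text \<open>When no vertex is left, every \<open>Q c\<close> is empty, so the pending pieces are
  enclosed by \<open>D c\<close> and count as pieces too. The potential gives
  \<open>K * q \<le> 2 * card V\<close>, and each of the \<open>q\<close> cuts contributes at most
  \<open>h + 1\<close> vertices.\<close>

lemma treewidth_separator:
  assumes G: "fin_graph V E" and tw: "treewidth V E \<le> int h"
  shows "\<exists>R\<subseteq>V. K * card R \<le> Suc h * (2 * card V) \<and>
    (\<forall>x\<in>V - R. \<exists>F. x \<in> F \<and> F \<subseteq> V - R \<and> card F \<le> K \<and> nbd E F \<subseteq> R \<and> card (nbd E F) \<le> 2 * h + 1)"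
proof -
  obtain H vs where H: "E \<subseteq> H" "set vs = V" "elim_order h H vs"
    using treewidth_elim_order[OF assms] by blast
  have fin: "finite V" using G by (simp add: fin_graph_def)
  have EV: "a \<in> V \<and> b \<in> V" if "{a, b} \<in> E" for a b
    using G that unfolding fin_graph_def by (fastforce simp: doubleton_eq_iff)
  have "elim_inv V E H h K vs {} {} (\<lambda>_. {}) (\<lambda>_. {}) (\<lambda>_. {}) 0"
    using H by (simp add: elim_inv_def)
  from elim_sweep[OF fin EV H(1) _ H(3) this] H(2)
  obtain R C P D Q q where inv: "elim_inv V E H h K [] R C P D Q q" by auto
  note inv = inv[unfolded elim_inv_def, simplified]
  have RV: "R \<subseteq> V" using inv by blast
  have cR: "card R \<le> Suc h * q" and "K * (q + card {c \<in> C. D c \<noteq> {}}) + 2 * (\<Sum>c\<in>C. card (P c)) \<le> 2 * card V"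
    using inv by auto
  then have "K * q \<le> 2 * card V" by (simp add: distrib_left)
  then have "Suc h * (K * q) \<le> Suc h * (2 * card V)" by (rule mult_le_mono2)
  moreover have "K * card R \<le> K * (Suc h * q)" using cR by (rule mult_le_mono2)
  ultimately have 1: "K * card R \<le> Suc h * (2 * card V)" by (simp only: mult.left_commute)
  have 2: "done_piece E K (2 * h + 1) R V x" if x: "x \<in> V - R" for x
  proof -
    have "(\<exists>c\<in>C. x \<in> P c) \<or> done_piece E K (2 * h + 1) R V x" using inv x by simp
    then show ?thesis
    proof
      assume "\<exists>c\<in>C. x \<in> P c"
      then obtain c where c: "c \<in> C" "x \<in> P c" by blast
      have "P c \<subseteq> V - R \<and> card (P c) \<le> K \<and> D c \<subseteq> R \<and> card (D c) \<le> Suc h \<and> Q c = {} \<and>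
          nbd E (P c) \<subseteq> Q c \<union> D c" using inv c(1) by blast
      then have c': "P c \<subseteq> V - R" "card (P c) \<le> K" "D c \<subseteq> R" "card (D c) \<le> Suc h" "nbd E (P c) \<subseteq> D c"
        by auto
      have "card (nbd E (P c)) \<le> card (D c)"
        using c' RV fin by (meson card_mono finite_subset)
      then show ?thesis using c c' unfolding done_piece_def by (intro exI[of _ "P c"]) auto
    qed
  qed
  show ?thesis
    by (intro exI[of _ R] conjI RV 1 ballI 2[unfolded done_piece_def])
qed

section \<open>Isolated sets and random ranks\<close>

definition bdry :: "'a set set \<Rightarrow> 'a set \<Rightarrow> ('a \<times> 'a) set" where
  "bdry E S = {(u, w). u \<in> S \<and> w \<notin> S \<and> {u, w} \<in> E}"

definition isolated :: "'a set set \<Rightarrow> nat \<Rightarrow> nat \<Rightarrow> nat \<Rightarrow> 'a set \<Rightarrow> bool" where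
  "isolated E K t \<Delta> S \<longleftrightarrow> induces_connected E S \<and> card S \<le> K \<and> card (nbd E S) \<le> t \<and>
     \<Delta> * card (bdry E S) \<le> card S"

lemma fin_graph_edge: "fin_graph V E \<Longrightarrow> {a, b} \<in> E \<Longrightarrow> a \<in> V \<and> b \<in> V \<and> a \<noteq> b"
  unfolding fin_graph_def by (fastforce simp: doubleton_eq_iff)

lemma bdry_subset: "fin_graph V E \<Longrightarrow> bdry E S \<subseteq> V \<times> V"
  using fin_graph_edge by (fastforce simp: bdry_def)

lemma finite_bdry: "fin_graph V E \<Longrightarrow> finite (bdry E S)"
  by (rule finite_subset[OF bdry_subset]) (auto simp: fin_graph_def)

text \<open>Pieces need not be connected, so the components of \<open>V - R\<close> are used
  instead; they inherit both bounds. Such a component fails to be isolated only if its size is below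
  \<open>\<Delta>\<close> times its boundary. Different components have disjoint sets of boundary
  pairs, all with outer end in \<open>R\<close>, hence at most \<open>d * card R\<close> in total.
  The vertices of \<open>R\<close> are added to the count.\<close>

lemma few_not_isolated:
  assumes G: "fin_graph V E" and deg: "max_degree_le V E d" and tw: "treewidth V E \<le> int h"
  shows "K * card {v \<in> V. \<not> (\<exists>S\<subseteq>V. v \<in> S \<and> isolated E K (2 * h + 1) \<Delta> S)}
           \<le> 2 * Suc h * (1 + d * \<Delta>) * card V"
proof -
  obtain R where R: "R \<subseteq> V" "K * card R \<le> Suc h * (2 * card V)"
    and F: "\<And>x. x \<in> V - R \<Longrightarrow> \<exists>F. x \<in> F \<and> F \<subseteq> V - R \<and> card F \<le> K \<and> nbd E F \<subseteq> R \<and> card (nbd E F) \<le> 2 * h + 1"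
    using treewidth_separator[OF G tw, of K] by blast
  have fin: "finite V" using G by (simp add: fin_graph_def)
  have finR: "finite R" using R fin finite_subset by blast
  let ?C = "comp_of E (V - R)"
  have CV: "?C x \<subseteq> V - R" if "x \<in> V - R" for x using comp_of_subset[OF that] .
  have finC: "finite (?C x)" if "x \<in> V - R" for x using CV[OF that] fin finite_subset by blast
  have C: "induces_connected E (?C x) \<and> card (?C x) \<le> K \<and> card (nbd E (?C x)) \<le> 2 * h + 1"
    if x: "x \<in> V - R" for x
  proof -
    obtain F where F: "x \<in> F" "F \<subseteq> V - R" "card F \<le> K" "nbd E F \<subseteq> R" "card (nbd E F) \<le> 2 * h + 1"
      using F[OF x] by blast
    have finF: "finite F" "finite (nbd E F)" using F fin finR by (meson finite_subset finite_Diff)+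
    \<comment> \<open>All neighbours of \<open>F\<close> are in \<open>R\<close>, so a walk in
      \<open>V - R\<close> cannot leave \<open>F\<close>.\<close>
    have CF: "?C x \<subseteq> F"
    proof
      fix z assume "z \<in> ?C x"
      then have "(x, z) \<in> (adj_in E (V - R))\<^sup>*" by (simp add: comp_of_def)
      then show "z \<in> F"
      proof (induction rule: rtrancl_induct)
        case (step y z)
        then have "z \<in> V - R" "{y, z} \<in> E" by (auto simp: adj_in_def)
        then show ?case using step.IH F(4) by (auto simp: nbd_def)
      qed (rule F)
    qed
    have "nbd E (?C x) \<subseteq> nbd E F"
    proof
      fix w assume w: "w \<in> nbd E (?C x)"
      then obtain u where u: "u \<in> ?C x" "{u, w} \<in> E" by (auto simp: nbd_def)
      have "w \<notin> V - R" using nbd_comp_of[OF x, of E] w by blast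
      then have "w \<notin> F" using F by blast
      then show "w \<in> nbd E F" using u CF by (auto simp: nbd_def)
    qed
    then have "card (nbd E (?C x)) \<le> 2 * h + 1" using card_mono[OF finF(2)] F(5) le_trans by blast
    moreover have "card (?C x) \<le> K" using card_mono[OF finF(1) CF] F(3) by linarith
    ultimately show ?thesis using comp_of_connected[of E "V - R" x] by blast
  qed
  define CC where "CC = {?C x | x. x \<in> V - R \<and> card (?C x) < \<Delta> * card (bdry E (?C x))}"
  have finCC: "finite CC" unfolding CC_def using fin by auto
  have "{v \<in> V. \<not> (\<exists>S\<subseteq>V. v \<in> S \<and> isolated E K (2 * h + 1) \<Delta> S)} \<subseteq> R \<union> \<Union>CC"
  proof
    fix v assume v: "v \<in> {v \<in> V. \<not> (\<exists>S\<subseteq>V. v \<in> S \<and> isolated E K (2 * h + 1) \<Delta> S)}"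
    show "v \<in> R \<union> \<Union>CC"
    proof (cases "v \<in> R")
      case False
      then have vR: "v \<in> V - R" using v by blast
      have "\<not> isolated E K (2 * h + 1) \<Delta> (?C v)"
      proof
        assume "isolated E K (2 * h + 1) \<Delta> (?C v)"
        moreover have "?C v \<subseteq> V" using CV[OF vR] by blast
        moreover have nv: "\<not> (\<exists>S\<subseteq>V. v \<in> S \<and> isolated E K (2 * h + 1) \<Delta> S)"
          using v unfolding mem_Collect_eq by (rule conjunct2)
        ultimately show False
          using spec[OF nv[unfolded not_ex], of "?C v"] comp_of_self[of v E "V - R"] by metis
      qed
      from this have "card (?C v) < \<Delta> * card (bdry E (?C v))"
        using C[OF vR] by (simp add: isolated_def)
      then have "?C v \<in> CC" using vR unfolding CC_def by blast
      then show ?thesis using comp_of_self[of v E "V - R"] by blast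
    qed simp
  qed
  moreover have "finite (R \<union> \<Union>CC)" using finR finCC finC by (auto simp: CC_def)
  ultimately have "card {v \<in> V. \<not> (\<exists>S\<subseteq>V. v \<in> S \<and> isolated E K (2 * h + 1) \<Delta> S)} \<le> card (R \<union> \<Union>CC)"
    by (rule card_mono[rotated])
  also have "\<dots> \<le> card R + card (\<Union>CC)" by (rule card_Un_le)
  also have "card (\<Union>CC) \<le> (\<Sum>A\<in>CC. card A)" using card_Union_le_sum_card by blast
  also have "\<dots> \<le> (\<Sum>A\<in>CC. \<Delta> * card (bdry E A))" by (rule sum_mono) (auto simp: CC_def)
  also have "\<dots> = \<Delta> * card (\<Union>A\<in>CC. bdry E A)"
  proof -
    have "card (\<Union>A\<in>CC. bdry E A) = (\<Sum>A\<in>CC. card (bdry E A))"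
    proof (rule card_UN_disjoint[OF finCC])
      show "\<forall>A\<in>CC. finite (bdry E A)" using finite_bdry[OF G] by blast
      show "\<forall>A\<in>CC. \<forall>B\<in>CC. A \<noteq> B \<longrightarrow> bdry E A \<inter> bdry E B = {}"
      proof (intro ballI impI)
        fix A B assume AB: "A \<in> CC" "B \<in> CC" "A \<noteq> B"
        then obtain x y where xy: "A = ?C x" "B = ?C y" by (auto simp: CC_def)
        have "z \<notin> A \<or> z \<notin> B" for z using comp_of_sym AB(3) unfolding xy by metis
        then show "bdry E A \<inter> bdry E B = {}" by (auto simp: bdry_def)
      qed
    qed
    then show ?thesis by (simp add: sum_distrib_left)
  qed
  also have "card (\<Union>A\<in>CC. bdry E A) \<le> d * card R"
  proof -
    have "(\<Union>A\<in>CC. bdry E A) \<subseteq> (\<lambda>(w, u). (u, w)) ` (SIGMA w:R. neighbors E w)"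
    proof
      fix p assume "p \<in> (\<Union>A\<in>CC. bdry E A)"
      then obtain x u w where p: "p = (u, w)" and x: "x \<in> V - R" and uw: "(u, w) \<in> bdry E (?C x)"
        by (cases p) (auto simp: CC_def)
      then have e: "{u, w} \<in> E" "w \<in> nbd E (?C x)" by (auto simp: bdry_def nbd_def)
      then have "w \<in> R" using nbd_comp_of[OF x, of E] fin_graph_edge[OF G e(1)] by blast
      then have "(w, u) \<in> (SIGMA w:R. neighbors E w)" using e by (auto simp: neighbors_def insert_commute)
      then show "p \<in> (\<lambda>(w, u). (u, w)) ` (SIGMA w:R. neighbors E w)" using p by force
    qed
    moreover have finN: "finite (neighbors E w)" for w
      using fin_graph_edge[OF G] fin by (auto simp: neighbors_def intro: finite_subset[of _ V])
    ultimately have "card (\<Union>A\<in>CC. bdry E A) \<le> card (SIGMA w:R. neighbors E w)"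
      using finR by (meson card_image_le card_mono finite_SigmaI finite_imageI le_trans)
    also have "\<dots> = (\<Sum>w\<in>R. card (neighbors E w))" using finN finR by simp
    also have "\<dots> \<le> (\<Sum>w\<in>R. d)" using deg R by (intro sum_mono) (auto simp: max_degree_le_def)
    finally show ?thesis by (simp add: mult.commute)
  qed
  finally have "card {v \<in> V. \<not> (\<exists>S\<subseteq>V. v \<in> S \<and> isolated E K (2 * h + 1) \<Delta> S)} \<le> card R + \<Delta> * (d * card R)"
    by simp
  also have "\<dots> = (1 + d * \<Delta>) * card R" by (simp add: algebra_simps)
  finally have le: "card {v \<in> V. \<not> (\<exists>S\<subseteq>V. v \<in> S \<and> isolated E K (2 * h + 1) \<Delta> S)} \<le> (1 + d * \<Delta>) * card R" .
  have "K * card {v \<in> V. \<not> (\<exists>S\<subseteq>V. v \<in> S \<and> isolated E K (2 * h + 1) \<Delta> S)} \<le> (1 + d * \<Delta>) * (K * card R)"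
    using mult_le_mono2[OF le, of K] by (simp only: mult.left_commute)
  also have "\<dots> \<le> (1 + d * \<Delta>) * (Suc h * (2 * card V))" using R(2) by (rule mult_le_mono2)
  finally show ?thesis by (simp add: algebra_simps)
qed

section \<open>Expected charge and cut edges under random ranks\<close>

lemma resample:
  fixes V :: "'a set" and N :: nat
  defines "\<Omega> \<equiv> PiE V (\<lambda>_. {..<N})"
  assumes w: "w \<in> V" and A: "A \<subseteq> {..<N}" "j \<in> A"
    and inv: "\<And>g a. g \<in> \<Omega> \<Longrightarrow> g w \<in> A \<Longrightarrow> a \<in> A \<Longrightarrow> P (g(w := a)) \<longleftrightarrow> P g"
  shows "card {g \<in> \<Omega>. g w = j \<and> P g} * card A = card {g \<in> \<Omega>. g w \<in> A \<and> P g}"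
proof -
  let ?X = "{g \<in> \<Omega>. g w = j \<and> P g}" and ?Y = "{g \<in> \<Omega>. g w \<in> A \<and> P g}"
  have upd: "g(w := a) \<in> \<Omega>" if "g \<in> \<Omega>" "a \<in> A" for g a
    using that A w unfolding \<Omega>_def by (auto simp: PiE_iff extensional_def)
  \<comment> \<open>Replacing the value at \<open>w\<close> by any \<open>a\<close> in
    \<open>A\<close> keeps \<open>P\<close>, so each map with value \<open>j\<close> accounts for
    \<open>card A\<close> maps. In other words, given \<open>P\<close> and a value in
    \<open>A\<close>, that value is uniform.\<close>
  have "bij_betw (\<lambda>(g, a). g(w := a)) (?X \<times> A) ?Y"
  proof (rule bij_betw_byWitness[where f' = "\<lambda>g. (g(w := j), g w)"])
    show "\<forall>p\<in>?X \<times> A. (\<lambda>g. (g(w := j), g w)) (case p of (g, a) \<Rightarrow> g(w := a)) = p" by auto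
    show "\<forall>g\<in>?Y. (case (g(w := j), g w) of (g, a) \<Rightarrow> g(w := a)) = g" by auto
    show "(\<lambda>(g, a). g(w := a)) ` (?X \<times> A) \<subseteq> ?Y" using upd inv A by auto
    show "(\<lambda>g. (g(w := j), g w)) ` ?Y \<subseteq> ?X \<times> A" using upd inv A by auto
  qed
  from bij_betw_same_card[OF this] show ?thesis by (simp add: card_cartesian_product)
qed

text \<open>Fix a rank \<open>r\<close> and let \<open>W\<close> be the indices of rank at most \<open>r\<close>. An index of rank \<open>r\<close> that is
  not covered by the smaller ranks belongs to the small subcover \<open>B W\<close>, or shares its rank with an
  element of \<open>B W\<close>. Neither \<open>W\<close> nor \<open>B W\<close> changes when ranks are resampled within
  \<open>{..r}\<close>, so both events have probability of order \<open>1 / (r + 1)\<close>.\<close>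

lemma sum_uncovered_le:
  fixes V D :: "'a set" and S :: "'a \<Rightarrow> 'b set" and c N :: nat
  defines "\<Omega> \<equiv> PiE V (\<lambda>_. {..<N})"
  assumes fin: "finite V" and D: "D \<subseteq> V"
    and cover: "\<And>W. W \<subseteq> D \<Longrightarrow> \<exists>J\<subseteq>W. card J \<le> c \<and> (\<Union>i\<in>W. S i) \<subseteq> (\<Union>i\<in>J. S i)"
    and N: "card D \<le> N" "N > 0"
  shows "(\<Sum>g\<in>\<Omega>. real (card {w \<in> D. \<not> S w \<subseteq> (\<Union>i\<in>{i \<in> D. g i < g w}. S i)}))
           \<le> 2 * real c * (\<Sum>r<N. 1 / real (Suc r)) * real (card \<Omega>)"
proof -
  define un where "un = (\<lambda>g w. \<not> S w \<subseteq> (\<Union>i\<in>{i \<in> D. g i < (g w :: nat)}. S i))"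
  define W where "W = (\<lambda>r g. {w \<in> D. g w \<le> (r::nat)})"
  have finD: "finite D" using D fin finite_subset by blast
  have fin\<Omega>: "finite \<Omega>" unfolding \<Omega>_def using fin by (intro finite_PiE) auto
  have "\<forall>X. \<exists>J. X \<subseteq> D \<longrightarrow> J \<subseteq> X \<and> card J \<le> c \<and> (\<Union>i\<in>X. S i) \<subseteq> (\<Union>i\<in>J. S i)"
    using cover by meson
  from choice[OF this] obtain B where
    B': "\<forall>X. X \<subseteq> D \<longrightarrow> B X \<subseteq> X \<and> card (B X) \<le> c \<and> (\<Union>i\<in>X. S i) \<subseteq> (\<Union>i\<in>B X. S i)" ..
  have BW: "B (W r g) \<subseteq> W r g" "card (B (W r g)) \<le> c" "(\<Union>i\<in>W r g. S i) \<subseteq> (\<Union>i\<in>B (W r g). S i)"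
    for r g using B'[rule_format, of "W r g"] by (auto simp: W_def)
  have WD: "W r g \<subseteq> D" for r g by (auto simp: W_def)
  have finW: "finite (W r g)" "finite (B (W r g))" for r g
    using finD WD BW(1) finite_subset by meson+
  let ?n = "real (card \<Omega>)"
  have inv: "W r (g(w := a)) = W r g" if "g w \<le> r" "a \<le> r" for r g w a
    using that by (auto simp: W_def)
  have rs: "real (card {g \<in> \<Omega>. g w = r \<and> P g}) * real (Suc r) = real (card {g \<in> \<Omega>. g w \<le> r \<and> P g})"
    if w: "w \<in> D" and r: "r < N" and P: "\<And>g a. g w \<le> r \<Longrightarrow> a \<le> r \<Longrightarrow> P (g(w := a)) \<longleftrightarrow> P g" for w r P
  proof -
    have "card {g \<in> \<Omega>. g w = r \<and> P g} * card {..r} = card {g \<in> \<Omega>. g w \<in> {..r} \<and> P g}"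
      unfolding \<Omega>_def by (rule resample) (use w r P D in auto)
    then show ?thesis by (simp del: of_nat_Suc of_nat_mult add: of_nat_mult[symmetric])
  qed
  have single: "real (card {g \<in> \<Omega>. g w \<le> r}) * real N = real (Suc r) * ?n" if w: "w \<in> D" and r: "r < N" for w r
  proof -
    have "card {g \<in> \<Omega>. g w = r \<and> True} * card {..<N} = card {g \<in> \<Omega>. g w \<in> {..<N} \<and> True}"
      unfolding \<Omega>_def by (rule resample) (use w r D in auto)
    moreover have "{g \<in> \<Omega>. g w \<in> {..<N} \<and> True} = \<Omega>" using w D by (auto simp: \<Omega>_def)
    ultimately have "card {g \<in> \<Omega>. g w = r} * N = card \<Omega>" by simp
    then have a: "real (card {g \<in> \<Omega>. g w = r}) * real N = ?n" by (simp flip: of_nat_mult)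
    have b: "real (card {g \<in> \<Omega>. g w \<le> r}) = real (card {g \<in> \<Omega>. g w = r}) * real (Suc r)"
      using rs[of w r "\<lambda>_. True"] w r by simp
    show ?thesis unfolding b a[symmetric] by (simp only: ac_simps)
  qed
  have swap: "(\<Sum>g\<in>\<Omega>. real (card {w \<in> D. Q g w})) = (\<Sum>w\<in>D. real (card {g \<in> \<Omega>. Q g w}))" for Q
  proof -
    have "(\<Sum>g\<in>\<Omega>. real (card {w \<in> D. Q g w})) = (\<Sum>g\<in>\<Omega>. \<Sum>w\<in>D. of_bool (Q g w))"
      using finD by (intro sum.cong) (auto simp: sum.If_cases of_bool_def Int_def)
    also have "\<dots> = (\<Sum>w\<in>D. \<Sum>g\<in>\<Omega>. of_bool (Q g w))" by (rule sum.swap)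
    also have "\<dots> = (\<Sum>w\<in>D. real (card {g \<in> \<Omega>. Q g w}))"
      using fin\<Omega> by (intro sum.cong) (auto simp: sum.If_cases of_bool_def Int_def)
    finally show ?thesis .
  qed
  have level: "(\<Sum>g\<in>\<Omega>. real (card {w \<in> D. g w = r \<and> un g w})) \<le> 2 * real c * (1 / real (Suc r)) * ?n"
    if r: "r < N" for r
  proof -
    let ?R = "real (Suc r)"
    have pt: "real (card {w \<in> D. g w = r \<and> un g w}) \<le> real (card {w \<in> D. g w = r \<and> w \<in> B (W r g)})
        + (\<Sum>b\<in>D. real (card {w \<in> D. g w = r \<and> (w \<noteq> b \<and> g b = r \<and> b \<in> B (W r g))}))" for g
    proof -
      have sub: "{w \<in> D. g w = r \<and> un g w} \<subseteq> {w \<in> D. g w = r \<and> w \<in> B (W r g)} \<union>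
         (\<Union>b\<in>D. {w \<in> D. g w = r \<and> (w \<noteq> b \<and> g b = r \<and> b \<in> B (W r g))})"
      proof
        fix w assume "w \<in> {w \<in> D. g w = r \<and> un g w}"
        then have w: "w \<in> D" "g w = r" "un g w" by auto
        show "w \<in> {w \<in> D. g w = r \<and> w \<in> B (W r g)} \<union>
         (\<Union>b\<in>D. {w \<in> D. g w = r \<and> (w \<noteq> b \<and> g b = r \<and> b \<in> B (W r g))})"
        proof (cases "w \<in> B (W r g)")
          case False
          have "S w \<subseteq> (\<Union>i\<in>B (W r g). S i)" using BW(3)[of r g] w by (auto simp: W_def)
          with w(3) obtain b where b: "b \<in> B (W r g)" "\<not> (b \<in> D \<and> g b < g w)"
            unfolding un_def by blast
          then have "b \<in> D" "g b \<le> r" using BW(1)[of r g] by (auto simp: W_def)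
          then show ?thesis using b w False by auto
        qed (use w in simp)
      qed
      have "card {w \<in> D. g w = r \<and> un g w} \<le> card ({w \<in> D. g w = r \<and> w \<in> B (W r g)} \<union>
         (\<Union>b\<in>D. {w \<in> D. g w = r \<and> (w \<noteq> b \<and> g b = r \<and> b \<in> B (W r g))}))"
        using sub finD by (intro card_mono) auto
      also have "\<dots> \<le> card {w \<in> D. g w = r \<and> w \<in> B (W r g)} +
         card (\<Union>b\<in>D. {w \<in> D. g w = r \<and> (w \<noteq> b \<and> g b = r \<and> b \<in> B (W r g))})" by (rule card_Un_le)
      also have "card (\<Union>b\<in>D. {w \<in> D. g w = r \<and> (w \<noteq> b \<and> g b = r \<and> b \<in> B (W r g))}) \<le>
         (\<Sum>b\<in>D. card {w \<in> D. g w = r \<and> (w \<noteq> b \<and> g b = r \<and> b \<in> B (W r g))})"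
        using finD by (intro card_UN_le)
      finally show ?thesis unfolding of_nat_sum[symmetric] of_nat_add[symmetric] of_nat_le_iff by simp
    qed
    \<comment> \<open>Resampling \<open>w\<close> within the ranks up to \<open>r\<close> trades the
      condition \<open>g w = r\<close> for \<open>g w \<le> r\<close> at the price of the factor
      \<open>r + 1\<close>. What remains is counted by the size of the subcover.\<close>
    have e1: "(\<Sum>g\<in>\<Omega>. real (card {w \<in> D. g w = r \<and> w \<in> B (W r g)})) * ?R \<le> real c * ?n"
    proof -
      have "(\<Sum>g\<in>\<Omega>. real (card {w \<in> D. g w = r \<and> w \<in> B (W r g)})) * ?R
          = (\<Sum>w\<in>D. real (card {g \<in> \<Omega>. g w = r \<and> w \<in> B (W r g)}) * ?R)"
        by (simp add: swap sum_distrib_right)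
      also have "\<dots> = (\<Sum>w\<in>D. real (card {g \<in> \<Omega>. g w \<le> r \<and> w \<in> B (W r g)}))"
        by (intro sum.cong refl rs) (simp_all add: r inv)
      also have "\<dots> = (\<Sum>g\<in>\<Omega>. real (card {w \<in> D. g w \<le> r \<and> w \<in> B (W r g)}))" by (rule swap[symmetric])
      also have "\<dots> \<le> (\<Sum>g\<in>\<Omega>. real c)"
      proof (rule sum_mono)
        fix g
        have "card {w \<in> D. g w \<le> r \<and> w \<in> B (W r g)} \<le> card (B (W r g))"
          using finW by (intro card_mono) auto
        then show "real (card {w \<in> D. g w \<le> r \<and> w \<in> B (W r g)}) \<le> real c" using BW(2)[of r g] by simp
      qed
      finally show ?thesis by (simp add: mult.commute)
    qed
    \<comment> \<open>Two resamplings, first of \<open>w\<close> and then of \<open>b\<close>; since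
      \<open>w \<noteq> b\<close>, the condition on one does not move with the other. Afterwards
      there are at most \<open>c\<close> choices of \<open>b\<close> and \<open>card (W r g)\<close>
      choices of \<open>w\<close>, and one of the two factors \<open>r + 1\<close> is used up by the
      mean size of \<open>W r g\<close>.\<close>
    have e2: "(\<Sum>g\<in>\<Omega>. \<Sum>b\<in>D. real (card {w \<in> D. g w = r \<and> (w \<noteq> b \<and> g b = r \<and> b \<in> B (W r g))})) * (?R * ?R)
        \<le> real c * (?R * ?n)"
    proof -
      have "(\<Sum>g\<in>\<Omega>. \<Sum>b\<in>D. real (card {w \<in> D. g w = r \<and> (w \<noteq> b \<and> g b = r \<and> b \<in> B (W r g))})) * (?R * ?R)
         = (\<Sum>b\<in>D. \<Sum>w\<in>D. real (card {g \<in> \<Omega>. g w = r \<and> (w \<noteq> b \<and> g b = r \<and> b \<in> B (W r g))}) * ?R * ?R)"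
        by (subst sum.swap) (simp add: swap sum_distrib_right mult.assoc)
      also have "\<dots> = (\<Sum>b\<in>D. \<Sum>w\<in>D. real (card {g \<in> \<Omega>. g b = r \<and> (w \<noteq> b \<and> g w \<le> r \<and> b \<in> B (W r g))}) * ?R)"
      proof (intro sum.cong refl arg_cong2[where f = "(*)"])
        fix b w assume "b \<in> D" "w \<in> D"
        have "real (card {g \<in> \<Omega>. g w = r \<and> (w \<noteq> b \<and> g b = r \<and> b \<in> B (W r g))}) * ?R
          = real (card {g \<in> \<Omega>. g w \<le> r \<and> (w \<noteq> b \<and> g b = r \<and> b \<in> B (W r g))})"
          using \<open>w \<in> D\<close> r by (intro rs) (auto simp: inv)
        also have "{g \<in> \<Omega>. g w \<le> r \<and> (w \<noteq> b \<and> g b = r \<and> b \<in> B (W r g))} =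
            {g \<in> \<Omega>. g b = r \<and> (w \<noteq> b \<and> g w \<le> r \<and> b \<in> B (W r g))}" by blast
        finally show "real (card {g \<in> \<Omega>. g w = r \<and> (w \<noteq> b \<and> g b = r \<and> b \<in> B (W r g))}) * ?R
          = real (card {g \<in> \<Omega>. g b = r \<and> (w \<noteq> b \<and> g w \<le> r \<and> b \<in> B (W r g))})" .
      qed
      also have "\<dots> = (\<Sum>b\<in>D. \<Sum>w\<in>D. real (card {g \<in> \<Omega>. g b \<le> r \<and> (w \<noteq> b \<and> g w \<le> r \<and> b \<in> B (W r g))}))"
        by (intro sum.cong refl rs) (auto simp: r inv)
      also have "\<dots> = (\<Sum>g\<in>\<Omega>. \<Sum>b\<in>D. real (card {w \<in> D. g b \<le> r \<and> (w \<noteq> b \<and> g w \<le> r \<and> b \<in> B (W r g))}))"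
        unfolding swap[symmetric] by (rule sum.swap)
      also have "\<dots> \<le> (\<Sum>g\<in>\<Omega>. real c * real (card (W r g)))"
      proof (rule sum_mono)
        fix g
        have "(\<Sum>b\<in>D. real (card {w \<in> D. g b \<le> r \<and> (w \<noteq> b \<and> g w \<le> r \<and> b \<in> B (W r g))}))
            \<le> (\<Sum>b\<in>D. if b \<in> B (W r g) then real (card (W r g)) else 0)"
        proof (rule sum_mono)
          fix b
          have "card {w \<in> D. g b \<le> r \<and> (w \<noteq> b \<and> g w \<le> r)} \<le> card (W r g)"
            using finW by (intro card_mono) (auto simp: W_def)
          then show "real (card {w \<in> D. g b \<le> r \<and> (w \<noteq> b \<and> g w \<le> r \<and> b \<in> B (W r g))})
            \<le> (if b \<in> B (W r g) then real (card (W r g)) else 0)" by auto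
        qed
        also have "\<dots> = real (card (B (W r g))) * real (card (W r g))"
        proof -
          have "D \<inter> B (W r g) = B (W r g)" using BW(1)[of r g] WD[of r g] by blast
          then show ?thesis using finD by (simp add: sum.If_cases)
        qed
        also have "\<dots> \<le> real c * real (card (W r g))" using BW(2)[of r g] by (intro mult_right_mono) auto
        finally show "(\<Sum>b\<in>D. real (card {w \<in> D. g b \<le> r \<and> (w \<noteq> b \<and> g w \<le> r \<and> b \<in> B (W r g))}))
            \<le> real c * real (card (W r g))" .
      qed
      also have "\<dots> = real c * (\<Sum>w\<in>D. real (card {g \<in> \<Omega>. g w \<le> r}))"
        unfolding W_def by (simp add: sum_distrib_left[symmetric] swap)
      \<comment> \<open>Each index has rank at most \<open>r\<close> with probability
        \<open>(r + 1) / N\<close>. As \<open>card D \<le> N\<close>, the mean size of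
        \<open>W r g\<close> is at most \<open>r + 1\<close>; collisions of ranks are therefore rare
        enough.\<close>
      also have "(\<Sum>w\<in>D. real (card {g \<in> \<Omega>. g w \<le> r})) = (\<Sum>w\<in>D. ?R * ?n / real N)"
        using single r N by (intro sum.cong) (auto simp: field_simps)
      also have "\<dots> \<le> ?R * ?n"
        using N mult_right_mono[of "real (card D)" "real N" "?R * ?n"] by (simp add: field_simps)
      finally show ?thesis by (simp add: mult_left_mono)
    qed
    have "(\<Sum>g\<in>\<Omega>. real (card {w \<in> D. g w = r \<and> un g w})) \<le>
       (\<Sum>g\<in>\<Omega>. real (card {w \<in> D. g w = r \<and> w \<in> B (W r g)})) +
       (\<Sum>g\<in>\<Omega>. \<Sum>b\<in>D. real (card {w \<in> D. g w = r \<and> (w \<noteq> b \<and> g b = r \<and> b \<in> B (W r g))}))"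
      unfolding sum.distrib[symmetric] by (rule sum_mono) (rule pt)
    also have "\<dots> \<le> real c * ?n / ?R + real c * ?n / ?R"
    proof (rule add_mono)
      show "(\<Sum>g\<in>\<Omega>. real (card {w \<in> D. g w = r \<and> w \<in> B (W r g)})) \<le> real c * ?n / ?R"
        using e1 by (subst pos_le_divide_eq) auto
      have "(\<Sum>g\<in>\<Omega>. \<Sum>b\<in>D. real (card {w \<in> D. g w = r \<and> (w \<noteq> b \<and> g b = r \<and> b \<in> B (W r g))})) * ?R * ?R
          \<le> real c * ?n * ?R" using e2 by (simp only: ac_simps)
      then have "(\<Sum>g\<in>\<Omega>. \<Sum>b\<in>D. real (card {w \<in> D. g w = r \<and> (w \<noteq> b \<and> g b = r \<and> b \<in> B (W r g))})) * ?R
          \<le> real c * ?n" by (rule mult_right_le_imp_le) simp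
      then show "(\<Sum>g\<in>\<Omega>. \<Sum>b\<in>D. real (card {w \<in> D. g w = r \<and> (w \<noteq> b \<and> g b = r \<and> b \<in> B (W r g))}))
          \<le> real c * ?n / ?R" by (subst pos_le_divide_eq) auto
    qed
    also have "\<dots> = 2 * real c * (1 / ?R) * ?n"
    proof -
      have "a * n / R + a * n / R = 2 * a * (1 / R) * n" for a n R :: real by simp
      then show ?thesis .
    qed
    finally show ?thesis .
  qed
  have "(\<Sum>g\<in>\<Omega>. real (card {w \<in> D. un g w})) \<le> (\<Sum>g\<in>\<Omega>. \<Sum>r<N. real (card {w \<in> D. g w = r \<and> un g w}))"
  proof (rule sum_mono)
    fix g assume g: "g \<in> \<Omega>"
    have "{w \<in> D. un g w} \<subseteq> (\<Union>r<N. {w \<in> D. g w = r \<and> un g w})"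
      using g D by (auto simp: \<Omega>_def PiE_iff)
    then have "card {w \<in> D. un g w} \<le> card (\<Union>r<N. {w \<in> D. g w = r \<and> un g w})"
      using finD by (intro card_mono) auto
    also have "\<dots> \<le> (\<Sum>r<N. card {w \<in> D. g w = r \<and> un g w})" by (intro card_UN_le) simp
    finally show "real (card {w \<in> D. un g w}) \<le> (\<Sum>r<N. real (card {w \<in> D. g w = r \<and> un g w}))"
      unfolding of_nat_sum[symmetric] by (rule of_nat_mono)
  qed
  also have "\<dots> = (\<Sum>r<N. \<Sum>g\<in>\<Omega>. real (card {w \<in> D. g w = r \<and> un g w}))" by (rule sum.swap)
  also have "\<dots> \<le> (\<Sum>r<N. 2 * real c * (1 / real (Suc r)) * ?n)" using level by (intro sum_mono) auto
  also have "\<dots> = 2 * real c * (\<Sum>r<N. 1 / real (Suc r)) * ?n"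
    by (simp add: sum_distrib_left sum_distrib_right)
  finally show ?thesis unfolding un_def .
qed

text \<open>Dyadic blocks: the terms from \<open>2 ^ L\<close> to \<open>2 ^ (L + 1) - 1\<close> are
  \<open>2 ^ L\<close> in number and each is at most \<open>1 / 2 ^ L\<close>.\<close>

lemma harmonic_power2_le: "(\<Sum>r<2 ^ L. 1 / real (Suc r)) \<le> 1 + real L"
proof (induction L)
  case (Suc L)
  have "(\<Sum>r<2 ^ Suc L. 1 / real (Suc r)) = (\<Sum>r<2 ^ L. 1 / real (Suc r)) + (\<Sum>r\<in>{2 ^ L..<2 ^ Suc L}. 1 / real (Suc r))"
    by (simp add: lessThan_atLeast0 sum.atLeastLessThan_concat)
  also have "(\<Sum>r\<in>{2 ^ L..<2 ^ Suc L}. 1 / real (Suc r)) \<le> (\<Sum>r\<in>{(2::nat) ^ L..<2 ^ Suc L}. 1 / 2 ^ L)"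
  proof (intro sum_mono divide_left_mono)
    fix r :: nat assume "r \<in> {2 ^ L..<2 ^ Suc L}"
    then have "2 ^ L \<le> Suc r" by simp
    then show "(2::real) ^ L \<le> real (Suc r)" by (metis of_nat_mono of_nat_numeral of_nat_power)
  qed auto
  also have "\<dots> = 1" by simp
  finally show ?case using Suc by simp
qed simp

text \<open>Ranks are drawn from a finite range and can coincide; the order of the labels makes the
  owner unique.\<close>

definition owner_of :: "('a::linorder \<Rightarrow> 'a set) \<Rightarrow> 'a set \<Rightarrow> ('a \<Rightarrow> nat) \<Rightarrow> 'a \<Rightarrow> 'a \<Rightarrow> bool" where
  "owner_of S V g x y \<longleftrightarrow> y \<in> V \<and> x \<in> S y \<and>
     (\<forall>w\<in>V. x \<in> S w \<longrightarrow> g y < g w \<or> (g y = g w \<and> y \<le> w))"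

text \<open>Only sets of owners matter. A set \<open>{w}\<close> without isolated alternative has at
  most \<open>d\<close> boundary edges. The boundary of an isolated set, multiplied by
  \<open>\<Delta>\<close>, is at most its size, so it is distributed over its members
  \<open>x\<close>, and for each \<open>x\<close> the owners that charge it are uncovered indices in
  the sense of \<open>sum_uncovered_le\<close>.\<close>

lemma sum_cut_edges_le:
  fixes V :: "'a::linorder set" and N :: nat
  defines "\<Omega> \<equiv> PiE V (\<lambda>_. {..<N})"
  assumes G: "fin_graph V E" and deg: "max_degree_le V E d"
    and S: "\<And>w. w \<in> V \<Longrightarrow> w \<in> S w \<and> S w \<subseteq> V"
    and good: "good \<subseteq> V" "\<And>w. w \<in> good \<Longrightarrow> isolated E K t \<Delta> (S w)"
    and bad: "\<And>w. w \<in> V - good \<Longrightarrow> S w = {w}"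
    and own: "\<And>g x. g \<in> \<Omega> \<Longrightarrow> x \<in> V \<Longrightarrow> owner_of S V g x (own g x)"
    and N: "fact (Suc t) * K \<le> N" "N > 0"
  shows "real \<Delta> * (\<Sum>g\<in>\<Omega>. real (card (cut_edges E (\<lambda>v. {u \<in> V. own g u = own g v}))))
    \<le> (2 * fact (Suc t) * (\<Sum>r<N. 1 / real (Suc r)) * real (card V)
        + real \<Delta> * real d * real (card (V - good))) * real (card \<Omega>)"
proof -
  have fin: "finite V" using G by (simp add: fin_graph_def)
  have fin\<Omega>: "finite \<Omega>" unfolding \<Omega>_def using fin by (intro finite_PiE) auto
  have fgood: "finite good" using good(1) fin finite_subset by blast
  define D where "D = (\<lambda>x. {w \<in> good. x \<in> S w})"
  define unc where "unc = (\<lambda>x (g :: 'a \<Rightarrow> nat). {w \<in> D x. \<not> S w \<subseteq> (\<Union>i\<in>{i \<in> D x. g i < g w}. S i)})"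
  have finS: "finite (S w)" if "w \<in> V" for w using S[OF that] fin finite_subset by blast
  have cover: "\<exists>J\<subseteq>W. card J \<le> fact (Suc t) \<and> (\<Union>i\<in>W. S i) \<subseteq> (\<Union>i\<in>J. S i)" if W: "W \<subseteq> D x" for W x
  proof (rule small_subcover)
    show "finite W" using W fgood by (auto simp: D_def intro: finite_subset)
    fix i assume "i \<in> W"
    then have i: "i \<in> good" "x \<in> S i" using W by (auto simp: D_def)
    have "nbd E (S i) \<subseteq> V" using fin_graph_edge[OF G] by (auto simp: nbd_def)
    then have "finite (nbd E (S i))" using fin finite_subset by blast
    then show "finite (S i) \<and> x \<in> S i \<and> induces_connected E (S i) \<and>
        finite (nbd E (S i)) \<and> card (nbd E (S i)) \<le> t"
      using i good finS[of i] by (auto simp: isolated_def)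
  qed
  \<comment> \<open>Since \<open>w\<close> is in \<open>S w\<close>, the indices of sets through
    \<open>x\<close> lie in the union of these sets, which is covered by \<open>fact (Suc t)\<close>
    sets of at most \<open>K\<close> vertices. This determines how many ranks are needed.\<close>
  have cardD: "card (D x) \<le> N" for x
  proof -
    obtain J where J: "J \<subseteq> D x" "card J \<le> fact (Suc t)" "(\<Union>i\<in>D x. S i) \<subseteq> (\<Union>i\<in>J. S i)"
      using cover[of "D x" x] by blast
    have finJ: "finite J" using J(1) fgood by (auto simp: D_def intro: finite_subset)
    have JV: "i \<in> V \<and> card (S i) \<le> K" if "i \<in> J" for i
      using that J(1) good by (auto simp: D_def isolated_def)
    have "D x \<subseteq> (\<Union>i\<in>J. S i)" using J(3) S good(1) by (fastforce simp: D_def)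
    then have "card (D x) \<le> card (\<Union>i\<in>J. S i)" using finJ JV finS by (intro card_mono) auto
    also have "\<dots> \<le> (\<Sum>i\<in>J. card (S i))" using finJ by (rule card_UN_le)
    also have "\<dots> \<le> (\<Sum>i\<in>J. K)" using JV by (intro sum_mono) auto
    also have "\<dots> = card J * K" by simp
    also have "\<dots> \<le> fact (Suc t) * K" using J(2) by (rule mult_le_mono1)
    finally show ?thesis using N by simp
  qed
  have pt: "\<Delta> * card (cut_edges E (\<lambda>v. {u \<in> V. own g u = own g v}))
      \<le> (\<Sum>x\<in>V. card (unc x g)) + \<Delta> * (d * card (V - good))" if g: "g \<in> \<Omega>" for g
  proof -
    define act where "act = own g ` V"
    have actV: "act \<subseteq> V" using own[OF g] by (auto simp: act_def owner_of_def)
    have finact: "finite act" using actV fin finite_subset by blast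
    have "cut_edges E (\<lambda>v. {u \<in> V. own g u = own g v}) \<subseteq> (\<Union>w\<in>act. (\<lambda>(u, x). {u, x}) ` bdry E (S w))"
    proof
      fix e assume "e \<in> cut_edges E (\<lambda>v. {u \<in> V. own g u = own g v})"
      then obtain u x where e: "e = {u, x}" "{u, x} \<in> E"
        and "{y \<in> V. own g y = own g u} \<noteq> {y \<in> V. own g y = own g x}"
        unfolding cut_edges_def by blast
      then have ne: "own g u \<noteq> own g x" by auto
      have V: "u \<in> V" "x \<in> V" using fin_graph_edge[OF G e(2)] by auto
      note o = own[OF g V(1), unfolded owner_of_def] own[OF g V(2), unfolded owner_of_def]
      \<comment> \<open>If both ends were in the sets of both owners, each owner would precede the
        other one.\<close>
      have "x \<notin> S (own g u) \<or> u \<notin> S (own g x)"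
      proof (rule ccontr)
        assume "\<not> ?thesis"
        then have xu: "x \<in> S (own g u)" "u \<in> S (own g x)" by auto
        have "g (own g u) < g (own g x) \<or> g (own g u) = g (own g x) \<and> own g u \<le> own g x"
          using o(1) o(2) xu(2) by blast
        moreover have "g (own g x) < g (own g u) \<or> g (own g x) = g (own g u) \<and> own g x \<le> own g u"
          using o(1) o(2) xu(1) by blast
        ultimately show False using ne by auto
      qed
      then show "e \<in> (\<Union>w\<in>act. (\<lambda>(u, x). {u, x}) ` bdry E (S w))"
      proof
        assume "x \<notin> S (own g u)"
        then have "(u, x) \<in> bdry E (S (own g u))" using o(1) e by (auto simp: bdry_def)
        then show ?thesis
          using V e unfolding act_def by (intro UN_I[of "own g u"] image_eqI[of _ _ "(u, x)"]) auto
      next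
        assume "u \<notin> S (own g x)"
        then have "(x, u) \<in> bdry E (S (own g x))" using o(2) e by (auto simp: bdry_def insert_commute)
        then show ?thesis
          using V e unfolding act_def by (intro UN_I[of "own g x"] image_eqI[of _ _ "(x, u)"]) auto
      qed
    qed
    then have "card (cut_edges E (\<lambda>v. {u \<in> V. own g u = own g v})) \<le>
        card (\<Union>w\<in>act. (\<lambda>(u, x). {u, x}) ` bdry E (S w))"
      using finact finite_bdry[OF G] by (intro card_mono) auto
    also have "\<dots> \<le> (\<Sum>w\<in>act. card ((\<lambda>(u, x). {u, x}) ` bdry E (S w)))" using finact by (rule card_UN_le)
    also have "\<dots> \<le> (\<Sum>w\<in>act. card (bdry E (S w)))"
      using finite_bdry[OF G] by (intro sum_mono card_image_le)
    also have "\<dots> = (\<Sum>w\<in>act \<inter> good. card (bdry E (S w))) + (\<Sum>w\<in>act - good. card (bdry E (S w)))"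
      using finact by (rule sum.Int_Diff)
    also have "(\<Sum>w\<in>act - good. card (bdry E (S w))) \<le> (\<Sum>w\<in>act - good. d)"
    proof (rule sum_mono)
      fix w assume w: "w \<in> act - good"
      then have wV: "w \<in> V" "w \<in> V - good" using actV by auto
      have "bdry E (S w) \<subseteq> Pair w ` neighbors E w"
        unfolding bad[OF wV(2)] by (auto simp: bdry_def neighbors_def)
      moreover have finN: "finite (neighbors E w)"
        using fin_graph_edge[OF G] fin by (auto simp: neighbors_def intro: finite_subset[of _ V])
      ultimately have "card (bdry E (S w)) \<le> card (neighbors E w)"
        by (meson card_image_le card_mono finite_imageI le_trans)
      then show "card (bdry E (S w)) \<le> d" using deg wV by (auto simp: max_degree_le_def)
    qed
    also have "(\<Sum>w\<in>act - good. d) \<le> d * card (V - good)"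
      using card_mono[of "V - good" "act - good"] actV fin by (auto simp: mult.commute)
    finally have "\<Delta> * card (cut_edges E (\<lambda>v. {u \<in> V. own g u = own g v})) \<le>
        \<Delta> * ((\<Sum>w\<in>act \<inter> good. card (bdry E (S w))) + d * card (V - good))" by (simp add: mult_le_mono2)
    also have "\<dots> = (\<Sum>w\<in>act \<inter> good. \<Delta> * card (bdry E (S w))) + \<Delta> * (d * card (V - good))"
      by (simp add: sum_distrib_left distrib_left)
    also have "(\<Sum>w\<in>act \<inter> good. \<Delta> * card (bdry E (S w))) \<le> (\<Sum>w\<in>act \<inter> good. card (S w))"
      using good(2) by (intro sum_mono) (auto simp: isolated_def)
    also have "\<dots> = (\<Sum>w\<in>act \<inter> good. \<Sum>x\<in>V. of_bool (x \<in> S w))"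
    proof (rule sum.cong[OF refl])
      fix w assume "w \<in> act \<inter> good"
      then have "V \<inter> S w = S w" using S good(1) by blast
      then show "card (S w) = (\<Sum>x\<in>V. of_bool (x \<in> S w))" using fin by (simp add: of_bool_def sum.If_cases)
    qed
    also have "\<dots> = (\<Sum>x\<in>V. \<Sum>w\<in>act \<inter> good. of_bool (x \<in> S w))" by (rule sum.swap)
    also have "\<dots> \<le> (\<Sum>x\<in>V. card (unc x g))"
    proof (rule sum_mono)
      fix x assume x: "x \<in> V"
      have "(\<Sum>w\<in>act \<inter> good. of_bool (x \<in> S w)) = card (act \<inter> good \<inter> {w. x \<in> S w})"
        using finact by (simp add: of_bool_def sum.If_cases)
      also have "\<dots> \<le> card (unc x g)"
      proof (rule card_mono)
        show "finite (unc x g)" using fgood by (simp add: unc_def D_def)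
        show "act \<inter> good \<inter> {w. x \<in> S w} \<subseteq> unc x g"
        proof
          fix w assume w: "w \<in> act \<inter> good \<inter> {w. x \<in> S w}"
          then obtain u where u: "u \<in> V" "w = own g u" by (auto simp: act_def)
          note o = own[OF g u(1), unfolded owner_of_def]
          \<comment> \<open>The vertex \<open>u\<close> that is owned by \<open>w\<close> lies in no
            set of lower rank, so it witnesses that \<open>S w\<close> is not covered by those sets
            through \<open>x\<close>.\<close>
          have "u \<notin> S i" if "i \<in> D x" "g i < g w" for i
          proof
            assume "u \<in> S i"
            moreover have "i \<in> V" using that good(1) by (auto simp: D_def)
            ultimately have "g w < g i \<or> (g w = g i \<and> w \<le> i)" using o u by blast
            then show False using that by auto
          qed
          then show "w \<in> unc x g" using w o u unfolding unc_def D_def by blast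
        qed
      qed
      finally show "(\<Sum>w\<in>act \<inter> good. of_bool (x \<in> S w)) \<le> card (unc x g)" .
    qed
    finally show ?thesis by simp
  qed
  let ?H = "\<Sum>r<N. 1 / real (Suc r)" and ?n = "real (card \<Omega>)"
  have "real \<Delta> * (\<Sum>g\<in>\<Omega>. real (card (cut_edges E (\<lambda>v. {u \<in> V. own g u = own g v}))))
    = (\<Sum>g\<in>\<Omega>. real (\<Delta> * card (cut_edges E (\<lambda>v. {u \<in> V. own g u = own g v}))))"
    by (simp add: sum_distrib_left)
  also have "\<dots> \<le> (\<Sum>g\<in>\<Omega>. real ((\<Sum>x\<in>V. card (unc x g)) + \<Delta> * (d * card (V - good))))"
    by (intro sum_mono of_nat_mono pt)
  also have "\<dots> = (\<Sum>x\<in>V. \<Sum>g\<in>\<Omega>. real (card (unc x g))) + real \<Delta> * real d * real (card (V - good)) * ?n"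
    by (subst sum.swap) (simp add: sum.distrib mult.assoc mult.commute mult.left_commute)
  also have "(\<Sum>x\<in>V. \<Sum>g\<in>\<Omega>. real (card (unc x g))) \<le> (\<Sum>x\<in>V. 2 * real (fact (Suc t)) * ?H * ?n)"
  proof (rule sum_mono)
    fix x
    show "(\<Sum>g\<in>\<Omega>. real (card (unc x g))) \<le> 2 * real (fact (Suc t)) * ?H * ?n"
      unfolding unc_def \<Omega>_def
      by (rule sum_uncovered_le[OF fin _ cover cardD N(2)]) (use good in \<open>auto simp: D_def\<close>)
  qed
  finally show ?thesis by (simp add: algebra_simps del: fact_Suc)
qed

section \<open>Ranks from coins\<close>

fun bits_val :: "(nat \<Rightarrow> bool) \<Rightarrow> nat \<Rightarrow> nat \<Rightarrow> nat" where
  "bits_val \<omega> a 0 = 0"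
| "bits_val \<omega> a (Suc i) = 2 * bits_val \<omega> a i + of_bool (\<omega> (a + i))"

text \<open>The coins \<open>w * L, \<dots>, w * L + L - 1\<close> form the rank of \<open>w\<close>.\<close>

definition vrank :: "nat \<Rightarrow> (nat \<Rightarrow> bool) \<Rightarrow> nat \<Rightarrow> nat" where
  "vrank L \<omega> w = bits_val \<omega> (w * L) L"

lemma bits_val_less: "bits_val \<omega> a i < 2 ^ i"
proof (induction i)
  case (Suc i)
  then show ?case by (cases "\<omega> (a + i)") auto
qed simp

text \<open>Binary digits are unique. The pattern \<open>b\<close> is independent of the coins and
  of the offset, which turns the event of having a given rank into a cylinder.\<close>

lemma bits_val_eq_iff:
  assumes "r < 2 ^ L"
  shows "\<exists>b. \<forall>\<omega> a. bits_val \<omega> a L = r \<longleftrightarrow> (\<forall>i<L. \<omega> (a + i) = b i)"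
  using assms
proof (induction L arbitrary: r)
  case (Suc L)
  have "r div 2 < 2 ^ L" using Suc.prems by auto
  from Suc.IH[OF this] obtain b where
    b: "\<And>\<omega> a. bits_val \<omega> a L = r div 2 \<longleftrightarrow> (\<forall>i<L. \<omega> (a + i) = b i)" by blast
  have "bits_val \<omega> a (Suc L) = r \<longleftrightarrow> (\<forall>i<Suc L. \<omega> (a + i) = (b(L := odd r)) i)" for \<omega> a
  proof -
    have "bits_val \<omega> a (Suc L) = r \<longleftrightarrow> bits_val \<omega> a L = r div 2 \<and> (\<omega> (a + L) \<longleftrightarrow> odd r)"
      by (cases "\<omega> (a + L)") (simp_all, presburger+)
    also have "\<dots> \<longleftrightarrow> (\<forall>i<Suc L. \<omega> (a + i) = (b(L := odd r)) i)"
      unfolding b by (auto simp: less_Suc_eq)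
    finally show ?thesis .
  qed
  then show ?case by blast
qed simp

lemma space_coin_space [simp]: "space coin_space = UNIV"
  unfolding coin_space_def space_PiM by (rule set_eqI) (simp add: PiE_iff extensional_def)

lemma prob_space_coin_space: "prob_space coin_space"
  unfolding coin_space_def by (intro prob_space_PiM measure_pmf.prob_space_axioms)

lemma coin_cylinder:
  assumes "finite J"
  shows "{\<omega>. \<forall>j\<in>J. \<omega> j = b j} \<in> sets coin_space"
    and "measure coin_space {\<omega>. \<forall>j\<in>J. \<omega> j = b j} = (1 / 2) ^ card J"
proof -
  interpret product_prob_space "\<lambda>_ :: nat. measure_pmf (bernoulli_pmf (1/2))" UNIV
    by (intro product_prob_spaceI measure_pmf.prob_space_axioms)
  have eq: "{\<omega>. \<forall>j\<in>J. \<omega> j = b j} =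
      {\<omega> \<in> space (Pi\<^sub>M UNIV (\<lambda>_. measure_pmf (bernoulli_pmf (1/2)))). \<forall>j\<in>J. \<omega> j \<in> {b j}}"
    using space_coin_space by (simp add: coin_space_def)
  show "{\<omega>. \<forall>j\<in>J. \<omega> j = b j} \<in> sets coin_space"
    unfolding eq coin_space_def using assms
    by (intro sets.sets_Collect_finite_All measurable_sets_Collect[OF measurable_component_singleton]) auto
  have "emeasure coin_space {\<omega>. \<forall>j\<in>J. \<omega> j = b j} =
      (\<Prod>j\<in>J. emeasure (measure_pmf (bernoulli_pmf (1/2))) {b j})"
    unfolding eq coin_space_def by (rule emeasure_PiM_Collect) (use assms in auto)
  also have "\<dots> = (\<Prod>j\<in>J. ennreal (1 / 2))"
  proof (intro prod.cong refl)
    show "emeasure (measure_pmf (bernoulli_pmf (1/2))) {b j} = ennreal (1 / 2)" for j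
      by (cases "b j") (simp_all add: emeasure_pmf_single)
  qed
  also have "\<dots> = ennreal ((1 / 2) ^ card J)"
    unfolding prod_constant by (rule ennreal_power) simp
  finally show "measure coin_space {\<omega>. \<forall>j\<in>J. \<omega> j = b j} = (1 / 2) ^ card J"
    by (simp add: measure_def)
qed

lemma vrank_less: "vrank L \<omega> w < 2 ^ L"
  by (simp add: vrank_def bits_val_less)

text \<open>Division by \<open>L\<close> recovers the vertex and the bit from the name of a coin, so
  different vertices use disjoint blocks of coins and their ranks are independent.\<close>

lemma vrank_cylinder:
  assumes "finite V" "\<And>w. w \<in> V \<Longrightarrow> g w < 2 ^ L"
  shows "{\<omega>. \<forall>w\<in>V. vrank L \<omega> w = g w} \<in> sets coin_space"
    and "measure coin_space {\<omega>. \<forall>w\<in>V. vrank L \<omega> w = g w} = 1 / (2 ^ L) ^ card V"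
proof -
  have "\<forall>w\<in>V. \<exists>b. \<forall>\<omega> a. bits_val \<omega> a L = g w \<longleftrightarrow> (\<forall>i<L. \<omega> (a + i) = b i)"
    using bits_val_eq_iff assms(2) by blast
  from bchoice[OF this] obtain b where "\<forall>w\<in>V. \<forall>\<omega> a. bits_val \<omega> a L = g w \<longleftrightarrow> (\<forall>i<L. \<omega> (a + i) = b w i)" ..
  then have b: "\<And>w \<omega> a. w \<in> V \<Longrightarrow> bits_val \<omega> a L = g w \<longleftrightarrow> (\<forall>i<L. \<omega> (a + i) = b w i)" by simp
  define J where "J = (\<lambda>(w, i). w * L + i) ` (V \<times> {..<L})"
  have dm: "(w * L + i) div L = w" "(w * L + i) mod L = i" if "i < L" for w i using that by auto
  have "inj_on (\<lambda>(w, i). w * L + i) (V \<times> {..<L})"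
    by (rule inj_on_inverseI[where g = "\<lambda>j. (j div L, j mod L)"]) (use dm in auto)
  then have cardJ: "card J = card V * L"
    unfolding J_def by (simp add: card_image card_cartesian_product)
  have eq: "{\<omega>. \<forall>w\<in>V. vrank L \<omega> w = g w} = {\<omega>. \<forall>j\<in>J. \<omega> j = b (j div L) (j mod L)}"
    unfolding vrank_def J_def using b dm by auto
  have finJ: "finite J" using assms by (simp add: J_def)
  show "{\<omega>. \<forall>w\<in>V. vrank L \<omega> w = g w} \<in> sets coin_space"
    unfolding eq by (rule coin_cylinder(1)[OF finJ])
  show "measure coin_space {\<omega>. \<forall>w\<in>V. vrank L \<omega> w = g w} = 1 / (2 ^ L) ^ card V"
    unfolding eq coin_cylinder(2)[OF finJ] cardJ
    by (simp add: power_one_over power_mult[symmetric] mult.commute)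
qed

text \<open>The ranks on \<open>V\<close> are uniform on \<open>\<Omega>\<close>; probabilities of
  events that depend on them become counting, which is the form in which the expectation was
  bounded.\<close>

lemma vrank_distribution:
  fixes V :: "nat set" and L :: nat
  defines "\<Omega> \<equiv> PiE V (\<lambda>_. {..<2 ^ L})"
  assumes "finite V"
  shows "measure coin_space {\<omega>. \<Phi> (restrict (vrank L \<omega>) V)} * real (card \<Omega>) = real (card {g \<in> \<Omega>. \<Phi> g})"
proof -
  interpret prob_space coin_space by (rule prob_space_coin_space)
  have fin\<Omega>: "finite \<Omega>" unfolding \<Omega>_def using assms by (intro finite_PiE) auto
  have card\<Omega>: "card \<Omega> = (2 ^ L) ^ card V" unfolding \<Omega>_def using assms by (simp add: card_PiE)
  define cyl where "cyl = (\<lambda>g. {\<omega>. \<forall>w\<in>V. vrank L \<omega> w = g w})"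
  have in\<Omega>: "restrict (vrank L \<omega>) V \<in> \<Omega>" for \<omega> by (auto simp: \<Omega>_def vrank_less)
  have cyl_iff: "\<omega> \<in> cyl g \<longleftrightarrow> restrict (vrank L \<omega>) V = g" if "g \<in> \<Omega>" for g \<omega>
    using that unfolding cyl_def \<Omega>_def by (auto simp: PiE_iff extensional_def restrict_def)
  have gl: "g w < 2 ^ L" if "g \<in> \<Omega>" "w \<in> V" for g w using that by (auto simp: \<Omega>_def)
  have "{\<omega>. \<Phi> (restrict (vrank L \<omega>) V)} = (\<Union>g\<in>{g \<in> \<Omega>. \<Phi> g}. cyl g)"
    using in\<Omega> cyl_iff by auto
  also have "measure coin_space \<dots> = (\<Sum>g\<in>{g \<in> \<Omega>. \<Phi> g}. measure coin_space (cyl g))"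
  proof (rule finite_measure_finite_Union)
    show "cyl ` {g \<in> \<Omega>. \<Phi> g} \<subseteq> sets coin_space"
      using vrank_cylinder(1)[OF assms(2)] gl unfolding cyl_def by blast
    show "disjoint_family_on cyl {g \<in> \<Omega>. \<Phi> g}"
      unfolding disjoint_family_on_def using cyl_iff by auto
  qed (use fin\<Omega> in simp)
  also have "\<dots> = (\<Sum>g\<in>{g \<in> \<Omega>. \<Phi> g}. 1 / (2 ^ L) ^ card V)"
    using vrank_cylinder(2)[OF assms(2)] gl unfolding cyl_def by (intro sum.cong) auto
  finally show ?thesis by (simp add: card\<Omega>)
qed

text \<open>Markov's inequality for the uniform distribution on \<open>A\<close>. The bound
  \<open>a = 0\<close> occurs for the graph without vertices and is treated separately, because
  there one cannot divide by \<open>a\<close>.\<close>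

lemma markov_counting:
  fixes X :: "'a \<Rightarrow> real"
  assumes "finite A" and nonneg: "\<And>x. x \<in> A \<Longrightarrow> X x \<ge> 0" and a: "a \<ge> 0"
    and le: "10 * (\<Sum>x\<in>A. X x) \<le> a * real (card A)"
  shows "9 / 10 * real (card A) \<le> real (card {x \<in> A. X x \<le> a})"
proof -
  let ?B = "{x \<in> A. X x \<le> a}" and ?C = "{x \<in> A. \<not> X x \<le> a}"
  have "A = ?B \<union> ?C" by blast
  then have card: "card A = card ?B + card ?C"
    using assms(1) card_Un_disjoint[of ?B ?C] by fastforce
  show ?thesis
  proof (cases "a = 0")
    case True
    then have "(\<Sum>x\<in>A. X x) \<le> 0" using le by simp
    moreover have "(\<Sum>x\<in>A. X x) \<ge> 0" using nonneg by (rule sum_nonneg)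
    ultimately have "\<forall>x\<in>A. X x = 0" using sum_nonneg_eq_0_iff[of A X] assms(1) nonneg by force
    then have "?B = A" using a by auto
    then show ?thesis by simp
  next
    case False
    have "a * real (card ?C) = (\<Sum>x\<in>?C. a)" by simp
    also have "\<dots> \<le> (\<Sum>x\<in>?C. X x)" by (intro sum_mono) auto
    also have "\<dots> \<le> (\<Sum>x\<in>A. X x)" using assms(1) nonneg by (intro sum_mono2) auto
    finally have "a * (10 * real (card ?C)) \<le> a * real (card A)" using le by simp
    then have "10 * real (card ?C) \<le> real (card A)" using False a by simp
    then show ?thesis using card by simp
  qed
qed

section \<open>A structured language on the machine\<close>

datatype op =
    VConst nat nat
  | VCopy nat nat
  | VInc nat
  | VAdd nat nat nat
  | VSub nat nat nat
  | VLoad nat nat nat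
  | VStore nat nat nat
  | VDeg nat nat
  | VNbr nat nat nat
  | VCoin nat nat
  | VEmit nat

datatype com =
    Skip
  | Op op
  | Seq com com (infixr ";;" 60)
  | IfLe nat nat com com
  | WhileLt nat nat com
  | WhileEps nat nat com

text \<open>Variables \<open>vr x\<close> live in the cells \<open>16 * x\<close>, the entries \<open>ar j i\<close> of the arrays
  \<open>1 \<le> j \<le> 14\<close> in the cells \<open>16 * i + j\<close>; the cells 15 and 31 are scratch. \<open>tm\<close> counts machine steps.\<close>

record ast =
  vr :: "nat \<Rightarrow> nat"
  ar :: "nat \<Rightarrow> nat \<Rightarrow> nat"
  fl :: "nat set"
  pr :: nat
  an :: "nat set"
  tm :: nat

definition tick :: "nat \<Rightarrow> ast \<Rightarrow> ast" where
  "tick n s = s\<lparr>tm := tm s + n\<rparr>"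

definition setv :: "nat \<Rightarrow> nat \<Rightarrow> nat \<Rightarrow> ast \<Rightarrow> ast" where
  "setv n x v s = s\<lparr>vr := (vr s)(x := v), tm := tm s + n\<rparr>"

fun opx :: "env \<Rightarrow> op \<Rightarrow> ast \<Rightarrow> ast option" where
  "opx I (VConst x n) s = Some (setv 1 x n s)"
| "opx I (VCopy x y) s = Some (setv 2 x (vr s y) s)"
| "opx I (VInc x) s = Some (setv 2 x (vr s x + 1) s)"
| "opx I (VAdd x y z) s = Some (setv 1 x (vr s y + vr s z) s)"
| "opx I (VSub x y z) s = Some (setv 1 x (vr s y - vr s z) s)"
| "opx I (VLoad x j y) s = (if 1 \<le> j \<and> j \<le> 14 then Some (setv 7 x (ar s j (vr s y)) s) else None)"
| "opx I (VStore j x y) s = (if 1 \<le> j \<and> j \<le> 14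
     then Some (s\<lparr>ar := (ar s)(j := (ar s j)(vr s x := vr s y)), tm := tm s + 7\<rparr>) else None)"
| "opx I (VDeg x y) s = (if vr s y \<in> verts I
     then Some (setv 1 x (length (nbrs I (vr s y))) (s\<lparr>pr := Suc (pr s)\<rparr>)) else None)"
| "opx I (VNbr x y z) s = (if vr s y \<in> verts I \<and> 1 \<le> vr s z \<and> vr s z \<le> length (nbrs I (vr s y))
     then Some (setv 1 x (nbrs I (vr s y) ! (vr s z - 1)) (s\<lparr>pr := Suc (pr s)\<rparr>)) else None)"
| "opx I (VCoin x y) s = (if vr s y \<in> fl s then None
     else Some (setv 1 x (of_bool (coins I (vr s y))) (s\<lparr>fl := insert (vr s y) (fl s)\<rparr>)))"
| "opx I (VEmit x) s = Some (s\<lparr>an := insert (vr s x) (an s), tm := tm s + 1\<rparr>)"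

text \<open>The ticks count the jumps of the compiled code exactly. The second branch of a
  conditional is placed first and must jump over the other one, hence the additional tick; leaving a
  loop on \<open>\<epsilon>\<close> takes two jumps, since the test can only jump when it
  succeeds.\<close>

inductive bs :: "env \<Rightarrow> com \<Rightarrow> ast \<Rightarrow> ast \<Rightarrow> bool" for I where
  Skip: "bs I Skip s s"
| Op: "opx I b s = Some s' \<Longrightarrow> bs I (Op b) s s'"
| Seq: "bs I c1 s s1 \<Longrightarrow> bs I c2 s1 s2 \<Longrightarrow> bs I (c1 ;; c2) s s2"
| IfT: "vr s x \<le> vr s y \<Longrightarrow> bs I c1 (tick 1 s) s1 \<Longrightarrow> bs I (IfLe x y c1 c2) s s1"
| IfF: "\<not> vr s x \<le> vr s y \<Longrightarrow> bs I c2 (tick 1 s) s1 \<Longrightarrow> bs I (IfLe x y c1 c2) s (tick 1 s1)"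
| WLF: "\<not> vr s x < vr s y \<Longrightarrow> bs I (WhileLt x y c) s (tick 1 s)"
| WLT: "vr s x < vr s y \<Longrightarrow> bs I c (tick 1 s) s1 \<Longrightarrow> bs I (WhileLt x y c) (tick 1 s1) s2 \<Longrightarrow>
    bs I (WhileLt x y c) s s2"
| WEF: "\<not> eps I * real (vr s x) \<le> real (vr s y) \<Longrightarrow> bs I (WhileEps x y c) s (tick 2 s)"
| WET: "eps I * real (vr s x) \<le> real (vr s y) \<Longrightarrow> bs I c (tick 1 s) s1 \<Longrightarrow>
    bs I (WhileEps x y c) (tick 1 s1) s2 \<Longrightarrow> bs I (WhileEps x y c) s s2"

text \<open>There is no multiplication: four doublings produce \<open>16 * i\<close> from the index
  \<open>i\<close>. The scratch cells have residue 15 modulo 16, which neither variables nor arrays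
  use.\<close>

definition addr :: "nat \<Rightarrow> nat \<Rightarrow> instr list" where
  "addr j y = [Add 15 (16 * y) (16 * y), Add 15 15 15, Add 15 15 15, Add 15 15 15,
     Const 31 j, Add 15 15 31]"

fun op_code :: "op \<Rightarrow> instr list" where
  "op_code (VConst x n) = [Const (16 * x) n]"
| "op_code (VCopy x y) = [Const 15 0, Add (16 * x) (16 * y) 15]"
| "op_code (VInc x) = [Const 15 1, Add (16 * x) (16 * x) 15]"
| "op_code (VAdd x y z) = [Add (16 * x) (16 * y) (16 * z)]"
| "op_code (VSub x y z) = [Sub (16 * x) (16 * y) (16 * z)]"
| "op_code (VLoad x j y) = addr j y @ [Load (16 * x) 15]"
| "op_code (VStore j x y) = addr j x @ [Store 15 (16 * y)]"
| "op_code (VDeg x y) = [Degree (16 * x) (16 * y)]"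
| "op_code (VNbr x y z) = [Neighbor (16 * x) (16 * y) (16 * z)]"
| "op_code (VCoin x y) = [Coin (16 * x) (16 * y)]"
| "op_code (VEmit x) = [Emit (16 * x)]"

section \<open>Compilation and its exact simulation\<close>

fun clen :: "com \<Rightarrow> nat" where
  "clen Skip = 0"
| "clen (Op b) = length (op_code b)"
| "clen (c1 ;; c2) = clen c1 + clen c2"
| "clen (IfLe x y c1 c2) = clen c1 + clen c2 + 2"
| "clen (WhileLt x y c) = clen c + 2"
| "clen (WhileEps x y c) = clen c + 3"

text \<open>Jump targets are absolute, hence the argument \<open>p\<close> for the position of the
  code. \<open>JumpLe 0 0\<close> compares a cell with itself and is an unconditional jump.\<close>

fun compile :: "nat \<Rightarrow> com \<Rightarrow> instr list" where
  "compile p Skip = []"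
| "compile p (Op b) = op_code b"
| "compile p (c1 ;; c2) = compile p c1 @ compile (p + clen c1) c2"
| "compile p (IfLe x y c1 c2) =
     [JumpLe (16 * x) (16 * y) (p + clen c2 + 2)] @ compile (p + 1) c2 @
     [JumpLe 0 0 (p + clen c2 + 2 + clen c1)] @ compile (p + clen c2 + 2) c1"
| "compile p (WhileLt x y c) =
     [JumpLe (16 * y) (16 * x) (p + clen c + 2)] @ compile (p + 1) c @ [JumpLe 0 0 p]"
| "compile p (WhileEps x y c) =
     [JumpEps (16 * x) (16 * y) (p + 2), JumpLe 0 0 (p + clen c + 3)] @ compile (p + 2) c @ [JumpLe 0 0 p]"

lemma length_compile [simp]: "length (compile p c) = clen c"
  by (induction c arbitrary: p) auto

definition code_at :: "program \<Rightarrow> nat \<Rightarrow> instr list \<Rightarrow> bool" where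
  "code_at P p cs \<longleftrightarrow> (\<forall>i<length cs. p + i < length P \<and> P ! (p + i) = cs ! i)"

lemma code_at_Nil [simp]: "code_at P p []"
  by (simp add: code_at_def)

lemma code_at_Cons [simp]: "code_at P p (c # cs) \<longleftrightarrow> p < length P \<and> P ! p = c \<and> code_at P (Suc p) cs"
  unfolding code_at_def by (auto simp: less_Suc_eq_0_disj)

lemma code_at_append [simp]: "code_at P p (cs @ ds) \<longleftrightarrow> code_at P p cs \<and> code_at P (p + length cs) ds"
  by (induction cs arbitrary: p) auto

lemma run_add: "run I P (m + n) s = Option.bind (run I P m s) (run I P n)"
  by (induction m arbitrary: s) (auto split: bind_split)

lemma run_trans: "run I P m s = Some s1 \<Longrightarrow> run I P n s1 = Some s2 \<Longrightarrow> run I P (m + n) s = Some s2"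
  by (simp add: run_add)

fun is_jump :: "instr \<Rightarrow> bool" where
  "is_jump (JumpLe a b l) = True"
| "is_jump (JumpEps a b l) = True"
| "is_jump _ = False"

fun execs :: "env \<Rightarrow> instr list \<Rightarrow> config \<Rightarrow> config option" where
  "execs I [] s = Some s"
| "execs I (i # is) s = Option.bind (exec I i s) (execs I is)"

lemma exec_pc: "\<not> is_jump i \<Longrightarrow> exec I i s = Some s' \<Longrightarrow> pc s' = Suc (pc s)"
  by (cases i) (auto simp: put_def next_pc_def count_probe_def Let_def split: if_splits)

lemma run_execs:
  assumes "code_at P (pc s) is" "\<forall>i\<in>set is. \<not> is_jump i" "execs I is s = Some s'"
  shows "run I P (length is) s = Some s' \<and> pc s' = pc s + length is"
  using assms
proof (induction "is" arbitrary: s)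
  case (Cons i "is")
  then obtain s1 where s1: "exec I i s = Some s1" "execs I is s1 = Some s'"
    by (auto simp: bind_eq_Some_conv)
  have "pc s1 = Suc (pc s)" using exec_pc[OF _ s1(1)] Cons.prems by simp
  moreover from this have "run I P (length is) s1 = Some s' \<and> pc s' = pc s1 + length is"
    using Cons.prems s1(2) by (intro Cons.IH) auto
  moreover have "step I P s = Some s1" using Cons.prems(1) s1(1) by (simp add: step_def)
  ultimately show ?case by simp
qed simp

definition sim :: "config \<Rightarrow> ast \<Rightarrow> bool" where
  "sim s a \<longleftrightarrow> (\<forall>x. mem s (16 * x) = vr a x) \<and>
     (\<forall>i j. 1 \<le> j \<longrightarrow> j \<le> 14 \<longrightarrow> mem s (16 * i + j) = ar a j i) \<and>
     flipped s = fl a \<and> probes s = pr a \<and> answer s = an a"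

lemma cell_eq_iff:
  fixes i i' j j' :: nat
  assumes "j < 16" "j' < 16"
  shows "16 * i + j = 16 * i' + j' \<longleftrightarrow> i = i' \<and> j = j'"
proof
  assume eq: "16 * i + j = 16 * i' + j'"
  have "(16 * i + j) div 16 = i" "(16 * i + j) mod 16 = j" using assms by auto
  moreover have "(16 * i' + j') div 16 = i'" "(16 * i' + j') mod 16 = j'" using assms by auto
  ultimately show "i = i' \<and> j = j'" using eq by metis
qed simp

lemma cell_neq:
  fixes x i i' j j' :: nat
  shows "16 * x \<noteq> 15" "16 * x \<noteq> 31"
    "j \<le> 14 \<Longrightarrow> 16 * i + j \<noteq> 15" "j \<le> 14 \<Longrightarrow> 16 * i + j \<noteq> 31"
    "1 \<le> j \<Longrightarrow> j \<le> 14 \<Longrightarrow> 16 * i + j \<noteq> 16 * x"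
    "j \<le> 14 \<Longrightarrow> j' \<le> 14 \<Longrightarrow> 16 * i + j = 16 * i' + j' \<longleftrightarrow> i = i' \<and> j = j'"
    "1 \<le> j \<Longrightarrow> j \<le> 14 \<Longrightarrow> 16 * x \<noteq> 16 * i + j"
  using cell_eq_iff[of 0 15 x 0] cell_eq_iff[of 0 15 x 1] cell_eq_iff[of j 15 i 0] cell_eq_iff[of j 15 i 1]
    cell_eq_iff[of j 0 i x] cell_eq_iff[of j j' i i'] by auto

lemma sim_upd_var:
  assumes "sim s a" "\<And>c. c \<noteq> 15 \<Longrightarrow> c \<noteq> 31 \<Longrightarrow> mem s' c = ((mem s)(16 * x := v)) c"
    "flipped s' = fl a'" "probes s' = pr a'" "answer s' = an a'" "vr a' = (vr a)(x := v)" "ar a' = ar a"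
  shows "sim s' a'"
  using assms unfolding sim_def by (auto simp: cell_neq)

lemma sim_upd_arr:
  assumes "sim s a" "1 \<le> j" "j \<le> 14"
    "\<And>c. c \<noteq> 15 \<Longrightarrow> c \<noteq> 31 \<Longrightarrow> mem s' c = ((mem s)(16 * i + j := v)) c"
    "flipped s' = fl a'" "probes s' = pr a'" "answer s' = an a'" "vr a' = vr a"
    "ar a' = (ar a)(j := (ar a j)(i := v))"
  shows "sim s' a'"
  using assms unfolding sim_def by (auto simp: cell_neq)

lemma sim_op:
  assumes sim: "sim s a" and "opx I b a = Some a'"
  shows "\<exists>s'. execs I (op_code b) s = Some s' \<and> sim s' a' \<and> tm a' = tm a + length (op_code b)"
proof -
  have m: "mem s (16 * x) = vr a x" for x using sim by (simp add: sim_def)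
  have m2: "mem s (16 * i + j) = ar a j i" if "1 \<le> j" "j \<le> 14" for i j using sim that by (simp add: sim_def)
  have m3: "flipped s = fl a" "probes s = pr a" "answer s = an a" using sim by (simp_all add: sim_def)
  have x16: "y + y + (y + y) + (y + y + (y + y)) + (y + y + (y + y) + (y + y + (y + y))) = 16 * y"
    for y :: nat by simp
  note defs = put_def next_pc_def count_probe_def Let_def setv_def addr_def cell_neq
  show ?thesis
  proof (cases b)
    case (VConst x n)
    then show ?thesis using assms m m3
      by (auto simp: defs intro!: sim_upd_var[OF sim, where x = x])
  next
    case (VCopy x y)
    then show ?thesis using assms m m3
      by (auto simp: defs intro!: sim_upd_var[OF sim, where x = x])
  next
    case (VInc x)
    then show ?thesis using assms m m3
      by (auto simp: defs intro!: sim_upd_var[OF sim, where x = x])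
  next
    case (VAdd x y z)
    then show ?thesis using assms m m3
      by (auto simp: defs intro!: sim_upd_var[OF sim, where x = x])
  next
    case (VSub x y z)
    then show ?thesis using assms m m3
      by (auto simp: defs intro!: sim_upd_var[OF sim, where x = x])
  next
    case (VLoad x j y)
    then show ?thesis using assms m m3 m2[of j "vr a y"]
      by (auto simp: defs x16 split: if_splits intro!: sim_upd_var[OF sim, where x = x])
  next
    case (VStore j x y)
    then show ?thesis using assms m m3
      by (auto simp: defs x16 split: if_splits intro!: sim_upd_arr[OF sim, where i = "vr a x" and j = j])
  next
    case (VDeg x y)
    then show ?thesis using assms m m3
      by (auto simp: defs split: if_splits intro!: sim_upd_var[OF sim, where x = x])
  next
    case (VNbr x y z)
    then show ?thesis using assms m m3
      by (auto simp: defs split: if_splits intro!: sim_upd_var[OF sim, where x = x])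
  next
    case (VCoin x y)
    then show ?thesis using assms m m3
      by (auto simp: defs split: if_splits intro!: sim_upd_var[OF sim, where x = x])
  next
    case (VEmit x)
    then show ?thesis using assms m m3
      by (auto simp: defs sim_def)
  qed
qed

lemma op_code_no_jump: "i \<in> set (op_code b) \<Longrightarrow> \<not> is_jump i"
  by (cases b) (auto simp: addr_def)

lemma sim_tick: "sim s (tick n a) \<longleftrightarrow> sim s a"
  by (simp add: sim_def tick_def)

lemma sim_tm: "sim s (a\<lparr>tm := n\<rparr>) \<longleftrightarrow> sim s a"
  by (simp add: sim_def)

lemma sim_pc: "sim (s\<lparr>pc := p\<rparr>) a \<longleftrightarrow> sim s a"
  by (simp add: sim_def)

lemma sim_vr: "sim s a \<Longrightarrow> mem s (16 * x) = vr a x"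
  by (simp add: sim_def)

lemma run_jump:
  assumes "pc s < length P" "P ! pc s = JumpLe x y l"
  shows "run I P 1 s = Some (s\<lparr>pc := if mem s x \<le> mem s y then l else Suc (pc s)\<rparr>)"
  using assms by (simp add: step_def goto_if_def next_pc_def)

lemma run_jump_eps:
  assumes "pc s < length P" "P ! pc s = JumpEps x y l"
  shows "run I P 1 s = Some (s\<lparr>pc := if eps I * real (mem s x) \<le> real (mem s y) then l else Suc (pc s)\<rparr>)"
  using assms by (simp add: step_def goto_if_def next_pc_def)

lemma compile_correct:
  assumes "bs I c a a'" "sim s a" "code_at P (pc s) (compile (pc s) c)"
  shows "\<exists>n s'. run I P n s = Some s' \<and> sim s' a' \<and> pc s' = pc s + clen c \<and> tm a' = tm a + n"
  using assms
proof (induction arbitrary: s rule: bs.induct)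
  case (Skip a)
  show ?case by (rule exI[of _ 0], rule exI[of _ s]) (use Skip in simp)
next
  case (Op b a a')
  from sim_op[OF Op.prems(1) Op.hyps] obtain s' where
    s': "execs I (op_code b) s = Some s'" "sim s' a'" "tm a' = tm a + length (op_code b)" by (elim exE conjE)
  have "run I P (length (op_code b)) s = Some s' \<and> pc s' = pc s + length (op_code b)"
    by (rule run_execs) (use Op.prems s' op_code_no_jump in auto)
  then show ?case using s' by auto
next
  case (Seq c1 a a1 c2 a2)
  have code: "code_at P (pc s) (compile (pc s) c1)" "code_at P (pc s + clen c1) (compile (pc s + clen c1) c2)"
    using Seq.prems by simp_all
  from Seq.IH(1)[OF Seq.prems(1) code(1)] obtain n1 s1 where
    1: "run I P n1 s = Some s1" "sim s1 a1" "pc s1 = pc s + clen c1" "tm a1 = tm a + n1" by (elim exE conjE)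
  from Seq.IH(2)[OF 1(2)] code(2) have "\<exists>n s'. run I P n s1 = Some s' \<and> sim s' a2 \<and> pc s' = pc s1 + clen c2 \<and> tm a2 = tm a1 + n"
    unfolding 1(3) .
  then obtain n2 s2 where
    2: "run I P n2 s1 = Some s2" "sim s2 a2" "pc s2 = pc s1 + clen c2" "tm a2 = tm a1 + n2"
    by (elim exE conjE)
  show ?case
    by (rule exI[of _ "n1 + n2"], rule exI[of _ s2]) (use 1 2 run_trans in auto)
next
  case (IfT a x y c1 a1 c2)
  let ?s = "s\<lparr>pc := pc s + clen c2 + 2\<rparr>"
  have 1: "run I P 1 s = Some ?s"
    using run_jump[of s P "16 * x" "16 * y" "pc s + clen c2 + 2" I] IfT by (simp add: sim_vr)
  have "\<exists>n s'. run I P n ?s = Some s' \<and> sim s' a1 \<and> pc s' = pc ?s + clen c1 \<and> tm a1 = tm (tick 1 a) + n"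
    using IfT.prems by (intro IfT.IH) (auto simp: sim_tick sim_pc add_ac)
  then obtain n s' where 2: "run I P n ?s = Some s'" "sim s' a1" "pc s' = pc ?s + clen c1"
    "tm a1 = tm (tick 1 a) + n" by (elim exE conjE)
  show ?case
    by (rule exI[of _ "1 + n"], rule exI[of _ s']) (use 2 run_trans[OF 1 2(1)] in \<open>auto simp: tick_def\<close>)
next
  case (IfF a x y c2 a1 c1)
  let ?s = "s\<lparr>pc := pc s + 1\<rparr>"
  have 1: "run I P 1 s = Some ?s"
    using run_jump[of s P "16 * x" "16 * y" "pc s + clen c2 + 2" I] IfF by (simp add: sim_vr)
  have "\<exists>n s'. run I P n ?s = Some s' \<and> sim s' a1 \<and> pc s' = pc ?s + clen c2 \<and> tm a1 = tm (tick 1 a) + n"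
    using IfF.prems by (intro IfF.IH) (auto simp: sim_tick sim_pc add_ac)
  then obtain n s' where 2: "run I P n ?s = Some s'" "sim s' a1" "pc s' = pc ?s + clen c2"
    "tm a1 = tm (tick 1 a) + n" by (elim exE conjE)
  let ?s2 = "s'\<lparr>pc := pc s + clen c2 + 2 + clen c1\<rparr>"
  have 3: "run I P 1 s' = Some ?s2"
    using run_jump[of s' P 0 0 "pc s + clen c2 + 2 + clen c1" I] IfF.prems 2(3) by simp
  show ?case
    by (rule exI[of _ "(1 + n) + 1"], rule exI[of _ ?s2])
      (use 2 run_trans[OF run_trans[OF 1 2(1)] 3] in \<open>auto simp: tick_def sim_tm sim_pc\<close>)
next
  case (WLF a x y c)
  let ?s = "s\<lparr>pc := pc s + clen c + 2\<rparr>"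
  have 1: "run I P 1 s = Some ?s"
    using run_jump[of s P "16 * y" "16 * x" "pc s + clen c + 2" I] WLF by (simp add: sim_vr)
  show ?case
    by (rule exI[of _ 1], rule exI[of _ ?s]) (use 1 WLF in \<open>auto simp: sim_tm sim_pc tick_def\<close>)
next
  case (WLT a x y c a1 a2)
  let ?s = "s\<lparr>pc := pc s + 1\<rparr>"
  have 1: "run I P 1 s = Some ?s"
    using run_jump[of s P "16 * y" "16 * x" "pc s + clen c + 2" I] WLT by (simp add: sim_vr)
  have "\<exists>n s'. run I P n ?s = Some s' \<and> sim s' a1 \<and> pc s' = pc ?s + clen c \<and> tm a1 = tm (tick 1 a) + n"
    using WLT.prems by (intro WLT.IH(1)) (auto simp: sim_tick sim_pc add_ac)
  then obtain n s' where 2: "run I P n ?s = Some s'" "sim s' a1" "pc s' = pc ?s + clen c"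
    "tm a1 = tm (tick 1 a) + n" by (elim exE conjE)
  let ?s2 = "s'\<lparr>pc := pc s\<rparr>"
  have 3: "run I P 1 s' = Some ?s2"
    using run_jump[of s' P 0 0 "pc s" I] WLT.prems 2(3) by simp
  have "\<exists>n s'. run I P n ?s2 = Some s' \<and> sim s' a2 \<and> pc s' = pc ?s2 + clen (WhileLt x y c) \<and>
      tm a2 = tm (tick 1 a1) + n"
    using WLT.prems 2(2) by (intro WLT.IH(2)) (auto simp: sim_tick sim_pc)
  then obtain m s'' where 4: "run I P m ?s2 = Some s''" "sim s'' a2"
    "pc s'' = pc ?s2 + clen (WhileLt x y c)" "tm a2 = tm (tick 1 a1) + m" by (elim exE conjE)
  show ?case
    by (rule exI[of _ "((1 + n) + 1) + m"], rule exI[of _ s''])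
      (use 2(4) 4 run_trans[OF run_trans[OF run_trans[OF 1 2(1)] 3] 4(1)] in \<open>auto simp: tick_def\<close>)
next
  case (WEF a x y c)
  let ?s = "s\<lparr>pc := Suc (pc s)\<rparr>" and ?s2 = "s\<lparr>pc := pc s + clen c + 3\<rparr>"
  have 1: "run I P 1 s = Some ?s"
    using run_jump_eps[of s P "16 * x" "16 * y" "pc s + 2" I] WEF by (simp add: sim_vr)
  have 2: "run I P 1 ?s = Some ?s2"
    using run_jump[of ?s P 0 0 "pc s + clen c + 3" I] WEF.prems by simp
  show ?case
    by (rule exI[of _ "1 + 1"], rule exI[of _ ?s2])
      (use run_trans[OF 1 2] WEF in \<open>auto simp: sim_tm sim_pc tick_def\<close>)
next
  case (WET a x y c a1 a2)
  let ?s = "s\<lparr>pc := pc s + 2\<rparr>"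
  have 1: "run I P 1 s = Some ?s"
    using run_jump_eps[of s P "16 * x" "16 * y" "pc s + 2" I] WET by (simp add: sim_vr)
  have "\<exists>n s'. run I P n ?s = Some s' \<and> sim s' a1 \<and> pc s' = pc ?s + clen c \<and> tm a1 = tm (tick 1 a) + n"
    using WET.prems by (intro WET.IH(1)) (auto simp: sim_tick sim_pc add_ac)
  then obtain n s' where 2: "run I P n ?s = Some s'" "sim s' a1" "pc s' = pc ?s + clen c"
    "tm a1 = tm (tick 1 a) + n" by (elim exE conjE)
  let ?s2 = "s'\<lparr>pc := pc s\<rparr>"
  have 3: "run I P 1 s' = Some ?s2"
    using run_jump[of s' P 0 0 "pc s" I] WET.prems 2(3) by simp
  have "\<exists>n s'. run I P n ?s2 = Some s' \<and> sim s' a2 \<and> pc s' = pc ?s2 + clen (WhileEps x y c) \<and>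
      tm a2 = tm (tick 1 a1) + n"
    using WET.prems 2(2) by (intro WET.IH(2)) (auto simp: sim_tick sim_pc)
  then obtain m s'' where 4: "run I P m ?s2 = Some s''" "sim s'' a2"
    "pc s'' = pc ?s2 + clen (WhileEps x y c)" "tm a2 = tm (tick 1 a1) + m" by (elim exE conjE)
  show ?case
    by (rule exI[of _ "((1 + n) + 1) + m"], rule exI[of _ s''])
      (use 2(4) 4 run_trans[OF run_trans[OF run_trans[OF 1 2(1)] 3] 4(1)] in \<open>auto simp: tick_def\<close>)
qed

section \<open>Total correctness by weakest preconditions\<close>

definition wp :: "env \<Rightarrow> com \<Rightarrow> (ast \<Rightarrow> bool) \<Rightarrow> ast \<Rightarrow> bool" where
  "wp I c Q s \<longleftrightarrow> (\<exists>s'. bs I c s s' \<and> Q s')"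

inductive_cases bs_elims:
  "bs I Skip s s'" "bs I (Op b) s s'" "bs I (c1 ;; c2) s s'" "bs I (IfLe x y c1 c2) s s'"

lemma wp_Skip [simp]: "wp I Skip Q s \<longleftrightarrow> Q s"
  by (auto simp: wp_def intro: bs.Skip elim: bs_elims)

lemma wp_Op [simp]: "wp I (Op b) Q s \<longleftrightarrow> (\<exists>s'. opx I b s = Some s' \<and> Q s')"
  by (auto simp: wp_def intro: bs.Op elim: bs_elims)

lemma wp_Seq [simp]: "wp I (c1 ;; c2) Q s \<longleftrightarrow> wp I c1 (wp I c2 Q) s"
  unfolding wp_def by (auto intro: bs.Seq elim!: bs_elims)

lemma wp_IfLe [simp]: "wp I (IfLe x y c1 c2) Q s \<longleftrightarrow>
    (if vr s x \<le> vr s y then wp I c1 Q (tick 1 s) else wp I c2 (\<lambda>s'. Q (tick 1 s')) (tick 1 s))"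
  by (auto simp: wp_def intro: bs.IfT[unfolded One_nat_def] bs.IfF[unfolded One_nat_def] elim!: bs_elims)

lemma wp_mono: "wp I c P s \<Longrightarrow> (\<And>s'. P s' \<Longrightarrow> Q s') \<Longrightarrow> wp I c Q s"
  unfolding wp_def by blast

lemma wp_seqI: "wp I c1 P s \<Longrightarrow> (\<And>s'. P s' \<Longrightarrow> wp I c2 Q s') \<Longrightarrow> wp I (c1 ;; c2) Q s"
  by (auto intro: wp_mono)

lemma wp_WhileLt_exit: "\<not> vr s x < vr s y \<Longrightarrow> Q (tick 1 s) \<Longrightarrow> wp I (WhileLt x y c) Q s"
  unfolding wp_def using bs.WLF by blast

lemma wp_WhileLt_step:
  "vr s x < vr s y \<Longrightarrow> wp I c (\<lambda>s1. wp I (WhileLt x y c) Q (tick 1 s1)) (tick 1 s) \<Longrightarrow>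
   wp I (WhileLt x y c) Q s"
  unfolding wp_def using bs.WLT by blast

lemma wp_WhileEps_exit:
  "\<not> eps I * real (vr s x) \<le> real (vr s y) \<Longrightarrow> Q (tick 2 s) \<Longrightarrow> wp I (WhileEps x y c) Q s"
  unfolding wp_def using bs.WEF by blast

lemma wp_WhileEps_step:
  "eps I * real (vr s x) \<le> real (vr s y) \<Longrightarrow>
   wp I c (\<lambda>s1. wp I (WhileEps x y c) Q (tick 1 s1)) (tick 1 s) \<Longrightarrow> wp I (WhileEps x y c) Q s"
  unfolding wp_def using bs.WET by blast

lemma setv_simps [simp]:
  "vr (setv n x v s) = (vr s)(x := v)" "ar (setv n x v s) = ar s" "fl (setv n x v s) = fl s"
  "pr (setv n x v s) = pr s" "an (setv n x v s) = an s" "tm (setv n x v s) = tm s + n"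
  by (simp_all add: setv_def)

lemma tick_simps [simp]:
  "vr (tick n s) = vr s" "ar (tick n s) = ar s" "fl (tick n s) = fl s"
  "pr (tick n s) = pr s" "an (tick n s) = an s" "tm (tick n s) = tm s + n"
  by (simp_all add: tick_def)

text \<open>\<open>upd X Y T p s s'\<close>: only the variables in \<open>X\<close> and the arrays in \<open>Y\<close> have changed, within
  \<open>T\<close> steps and \<open>p\<close> probes. Coins are flipped only when array 7 changes, which keeps their
  outcomes between queries.\<close>

definition upd :: "nat set \<Rightarrow> nat set \<Rightarrow> nat \<Rightarrow> nat \<Rightarrow> ast \<Rightarrow> ast \<Rightarrow> bool" where
  "upd X Y T p s s' \<longleftrightarrow> (\<forall>x. x \<notin> X \<longrightarrow> vr s' x = vr s x) \<and> (\<forall>j. j \<notin> Y \<longrightarrow> ar s' j = ar s j) \<and>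
     (7 \<notin> Y \<longrightarrow> fl s' = fl s) \<and> an s' = an s \<and> tm s' \<le> tm s + T \<and> pr s' \<le> pr s + p"

lemma upd_vr: "upd X Y T p s s' \<Longrightarrow> x \<notin> X \<Longrightarrow> vr s' x = vr s x"
  by (simp add: upd_def)

lemma upd_ar: "upd X Y T p s s' \<Longrightarrow> j \<notin> Y \<Longrightarrow> ar s' j = ar s j"
  by (simp add: upd_def)

lemma upd_fl: "upd X Y T p s s' \<Longrightarrow> 7 \<notin> Y \<Longrightarrow> fl s' = fl s"
  by (simp add: upd_def)

lemma upd_refl: "upd X Y T p s s"
  by (simp add: upd_def)

lemma upd_trans:
  assumes "upd X Y T p s s1" "upd X' Y' T' p' s1 s2" "X \<subseteq> X''" "X' \<subseteq> X''" "Y \<subseteq> Y''" "Y' \<subseteq> Y''"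
    "T + T' \<le> T''" "p + p' \<le> p''"
  shows "upd X'' Y'' T'' p'' s s2"
proof -
  have "vr s2 x = vr s x" if "x \<notin> X''" for x
    using that assms(3,4) upd_vr[OF assms(1), of x] upd_vr[OF assms(2), of x] by (metis subsetD)
  moreover have "ar s2 j = ar s j" if "j \<notin> Y''" for j
    using that assms(5,6) upd_ar[OF assms(1), of j] upd_ar[OF assms(2), of j] by (metis subsetD)
  moreover have "fl s2 = fl s" if "7 \<notin> Y''"
    using that assms(5,6) upd_fl[OF assms(1)] upd_fl[OF assms(2)] by (metis subsetD)
  moreover have "an s2 = an s" "tm s2 \<le> tm s + T''" "pr s2 \<le> pr s + p''"
    using assms(1,2,7,8) by (auto simp: upd_def)
  ultimately show ?thesis by (simp add: upd_def)
qed

lemma upd_weaken: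
  assumes "upd X Y T p s s1" "X \<subseteq> X'" "Y \<subseteq> Y'" "T \<le> T'" "p \<le> p'"
  shows "upd X' Y' T' p' s s1"
  using upd_trans[OF assms(1) upd_refl[of X Y 0 0]] assms by simp

definition For :: "nat \<Rightarrow> nat \<Rightarrow> com \<Rightarrow> com" where
  "For i n c = Op (VConst i 0) ;; WhileLt i n (c ;; Op (VInc i))"

text \<open>The 4 steps per round are the test, the increment (two instructions) and the jump back;
  the other 2 are the initialisation and the last test. Because \<open>J\<close> must survive any
  change of the counter and of the time, it can describe data only; costs are carried by
  \<open>upd\<close>.\<close>

lemma wp_For:
  assumes i: "i \<notin> X" "n \<notin> X" "i \<noteq> n" and N: "vr s n = N" and J0: "J 0 s"
    and ins: "\<And>k s' m v. J k s' \<Longrightarrow> J k (setv m i v s')"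
    and body: "\<And>k s'. k < N \<Longrightarrow> vr s' i = k \<Longrightarrow> upd (insert i X) Y (N * (T + 4) + 2) (N * p) s s' \<Longrightarrow>
      J k s' \<Longrightarrow> wp I c (\<lambda>s''. upd X Y T p s' s'' \<and> J (Suc k) s'') s'"
  shows "wp I (For i n c) (\<lambda>s'. upd (insert i X) Y (N * (T + 4) + 2) (N * p) s s' \<and> J N s') s"
proof -
  let ?Q = "\<lambda>s'. upd (insert i X) Y (N * (T + 4) + 2) (N * p) s s' \<and> J N s'"
  have tick: "J k (tick m s')" if "J k s'" for k m s'
  proof -
    have eq: "setv m i (vr s' i) s' = tick m s'" by (simp add: setv_def tick_def)
    show ?thesis using ins[OF that, of m "vr s' i"] unfolding eq .
  qed
  have loop: "wp I (WhileLt i n (c ;; Op (VInc i))) ?Q s'"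
    if "k \<le> N" "vr s' i = k" "upd (insert i X) Y (k * (T + 4) + 1) (k * p) s s'" "J k s'" for k s'
    using that
  proof (induction "N - k" arbitrary: k s')
    case 0
    then have k: "k = N" by simp
    have n: "vr s' n = N" using upd_vr[OF 0(4), of n] i N by auto
    show ?case
    proof (rule wp_WhileLt_exit)
      show "\<not> vr s' i < vr s' n" using 0 k n by simp
      have "upd (insert i X) Y (N * (T + 4) + 2) (N * p) s (tick 1 s')"
        using 0(4) k by (auto simp: upd_def)
      then show "?Q (tick 1 s')" using tick[OF 0(5)] k by simp
    qed
  next
    case (Suc m)
    then have k: "k < N" by simp
    have n: "vr s' n = N" using upd_vr[OF Suc(5), of n] i N by auto
    let ?s = "tick 1 s'"
    have le: "Suc k * (T + 4) \<le> N * (T + 4)" "k * p \<le> N * p" using k by (intro mult_le_mono1, simp)+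
    have u1: "upd (insert i X) Y (N * (T + 4) + 2) (N * p) s ?s"
      by (rule upd_trans[OF Suc(5), of "{}" "{}" 1 0]) (use le k in \<open>auto simp: upd_def\<close>)
    have w: "wp I c (\<lambda>s''. upd X Y T p ?s s'' \<and> J (Suc k) s'') ?s"
      by (rule body[OF k _ u1 tick[OF Suc(6)]]) (use Suc in simp)
    show ?case
    proof (rule wp_WhileLt_step)
      show "vr s' i < vr s' n" using Suc k n by simp
      show "wp I (c ;; Op (VInc i)) (\<lambda>s1. wp I (WhileLt i n (c ;; Op (VInc i))) ?Q (tick 1 s1)) ?s"
        unfolding wp_Seq
      proof (rule wp_mono[OF w])
        fix s1 assume s1: "upd X Y T p ?s s1 \<and> J (Suc k) s1"
        have ik: "vr s1 i = k" using upd_vr[OF conjunct1[OF s1], of i] i Suc by simp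
        let ?s2 = "setv 2 i (Suc k) s1"
        have "wp I (WhileLt i n (c ;; Op (VInc i))) ?Q (tick 1 ?s2)"
        proof (rule Suc.hyps(1))
          show "m = N - Suc k" using Suc by simp
          show "upd (insert i X) Y (Suc k * (T + 4) + 1) (Suc k * p) s (tick 1 ?s2)"
            using Suc(5) s1 by (auto simp: upd_def)
          show "J (Suc k) (tick 1 ?s2)" using s1 ins tick by blast
        qed (use k in simp_all)
        then show "wp I (Op (VInc i)) (\<lambda>s1. wp I (WhileLt i n (c ;; Op (VInc i))) ?Q (tick 1 s1)) s1"
          using ik by simp
      qed
    qed
  qed
  have "wp I (WhileLt i n (c ;; Op (VInc i))) ?Q (setv 1 i 0 s)"
  proof (rule loop[of 0])
    show "upd (insert i X) Y (0 * (T + 4) + 1) (0 * p) s (setv 1 i 0 s)" by (simp add: upd_def)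
    show "J 0 (setv 1 i 0 s)" using ins[OF J0] .
  qed simp_all
  then show ?thesis by (simp add: For_def)
qed

text \<open>A rule for bodies that emit answers, which \<open>upd\<close> excludes. The invariant
  then has to keep track of counter, time and probes itself.\<close>

lemma wp_For_gen:
  assumes J0: "J 0 (setv 1 i 0 s)"
    and Jv: "\<And>k s'. J k s' \<Longrightarrow> vr s' i = k \<and> vr s' n = N"
    and body: "\<And>k s'. k < N \<Longrightarrow> J k s' \<Longrightarrow>
      wp I c (\<lambda>s''. vr s'' i = k \<and> J (Suc k) (tick 1 (setv 2 i (Suc k) s''))) (tick 1 s')"
  shows "wp I (For i n c) (\<lambda>s'. \<exists>s''. s' = tick 1 s'' \<and> J N s'') s"
proof -
  let ?Q = "\<lambda>s'. \<exists>s''. s' = tick 1 s'' \<and> J N s''"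
  have "wp I (WhileLt i n (c ;; Op (VInc i))) ?Q s'" if "k \<le> N" "J k s'" for k s'
    using that
  proof (induction "N - k" arbitrary: k s')
    case 0
    then have "k = N" by simp
    then show ?case using 0 Jv[of k s'] by (intro wp_WhileLt_exit) auto
  next
    case (Suc m)
    then have k: "k < N" by simp
    show ?case
    proof (rule wp_WhileLt_step)
      show "vr s' i < vr s' n" using Jv[OF Suc(4)] k by simp
      show "wp I (c ;; Op (VInc i)) (\<lambda>s1. wp I (WhileLt i n (c ;; Op (VInc i))) ?Q (tick 1 s1)) (tick 1 s')"
        unfolding wp_Seq
      proof (rule wp_mono[OF body[OF k Suc(4)]])
        fix s1 assume s1: "vr s1 i = k \<and> J (Suc k) (tick 1 (setv 2 i (Suc k) s1))"
        have "wp I (WhileLt i n (c ;; Op (VInc i))) ?Q (tick 1 (setv 2 i (Suc k) s1))"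
          by (rule Suc.hyps(1)[of "Suc k"]) (use Suc(2) k s1 in auto)
        then show "wp I (Op (VInc i)) (\<lambda>s1. wp I (WhileLt i n (c ;; Op (VInc i))) ?Q (tick 1 s1)) s1"
          using s1 by simp
      qed
    qed
  qed
  from this[of 0, OF _ J0] show ?thesis by (simp add: For_def)
qed

text \<open>The default \<open>n\<close> for the position \<open>p\<close> stands for absence, so
  afterwards \<open>p < n\<close> is the membership test.\<close>

definition scan :: "nat \<Rightarrow> nat \<Rightarrow> nat \<Rightarrow> nat \<Rightarrow> com" where
  "scan j n w p = Op (VCopy p n) ;; For 10 n (Op (VLoad 11 j 10) ;;
     IfLe 11 w (IfLe w 11 (Op (VCopy p 10)) Skip) Skip)"

lemma wp_scan:
  assumes "1 \<le> j" "j \<le> 14" "p \<notin> {10, 11}" "n \<notin> {10, 11, p}" "w \<notin> {10, 11, p}"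
  shows "wp I (scan j n w p) (\<lambda>s'. upd {10, 11, p} {} (16 * vr s n + 4) 0 s s' \<and>
    (vr s' p < vr s n \<and> ar s j (vr s' p) = vr s w \<or>
     vr s' p = vr s n \<and> vr s w \<notin> ar s j ` {..<vr s n})) s"
proof -
  let ?N = "vr s n" and ?s = "setv 2 p (vr s n) s"
  let ?J = "\<lambda>k s'. vr s' p < ?N \<and> ar s j (vr s' p) = vr s w \<or>
     vr s' p = ?N \<and> vr s w \<notin> ar s j ` {..<k}"
  have w: "wp I (For 10 n (Op (VLoad 11 j 10) ;; IfLe 11 w (IfLe w 11 (Op (VCopy p 10)) Skip) Skip))
     (\<lambda>s'. upd (insert 10 {11, p}) {} (?N * (12 + 4) + 2) (?N * 0) ?s s' \<and> ?J ?N s') ?s"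
  proof (rule wp_For[where J = ?J])
    fix k s' assume k: "k < ?N" "vr s' 10 = k"
      and u: "upd (insert 10 {11, p}) {} (?N * (12 + 4) + 2) (?N * 0) ?s s'" and J: "?J k s'"
    have w: "vr s' w = vr s w" using upd_vr[OF u, of w] assms by simp
    have a: "ar s' j = ar s j" using upd_ar[OF u, of j] by simp
    show "wp I (Op (VLoad 11 j 10) ;; IfLe 11 w (IfLe w 11 (Op (VCopy p 10)) Skip) Skip)
      (\<lambda>s''. upd {11, p} {} 12 0 s' s'' \<and> ?J (Suc k) s'') s'"
      using k J w a assms by (auto simp: upd_def less_Suc_eq)
  qed (use assms in auto)
  show ?thesis
    unfolding scan_def wp_Seq wp_Op opx.simps
    by (rule exI[of _ ?s], rule conjI[OF refl], rule wp_mono[OF w]) (auto simp: upd_def)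
qed

definition lst :: "ast \<Rightarrow> nat \<Rightarrow> nat \<Rightarrow> nat list" where
  "lst s j n = map (ar s j) [0..<n]"

lemma length_lst [simp]: "length (lst s j n) = n"
  by (simp add: lst_def)

lemma nth_lst [simp]: "i < n \<Longrightarrow> lst s j n ! i = ar s j i"
  by (simp add: lst_def)

lemma set_lst: "set (lst s j n) = ar s j ` {..<n}"
  by (auto simp: lst_def)

lemma lst_Suc: "lst s j (Suc n) = lst s j n @ [ar s j n]"
  by (simp add: lst_def)

lemma lst_tick [simp]: "lst (tick n s) j m = lst s j m" "lst (setv n x v s) j m = lst s j m"
  by (simp_all add: lst_def)

definition copy :: "nat \<Rightarrow> nat \<Rightarrow> nat \<Rightarrow> com" where
  "copy j n j' = For 22 n (Op (VLoad 23 j 22) ;; Op (VStore j' 22 23))"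

lemma wp_copy:
  assumes "1 \<le> j" "j \<le> 14" "1 \<le> j'" "j' \<le> 14" "j \<noteq> j'" "n \<notin> {22, 23}" "j' \<noteq> 7"
  shows "wp I (copy j n j') (\<lambda>s'. upd {22, 23} {j'} (18 * vr s n + 2) 0 s s' \<and>
    lst s' j' (vr s n) = lst s j (vr s n)) s"
proof -
  let ?N = "vr s n"
  let ?J = "\<lambda>k s'. lst s' j' k = lst s j k"
  have "wp I (For 22 n (Op (VLoad 23 j 22) ;; Op (VStore j' 22 23)))
     (\<lambda>s'. upd (insert 22 {23}) {j'} (?N * (14 + 4) + 2) (?N * 0) s s' \<and> ?J ?N s') s"
  proof (rule wp_For[where J = ?J])
    show "?J 0 s" by (simp add: lst_def)
    show "?J k (setv m 22 v s')" if "?J k s'" for k s' m v using that by (simp add: lst_def)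
    fix k s' assume k: "k < ?N" "vr s' 22 = k"
      and u: "upd (insert 22 {23}) {j'} (?N * (14 + 4) + 2) (?N * 0) s s'" and J: "?J k s'"
    have a: "ar s' j = ar s j" using upd_ar[OF u, of j] assms by simp
    show "wp I (Op (VLoad 23 j 22) ;; Op (VStore j' 22 23))
      (\<lambda>s''. upd {23} {j'} 14 0 s' s'' \<and> ?J (Suc k) s'') s'"
      using k J a assms by (auto simp: upd_def lst_def)
  qed (use assms in auto)
  then show ?thesis unfolding copy_def by (elim wp_mono) (auto simp: upd_def)
qed

text \<open>\<open>nest D x j c\<close> runs \<open>c\<close> for all values of the entries \<open>0, \<dots>, j - 1\<close> of array \<open>D\<close> in \<open>{1..B}\<close>,
  where variable 1 holds \<open>B\<close>. The loop counters are \<open>x, x + 2, \<dots>\<close>.\<close>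

fun nest :: "nat \<Rightarrow> nat \<Rightarrow> nat \<Rightarrow> com \<Rightarrow> com" where
  "nest D x 0 c = c"
| "nest D x (Suc j) c = For (x + 2 * j) 1 (Op (VConst 27 j) ;; Op (VCopy 28 (x + 2 * j)) ;;
     Op (VInc 28) ;; Op (VStore D 27 28) ;; nest D x j c)"

definition dlists :: "nat \<Rightarrow> nat \<Rightarrow> nat list set" where
  "dlists B j = {ds. length ds = j \<and> set ds \<subseteq> {1..B}}"

lemma dlists_Suc: "dlists B (Suc j) = {ds @ [v] |ds v. ds \<in> dlists B j \<and> v \<in> {1..B}}"
proof (intro equalityI subsetI)
  fix ds assume ds: "ds \<in> dlists B (Suc j)"
  then have "ds \<noteq> []" by (auto simp: dlists_def)
  then obtain es v where "ds = es @ [v]" by (metis append_butlast_last_id)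
  then show "ds \<in> {ds @ [v] |ds v. ds \<in> dlists B j \<and> v \<in> {1..B}}" using ds by (auto simp: dlists_def)
qed (auto simp: dlists_def)

text \<open>\<open>J Z\<close> says that the lists in \<open>Z\<close> have been dealt with. Outer
  loops fix the last digits, so at depth \<open>j\<close> the entries from \<open>j\<close> on are
  the given list \<open>es\<close> and the inner loops run through all prefixes. The counters are
  two apart because one enumeration runs inside another: one uses even variables from 100, the other
  odd ones from 101.\<close>

lemma wp_nest:
  assumes D: "1 \<le> D" "D \<le> 14" "D \<noteq> 7" "D \<notin> Yb"
    and x: "x \<ge> 100" "\<And>i. x + 2 * i \<notin> Xb" "1 \<notin> Xb" and B: "B \<ge> 2"
    and pars: "\<And>Z s. J Z s \<Longrightarrow> vr s 1 = B"
    and ins: "\<And>Z s s' T p. J Z s \<Longrightarrow> upd ({27, 28} \<union> {x + 2 * i |i. True}) {D} T p s s' \<Longrightarrow> J Z s'"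
    and body: "\<And>ds Z s. ds \<in> dlists B t \<Longrightarrow> lst s D t = ds \<Longrightarrow> J Z s \<Longrightarrow>
       wp I c (\<lambda>s'. upd Xb Yb T p s s' \<and> J (insert ds Z) s') s"
    and "j \<le> t" "map (ar s D) [j..<t] = es" "es \<in> dlists B (t - j)" "J Z s"
  shows "wp I (nest D x j c)
    (\<lambda>s'. upd (Xb \<union> {27, 28} \<union> {x + 2 * i |i. i < j}) (insert D Yb) (B ^ j * (T + 30 * j)) (B ^ j * p) s s' \<and>
       J (Z \<union> {ds @ es |ds. ds \<in> dlists B j}) s' \<and> (\<forall>i\<ge>j. ar s' D i = ar s D i)) s"
  using assms(12-)
proof (induction j arbitrary: s es Z)
  case 0
  have "es \<in> dlists B t" "lst s D t = es" using 0 by (auto simp: lst_def)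
  from body[OF this 0(4)] show ?case
    unfolding nest.simps by (rule wp_mono) (use D in \<open>auto simp: dlists_def upd_def\<close>)
next
  case (Suc j)
  let ?i = "x + 2 * j" and ?X = "Xb \<union> {27, 28} \<union> {x + 2 * i |i. i < j}" and ?Y = "insert D Yb"
  let ?T = "B ^ j * (T + 30 * j)" and ?p = "B ^ j * p"
  let ?F = "\<lambda>k. {ds @ v # es |ds v. ds \<in> dlists B j \<and> v \<in> {1..k}}"
  let ?J = "\<lambda>k s'. J (Z \<union> ?F k) s' \<and> (\<forall>i\<ge>Suc j. ar s' D i = ar s D i)"
  have iX: "?i \<notin> ?X" "1 \<notin> ?X" using x by auto
  have "wp I (nest D x (Suc j) c) (\<lambda>s'. upd (insert ?i ?X) ?Y (B * ((?T + 12) + 4) + 2) (B * ?p) s s' \<and> ?J B s') s"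
    unfolding nest.simps
  proof (rule wp_For[OF iX, where J = ?J])
    show "vr s 1 = B" using pars Suc.prems by blast
    show "?J 0 s" using Suc.prems by simp
    show "?J k (setv m ?i v s')" if "?J k s'" for k s' m v
    proof -
      have "upd ({27, 28} \<union> {x + 2 * i |i. True}) {D} m 0 s' (setv m ?i v s')" by (auto simp: upd_def)
      then show ?thesis using that ins by auto
    qed
    show "?i \<noteq> 1" using x by simp
    fix k s' assume k: "k < B" "vr s' ?i = k" and J: "?J k s'"
    let ?s = "s'\<lparr>vr := (vr s')(27 := j, 28 := Suc k), ar := (ar s')(D := (ar s' D)(j := Suc k)), tm := tm s' + 12\<rparr>"
    have u1: "upd {27, 28} {D} 12 0 s' ?s" using D by (auto simp: upd_def)
    have J1: "J (Z \<union> ?F k) ?s"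
      by (rule ins[OF conjunct1[OF J]]) (rule upd_weaken[OF u1], auto)
    have jt: "j < t" using Suc.prems by simp
    have es: "map (ar ?s D) [j..<t] = Suc k # es"
    proof -
      have "map (ar ?s D) [Suc j..<t] = map (ar s D) [Suc j..<t]" using J by (intro map_cong) auto
      then show ?thesis using jt Suc.prems by (simp add: upt_conv_Cons)
    qed
    have tl2: "Suc k # es \<in> dlists B (t - j)" using Suc.prems k jt by (auto simp: dlists_def)
    have w: "wp I (nest D x j c) (\<lambda>s'. upd ?X ?Y ?T ?p ?s s' \<and>
       J (Z \<union> ?F k \<union> {ds @ (Suc k # es) |ds. ds \<in> dlists B j}) s' \<and> (\<forall>i\<ge>j. ar s' D i = ar ?s D i)) ?s"
      using Suc.prems by (intro Suc.IH[OF _ es tl2 J1]) simp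
    have F: "?F k \<union> {ds @ (Suc k # es) |ds. ds \<in> dlists B j} = ?F (Suc k)"
      by (auto simp: le_Suc_eq)
    have "wp I (nest D x j c) (\<lambda>s''. upd ?X ?Y (?T + 12) ?p s' s'' \<and> ?J (Suc k) s'') ?s"
    proof (rule wp_mono[OF w])
      fix s'' assume a: "upd ?X ?Y ?T ?p ?s s'' \<and>
         J (Z \<union> ?F k \<union> {ds @ (Suc k # es) |ds. ds \<in> dlists B j}) s'' \<and> (\<forall>i\<ge>j. ar s'' D i = ar ?s D i)"
      have "J (Z \<union> ?F (Suc k)) s''" using a F by (simp add: Un_assoc)
      moreover have "upd ?X ?Y (?T + 12) ?p s' s''"
        by (rule upd_trans[OF u1 conjunct1[OF a]]) auto
      moreover have "\<forall>i\<ge>Suc j. ar s'' D i = ar s D i" using a J by auto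
      ultimately show "upd ?X ?Y (?T + 12) ?p s' s'' \<and> ?J (Suc k) s''" by blast
    qed
    then show "wp I (Op (VConst 27 j) ;; Op (VCopy 28 ?i) ;; Op (VInc 28) ;; Op (VStore D 27 28) ;; nest D x j c)
       (\<lambda>s''. upd ?X ?Y (?T + 12) ?p s' s'' \<and> ?J (Suc k) s'') s'"
      using k D x by (simp add: setv_def add.commute[of 12])
  qed
  then show ?case
  proof (rule wp_mono)
    fix s' assume a: "upd (insert ?i ?X) ?Y (B * ((?T + 12) + 4) + 2) (B * ?p) s s' \<and> ?J B s'"
    have "{ds @ es |ds. ds \<in> dlists B (Suc j)} = ?F B" unfolding dlists_Suc by auto
    moreover have "upd (Xb \<union> {27, 28} \<union> {x + 2 * i |i. i < Suc j}) (insert D Yb) (B ^ Suc j * (T + 30 * Suc j))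
        (B ^ Suc j * p) s s'"
    proof (rule upd_weaken[OF conjunct1[OF a]])
      have "1 \<le> B ^ j" using B by simp
      then have 1: "B * 30 \<le> B * (B ^ j * 30)" by simp
      have 2: "B * ((?T + 12) + 4) + 2 \<le> B * ?T + B * 30" using B by (simp add: distrib_left)
      have 3: "B ^ Suc j * (T + 30 * Suc j) = B * ?T + B * (B ^ j * 30)" by (simp add: algebra_simps)
      show "B * ((?T + 12) + 4) + 2 \<le> B ^ Suc j * (T + 30 * Suc j)"
        unfolding 3 using 1 2 by (meson add_left_mono le_trans)
    qed auto
    ultimately show "upd (Xb \<union> {27, 28} \<union> {x + 2 * i |i. i < Suc j}) (insert D Yb) (B ^ Suc j * (T + 30 * Suc j))
        (B ^ Suc j * p) s s' \<and> J (Z \<union> {ds @ es |ds. ds \<in> dlists B (Suc j)}) s' \<and>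
        (\<forall>i\<ge>Suc j. ar s' D i = ar s D i)" using a by simp
  qed
qed

section \<open>Enumerating isolated sets\<close>

definition cut_verts :: "nat set \<Rightarrow> nat list \<Rightarrow> nat set" where
  "cut_verts A qs = (!) qs ` (A \<inter> {..<length qs})"

definition push :: "nat list \<Rightarrow> nat \<Rightarrow> nat list" where
  "push qs w = (if w \<in> set qs then qs else qs @ [w])"

definition discover :: "nat set \<Rightarrow> nat list \<times> nat \<Rightarrow> nat \<Rightarrow> nat list \<times> nat" where
  "discover A st w = (let qs = push (fst st) w in (qs, snd st + of_bool (w \<in> cut_verts A qs)))"

text \<open>Breadth-first search in which the vertices discovered at the positions in \<open>A\<close> are not
  expanded. The components are the queue, the number of edges from expanded vertices to
  vertices at positions in \<open>A\<close>, and the expanded vertices.\<close>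

fun bfs :: "(nat \<Rightarrow> nat list) \<Rightarrow> nat set \<Rightarrow> nat \<Rightarrow> nat \<Rightarrow> nat list \<times> nat \<times> nat list" where
  "bfs nbr A v 0 = ([v], 0, [])"
| "bfs nbr A v (Suc k) = (case bfs nbr A v k of (qs, e, cs) \<Rightarrow>
     if k < length qs \<and> k \<notin> A
     then case foldl (discover A) (qs, e) (nbr (qs ! k)) of (qs', e') \<Rightarrow> (qs', e', cs @ [qs ! k])
     else (qs, e, cs))"

lemma push_props:
  assumes "distinct qs"
  shows "distinct (push qs w)" "set (push qs w) = insert w (set qs)" "\<exists>zs. push qs w = qs @ zs"
  using assms by (auto simp: push_def)

lemma foldl_push_all:
  "distinct qs \<Longrightarrow> distinct (foldl push qs ws) \<and> set (foldl push qs ws) = set qs \<union> set ws \<and>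
    (\<exists>zs. foldl push qs ws = qs @ zs)"
proof (induction ws arbitrary: qs)
  case (Cons w ws)
  note p = push_props[OF Cons.prems, of w]
  show ?case using Cons.IH[OF p(1)] p(2,3) by auto
qed simp

lemma foldl_push:
  assumes "distinct qs"
  shows "distinct (foldl push qs ws)" "set (foldl push qs ws) = set qs \<union> set ws"
    "\<exists>zs. foldl push qs ws = qs @ zs"
  using foldl_push_all[OF assms] by auto

lemma fst_foldl_disc1: "fst (foldl (discover A) st ws) = foldl push (fst st) ws"
  by (induction ws arbitrary: st) (auto simp: discover_def Let_def)

text \<open>The queue only grows at its end, so a vertex keeps its position and with it the decision
  whether it is expanded.\<close>

lemma cut_verts_append:
  assumes "distinct (qs @ zs)" "w \<in> set qs"
  shows "w \<in> cut_verts A (qs @ zs) \<longleftrightarrow> w \<in> cut_verts A qs"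
proof
  assume "w \<in> cut_verts A (qs @ zs)"
  then obtain i where i: "i \<in> A" "i < length (qs @ zs)" "w = (qs @ zs) ! i" by (auto simp: cut_verts_def)
  obtain j where j: "j < length qs" "w = qs ! j" using assms(2) by (auto simp: in_set_conv_nth)
  have "(qs @ zs) ! i = (qs @ zs) ! j" using i j by (simp add: nth_append)
  then have "i = j" using assms(1) i j nth_eq_iff_index_eq[of "qs @ zs" i j] by simp
  then show "w \<in> cut_verts A qs" unfolding cut_verts_def using i(1) j by blast
next
  assume "w \<in> cut_verts A qs"
  then obtain i where i: "i \<in> A" "i < length qs" "w = qs ! i" by (auto simp: cut_verts_def)
  then show "w \<in> cut_verts A (qs @ zs)"
    by (auto simp: cut_verts_def nth_append intro!: image_eqI[of _ _ i])
qed

text \<open>The counter tests a neighbour at the moment of its discovery. By the stability of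
  positions the test gives the same answer in the final queue, so the counter is a
  cardinality.\<close>

lemma snd_foldl_disc1:
  assumes "distinct qs" "distinct ws"
  shows "snd (foldl (discover A) (qs, e) ws) = e + card {w \<in> set ws. w \<in> cut_verts A (foldl push qs ws)}"
  using assms
proof (induction ws arbitrary: qs e)
  case (Cons w ws)
  note p = push_props[OF Cons.prems(1), of w]
  let ?F = "foldl push (push qs w) ws"
  obtain zs where zs: "?F = push qs w @ zs" using foldl_push(3)[OF p(1)] by blast
  have dF: "distinct ?F" using foldl_push(1)[OF p(1)] .
  have w: "w \<in> cut_verts A (push qs w) \<longleftrightarrow> w \<in> cut_verts A ?F"
    using cut_verts_append[of "push qs w" zs w A] dF zs p(2) by simp
  have "{x \<in> set (w # ws). x \<in> cut_verts A ?F} =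
      {x \<in> set ws. x \<in> cut_verts A ?F} \<union> (if w \<in> cut_verts A ?F then {w} else {})" by auto
  then have "card {x \<in> set (w # ws). x \<in> cut_verts A ?F} =
      card {x \<in> set ws. x \<in> cut_verts A ?F} + of_bool (w \<in> cut_verts A ?F)"
    using Cons.prems(2) by auto
  then show ?case using Cons.IH[OF p(1), of "e + of_bool (w \<in> cut_verts A (push qs w))"] Cons.prems w
    by (simp add: discover_def Let_def)
qed simp

lemma bfs_Suc:
  assumes "bfs nbr A v k = (qs, e, cs)"
  shows "bfs nbr A v (Suc k) = (if k < length qs \<and> k \<notin> A
    then (foldl push qs (nbr (qs ! k)), snd (foldl (discover A) (qs, e) (nbr (qs ! k))), cs @ [qs ! k])
    else (qs, e, cs))"
  using assms fst_foldl_disc1[of A "(qs, e)" "nbr (qs ! k)"] by (auto split: prod.split)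

section \<open>Soundness and completeness of the guessed searches\<close>

locale query_graph =
  fixes V :: "nat set" and E :: "nat set set" and nbr :: "nat \<Rightarrow> nat list" and d :: nat
  assumes G: "fin_graph V E" and deg: "max_degree_le V E d" and nbr: "neighbor_lists V E nbr"
begin

lemma finV: "finite V"
  using G by (simp add: fin_graph_def)

lemma nbr_distinct: "v \<in> V \<Longrightarrow> distinct (nbr v)"
  using nbr by (simp add: neighbor_lists_def)

lemma set_nbr: "v \<in> V \<Longrightarrow> w \<in> set (nbr v) \<longleftrightarrow> {v, w} \<in> E"
  using nbr by (simp add: neighbor_lists_def neighbors_def)

lemma nbr_V: "v \<in> V \<Longrightarrow> set (nbr v) \<subseteq> V"
  using set_nbr fin_graph_edge[OF G] by blast

lemma length_nbr: "v \<in> V \<Longrightarrow> length (nbr v) \<le> d"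
  using nbr deg distinct_card[of "nbr v"] by (auto simp: neighbor_lists_def max_degree_le_def)

text \<open>Every discovered vertex except \<open>v\<close> has an expanded neighbour; this keeps
  the expanded set connected when the next vertex of the queue is expanded.\<close>

definition bfs_inv where
  "bfs_inv A v k qs e cs \<longleftrightarrow> distinct qs \<and> (\<exists>zs. qs = v # zs) \<and> set qs \<subseteq> V \<and> distinct cs \<and>
     set cs = {qs ! i |i. i < k \<and> i < length qs \<and> i \<notin> A} \<and>
     (\<forall>u\<in>set cs. set (nbr u) \<subseteq> set qs) \<and>
     (\<forall>x\<in>set qs. x \<noteq> v \<longrightarrow> (\<exists>y\<in>set cs. {y, x} \<in> E)) \<and>
     induces_connected E (set cs) \<and> (cs \<noteq> [] \<longrightarrow> v \<in> set cs) \<and>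
     e = card {(u, w). u \<in> set cs \<and> {u, w} \<in> E \<and> w \<in> cut_verts A qs} \<and> length qs \<le> 1 + k * d"

lemma bfs_invariant:
  assumes v: "v \<in> V" and A: "0 \<notin> A" and "bfs nbr A v k = (qs, e, cs)"
  shows "bfs_inv A v k qs e cs"
  using assms(3)
proof (induction k arbitrary: qs e cs)
  case 0
  then show ?case using v by (auto simp: bfs_inv_def induces_connected_def)
next
  case (Suc k)
  obtain qs0 e0 cs0 where b: "bfs nbr A v k = (qs0, e0, cs0)" by (metis prod_cases3)
  note inv = Suc.IH[OF b, unfolded bfs_inv_def]
  have dq: "distinct qs0" and Vq: "set qs0 \<subseteq> V" and dc: "distinct cs0"
    and cs0: "set cs0 = {qs0 ! i |i. i < k \<and> i < length qs0 \<and> i \<notin> A}"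
    and nb: "\<And>u. u \<in> set cs0 \<Longrightarrow> set (nbr u) \<subseteq> set qs0"
    and par: "\<And>x. x \<in> set qs0 \<Longrightarrow> x \<noteq> v \<Longrightarrow> \<exists>y\<in>set cs0. {y, x} \<in> E"
    and conn: "induces_connected E (set cs0)" and vcs: "cs0 \<noteq> [] \<Longrightarrow> v \<in> set cs0"
    and e0: "e0 = card {(u, w). u \<in> set cs0 \<and> {u, w} \<in> E \<and> w \<in> cut_verts A qs0}"
    and len: "length qs0 \<le> 1 + k * d"
    using inv by blast+
  obtain zs0 where zs0: "qs0 = v # zs0" using inv by blast
  show ?case
  proof (cases "k < length qs0 \<and> k \<notin> A")
    case False
    have eqs: "qs = qs0" "e = e0" "cs = cs0" using Suc.prems bfs_Suc[OF b] False by auto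
    have "{qs0 ! i |i. i < k \<and> i < length qs0 \<and> i \<notin> A} =
        {qs0 ! i |i. i < Suc k \<and> i < length qs0 \<and> i \<notin> A}"
      using False by (auto simp: less_Suc_eq)
    then have scs: "set cs0 = {qs0 ! i |i. i < Suc k \<and> i < length qs0 \<and> i \<notin> A}"
      using cs0 by metis
    show ?thesis unfolding bfs_inv_def eqs
      by (intro conjI ballI impI dq Vq dc scs nb par conn vcs e0) (use zs0 len in auto)
  next
    case True
    let ?u = "qs0 ! k"
    have u: "?u \<in> set qs0" "?u \<in> V" using True Vq by auto
    have qs: "qs = foldl push qs0 (nbr ?u)" "e = snd (foldl (discover A) (qs0, e0) (nbr ?u))" "cs = cs0 @ [?u]"
      using Suc.prems bfs_Suc[OF b] True by auto
    obtain zs where zs: "qs = qs0 @ zs" using foldl_push(3)[OF dq] qs(1) by blast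
    have dqs: "distinct qs" and sqs: "set qs = set qs0 \<union> set (nbr ?u)"
      using foldl_push[OF dq] qs(1) by auto
    have ucs: "?u \<notin> set cs0"
    proof
      assume "?u \<in> set cs0"
      then obtain i where "i < k" "i < length qs0" "qs0 ! k = qs0 ! i" using cs0 by auto
      then show False using dq True nth_eq_iff_index_eq[of qs0 k i] by auto
    qed
    have scs: "set cs = {qs ! i |i. i < Suc k \<and> i < length qs \<and> i \<notin> A}"
    proof -
      have "{qs ! i |i. i < Suc k \<and> i < length qs \<and> i \<notin> A} =
          {qs0 ! i |i. i < Suc k \<and> i < length qs0 \<and> i \<notin> A}"
        using True unfolding zs by (auto simp: nth_append less_Suc_eq)
      also have "\<dots> = insert ?u (set cs0)" unfolding cs0 using True by (auto simp: less_Suc_eq)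
      finally show ?thesis using qs(3) by simp
    qed
    have edge: "?u = v \<or> (\<exists>y\<in>set cs0. {y, ?u} \<in> E)" using par u by blast
    have cs_empty: "cs0 = []" if "?u = v"
    proof -
      have "k = 0" using that True dq zs0 nth_eq_iff_index_eq[of qs0 k 0] by auto
      then show ?thesis using cs0 by auto
    qed
    have conn': "induces_connected E (set cs)"
    proof (cases "?u = v")
      case True
      then show ?thesis using cs_empty qs(3) by (simp add: induces_connected_def)
    next
      case False
      then obtain y where y: "y \<in> set cs0" "{y, ?u} \<in> E" using edge by blast
      have "set cs \<subseteq> comp_of E (set cs) y"
      proof
        fix z assume z: "z \<in> set cs"
        have yz: "(y, z') \<in> (adj_in E (set cs))\<^sup>*" if "z' \<in> set cs0" for z'
        proof -
          have "(y, z') \<in> (adj_in E (set cs0))\<^sup>*" using conn y that by (auto simp: induces_connected_adj_in)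
          moreover have "adj_in E (set cs0) \<subseteq> adj_in E (set cs)" using qs(3) by (auto simp: adj_in_def)
          ultimately show ?thesis using rtrancl_mono by blast
        qed
        show "z \<in> comp_of E (set cs) y"
        proof (cases "z = ?u")
          case True
          then show ?thesis using y qs(3) comp_of_step[of y E "set cs" y ?u] by simp
        next
          case False
          then show ?thesis using yz z qs(3) by (auto simp: comp_of_def)
        qed
      qed
      then have "comp_of E (set cs) y = set cs"
        using comp_of_subset[of y "set cs" E] y qs(3) by auto
      then show ?thesis using comp_of_connected[of E "set cs" y] by simp
    qed
    have cv: "w \<in> cut_verts A qs \<longleftrightarrow> w \<in> cut_verts A qs0" if "w \<in> set qs0" for w
      using cut_verts_append[of qs0 zs w A] that dqs zs by simp
    have e': "e = card {(u, w). u \<in> set cs \<and> {u, w} \<in> E \<and> w \<in> cut_verts A qs}"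
    proof -
      let ?P = "{(u, w). u \<in> set cs0 \<and> {u, w} \<in> E \<and> w \<in> cut_verts A qs0}"
      let ?R = "Pair ?u ` {w \<in> set (nbr ?u). w \<in> cut_verts A qs}"
      have "(u, w) \<in> ?P \<longleftrightarrow> u \<in> set cs0 \<and> {u, w} \<in> E \<and> w \<in> cut_verts A qs" for u w
      proof -
        have "w \<in> set qs0" if "u \<in> set cs0" "{u, w} \<in> E"
        proof -
          have "u \<in> V" using that(1) cs0 Vq by auto
          then show ?thesis using nb[OF that(1)] set_nbr that(2) by blast
        qed
        then show ?thesis using cv by auto
      qed
      then have eq: "{(u, w). u \<in> set cs \<and> {u, w} \<in> E \<and> w \<in> cut_verts A qs} = ?P \<union> ?R"
        using set_nbr[OF u(2)] qs(3) by auto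
      have "?P \<subseteq> V \<times> V" using cs0 Vq by (auto simp: cut_verts_def)
      then have "finite ?P" using finV finite_subset by blast
      moreover have "?P \<inter> ?R = {}" using ucs by auto
      ultimately have "card (?P \<union> ?R) = card ?P + card ?R" by (intro card_Un_disjoint) auto
      also have "card ?R = card {w \<in> set (nbr ?u). w \<in> cut_verts A qs}"
        by (rule card_image) (simp add: inj_on_def)
      also have "card ?P + card {w \<in> set (nbr ?u). w \<in> cut_verts A qs} = e"
        unfolding qs(2) snd_foldl_disc1[OF dq nbr_distinct[OF u(2)]] e0 qs(1) ..
      finally show ?thesis unfolding eq by simp
    qed
    have "length qs = card (set qs)" using dqs by (simp add: distinct_card)
    also have "\<dots> \<le> card (set qs0) + card (set (nbr ?u))" unfolding sqs by (rule card_Un_le)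
    also have "\<dots> \<le> (1 + k * d) + d"
      using len length_nbr[OF u(2)] card_length[of qs0] card_length[of "nbr ?u"] by linarith
    finally have len': "length qs \<le> 1 + Suc k * d" by simp
    have vcs': "v \<in> set cs"
      using vcs edge qs(3) by (cases "?u = v"; cases "cs0 = []") auto
    show ?thesis
      unfolding bfs_inv_def
    proof (intro conjI ballI impI)
      show "\<exists>zs. qs = v # zs" using zs zs0 by simp
      show "set qs \<subseteq> V" using sqs Vq nbr_V[OF u(2)] by blast
      show "distinct cs" using dc ucs qs(3) by simp
      show "set (nbr x) \<subseteq> set qs" if "x \<in> set cs" for x using that nb sqs qs(3) by auto
      show "\<exists>y\<in>set cs. {y, x} \<in> E" if "x \<in> set qs" "x \<noteq> v" for x
        using that par[of x] set_nbr[OF u(2), of x] sqs qs(3) by auto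
    qed (use dqs scs conn' e' len' vcs' in auto)
  qed
qed

text \<open>A queue of length at most \<open>B\<close> has been processed completely. Then every
  discovered vertex is either expanded or at a position in \<open>A\<close>, so the neighbours of
  the expanded set sit at positions in \<open>A\<close> and the counter is the size of the
  boundary.\<close>

lemma bfs_sound:
  assumes v: "v \<in> V" and A: "0 \<notin> A" "finite A" and b: "bfs nbr A v B = (qs, e, cs)" and B: "length qs \<le> B"
  shows "v \<in> set cs" "set cs \<subseteq> V" "induces_connected E (set cs)" "card (nbd E (set cs)) \<le> card A"
    "e = card (bdry E (set cs))" "distinct cs"
proof -
  note inv = bfs_invariant[OF v A(1) b, unfolded bfs_inv_def]
  obtain zs where zs: "qs = v # zs" using inv by blast
  have scs: "set cs = {qs ! i |i. i < B \<and> i < length qs \<and> i \<notin> A}" using inv by blast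
  have dq: "distinct qs" using inv by blast
  have cut: "x \<in> cut_verts A qs \<longleftrightarrow> x \<notin> set cs" if x: "x \<in> set qs" for x
  proof -
    obtain i where i: "i < length qs" "x = qs ! i" using x by (auto simp: in_set_conv_nth)
    have "x \<in> cut_verts A qs \<longleftrightarrow> i \<in> A"
      using i nth_eq_iff_index_eq[OF dq] by (auto simp: cut_verts_def)
    moreover have "x \<in> set cs \<longleftrightarrow> i \<notin> A"
      using i B nth_eq_iff_index_eq[OF dq] unfolding scs by auto
    ultimately show ?thesis by simp
  qed
  have "qs ! 0 = v" "0 < length qs" "0 < B" using zs B by auto
  then show v': "v \<in> set cs" unfolding scs using A by blast
  have csq: "set cs \<subseteq> set qs" unfolding scs by auto
  then show csV: "set cs \<subseteq> V" using inv by blast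
  show "induces_connected E (set cs)" using inv by blast
  show "distinct cs" using inv by blast
  have nq: "w \<in> set qs" if "u \<in> set cs" "{u, w} \<in> E" for u w
    using that inv csV set_nbr by blast
  have "nbd E (set cs) \<subseteq> cut_verts A qs" using nq cut by (auto simp: nbd_def)
  then have "card (nbd E (set cs)) \<le> card (cut_verts A qs)"
    by (rule card_mono[rotated]) (simp add: cut_verts_def)
  also have "\<dots> \<le> card (A \<inter> {..<length qs})" unfolding cut_verts_def by (intro card_image_le) simp
  also have "\<dots> \<le> card A" using A by (intro card_mono) auto
  finally show "card (nbd E (set cs)) \<le> card A" .
  have "{(u, w). u \<in> set cs \<and> {u, w} \<in> E \<and> w \<in> cut_verts A qs} = bdry E (set cs)"
    unfolding bdry_def using nq cut by (auto simp: cut_verts_def)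
  then show "e = card (bdry E (set cs))" using inv by simp
qed

text \<open>The search that expands exactly the vertices in \<open>S\<close>; the positions of the other
  discovered vertices are the set \<open>A\<close> that makes \<open>bfs\<close> find \<open>S\<close>.\<close>

fun guided :: "nat set \<Rightarrow> nat \<Rightarrow> nat \<Rightarrow> nat list" where
  "guided S v 0 = [v]"
| "guided S v (Suc k) = (let qs = guided S v k in
     if k < length qs \<and> qs ! k \<in> S then foldl push qs (nbr (qs ! k)) else qs)"

lemma guided_inv:
  assumes "v \<in> S" "S \<subseteq> V"
  shows "distinct (guided S v k) \<and> set (guided S v k) \<subseteq> S \<union> nbd E S \<and> (\<exists>zs. guided S v k = v # zs)"
proof (induction k)
  case (Suc k)
  let ?q = "guided S v k"
  show ?case
  proof (cases "k < length ?q \<and> ?q ! k \<in> S")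
    case True
    have "set (nbr (?q ! k)) \<subseteq> S \<union> nbd E S" using True assms set_nbr by (auto simp: nbd_def)
    moreover obtain zs where "foldl push ?q (nbr (?q ! k)) = ?q @ zs" using foldl_push(3) Suc by blast
    ultimately show ?thesis using True Suc foldl_push(1,2)[of ?q "nbr (?q ! k)"] by (auto simp: Let_def)
  next
    case False
    then have "guided S v (Suc k) = ?q" by (auto simp: Let_def)
    then show ?thesis using Suc by simp
  qed
qed (use assms in auto)

lemma guided_prefix:
  assumes "v \<in> S" "S \<subseteq> V"
  shows "\<exists>zs. guided S v (k + m) = guided S v k @ zs"
proof (induction m)
  case (Suc m)
  let ?q = "guided S v (k + m)"
  have "\<exists>zs. guided S v (Suc (k + m)) = ?q @ zs"
    using foldl_push(3)[of ?q "nbr (?q ! (k + m))"] guided_inv[OF assms, of "k + m"] by (auto simp: Let_def)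
  then show ?case using Suc by auto
qed simp

text \<open>The guided search meets only \<open>S\<close> and its neighbours, hence at most
  \<open>B\<close> vertices. Its queues are prefixes of the final one, so a set \<open>A\<close>
  read off the final queue reproduces every decision on the way, and both searches have the same
  queue in each round. Connectedness makes them reach all of \<open>S\<close>.\<close>

lemma bfs_complete:
  assumes S: "v \<in> S" "S \<subseteq> V" "induces_connected E S" "card S + card (nbd E S) \<le> B"
    and A: "\<And>i. i < length (guided S v B) \<Longrightarrow> i \<in> A \<longleftrightarrow> guided S v B ! i \<notin> S"
  shows "\<exists>qs e cs. bfs nbr A v B = (qs, e, cs) \<and> length qs \<le> B \<and> S \<subseteq> set qs \<and> set cs = S"
proof -
  let ?G = "guided S v B"
  note gi = guided_inv[OF S(1,2), of B]
  have vV: "v \<in> V" using S by blast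
  have finS: "finite S" "finite (nbd E S)"
    using S(2) finV fin_graph_edge[OF G] by (auto simp: nbd_def intro: finite_subset[of _ V])
  have len: "length ?G \<le> B"
  proof -
    have "length ?G = card (set ?G)" using gi distinct_card by metis
    also have "\<dots> \<le> card (S \<union> nbd E S)" using gi finS by (intro card_mono) auto
    also have "\<dots> \<le> B" using card_Un_le[of S "nbd E S"] S(4) by linarith
    finally show ?thesis .
  qed
  obtain zs where zs: "?G = v # zs" using gi by blast
  have A0: "0 \<notin> A" using A[of 0] zs S(1) by simp
  have run: "fst (bfs nbr A v k) = guided S v k" if "k \<le> B" for k
    using that
  proof (induction k)
    case (Suc k)
    obtain qs e cs where b: "bfs nbr A v k = (qs, e, cs)" by (metis prod_cases3)
    then have qs: "qs = guided S v k" using Suc by simp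
    obtain ys where ys: "?G = qs @ ys" using guided_prefix[OF S(1,2), of k "B - k"] Suc.prems qs by auto
    have "k \<in> A \<longleftrightarrow> qs ! k \<notin> S" if "k < length qs"
      using A[of k] that ys by (simp add: nth_append)
    then have "k < length qs \<and> k \<notin> A \<longleftrightarrow> k < length qs \<and> qs ! k \<in> S" by blast
    then show ?case using bfs_Suc[OF b] qs by (auto simp: Let_def)
  qed simp
  obtain qs e cs where b: "bfs nbr A v B = (qs, e, cs)" by (metis prod_cases3)
  then have qs: "qs = ?G" using run[of B] by simp
  note inv = bfs_invariant[OF vV A0 b, unfolded bfs_inv_def]
  have scs: "set cs = {qs ! i |i. i < B \<and> i < length qs \<and> i \<notin> A}" using inv by blast
  have "x \<in> set cs \<longleftrightarrow> x \<in> set qs \<inter> S" for x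
  proof
    assume "x \<in> set cs"
    then obtain i where "x = qs ! i" "i < length qs" "i \<notin> A" unfolding scs by blast
    then show "x \<in> set qs \<inter> S" using A qs by auto
  next
    assume "x \<in> set qs \<inter> S"
    then obtain i where "x = qs ! i" "i < length qs" "x \<in> S" by (auto simp: in_set_conv_nth)
    moreover from this have "i \<notin> A" "i < B" using A len qs by auto
    ultimately show "x \<in> set cs" unfolding scs by blast
  qed
  then have scs': "set cs = set qs \<inter> S" by blast
  have nbq: "set (nbr u) \<subseteq> set qs" if "u \<in> set cs" for u using inv that by blast
  have "S \<subseteq> set qs"
  proof
    fix z assume "z \<in> S"
    then have "(v, z) \<in> (adj_in E S)\<^sup>*" using S(1,3) by (auto simp: induces_connected_adj_in)
    then show "z \<in> set qs"
    proof (induction rule: rtrancl_induct)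
      case base
      then show ?case using zs qs by simp
    next
      case (step y z)
      then have "y \<in> S" "{y, z} \<in> E" by (auto simp: adj_in_def)
      then show ?case using step.IH scs' nbq[of y] set_nbr[of y z] S(2) by blast
    qed
  qed
  then show ?thesis using b len qs scs' by auto
qed

end

lemma map_if_upt [simp]: "map (\<lambda>x. if x = n then w else f x) [0..<n] = map f [0..<n]"
  by (rule map_cong) auto

lemma scan_iff:
  "p < n \<and> f p = y \<or> p = n \<and> y \<notin> f ` {..<n} \<Longrightarrow> p < n \<longleftrightarrow> y \<in> f ` {..<(n::nat)}"
  by (metis imageI lessThan_iff less_irrefl)

lemma cut_verts_nth:
  assumes "distinct qs" "p < length qs"
  shows "qs ! p \<in> cut_verts A qs \<longleftrightarrow> p \<in> A"
  using assms nth_eq_iff_index_eq[OF assms(1)] by (auto simp: cut_verts_def)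

section \<open>The programs\<close>

text \<open>The search of \<open>bfs_prog D Q v c\<close> from the vertex in variable \<open>v\<close> keeps its queue in array \<open>Q\<close> with
  length in variable \<open>c\<close>, and the expanded vertices in array 5 with length in variable 21. Array \<open>D\<close> holds
  the positions that are not expanded, and variable 20 counts the boundary edges, multiplied by \<open>\<Delta>\<close>.\<close>

definition expand_step :: "nat \<Rightarrow> nat \<Rightarrow> nat \<Rightarrow> com" where
  "expand_step D Q c = Op (VCopy 19 15) ;; Op (VInc 19) ;; Op (VNbr 16 13 19) ;;
     scan Q c 16 17 ;; IfLe c 17 (Op (VStore Q c 16) ;; Op (VInc c)) Skip ;;
     scan D 5 17 18 ;; IfLe 5 18 Skip (Op (VAdd 20 20 3))"

definition expand :: "nat \<Rightarrow> nat \<Rightarrow> nat \<Rightarrow> com" where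
  "expand D Q c = Op (VDeg 14 13) ;; For 15 14 (expand_step D Q c)"

definition bfs_step :: "nat \<Rightarrow> nat \<Rightarrow> nat \<Rightarrow> com" where
  "bfs_step D Q c = IfLe c 12 Skip (scan D 5 12 18 ;;
     IfLe 5 18 (Op (VLoad 13 Q 12) ;; Op (VStore 5 21 13) ;; Op (VInc 21) ;; expand D Q c) Skip)"

definition bfs_prog :: "nat \<Rightarrow> nat \<Rightarrow> nat \<Rightarrow> nat \<Rightarrow> com" where
  "bfs_prog D Q v c = Op (VConst 9 0) ;; Op (VStore Q 9 v) ;; Op (VConst c 1) ;; Op (VConst 20 0) ;;
     Op (VConst 21 0) ;; For 12 1 (bfs_step D Q c)"

text \<open>\<open>B\<close> bounds the queue of a successful search, \<open>K\<close> members and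
  \<open>t\<close> neighbours, and is also the base in which stopping positions are enumerated.
  \<open>Z\<close> is a common bound for the lengths of lists and loops, including queues that
  overshoot \<open>B\<close>, since \<open>1 + B * d \<le> Z\<close>; all running times are
  expressed in it.\<close>

locale machine = query_graph +
  fixes \<epsilon> :: real and \<omega> :: "nat \<Rightarrow> bool" and B K \<Delta> L t Z :: nat
  assumes B: "B = K + t" "B \<ge> 2" and t: "t \<ge> 1" and Z: "B * (d + 1) \<le> Z" "L \<le> Z" "100 \<le> Z"
begin

abbreviation I :: env where
  "I \<equiv> \<lparr>eps = \<epsilon>, verts = V, nbrs = nbr, coins = \<omega>\<rparr>"

definition pars :: "ast \<Rightarrow> bool" where
  "pars s \<longleftrightarrow> vr s 1 = B \<and> vr s 2 = K \<and> vr s 3 = \<Delta> \<and> vr s 4 = L \<and> vr s 5 = t"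

lemma pars_upd: "pars s \<Longrightarrow> upd X Y T p s s' \<Longrightarrow> {1..5} \<inter> X = {} \<Longrightarrow> pars s'"
  unfolding pars_def by (auto simp: upd_def disjoint_iff)

lemma pars_simps: "pars s \<Longrightarrow> vr s 1 = B" "pars s \<Longrightarrow> vr s 2 = K" "pars s \<Longrightarrow> vr s 3 = \<Delta>"
  "pars s \<Longrightarrow> vr s 4 = L" "pars s \<Longrightarrow> vr s 5 = t"
  by (auto simp: pars_def)

lemma Z_bounds: "B \<le> Z" "t \<le> Z" "d \<le> Z" "1 + B * d \<le> Z"
proof -
  have "B \<le> B * (d + 1)" "1 + B * d \<le> B * (d + 1)" using B(2) by simp_all
  moreover have "d + 1 \<le> B * (d + 1)" using B(2) mult_le_mono1[of 1 B "d + 1"] by simp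
  ultimately show "B \<le> Z" "d \<le> Z" "1 + B * d \<le> Z" using Z(1) by (meson le_trans add_leE)+
  then show "t \<le> Z" using B by linarith
qed

lemma wp_expand_step:
  assumes p: "pars s" and D: "D = 1 \<or> D = 3" and Q: "Q = 2 \<or> Q = 4" and c: "c \<ge> 30"
    and A: "A = set (lst s D t)" and u: "vr s 13 = u" "u \<in> V" and k: "vr s 15 = k" "k < length (nbr u)"
    and qs: "lst s Q (vr s c) = qs" "distinct qs" "length qs \<le> Z" and e: "vr s 20 = \<Delta> * e"
  shows "wp I (expand_step D Q c) (\<lambda>s'. upd {10, 11, 16, 17, 18, 19, 20, c} {Q} (32 * Z + 30) 1 s s' \<and>
    lst s' Q (vr s' c) = fst (discover A (qs, e) (nbr u ! k)) \<and>
    vr s' 20 = \<Delta> * snd (discover A (qs, e) (nbr u ! k))) s"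
proof -
  let ?w = "nbr u ! k" and ?n = "length qs"
  let ?post = "\<lambda>s'. upd {10, 11, 16, 17, 18, 19, 20, c} {Q} (32 * Z + 30) 1 s s' \<and>
    lst s' Q (vr s' c) = fst (discover A (qs, e) ?w) \<and> vr s' 20 = \<Delta> * snd (discover A (qs, e) ?w)"
  let ?s1 = "s\<lparr>pr := Suc (pr s), vr := (vr s)(19 := Suc k, 16 := ?w), tm := tm s + 2 + 2 + 1\<rparr>"
  let ?c3 = "scan D 5 17 18 ;; IfLe 5 18 Skip (Op (VAdd 20 20 3))"
  let ?c2 = "IfLe c 17 (Op (VStore Q c 16) ;; Op (VInc c)) Skip"
  have n: "vr s c = ?n" using qs(1) by (metis length_lst)
  have qsn: "ar s Q i = qs ! i" if "i < ?n" for i using qs(1) n that by (metis nth_lst)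
  have setq: "ar s Q ` {..<?n} = set qs" using qs(1) n set_lst by metis
  let ?P2 = "\<lambda>s2. upd {10, 11, 17} {} (16 * vr ?s1 c + 4) 0 ?s1 s2 \<and>
    (vr s2 17 < vr ?s1 c \<and> ar ?s1 Q (vr s2 17) = vr ?s1 16 \<or>
     vr s2 17 = vr ?s1 c \<and> vr ?s1 16 \<notin> ar ?s1 Q ` {..<vr ?s1 c})"
  have "wp I (scan Q c 16 17 ;; ?c2 ;; ?c3) ?post ?s1"
  proof (rule wp_seqI[where P = ?P2])
    show "wp I (scan Q c 16 17) ?P2 ?s1" by (rule wp_scan) (use Q c in auto)
    fix s2 assume s2: "?P2 s2"
    have u2: "upd {10, 11, 17} {} (16 * ?n + 4) 0 ?s1 s2"
      and p2: "vr s2 17 < ?n \<and> qs ! vr s2 17 = ?w \<or> vr s2 17 = ?n \<and> ?w \<notin> set qs"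
      using s2 n c qsn setq by auto
    have v2: "vr s2 c = ?n" "vr s2 16 = ?w" "ar s2 = ar s" "vr s2 20 = \<Delta> * e" "vr s2 5 = t" "vr s2 3 = \<Delta>"
      using u2 c n e p pars_simps by (auto simp: upd_def)
    let ?P3 = "\<lambda>s3. upd {10, 11, 16, 17, 19, c} {Q} (16 * ?n + 20) 1 s s3 \<and>
      lst s3 Q (vr s3 c) = push qs ?w \<and> vr s3 17 < length (push qs ?w) \<and> push qs ?w ! vr s3 17 = ?w"
    show "wp I (?c2 ;; ?c3) ?post s2"
    proof (rule wp_seqI[where P = ?P3])
      show "wp I ?c2 ?P3 s2"
      proof (cases "vr s2 17 < ?n")
        case True
        then have "?w \<in> set qs" using p2 nth_mem[of "vr s2 17" qs] by auto
        then have "push qs ?w = qs" by (simp add: push_def)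
        moreover have "lst s2 Q ?n = qs" using qs n v2 by (simp add: lst_def)
        ultimately show ?thesis using True p2 u2 v2 by (auto simp: upd_def)
      next
        case False
        then have 1: "vr s2 17 = ?n" "push qs ?w = qs @ [?w]" using p2 by (auto simp: push_def)
        have "lst s Q ?n = qs" using qs n by simp
        then show ?thesis using 1 u2 v2 Q c by (auto simp: upd_def lst_def cong: map_cong)
      qed
      fix s3 assume s3: "?P3 s3"
      have u3: "upd {10, 11, 16, 17, 19, c} {Q} (16 * ?n + 20) 1 s s3" using s3 by blast
      have dq: "distinct (push qs ?w)" using push_props(1)[OF qs(2)] .
      have DQ: "D \<notin> {Q}" using D Q by auto
      have v3: "vr s3 5 = t" "vr s3 20 = \<Delta> * e" "vr s3 3 = \<Delta>" "ar s3 D = ar s D"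
        using upd_vr[OF u3, of 5] upd_vr[OF u3, of 3] upd_vr[OF u2, of 20] upd_vr[OF u3, of 20] upd_ar[OF u3 DQ]
          c e pars_simps[OF p] by auto
      have A3: "ar s3 D ` {..<t} = A" using v3 A by (simp add: set_lst)
      have cut: "?w \<in> cut_verts A (push qs ?w) \<longleftrightarrow> vr s3 17 \<in> A"
        using cut_verts_nth[OF dq, of "vr s3 17" A] s3 by simp
      let ?P4 = "\<lambda>s4. upd {10, 11, 18} {} (16 * vr s3 5 + 4) 0 s3 s4 \<and>
        (vr s4 18 < vr s3 5 \<and> ar s3 D (vr s4 18) = vr s3 17 \<or>
         vr s4 18 = vr s3 5 \<and> vr s3 17 \<notin> ar s3 D ` {..<vr s3 5})"
      show "wp I ?c3 ?post s3"
      proof (rule wp_seqI[where P = ?P4])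
        show "wp I (scan D 5 17 18) ?P4 s3" by (rule wp_scan) (use D in auto)
        fix s4 assume s4: "?P4 s4"
        have u4: "upd {10, 11, 18} {} (16 * t + 4) 0 s3 s4" using s4 v3 by simp
        have "vr s4 18 < t \<and> ar s3 D (vr s4 18) = vr s3 17 \<or> vr s4 18 = t \<and> vr s3 17 \<notin> ar s3 D ` {..<t}"
          using s4 v3(1) by simp
        then have "vr s4 18 < t \<longleftrightarrow> vr s3 17 \<in> A" unfolding A3[symmetric] by (rule scan_iff)
        then have in4: "vr s4 18 < t \<longleftrightarrow> ?w \<in> cut_verts A (push qs ?w)" using cut by simp
        have u34: "upd {10, 11, 16, 17, 18, 19, 20, c} {Q} (32 * Z + 24) 1 s s4"
          by (rule upd_trans[OF u3 u4]) (use qs(3) Z_bounds in auto)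
        have v4: "vr s4 5 = t" "vr s4 20 = \<Delta> * e" "vr s4 3 = \<Delta>" "vr s4 c = vr s3 c" "ar s4 = ar s3"
          using u4 v3 c by (auto simp: upd_def)
        have l4: "lst s4 Q (vr s4 c) = push qs ?w" using s3 v4 by (simp add: lst_def)
        show "wp I (IfLe 5 18 Skip (Op (VAdd 20 20 3))) ?post s4"
        proof (cases "vr s4 18 < t")
          case True
          let ?s5 = "tick 1 (setv 1 20 (vr (tick 1 s4) 20 + vr (tick 1 s4) 3) (tick 1 s4))"
          have "upd {10, 11, 16, 17, 18, 19, 20, c} {Q} (32 * Z + 30) 1 s ?s5"
            by (rule upd_trans[OF u34, of "{20}" "{}" 3 0]) (auto simp: upd_def)
          moreover have "lst ?s5 Q (vr ?s5 c) = push qs ?w" using l4 c by simp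
          moreover have "vr ?s5 20 = \<Delta> * snd (discover A (qs, e) ?w)"
            using True in4 v4 by (simp add: discover_def Let_def)
          ultimately have p5: "?post ?s5" using c by (simp add: discover_def Let_def)
          have "wp I (Op (VAdd 20 20 3)) (\<lambda>s'. ?post (tick 1 s')) (tick 1 s4)"
            unfolding wp_Op opx.simps by (rule exI, rule conjI[OF refl], rule p5)
          then show ?thesis using True v4(1) by (simp del: wp_Op)
        next
          case False
          have "upd {10, 11, 16, 17, 18, 19, 20, c} {Q} (32 * Z + 30) 1 s (tick 1 s4)"
            by (rule upd_trans[OF u34, of "{20}" "{}" 3 0]) (auto simp: upd_def)
          moreover have "vr (tick 1 s4) 20 = \<Delta> * snd (discover A (qs, e) ?w)"
            using False in4 v4 by (simp add: discover_def Let_def)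
          ultimately have "?post (tick 1 s4)" using l4 by (simp add: discover_def Let_def)
          then show ?thesis using False v4(1) by simp
        qed
      qed
    qed
  qed
  then show ?thesis
    unfolding expand_step_def using u k by (simp add: setv_def)
qed

lemma wp_expand:
  assumes p: "pars s" and D: "D = 1 \<or> D = 3" and Q: "Q = 2 \<or> Q = 4" and c: "c \<ge> 30"
    and A: "A = set (lst s D t)" and u: "vr s 13 = u" "u \<in> V"
    and qs: "lst s Q (vr s c) = qs" "distinct qs" "length qs + d \<le> Z" and e: "vr s 20 = \<Delta> * e"
  shows "wp I (expand D Q c) (\<lambda>s'. upd {10, 11, 14, 15, 16, 17, 18, 19, 20, c} {Q} (d * (32 * Z + 34) + 3) (d + 1) s s' \<and>
    lst s' Q (vr s' c) = fst (foldl (discover A) (qs, e) (nbr u)) \<and>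
    vr s' 20 = \<Delta> * snd (foldl (discover A) (qs, e) (nbr u))) s"
proof -
  let ?n = "length (nbr u)" and ?s = "setv 1 14 (length (nbr u)) (s\<lparr>pr := Suc (pr s)\<rparr>)"
  let ?st = "\<lambda>k. foldl (discover A) (qs, e) (take k (nbr u))"
  let ?J = "\<lambda>k s'. lst s' Q (vr s' c) = fst (?st k) \<and> vr s' 20 = \<Delta> * snd (?st k)"
  let ?X = "{10, 11, 16, 17, 18, 19, 20, c}"
  have nd: "?n \<le> d" using length_nbr u by blast
  have st: "distinct (fst (?st k)) \<and> length (fst (?st k)) \<le> Z" if "k \<le> ?n" for k
  proof -
    have f: "fst (?st k) = foldl push qs (take k (nbr u))" by (simp add: fst_foldl_disc1)
    have "distinct (fst (?st k))" unfolding f by (rule foldl_push(1)[OF qs(2)])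
    then have "length (fst (?st k)) = card (set (fst (?st k)))" by (simp add: distinct_card)
    also have "\<dots> \<le> card (set qs) + card (set (take k (nbr u)))"
      unfolding f foldl_push(2)[OF qs(2)] by (rule card_Un_le)
    also have "\<dots> \<le> length qs + k" using that card_length[of qs] card_length[of "take k (nbr u)"] by simp
    finally show ?thesis using \<open>distinct (fst (?st k))\<close> qs(3) nd that by simp
  qed
  have "wp I (For 15 14 (expand_step D Q c))
    (\<lambda>s'. upd (insert 15 ?X) {Q} (?n * ((32 * Z + 30) + 4) + 2) (?n * 1) ?s s' \<and> ?J ?n s') ?s"
  proof (rule wp_For[where J = ?J])
    show "?J 0 ?s" using qs(1) e c by (simp add: lst_def)
    show "?J k (setv m 15 v s')" if "?J k s'" for k s' m v using that c by (simp add: lst_def)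
    fix k s' assume k: "k < ?n" "vr s' 15 = k"
      and us: "upd (insert 15 ?X) {Q} (?n * ((32 * Z + 30) + 4) + 2) (?n * 1) ?s s'" and J: "?J k s'"
    have "pars ?s" using p by (simp add: pars_def)
    then have p': "pars s'" using us c by (auto elim!: pars_upd)
    have v: "vr s' 13 = u" using us u c by (auto simp: upd_def)
    have A': "A = set (lst s' D t)" using us A D Q by (auto simp: upd_def lst_def)
    have "take (Suc k) (nbr u) = take k (nbr u) @ [nbr u ! k]" using k by (simp add: take_Suc_conv_app_nth)
    then have step: "?st (Suc k) = discover A (fst (?st k), snd (?st k)) (nbr u ! k)" by simp
    show "wp I (expand_step D Q c) (\<lambda>s''. upd ?X {Q} (32 * Z + 30) 1 s' s'' \<and> ?J (Suc k) s'') s'"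
      unfolding step
      by (rule wp_expand_step[OF p' D Q c A' v u(2) k(2,1)]) (use J st[of k] k in auto)
  qed (use c in auto)
  then have w: "wp I (For 15 14 (expand_step D Q c))
    (\<lambda>s'. upd {10, 11, 14, 15, 16, 17, 18, 19, 20, c} {Q} (d * (32 * Z + 34) + 3) (d + 1) s s' \<and>
      lst s' Q (vr s' c) = fst (foldl (discover A) (qs, e) (nbr u)) \<and>
      vr s' 20 = \<Delta> * snd (foldl (discover A) (qs, e) (nbr u))) ?s"
  proof (rule wp_mono)
    fix s' assume a: "upd (insert 15 ?X) {Q} (?n * ((32 * Z + 30) + 4) + 2) (?n * 1) ?s s' \<and> ?J ?n s'"
    have "(32 * Z + 30) + 4 = 32 * Z + 34" by simp
    then have le: "?n * ((32 * Z + 30) + 4) \<le> d * (32 * Z + 34)"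
      using mult_le_mono1[OF nd, of "32 * Z + 34"] by (simp only:)
    have "upd {14} {} 1 1 s ?s" by (simp add: upd_def)
    from upd_trans[OF this conjunct1[OF a], of "{10, 11, 14, 15, 16, 17, 18, 19, 20, c}" "{Q}"
        "d * (32 * Z + 34) + 3" "d + 1"]
    have "upd {10, 11, 14, 15, 16, 17, 18, 19, 20, c} {Q} (d * (32 * Z + 34) + 3) (d + 1) s s'"
      using le nd by auto
    then show "upd {10, 11, 14, 15, 16, 17, 18, 19, 20, c} {Q} (d * (32 * Z + 34) + 3) (d + 1) s s' \<and>
      lst s' Q (vr s' c) = fst (foldl (discover A) (qs, e) (nbr u)) \<and>
      vr s' 20 = \<Delta> * snd (foldl (discover A) (qs, e) (nbr u))" using a by simp
  qed
  then show ?thesis unfolding expand_def using u by simp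
qed

definition bfs_st where
  "bfs_st A v k Q c s \<longleftrightarrow>
     (\<exists>e. bfs nbr A v k = (lst s Q (vr s c), e, lst s 5 (vr s 21)) \<and> vr s 20 = \<Delta> * e)"

lemma bfs_st_cong:
  assumes "bfs_st A v k Q c s" "ar s' Q = ar s Q" "ar s' 5 = ar s 5" "vr s' c = vr s c"
    "vr s' 20 = vr s 20" "vr s' 21 = vr s 21"
  shows "bfs_st A v k Q c s'"
  using assms by (simp add: bfs_st_def lst_def)

lemma wp_bfs_step:
  assumes p: "pars s" and D: "D = 1 \<or> D = 3" and Q: "Q = 2 \<or> Q = 4" and c: "c \<ge> 30"
    and A: "A = set (lst s D t)" "0 \<notin> A" and v: "v \<in> V" and k: "vr s 12 = k" "k < B"
    and st: "bfs_st A v k Q c s"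
  shows "wp I (bfs_step D Q c) (\<lambda>s'. upd {10, 11, 13, 14, 15, 16, 17, 18, 19, 20, 21, c} {Q, 5}
      (d * (32 * Z + 34) + 16 * Z + 28) (d + 1) s s' \<and> bfs_st A v (Suc k) Q c s') s"
proof -
  let ?X = "{10, 11, 13, 14, 15, 16, 17, 18, 19, 20, 21, c}" and ?T = "d * (32 * Z + 34) + 16 * Z + 28"
  let ?post = "\<lambda>s'. upd ?X {Q, 5} ?T (d + 1) s s' \<and> bfs_st A v (Suc k) Q c s'"
  obtain e where b: "bfs nbr A v k = (lst s Q (vr s c), e, lst s 5 (vr s 21))" "vr s 20 = \<Delta> * e"
    using st unfolding bfs_st_def by auto
  let ?qs = "lst s Q (vr s c)"
  note inv = bfs_invariant[OF v A(2) b(1), unfolded bfs_inv_def]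
  have dq: "distinct ?qs" and qV: "set ?qs \<subseteq> V" and lq: "length ?qs \<le> 1 + k * d" using inv by blast+
  have "(k + 1) * d \<le> B * d" using k(2) by (intro mult_le_mono1) simp
  then have lq': "length ?qs + d \<le> Z" using lq Z_bounds(4) by simp
  show ?thesis
  proof (cases "k < vr s c")
    case False
    then have "bfs nbr A v (Suc k) = bfs nbr A v k" using bfs_Suc[OF b(1)] b(1) by simp
    then have "bfs_st A v (Suc k) Q c (tick 1 s)" using st by (simp add: bfs_st_def lst_def)
    moreover have "upd ?X {Q, 5} ?T (d + 1) s (tick 1 s)" by (simp add: upd_def)
    ultimately show ?thesis using False k unfolding bfs_step_def by simp
  next
    case True
    let ?s1 = "tick 1 s"
    let ?c2 = "IfLe 5 18 (Op (VLoad 13 Q 12) ;; Op (VStore 5 21 13) ;; Op (VInc 21) ;; expand D Q c) Skip"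
    let ?P2 = "\<lambda>s2. upd {10, 11, 18} {} (16 * vr s 5 + 4) 0 ?s1 s2 \<and>
        (vr s2 18 < vr s 5 \<and> ar s D (vr s2 18) = vr s 12 \<or>
         vr s2 18 = vr s 5 \<and> vr s 12 \<notin> ar s D ` {..<vr s 5})"
    let ?post' = "\<lambda>s'. upd ?X {Q, 5} (?T - 1) (d + 1) s s' \<and> bfs_st A v (Suc k) Q c s'"
    have "wp I (scan D 5 12 18 ;; ?c2) ?post' ?s1"
    proof (rule wp_seqI[where P = ?P2])
      have "wp I (scan D 5 12 18) (\<lambda>s2. upd {10, 11, 18} {} (16 * vr ?s1 5 + 4) 0 ?s1 s2 \<and>
        (vr s2 18 < vr ?s1 5 \<and> ar ?s1 D (vr s2 18) = vr ?s1 12 \<or>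
         vr s2 18 = vr ?s1 5 \<and> vr ?s1 12 \<notin> ar ?s1 D ` {..<vr ?s1 5})) ?s1"
        by (rule wp_scan) (use D in auto)
      then show "wp I (scan D 5 12 18) ?P2 ?s1" by simp
      fix s2 assume s2: "?P2 s2"
      have t5: "vr s 5 = t" using p pars_simps by blast
      have u2: "upd {10, 11, 18} {} (16 * t + 5) 0 s s2"
        using s2 unfolding t5 by (auto simp: upd_def)
      have A2: "ar s D ` {..<t} = A" using A(1) by (simp add: set_lst)
      have in2: "vr s2 18 < t \<longleftrightarrow> k \<in> A"
        using s2 unfolding t5 k(1) A2[symmetric] by (intro scan_iff) simp
      have v2: "vr s2 5 = t" "ar s2 = ar s" "vr s2 12 = k" "vr s2 c = vr s c" "vr s2 20 = vr s 20"
         "vr s2 21 = vr s 21" "pr s2 \<le> pr s" "tm s2 \<le> tm s + (16 * t + 5)"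
        using u2 k c t5 by (auto simp: upd_def)
      show "wp I ?c2 ?post' s2"
      proof (cases "k \<in> A")
        case kA: True
        then have "bfs nbr A v (Suc k) = bfs nbr A v k" using bfs_Suc[OF b(1)] b(1) by simp
        then have "bfs_st A v (Suc k) Q c s" using st by (simp add: bfs_st_def)
        then have "bfs_st A v (Suc k) Q c (tick 1 (tick 1 s2))"
          by (rule bfs_st_cong) (use v2 in auto)
        moreover have "upd ?X {Q, 5} (?T - 1) (d + 1) s (tick 1 (tick 1 s2))"
          using u2 Z_bounds by (auto simp: upd_def)
        ultimately show ?thesis using kA in2 v2 by auto
      next
        case kA: False
        let ?u = "?qs ! k"
        have u: "?u \<in> V" using True qV nth_mem[of k ?qs] by auto
        let ?s3 = "s2\<lparr>ar := (ar s2)(5 := (ar s2 5)(vr s 21 := ?u)), vr := (vr s2)(13 := ?u, 21 := Suc (vr s 21)),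
           tm := 17 + tm s2\<rparr>"
        have u3: "upd {10, 11, 13, 18, 21} {5} (16 * t + 22) 0 s ?s3" using u2 by (auto simp: upd_def)
        have Q5: "Q \<noteq> 5" "D \<noteq> 5" using Q D by auto
        have p3: "pars ?s3" by (rule pars_upd[OF p u3]) auto
        have A3: "A = set (lst ?s3 D t)" using A(1) v2 Q5 by (auto simp: lst_def)
        have q3: "lst ?s3 Q (vr ?s3 c) = ?qs" using v2 Q5 c by (simp add: lst_def)
        have c3: "lst ?s3 5 (vr ?s3 21) = lst s 5 (vr s 21) @ [?u]"
          using v2 by (auto simp: lst_def)
        have w: "wp I (expand D Q c) (\<lambda>s'. upd {10, 11, 14, 15, 16, 17, 18, 19, 20, c} {Q} (d * (32 * Z + 34) + 3) (d + 1) ?s3 s' \<and>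
          lst s' Q (vr s' c) = fst (foldl (discover A) (?qs, e) (nbr ?u)) \<and>
          vr s' 20 = \<Delta> * snd (foldl (discover A) (?qs, e) (nbr ?u))) ?s3"
          by (rule wp_expand[OF p3 D Q c A3 _ u q3 dq lq']) (use b(2) v2 in auto)
        have "wp I (expand D Q c) ?post' ?s3"
        proof (rule wp_mono[OF w])
          fix s' assume a: "upd {10, 11, 14, 15, 16, 17, 18, 19, 20, c} {Q} (d * (32 * Z + 34) + 3) (d + 1) ?s3 s' \<and>
            lst s' Q (vr s' c) = fst (foldl (discover A) (?qs, e) (nbr ?u)) \<and>
            vr s' 20 = \<Delta> * snd (foldl (discover A) (?qs, e) (nbr ?u))"
          have "upd ?X {Q, 5} (?T - 1) (d + 1) s s'"
            by (rule upd_trans[OF u3 conjunct1[OF a]]) (use Z_bounds in auto)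
          moreover have "lst s' 5 (vr s' 21) = lst s 5 (vr s 21) @ [?u]"
          proof -
            have "vr s' 21 = vr ?s3 21" "ar s' 5 = ar ?s3 5" using a Q5 c by (auto simp: upd_def)
            then show ?thesis using c3 by (simp add: lst_def)
          qed
          moreover have "bfs nbr A v (Suc k) = (fst (foldl (discover A) (?qs, e) (nbr ?u)),
             snd (foldl (discover A) (?qs, e) (nbr ?u)), lst s 5 (vr s 21) @ [?u])"
            using bfs_Suc[OF b(1)] True kA by (simp add: fst_foldl_disc1)
          ultimately show "?post' s'" using a by (simp add: bfs_st_def)
        qed
        moreover have "ar s2 Q k = ?u" using v2 True by simp
        ultimately show ?thesis using kA in2 v2 Q by (auto simp: setv_def tick_def)
      qed
    qed
    then have "wp I (scan D 5 12 18 ;; ?c2) (\<lambda>s'. ?post (tick 1 s')) ?s1"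
    proof (rule wp_mono)
      fix s' assume a: "?post' s'"
      have "upd ?X {Q, 5} ?T (d + 1) s (tick 1 s')" using a by (auto simp: upd_def)
      moreover have "bfs_st A v (Suc k) Q c (tick 1 s')" using a by (auto intro: bfs_st_cong)
      ultimately show "?post (tick 1 s')" by blast
    qed
    then show ?thesis using True k unfolding bfs_step_def by simp
  qed
qed

text \<open>At most \<open>B * d \<le> Z\<close> neighbours are inspected in one search, and each
  costs two scans of lists of length at most \<open>Z\<close>.\<close>

lemma wp_bfs:
  assumes p: "pars s" and D: "D = 1 \<or> D = 3" and Q: "Q = 2 \<or> Q = 4" and c: "c \<ge> 30"
    and A: "A = set (lst s D t)" "0 \<notin> A" and x: "x \<ge> 30" "x \<noteq> c" and v: "vr s x = v" "v \<in> V"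
  shows "wp I (bfs_prog D Q x c) (\<lambda>s'. upd ({9..<22} \<union> {c}) {Q, 5} (60 * Z ^ 2) (B * (d + 1)) s s' \<and>
    bfs_st A v B Q c s') s"
proof -
  let ?X = "{10, 11, 13, 14, 15, 16, 17, 18, 19, 20, 21, c}" and ?T = "d * (32 * Z + 34) + 16 * Z + 28"
  let ?s = "s\<lparr>ar := (ar s)(Q := (ar s Q)(0 := v)), vr := (vr s)(9 := 0, c := 1, 20 := 0, 21 := 0), tm := 11 + tm s\<rparr>"
  have Q5: "Q \<noteq> 5" "D \<noteq> 5" "D \<noteq> Q" using Q D by auto
  have u1: "upd {9, c, 20, 21} {Q} 11 0 s ?s" using Q by (auto simp: upd_def)
  have p1: "pars ?s" by (rule pars_upd[OF p u1]) (use c in auto)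
  have w: "wp I (For 12 1 (bfs_step D Q c))
    (\<lambda>s'. upd (insert 12 ?X) {Q, 5} (B * (?T + 4) + 2) (B * (d + 1)) ?s s' \<and> bfs_st A v B Q c s') ?s"
  proof (rule wp_For[where J = "\<lambda>k. bfs_st A v k Q c"])
    show "bfs_st A v 0 Q c ?s" using c by (simp add: bfs_st_def lst_def)
    show "bfs_st A v k Q c (setv m 12 y s')" if "bfs_st A v k Q c s'" for k s' m y
      using that c by (auto intro: bfs_st_cong)
    show "vr ?s 1 = B" using p1 pars_simps by blast
    fix k s' assume k: "k < B" "vr s' 12 = k"
      and us: "upd (insert 12 ?X) {Q, 5} (B * (?T + 4) + 2) (B * (d + 1)) ?s s'" and J: "bfs_st A v k Q c s'"
    have p': "pars s'" by (rule pars_upd[OF p1 us]) (use c in auto)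
    have A': "A = set (lst s' D t)" using us A Q5 by (auto simp: upd_def lst_def)
    show "wp I (bfs_step D Q c) (\<lambda>s''. upd ?X {Q, 5} ?T (d + 1) s' s'' \<and> bfs_st A v (Suc k) Q c s'') s'"
      by (rule wp_bfs_step[OF p' D Q c A' A(2) v(2) k(2,1) J])
  qed (use c in auto)
  have "B * (?T + 4) + 13 \<le> 60 * Z ^ 2"
  proof -
    have "B * (?T + 4) = (B * d) * (32 * Z + 34) + B * (16 * Z + 32)" by (simp add: algebra_simps)
    also have "\<dots> \<le> Z * (32 * Z + 34) + Z * (16 * Z + 32)"
      using Z_bounds by (intro add_mono mult_le_mono1) auto
    also have "\<dots> = 48 * (Z * Z) + 66 * Z" by (simp add: algebra_simps)
    finally have "B * (?T + 4) + 13 \<le> 48 * (Z * Z) + 66 * Z + 13" by (rule add_le_mono1)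
    also have "100 * Z \<le> Z * Z" using Z(3) by (rule mult_le_mono1)
    then have "48 * (Z * Z) + 66 * Z + 13 \<le> 60 * (Z * Z)" using Z(3) by linarith
    finally show ?thesis by (simp add: power2_eq_square)
  qed
  then have "wp I (For 12 1 (bfs_step D Q c)) (\<lambda>s'. upd ({9..<22} \<union> {c}) {Q, 5} (60 * Z ^ 2) (B * (d + 1)) s s' \<and>
    bfs_st A v B Q c s') ?s"
    by (intro wp_mono[OF w] conjI upd_trans[OF u1]) auto
  then show ?thesis unfolding bfs_prog_def using v Q x c
    by (auto simp: setv_def)
qed

end

section \<open>Choosing a canonical isolated set\<close>

definition suc_max :: "nat set \<Rightarrow> nat" where
  "suc_max S = (if S = {} then 0 else Suc (Max S))"

lemma suc_max_insert: "finite S \<Longrightarrow> suc_max (insert a S) = max (suc_max S) (Suc a)"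
  by (simp add: suc_max_def max.commute)

lemma set_encode_less_mx:
  assumes "finite S" shows "set_encode S < 2 ^ suc_max S"
proof -
  have "S \<subseteq> {0..<suc_max S}" using assms by (auto simp: suc_max_def less_Suc_eq_le)
  then have "set_encode S \<le> (\<Sum>i=0..<suc_max S. 2 ^ i)" unfolding set_encode_def by (intro sum_mono2) auto
  also have "\<dots> < 2 ^ suc_max S" by (simp add: sum_power2)
  finally show ?thesis .
qed

lemma set_encode_ge_mx:
  assumes "finite S" "suc_max S = Suc m" shows "2 ^ m \<le> set_encode S"
proof -
  have "S \<noteq> {}" "m = Max S" using assms by (auto simp: suc_max_def split: if_splits)
  then have "m \<in> S" using assms by simp
  then show ?thesis unfolding set_encode_def using assms member_le_sum[of m S "\<lambda>i. (2::nat) ^ i"] by simp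
qed

lemma set_encode_mono_mx:
  assumes "finite S" "finite T" "suc_max S < suc_max T" shows "set_encode S < set_encode T"
proof -
  obtain m where m: "suc_max T = Suc m" using assms(3) by (cases "suc_max T") auto
  have "set_encode S < 2 ^ suc_max S" by (rule set_encode_less_mx[OF assms(1)])
  also have "\<dots> \<le> 2 ^ m" using assms(3) m by simp
  also have "\<dots> \<le> set_encode T" by (rule set_encode_ge_mx[OF assms(2) m])
  finally show ?thesis .
qed

text \<open>The order of the binary encodings is decided by the largest element of the symmetric
  difference, which the machine can find without computing powers.\<close>

lemma set_encode_le_iff:
  assumes "finite S" "finite T"
  shows "set_encode S \<le> set_encode T \<longleftrightarrow> suc_max (S - T) \<le> suc_max (T - S)"
proof -
  have split: "set_encode A = set_encode (A \<inter> B) + set_encode (A - B)" if "finite A" for A B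
    unfolding set_encode_def using that by (metis sum.Int_Diff)
  have eq: "set_encode S \<le> set_encode T \<longleftrightarrow> set_encode (S - T) \<le> set_encode (T - S)"
    using split[OF assms(1), of T] split[OF assms(2), of S] by (simp add: Int_commute)
  consider "suc_max (S - T) < suc_max (T - S)" | "suc_max (T - S) < suc_max (S - T)" | "suc_max (S - T) = suc_max (T - S)" by linarith
  then show ?thesis
  proof cases
    case 3
    have "S - T = {} \<and> T - S = {}"
    proof (rule ccontr)
      assume "\<not> ?thesis"
      then have ne: "S - T \<noteq> {}" "T - S \<noteq> {}" and "Max (S - T) = Max (T - S)"
        using 3 by (auto simp: suc_max_def split: if_splits)
      then show False using Max_in[OF _ ne(1)] Max_in[OF _ ne(2)] assms by auto
    qed
    then have "S = T" by blast
    then show ?thesis by simp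
  qed (use eq set_encode_mono_mx[of "S - T" "T - S"] set_encode_mono_mx[of "T - S" "S - T"] assms in auto)
qed

definition is_best :: "nat set set \<Rightarrow> nat set \<Rightarrow> bool" where
  "is_best F S \<longleftrightarrow> S \<in> F \<and> (\<forall>T\<in>F. set_encode T \<le> set_encode S)"

lemma is_best_unique:
  assumes "is_best F S" "is_best F T" "\<And>S. S \<in> F \<Longrightarrow> finite S" shows "S = T"
  using assms set_encode_eq[of S T] unfolding is_best_def by (metis antisym)

lemma is_best_insert:
  "is_best F S \<Longrightarrow> is_best (insert T F) (if set_encode T \<le> set_encode S then S else T)"
  by (auto simp: is_best_def)

text \<open>Applied in both directions, this yields the two sides of
  \<open>set_encode_le_iff\<close>. An empty difference gives 0, below the value of every nonempty
  one.\<close>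

definition diffmax :: "nat \<Rightarrow> nat \<Rightarrow> nat \<Rightarrow> nat \<Rightarrow> nat \<Rightarrow> com" where
  "diffmax j nx j' ny m = Op (VConst m 0) ;; For 22 nx (Op (VLoad 23 j 22) ;; scan j' ny 23 24 ;;
     IfLe ny 24 (IfLe m 23 (Op (VCopy m 23) ;; Op (VInc m)) Skip) Skip)"

text \<open>\<open>best_prog\<close> computes \<open>Sof w\<close> for the vertex \<open>w\<close> in variable 30, in array 6 with length in variable 31.\<close>

definition best_step :: com where
  "best_step = IfLe 41 1 (IfLe 21 2 (IfLe 20 21 (diffmax 5 21 6 31 25 ;; diffmax 6 31 5 21 26 ;;
     IfLe 25 26 Skip (copy 5 21 6 ;; Op (VCopy 31 21))) Skip) Skip) Skip"

definition best_prog :: "nat \<Rightarrow> com" where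
  "best_prog t = Op (VConst 9 0) ;; Op (VStore 6 9 30) ;; Op (VConst 31 1) ;;
     nest 3 101 t (bfs_prog 3 4 30 41 ;; best_step)"

lemma wp_diffmax:
  assumes "1 \<le> j" "j \<le> 14" "1 \<le> j'" "j' \<le> 14" "m \<in> {25, 26}" "nx \<in> {21, 31}" "ny \<in> {21, 31}"
    and T: "vr s nx \<le> Z" "vr s ny \<le> Z" "Z \<ge> 100"
  shows "wp I (diffmax j nx j' ny m) (\<lambda>s'. upd {10, 11, 22, 23, 24, m} {} (20 * Z ^ 2) 0 s s' \<and>
    vr s' m = suc_max (set (lst s j (vr s nx)) - set (lst s j' (vr s ny)))) s"
proof -
  let ?X = "{10, 11, 23, 24, m}" and ?N = "vr s nx" and ?M = "vr s ny" and ?s = "setv 1 m 0 s"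
  let ?T = "set (lst s j' ?M)"
  let ?J = "\<lambda>k s'. vr s' m = suc_max (set (lst s j k) - ?T)"
  let ?c2 = "IfLe ny 24 (IfLe m 23 (Op (VCopy m 23) ;; Op (VInc m)) Skip) Skip"
  have w: "wp I (For 22 nx (Op (VLoad 23 j 22) ;; scan j' ny 23 24 ;; ?c2))
    (\<lambda>s'. upd (insert 22 ?X) {} (?N * ((16 * Z + 20) + 4) + 2) (?N * 0) ?s s' \<and> ?J ?N s') ?s"
  proof (rule wp_For[where J = ?J])
    show "?J 0 ?s" by (simp add: lst_def suc_max_def)
    show "?J k (setv n 22 v s')" if "?J k s'" for k s' n v using that assms by auto
    show "vr ?s nx = ?N" using assms by auto
    fix k s' assume k: "k < ?N" "vr s' 22 = k"
      and us: "upd (insert 22 ?X) {} (?N * ((16 * Z + 20) + 4) + 2) (?N * 0) ?s s'" and J: "?J k s'"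
    let ?u = "ar s j k" and ?s1 = "setv 7 23 (ar s j k) s'"
    have a: "ar s' = ar s" using us by (auto simp: upd_def)
    have v: "vr s' ny = ?M" using upd_vr[OF us, of ny] assms by auto
    let ?P2 = "\<lambda>s2. upd {10, 11, 24} {} (16 * ?M + 4) 0 ?s1 s2 \<and>
        (vr s2 24 < ?M \<and> ar s j' (vr s2 24) = ?u \<or> vr s2 24 = ?M \<and> ?u \<notin> ar s j' ` {..<?M})"
    have "wp I (scan j' ny 23 24 ;; ?c2) (\<lambda>s''. upd ?X {} (16 * Z + 20) 0 s' s'' \<and> ?J (Suc k) s'') ?s1"
    proof (rule wp_seqI[where P = ?P2])
      have "wp I (scan j' ny 23 24) (\<lambda>s2. upd {10, 11, 24} {} (16 * vr ?s1 ny + 4) 0 ?s1 s2 \<and>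
        (vr s2 24 < vr ?s1 ny \<and> ar ?s1 j' (vr s2 24) = vr ?s1 23 \<or>
         vr s2 24 = vr ?s1 ny \<and> vr ?s1 23 \<notin> ar ?s1 j' ` {..<vr ?s1 ny})) ?s1"
        by (rule wp_scan) (use assms in auto)
      moreover have "vr ?s1 ny = ?M" "vr ?s1 23 = ?u" "ar ?s1 = ar s" using v a assms by auto
      ultimately show "wp I (scan j' ny 23 24) ?P2 ?s1" by metis
      fix s2 assume s2: "?P2 s2"
      have v2: "vr s2 ny = ?M" "vr s2 23 = ?u" "vr s2 m = vr s' m"
        using upd_vr[OF conjunct1[OF s2], of ny] upd_vr[OF conjunct1[OF s2], of 23]
          upd_vr[OF conjunct1[OF s2], of m] v assms by auto
      have u2: "upd {10, 11, 23, 24} {} (16 * Z + 11) 0 s' s2"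
        using s2 T by (auto simp: upd_def)
      have in2: "vr s2 24 < ?M \<longleftrightarrow> ?u \<in> ?T"
        unfolding set_lst using s2 by (intro scan_iff) simp
      have Tk: "set (lst s j (Suc k)) - ?T = (if ?u \<in> ?T then set (lst s j k) - ?T else insert ?u (set (lst s j k) - ?T))"
        by (auto simp: lst_Suc)
      have mxk: "suc_max (set (lst s j (Suc k)) - ?T) =
         (if ?u \<in> ?T then suc_max (set (lst s j k) - ?T) else max (suc_max (set (lst s j k) - ?T)) (Suc ?u))"
        unfolding Tk by (simp add: suc_max_insert)
      show "wp I ?c2 (\<lambda>s''. upd ?X {} (16 * Z + 20) 0 s' s'' \<and> ?J (Suc k) s'') s2"
        unfolding mxk using v2 u2 in2 J assms(5) by (auto simp: upd_def max_def)
    qed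
    then show "wp I (Op (VLoad 23 j 22) ;; scan j' ny 23 24 ;; ?c2)
       (\<lambda>s''. upd ?X {} (16 * Z + 20) 0 s' s'' \<and> ?J (Suc k) s'') s'"
      using a k assms by simp
  qed (use assms in auto)
  have le: "?N * ((16 * Z + 20) + 4) + 3 \<le> 20 * Z ^ 2"
  proof -
    have "?N * ((16 * Z + 20) + 4) + 3 \<le> Z * ((16 * Z + 20) + 4) + 3" using T(1) by (intro add_mono mult_le_mono1) auto
    also have "\<dots> = 16 * (Z * Z) + 24 * Z + 3" by (simp add: algebra_simps)
    also have "\<dots> \<le> 20 * (Z * Z)"
    proof -
      have "100 * Z \<le> Z * Z" using T(3) by (rule mult_le_mono1)
      then show ?thesis using T(3) by linarith
    qed
    finally show ?thesis by (simp add: power2_eq_square)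
  qed
  have u1: "upd {m} {} 1 0 s ?s" by (simp add: upd_def)
  have "wp I (For 22 nx (Op (VLoad 23 j 22) ;; scan j' ny 23 24 ;; ?c2))
    (\<lambda>s'. upd {10, 11, 22, 23, 24, m} {} (20 * Z ^ 2) 0 s s' \<and> ?J ?N s') ?s"
    by (intro wp_mono[OF w] conjI upd_trans[OF u1]) (use le in auto)
  then show ?thesis unfolding diffmax_def by simp
qed

context machine
begin

definition cands :: "nat \<Rightarrow> nat list \<Rightarrow> nat set set" where
  "cands w ds = {S. \<exists>qs e cs. bfs nbr (set ds) w B = (qs, e, cs) \<and> length qs \<le> B \<and> length cs \<le> K \<and>
     \<Delta> * e \<le> length cs \<and> S = set cs}"

text \<open>Ties are broken by the encoding, because \<open>Sof\<close> must not depend on the order of the neighbor lists.\<close>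

definition fam :: "nat \<Rightarrow> nat set set" where
  "fam w = insert {w} {S. S \<subseteq> V \<and> w \<in> S \<and> isolated E K t \<Delta> S}"

definition Sof :: "nat \<Rightarrow> nat set" where
  "Sof w = (THE S. is_best (fam w) S)"

lemma dlists_set: "ds \<in> dlists B j \<Longrightarrow> 0 \<notin> set ds \<and> card (set ds) \<le> j"
  by (auto simp: dlists_def intro: card_length)

text \<open>The stopping positions are those of vertices outside \<open>S\<close> in the guided
  queue. These are neighbours of \<open>S\<close>, so there are at most \<open>t\<close>, and
  position 0 holds the start and is not among them. That the queue contains all of \<open>S\<close>,
  not only the start, is needed for finding possible owners.\<close>

lemma bfs_digits:
  assumes w: "w \<in> S" "S \<subseteq> V" "isolated E K t \<Delta> S"
  shows "\<exists>ds qs e cs. ds \<in> dlists B t \<and> bfs nbr (set ds) w B = (qs, e, cs) \<and> length qs \<le> B \<and>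
     S \<subseteq> set qs \<and> set cs = S"
proof -
  let ?G = "guided S w B"
  have iso: "induces_connected E S" "card S \<le> K" "card (nbd E S) \<le> t" using w(3) by (auto simp: isolated_def)
  have le: "card S + card (nbd E S) \<le> B" using iso B by simp
  define A where "A = {i. i < length ?G \<and> ?G ! i \<notin> S}"
  note gi = guided_inv[OF w(1,2), of B]
  have finN: "finite (nbd E S)" using fin_graph_edge[OF G] finV by (auto simp: nbd_def intro: finite_subset[of _ V])
  have finS: "finite S" using w(2) finV finite_subset by blast
  have finA: "finite A" by (simp add: A_def)
  have "card A = card ((!) ?G ` A)"
    using gi by (intro card_image[symmetric]) (auto simp: inj_on_def A_def nth_eq_iff_index_eq)
  also have "\<dots> \<le> card (nbd E S)" using gi finN by (intro card_mono) (auto simp: A_def dest: nth_mem)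
  finally have cA: "card A \<le> t" using iso by simp
  have lenG: "length ?G \<le> B"
  proof -
    have "length ?G = card (set ?G)" using gi distinct_card by metis
    also have "\<dots> \<le> card (S \<union> nbd E S)" using gi finS finN by (intro card_mono) auto
    also have "\<dots> \<le> B" using card_Un_le[of S "nbd E S"] le by linarith
    finally show ?thesis .
  qed
  have A0: "0 \<notin> A" using gi w(1) by (auto simp: A_def)
  \<comment> \<open>Padding with \<open>B\<close> is harmless: the queue has length at most
    \<open>B\<close>, so this position does not occur in it.\<close>
  define ds where "ds = sorted_list_of_set A @ replicate (t - card A) B"
  have "A \<subseteq> {1..B}"
  proof
    fix i assume i: "i \<in> A"
    then have "i \<noteq> 0" using A0 by metis
    then show "i \<in> {1..B}" using i lenG by (auto simp: A_def)
  qed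
  moreover have sub: "set ds \<subseteq> insert B A" "A \<subseteq> set ds"
    using finA by (auto simp: ds_def set_replicate_conv_if split: if_splits)
  moreover have "B \<in> {1..B}" using B(2) by simp
  moreover have "length ds = t" using finA cA by (simp add: ds_def)
  ultimately have "ds \<in> dlists B t" unfolding dlists_def by blast
  moreover have "i \<in> set ds \<longleftrightarrow> ?G ! i \<notin> S" if "i < length ?G" for i
    using that lenG sub by (auto simp: A_def)
  then have "\<exists>qs e cs. bfs nbr (set ds) w B = (qs, e, cs) \<and> length qs \<le> B \<and> S \<subseteq> set qs \<and> set cs = S"
    by (intro bfs_complete[OF w(1,2) iso(1) le])
  ultimately show ?thesis by blast
qed

text \<open>The machine checks only lengths and a counter. By distinctness and
  \<open>bfs_sound\<close> these are the size and the boundary of the set, while the bound on the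
  neighbours is built into the number of digits.\<close>

lemma cands_all:
  assumes w: "w \<in> V"
  shows "insert {w} (\<Union>ds\<in>dlists B t. cands w ds) = fam w"
proof -
  have "S \<in> (\<Union>ds\<in>dlists B t. cands w ds) \<longleftrightarrow> S \<subseteq> V \<and> w \<in> S \<and> isolated E K t \<Delta> S" for S
  proof
    assume "S \<in> (\<Union>ds\<in>dlists B t. cands w ds)"
    then obtain ds qs e cs where ds: "ds \<in> dlists B t" and b: "bfs nbr (set ds) w B = (qs, e, cs)"
      "length qs \<le> B" "length cs \<le> K" "\<Delta> * e \<le> length cs" "S = set cs" by (auto simp: cands_def)
    note d = dlists_set[OF ds]
    note snd = bfs_sound[OF w conjunct1[OF d] finite_set b(1,2)]
    have "card S = length cs" using snd(6) b(5) by (simp add: distinct_card)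
    moreover have "card (nbd E S) \<le> t"
      using order_trans[OF snd(4) conjunct2[OF d]] unfolding b(5) .
    moreover have "\<Delta> * card (bdry E S) \<le> length cs"
      using b(4) unfolding snd(5) b(5) .
    ultimately show "S \<subseteq> V \<and> w \<in> S \<and> isolated E K t \<Delta> S"
      unfolding isolated_def b(5) using snd(1-3) b(3) by (intro conjI) simp_all
  next
    assume S: "S \<subseteq> V \<and> w \<in> S \<and> isolated E K t \<Delta> S"
    then have "\<exists>ds qs e cs. ds \<in> dlists B t \<and> bfs nbr (set ds) w B = (qs, e, cs) \<and> length qs \<le> B \<and>
       S \<subseteq> set qs \<and> set cs = S" by (intro bfs_digits) auto
    then obtain ds qs e cs where ds: "ds \<in> dlists B t" and b: "bfs nbr (set ds) w B = (qs, e, cs)"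
      "length qs \<le> B" "set cs = S" by (elim exE conjE)
    note d = dlists_set[OF ds]
    note snd = bfs_sound[OF w conjunct1[OF d] finite_set b(1,2)]
    have "card S = length cs" using snd(6) b(3) distinct_card by metis
    then have "S \<in> cands w ds" using S b snd(5) unfolding cands_def isolated_def by auto
    then show "S \<in> (\<Union>ds\<in>dlists B t. cands w ds)" using ds by blast
  qed
  then show ?thesis unfolding fam_def by blast
qed

lemma fam_finite: "w \<in> V \<Longrightarrow> finite (fam w)" "w \<in> V \<Longrightarrow> S \<in> fam w \<Longrightarrow> S \<subseteq> V \<and> w \<in> S \<and> finite S"
proof -
  assume w: "w \<in> V"
  have "fam w \<subseteq> Pow V" using w by (auto simp: fam_def)
  then show "finite (fam w)" using finV finite_subset by blast
  show "S \<subseteq> V \<and> w \<in> S \<and> finite S" if "S \<in> fam w"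
    using that w finV finite_subset by (auto simp: fam_def)
qed

lemma Sof_eq:
  assumes w: "w \<in> V" and S: "is_best (fam w) S" shows "Sof w = S"
  unfolding Sof_def using is_best_unique[of "fam w"] S fam_finite(2)[OF w] by (intro the_equality) blast+

definition best_fam :: "nat \<Rightarrow> nat list set \<Rightarrow> nat set set" where
  "best_fam w X = insert {w} (\<Union>ds\<in>X. cands w ds)"

definition best_inv :: "nat \<Rightarrow> nat list set \<Rightarrow> ast \<Rightarrow> bool" where
  "best_inv w X s \<longleftrightarrow> pars s \<and> vr s 30 = w \<and> distinct (lst s 6 (vr s 31)) \<and> vr s 31 \<le> B \<and>
     is_best (best_fam w X) (set (lst s 6 (vr s 31)))"

lemma best_inv_cong:
  assumes "best_inv w X s" "\<And>x. x \<in> {1..5} \<union> {30, 31} \<Longrightarrow> vr s' x = vr s x" "ar s' 6 = ar s 6"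
  shows "best_inv w X s'"
proof -
  have "pars s'" using assms(1,2) by (simp add: best_inv_def pars_def)
  then show ?thesis using assms by (simp add: best_inv_def lst_def)
qed

lemma wp_best_step:
  assumes J: "best_inv w X s" and w: "w \<in> V" and ds: "ds \<in> dlists B t"
    and st: "bfs_st (set ds) w B 4 41 s"
  shows "wp I best_step (\<lambda>s'. upd {10, 11, 22, 23, 24, 25, 26, 31} {6} (60 * Z ^ 2) 0 s s' \<and>
    best_inv w (insert ds X) s') s"
proof -
  let ?X = "{10, 11, 22, 23, 24, 25, 26, 31}"
  let ?post = "\<lambda>s'. upd ?X {6} (60 * Z ^ 2) 0 s s' \<and> best_inv w (insert ds X) s'"
  obtain e where b: "bfs nbr (set ds) w B = (lst s 4 (vr s 41), e, lst s 5 (vr s 21))" "vr s 20 = \<Delta> * e"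
    using st unfolding bfs_st_def by (elim exE conjE)
  let ?cs = "lst s 5 (vr s 21)" and ?b = "lst s 6 (vr s 31)"
  have p: "pars s" and p30: "vr s 30 = w" and db: "distinct ?b" and bB: "vr s 31 \<le> B"
    and best: "is_best (best_fam w X) (set ?b)" using J by (auto simp: best_inv_def)
  note ps = pars_simps[OF p]
  have dc: "distinct ?cs"
    using bfs_invariant[OF w conjunct1[OF dlists_set[OF ds]] b(1)] by (simp add: bfs_inv_def)
  have Z1: "100 * Z \<le> Z ^ 2" "10000 \<le> Z ^ 2"
    using Z(3) mult_le_mono[of 100 Z 100 Z] mult_le_mono1[of 100 Z Z] by (simp_all add: power2_eq_square)
  define ok where "ok \<longleftrightarrow> vr s 41 \<le> B \<and> vr s 21 \<le> K \<and> \<Delta> * e \<le> vr s 21"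
  have cand: "cands w ds = (if ok then {set ?cs} else {})"
    unfolding cands_def b(1) ok_def by auto
  have fam: "best_fam w (insert ds X) = (if ok then insert (set ?cs) (best_fam w X) else best_fam w X)"
    unfolding best_fam_def using cand by auto
  show ?thesis
  proof (cases ok)
    case False
    have tk: "?post (tick n s)" if "n \<le> 6" for n
    proof
      show "upd ?X {6} (60 * Z ^ 2) 0 s (tick n s)" using that Z1 by (simp add: upd_def)
      have "best_inv w (insert ds X) s" using J fam False by (simp add: best_inv_def)
      then show "best_inv w (insert ds X) (tick n s)" by (rule best_inv_cong) auto
    qed
    have tt: "tick n (tick m s) = tick (m + n) s" for n m by (simp add: tick_def)
    show ?thesis using False ps b(2) tk[of 2] tk[of 3] tk[of 4] tk[of 5] tk[of 6]
      unfolding ok_def best_step_def by (auto simp: tt numeral_eq_Suc)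
  next
    case True
    let ?c2 = "diffmax 6 31 5 21 26 ;; IfLe 25 26 Skip (copy 5 21 6 ;; Op (VCopy 31 21))"
    let ?s1 = "tick 1 (tick 1 (tick 1 s))"
    have lens: "vr s 21 \<le> Z" "vr s 31 \<le> Z" using True B Z_bounds bB unfolding ok_def by auto
    let ?P1 = "\<lambda>s'. upd {10, 11, 22, 23, 24, 25} {} (20 * Z ^ 2) 0 ?s1 s' \<and> vr s' 25 = suc_max (set ?cs - set ?b)"
    have "wp I (diffmax 5 21 6 31 25) ?P1 ?s1"
      using wp_diffmax[of 5 6 25 21 31 ?s1 Z] lens Z(3) by simp
    then have "wp I (diffmax 5 21 6 31 25 ;; ?c2) ?post ?s1"
    proof (rule wp_seqI)
      fix s2 assume s2: "?P1 s2"
      have v2: "vr s2 21 = vr s 21" "vr s2 31 = vr s 31" "ar s2 = ar s"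
        using s2 by (auto simp: upd_def)
      then have l2: "lst s2 5 (vr s2 21) = ?cs" "lst s2 6 (vr s2 31) = ?b" by (simp_all add: lst_def)
      let ?P2 = "\<lambda>s'. upd {10, 11, 22, 23, 24, 26} {} (20 * Z ^ 2) 0 s2 s' \<and> vr s' 26 = suc_max (set ?b - set ?cs)"
      have "wp I (diffmax 6 31 5 21 26) ?P2 s2"
        using wp_diffmax[of 6 5 26 31 21 s2 Z] lens Z(3) v2 l2 by simp
      then show "wp I ?c2 ?post s2"
      proof (rule wp_seqI)
        fix s3 assume s3: "?P2 s3"
        have u1: "upd {} {} 3 0 s ?s1" by (simp add: upd_def)
        have u2: "upd {10, 11, 22, 23, 24, 25} {} (20 * Z ^ 2 + 3) 0 s s2"
          by (rule upd_trans[OF u1 conjunct1[OF s2]]) auto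
        have u3: "upd {10, 11, 22, 23, 24, 25, 26} {} (40 * Z ^ 2 + 3) 0 s s3"
          by (rule upd_trans[OF u2 conjunct1[OF s3]]) auto
        have v3: "vr s3 21 = vr s 21" "vr s3 31 = vr s 31" "ar s3 = ar s"
          using u3 by (auto simp: upd_def)
        have m3: "vr s3 25 = suc_max (set ?cs - set ?b)" "vr s3 26 = suc_max (set ?b - set ?cs)"
          using s2 s3 upd_vr[OF conjunct1[OF s3], of 25] by auto
        have le: "vr s3 25 \<le> vr s3 26 \<longleftrightarrow> set_encode (set ?cs) \<le> set_encode (set ?b)"
          unfolding m3 by (rule set_encode_le_iff[symmetric]) auto
        have ib: "is_best (best_fam w (insert ds X))
            (if vr s3 25 \<le> vr s3 26 then set ?b else set ?cs)"
          using is_best_insert[OF best, of "set ?cs"] True le unfolding fam by simp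
        show "wp I (IfLe 25 26 Skip (copy 5 21 6 ;; Op (VCopy 31 21))) ?post s3"
        proof (cases "vr s3 25 \<le> vr s3 26")
          case le: True
          have "best_inv w (insert ds X) s" using J ib le by (simp add: best_inv_def)
          then have "best_inv w (insert ds X) (tick 1 s3)"
            by (rule best_inv_cong) (use upd_vr[OF u3] upd_ar[OF u3] in auto)
          moreover have "upd ?X {6} (60 * Z ^ 2) 0 s (tick 1 s3)"
            by (rule upd_trans[OF u3, of "{}" "{}" 1 0]) (use Z1 in \<open>auto simp: upd_def\<close>)
          ultimately show ?thesis using le by simp
        next
          case gt: False
          let ?s4 = "tick 1 s3"
          have c: "wp I (copy 5 21 6) (\<lambda>s'. upd {22, 23} {6} (18 * vr ?s4 21 + 2) 0 ?s4 s' \<and>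
            lst s' 6 (vr ?s4 21) = lst ?s4 5 (vr ?s4 21)) ?s4"
            by (rule wp_copy) auto
          have "wp I (copy 5 21 6 ;; Op (VCopy 31 21)) (\<lambda>s'. ?post (tick 1 s')) ?s4"
          proof (rule wp_seqI[OF c])
            fix s5 assume s5: "upd {22, 23} {6} (18 * vr ?s4 21 + 2) 0 ?s4 s5 \<and>
              lst s5 6 (vr ?s4 21) = lst ?s4 5 (vr ?s4 21)"
            let ?s6 = "tick 1 (setv 2 31 (vr s5 21) s5)"
            have v5: "vr s5 21 = vr s 21" using s5 v3 by (auto simp: upd_def)
            have l5: "lst s5 6 (vr s 21) = ?cs" using s5 v3 by (simp add: lst_def)
            have u4: "upd {10, 11, 22, 23, 24, 25, 26} {} (40 * Z ^ 2 + 4) 0 s ?s4"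
              using u3 by (auto simp: upd_def)
            have u5: "upd {10, 11, 22, 23, 24, 25, 26} {6} (40 * Z ^ 2 + 18 * Z + 6) 0 s s5"
              by (rule upd_trans[OF u4 conjunct1[OF s5]]) (use lens v3 in auto)
            have u6: "upd ?X {6} (60 * Z ^ 2) 0 s ?s6"
              by (rule upd_trans[OF u5, of "{31}" "{}" 3 0]) (use Z1 in \<open>auto simp: upd_def\<close>)
            have v6: "vr ?s6 31 = vr s 21" "lst ?s6 6 (vr s 21) = ?cs" using v5 l5 by auto
            have "pars ?s6" by (rule pars_upd[OF p u6]) auto
            moreover have "vr ?s6 30 = w" using upd_vr[OF u6, of 30] p30 by simp
            moreover have "vr s 21 \<le> B" using True B unfolding ok_def by simp
            ultimately have "best_inv w (insert ds X) ?s6"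
              unfolding best_inv_def v6 using dc ib gt by simp
            then show "wp I (Op (VCopy 31 21)) (\<lambda>s'. ?post (tick 1 s')) s5" using u6 by simp
          qed
          then show ?thesis using gt by simp
        qed
      qed
    qed
    then show ?thesis using True ps b(2) unfolding ok_def best_step_def by simp
  qed
qed

lemma wp_best:
  assumes p: "pars s" and w: "vr s 30 = w" "w \<in> V"
  shows "wp I (best_prog t) (\<lambda>s'. upd ({9..<30} \<union> {31, 41} \<union> {x. 100 \<le> x \<and> odd x}) {3, 4, 5, 6}
      (B ^ t * (122 * Z ^ 2)) (B ^ t * (B * (d + 1))) s s' \<and>
    distinct (lst s' 6 (vr s' 31)) \<and> vr s' 31 \<le> B \<and> set (lst s' 6 (vr s' 31)) = Sof w) s"
proof -
  let ?s = "s\<lparr>ar := (ar s)(6 := (ar s 6)(0 := w)), vr := (vr s)(9 := 0, 31 := 1), tm := 9 + tm s\<rparr>"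
  let ?Xb = "{9..<30} \<union> {31, 41}" and ?Yb = "{4, 5, 6}"
  have u1: "upd {9, 31} {6} 9 0 s ?s" by (auto simp: upd_def)
  have p1: "pars ?s" by (rule pars_upd[OF p u1]) auto
  have Z1: "30 * t \<le> Z ^ 2" "9 \<le> Z ^ 2"
  proof -
    have "30 * t \<le> Z * Z" using Z_bounds(2) Z(3) by (intro mult_le_mono) auto
    then show "30 * t \<le> Z ^ 2" by (simp add: power2_eq_square)
    have "9 * 1 \<le> Z * Z" using Z(3) by (intro mult_le_mono) auto
    then show "9 \<le> Z ^ 2" by (simp add: power2_eq_square)
  qed
  have j0: "best_inv w {} ?s"
    using p1 w B(2) by (simp add: best_inv_def best_fam_def is_best_def lst_def)
  have "wp I (nest 3 101 t (bfs_prog 3 4 30 41 ;; best_step))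
    (\<lambda>s'. upd (?Xb \<union> {27, 28} \<union> {101 + 2 * i |i. i < t}) (insert 3 ?Yb) (B ^ t * (120 * Z ^ 2 + 30 * t))
       (B ^ t * (B * (d + 1))) ?s s' \<and> best_inv w ({} \<union> {ds @ [] |ds. ds \<in> dlists B t}) s' \<and>
       (\<forall>i\<ge>t. ar s' 3 i = ar ?s 3 i)) ?s"
  proof (rule wp_nest[where J = "best_inv w" and B = B and t = t])
    show "vr s' 1 = B" if "best_inv w X s'" for X s'
      using that pars_simps by (auto simp: best_inv_def)
    show "best_inv w X s2" if "best_inv w X s1" "upd ({27, 28} \<union> {101 + 2 * i |i. True}) {3} T p s1 s2"
      for X s1 s2 T p
      by (rule best_inv_cong[OF that(1)]) (use upd_vr[OF that(2)] upd_ar[OF that(2)] in auto)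
    show "[] \<in> dlists B (t - t)" by (simp add: dlists_def)
    fix ds X s1 assume ds: "ds \<in> dlists B t" "lst s1 3 t = ds" and J: "best_inv w X s1"
    have p2: "pars s1" and w2: "vr s1 30 = w" using J by (auto simp: best_inv_def)
    have b: "wp I (bfs_prog 3 4 30 41) (\<lambda>s'. upd ({9..<22} \<union> {41}) {4, 5} (60 * Z ^ 2) (B * (d + 1)) s1 s' \<and>
      bfs_st (set ds) w B 4 41 s') s1"
      by (rule wp_bfs[OF p2]) (use ds dlists_set[OF ds(1)] w w2 in auto)
    show "wp I (bfs_prog 3 4 30 41 ;; best_step)
       (\<lambda>s'. upd ?Xb ?Yb (120 * Z ^ 2) (B * (d + 1)) s1 s' \<and> best_inv w (insert ds X) s') s1"
    proof (rule wp_seqI[OF b])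
      fix s2 assume s2: "upd ({9..<22} \<union> {41}) {4, 5} (60 * Z ^ 2) (B * (d + 1)) s1 s2 \<and>
        bfs_st (set ds) w B 4 41 s2"
      have J2: "best_inv w X s2"
        by (rule best_inv_cong[OF J]) (use upd_vr[OF conjunct1[OF s2]] upd_ar[OF conjunct1[OF s2]] in auto)
      show "wp I best_step (\<lambda>s'. upd ?Xb ?Yb (120 * Z ^ 2) (B * (d + 1)) s1 s' \<and> best_inv w (insert ds X) s') s2"
      proof (rule wp_mono[OF wp_best_step[OF J2 w(2) ds(1) conjunct2[OF s2]]], rule conjI)
        fix s3 assume a: "upd {10, 11, 22, 23, 24, 25, 26, 31} {6} (60 * Z ^ 2) 0 s2 s3 \<and>
          best_inv w (insert ds X) s3"
        show "upd ?Xb ?Yb (120 * Z ^ 2) (B * (d + 1)) s1 s3"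
          by (rule upd_trans[OF conjunct1[OF s2] conjunct1[OF a]]) auto
        show "best_inv w (insert ds X) s3" using a by simp
      qed
    qed
  qed (use B(2) j0 in auto)
  then have "wp I (nest 3 101 t (bfs_prog 3 4 30 41 ;; best_step))
    (\<lambda>s'. upd ({9..<30} \<union> {31, 41} \<union> {x. 100 \<le> x \<and> odd x}) {3, 4, 5, 6}
      (B ^ t * (122 * Z ^ 2)) (B ^ t * (B * (d + 1))) s s' \<and>
    distinct (lst s' 6 (vr s' 31)) \<and> vr s' 31 \<le> B \<and> set (lst s' 6 (vr s' 31)) = Sof w) ?s"
  proof (rule wp_mono)
    fix s' assume a: "upd (?Xb \<union> {27, 28} \<union> {101 + 2 * i |i. i < t}) (insert 3 ?Yb) (B ^ t * (120 * Z ^ 2 + 30 * t))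
       (B ^ t * (B * (d + 1))) ?s s' \<and> best_inv w ({} \<union> {ds @ [] |ds. ds \<in> dlists B t}) s' \<and>
       (\<forall>i\<ge>t. ar s' 3 i = ar ?s 3 i)"
    have tm: "9 + B ^ t * (120 * Z ^ 2 + 30 * t) \<le> B ^ t * (122 * Z ^ 2)"
    proof -
      have "9 \<le> B ^ t * Z ^ 2" using Z1(2) B(2) mult_le_mono[of 1 "B ^ t" 9 "Z ^ 2"] by simp
      moreover have "B ^ t * (120 * Z ^ 2 + 30 * t) \<le> B ^ t * (121 * Z ^ 2)"
        using Z1 by (intro mult_le_mono2) linarith
      ultimately have "9 + B ^ t * (120 * Z ^ 2 + 30 * t) \<le> B ^ t * Z ^ 2 + B ^ t * (121 * Z ^ 2)" by (rule add_mono)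
      also have "\<dots> = B ^ t * (122 * Z ^ 2)" by simp
      finally show ?thesis .
    qed
    have u: "upd ({9..<30} \<union> {31, 41} \<union> {x. 100 \<le> x \<and> odd x}) {3, 4, 5, 6}
      (B ^ t * (122 * Z ^ 2)) (B ^ t * (B * (d + 1))) s s'"
      by (rule upd_trans[OF u1 conjunct1[OF a]]) (use tm in auto)
    have "{} \<union> {ds @ [] |ds. ds \<in> dlists B t} = dlists B t" by auto
    then have J: "best_inv w (dlists B t) s'" using a by metis
    have "best_fam w (dlists B t) = fam w" unfolding best_fam_def by (rule cands_all[OF w(2)])
    then have "is_best (fam w) (set (lst s' 6 (vr s' 31)))" using J by (simp add: best_inv_def)
    then show "upd ({9..<30} \<union> {31, 41} \<union> {x. 100 \<le> x \<and> odd x}) {3, 4, 5, 6}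
      (B ^ t * (122 * Z ^ 2)) (B ^ t * (B * (d + 1))) s s' \<and>
      distinct (lst s' 6 (vr s' 31)) \<and> vr s' 31 \<le> B \<and> set (lst s' 6 (vr s' 31)) = Sof w"
      using u J Sof_eq[OF w(2)] by (auto simp: best_inv_def)
  qed
  then show ?thesis unfolding best_prog_def using w by (simp add: setv_def)
qed

end

section \<open>Ranks and owners on the machine\<close>

definition rank_prog :: com where
  "rank_prog = Op (VLoad 32 7 30) ;; Op (VConst 9 0) ;;
     IfLe 32 9 (Op (VConst 33 0) ;; For 35 4 (Op (VAdd 33 33 30)) ;; Op (VConst 32 0) ;;
       For 35 4 (Op (VCoin 34 33) ;; Op (VAdd 32 32 32) ;; Op (VAdd 32 32 34) ;; Op (VInc 33)) ;;
       Op (VInc 32) ;; Op (VStore 7 30 32)) Skip"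

definition take_owner :: com where
  "take_owner = Op (VCopy 43 30) ;; Op (VCopy 44 32)"

text \<open>\<open>owner_prog\<close> computes the owner of the vertex in variable 42, in variable 43 with its rank plus one in 44.\<close>

definition owner_compare :: com where
  "owner_compare = IfLe 31 46 Skip (rank_prog ;;
     IfLe 32 44 (IfLe 44 32 (IfLe 43 30 Skip take_owner) take_owner) Skip)"

definition owner_step :: "nat \<Rightarrow> com" where
  "owner_step t = IfLe 40 45 Skip (Op (VLoad 30 2 45) ;; best_prog t ;; scan 6 31 42 46 ;; owner_compare)"

definition owner_prog :: "nat \<Rightarrow> com" where
  "owner_prog t = Op (VCopy 30 42) ;; rank_prog ;; Op (VCopy 43 42) ;; Op (VCopy 44 32) ;;
     nest 1 100 t (bfs_prog 1 2 42 40 ;; For 45 1 (owner_step t))"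

text \<open>Array 7 keeps the rank of a vertex, increased by one, once its coins have been flipped.\<close>

definition coin_inv :: "nat \<Rightarrow> (nat \<Rightarrow> bool) \<Rightarrow> (nat \<Rightarrow> nat) \<Rightarrow> nat set \<Rightarrow> bool" where
  "coin_inv L \<omega> rk F \<longleftrightarrow> (\<forall>w. rk w = 0 \<or> rk w = Suc (vrank L \<omega> w)) \<and>
     F = {w * L + i |w i. rk w \<noteq> 0 \<and> i < L}"

definition lex_min :: "(nat \<Rightarrow> nat) \<Rightarrow> nat set \<Rightarrow> nat \<Rightarrow> bool" where
  "lex_min r C x \<longleftrightarrow> x \<in> C \<and> (\<forall>w\<in>C. r x < r w \<or> (r x = r w \<and> x \<le> w))"

lemma lex_min_insert:
  assumes "lex_min r C x"
  shows "lex_min r (insert w C) (if r w < r x \<or> (r w = r x \<and> w < x) then w else x)"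
proof (cases "r w < r x \<or> (r w = r x \<and> w < x)")
  case True
  have "r w < r y \<or> (r w = r y \<and> w \<le> y)" if "y \<in> C" for y
  proof -
    have "r x < r y \<or> (r x = r y \<and> x \<le> y)" using assms that by (auto simp: lex_min_def)
    then show ?thesis using True by linarith
  qed
  then show ?thesis using True unfolding lex_min_def by auto
next
  case False
  then have "r x < r w \<or> (r x = r w \<and> x \<le> w)" by linarith
  then show ?thesis using assms False unfolding lex_min_def by auto
qed

lemma lex_min_unique: "lex_min r C x \<Longrightarrow> lex_min r C y \<Longrightarrow> x = y"
  unfolding lex_min_def by (metis antisym less_asym less_irrefl)

lemma lex_min_exists:
  assumes "finite C" "C \<noteq> {}" shows "\<exists>x. lex_min r C x"
  using assms
proof (induction rule: finite_ne_induct)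
  case (singleton x)
  then show ?case by (auto simp: lex_min_def)
next
  case (insert x F)
  then show ?case using lex_min_insert by blast
qed

definition lex_arg :: "(nat \<Rightarrow> nat) \<Rightarrow> nat set \<Rightarrow> nat" where
  "lex_arg r C = (THE x. lex_min r C x)"

lemma lex_arg_eq: "lex_min r C x \<Longrightarrow> lex_arg r C = x"
  unfolding lex_arg_def using lex_min_unique by (intro the_equality)

lemma coin_name_eq:
  assumes "i < L" "j < (L::nat)" "w * L + i = w' * L + j" shows "w = w' \<and> i = j"
proof -
  have "(w * L + i) div L = w" "(w * L + i) mod L = i" "(w' * L + j) div L = w'" "(w' * L + j) mod L = j"
    using assms(1,2) by auto
  then show ?thesis using assms(3) by metis
qed

context machine
begin

text \<open>Coins are flipped at the first request only and the result is kept, since they cannot be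
  flipped again. The first loop adds up \<open>w * L\<close>, the name of the first coin; the second
  one shifts in the bits by doubling. Storing the rank plus one lets 0, the initial content of the
  memory, mean that no rank has been drawn.\<close>

lemma wp_rank:
  assumes p: "pars s" and w: "vr s 30 = w" and ci: "coin_inv L \<omega> (ar s 7) (fl s)"
  shows "wp I rank_prog (\<lambda>s'. upd {9, 32, 33, 34, 35} {7} (40 * Z) 0 s s' \<and>
    vr s' 32 = Suc (vrank L \<omega> w) \<and> coin_inv L \<omega> (ar s' 7) (fl s')) s"
proof -
  let ?post = "\<lambda>s'. upd {9, 32, 33, 34, 35} {7} (40 * Z) 0 s s' \<and>
    vr s' 32 = Suc (vrank L \<omega> w) \<and> coin_inv L \<omega> (ar s' 7) (fl s')"
  let ?s1 = "setv 1 9 0 (setv 7 32 (ar s 7 w) s)"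
  let ?c = "Op (VConst 33 0) ;; For 35 4 (Op (VAdd 33 33 30)) ;; Op (VConst 32 0) ;;
       For 35 4 (Op (VCoin 34 33) ;; Op (VAdd 32 32 32) ;; Op (VAdd 32 32 34) ;; Op (VInc 33)) ;;
       Op (VInc 32) ;; Op (VStore 7 30 32)"
  show ?thesis
  proof (cases "ar s 7 w = 0")
    case False
    have "ar s 7 w = 0 \<or> ar s 7 w = Suc (vrank L \<omega> w)" using ci unfolding coin_inv_def by blast
    then have eq: "ar s 7 w = Suc (vrank L \<omega> w)" using False by simp
    then have "?post (tick 1 (tick 1 ?s1))" using ci Z(3) by (auto simp: upd_def)
    then show ?thesis using False w unfolding rank_prog_def by (simp add: eq)
  next
    case True
    let ?s2 = "tick 1 ?s1"
    let ?s3 = "setv 1 33 0 ?s2"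
    have v3: "vr ?s3 30 = w" "vr ?s3 4 = L" "vr ?s3 33 = 0" using w pars_simps(4)[OF p] by auto
    let ?J1 = "\<lambda>k s'. vr s' 33 = k * w"
    let ?P1 = "\<lambda>s'. upd (insert 35 {33}) {} (L * (1 + 4) + 2) (L * 0) ?s3 s' \<and> ?J1 L s'"
    have f1: "wp I (For 35 4 (Op (VAdd 33 33 30))) ?P1 ?s3"
    proof (rule wp_For[where J = ?J1])
      fix k s' assume us: "upd (insert 35 {33}) {} (L * (1 + 4) + 2) (L * 0) ?s3 s'" and J: "?J1 k s'"
      have "vr s' 30 = w" using upd_vr[OF us, of 30] w by simp
      then show "wp I (Op (VAdd 33 33 30)) (\<lambda>s''. upd {33} {} 1 0 s' s'' \<and> ?J1 (Suc k) s'') s'"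
        using J by (simp add: upd_def)
    qed (use v3 in auto)
    have "wp I ?c ?post ?s2"
      unfolding wp_Seq wp_Op[of _ "VConst 33 0"] opx.simps
    proof (rule exI[of _ ?s3], rule conjI[OF refl], rule wp_mono[OF f1])
      fix s4 assume s4: "?P1 s4"
      let ?s5 = "setv 1 32 0 s4"
      have u4: "upd {9, 32, 33, 35} {} (5 * L + 12) 0 s s4"
        by (rule upd_trans[of "{9, 32, 33}" "{}" 10 0 s ?s3, OF _ conjunct1[OF s4]])
          (auto simp: upd_def)
      have u5: "upd {9, 32, 33, 35} {} (5 * L + 13) 0 s ?s5" using u4 by (auto simp: upd_def)
      have fl5: "fl ?s5 = fl s" "ar ?s5 = ar s" using u5 by (auto simp: upd_def)
      let ?name = "\<lambda>k. w * L + k"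
      let ?J2 = "\<lambda>k s'. vr s' 33 = ?name k \<and> vr s' 32 = bits_val \<omega> (w * L) k \<and> fl s' = fl s \<union> ?name ` {..<k} \<and>
         ar s' 7 = ar s 7"
      let ?X = "{32, 33, 34}"
      have no: "?name k \<notin> fl s" if "k < L" for k
      proof
        assume "?name k \<in> fl s"
        then have "?name k \<in> {w' * L + i |w' i. ar s 7 w' \<noteq> 0 \<and> i < L}"
          using conjunct2[OF ci[unfolded coin_inv_def]] by metis
        then obtain w' i where "?name k = w' * L + i" "ar s 7 w' \<noteq> 0" "i < L" by auto
        then show False using coin_name_eq[OF that] True by metis
      qed
      have f2: "wp I (For 35 4 (Op (VCoin 34 33) ;; Op (VAdd 32 32 32) ;; Op (VAdd 32 32 34) ;; Op (VInc 33)))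
         (\<lambda>s'. upd (insert 35 ?X) {7} (L * (5 + 4) + 2) (L * 0) ?s5 s' \<and> ?J2 L s') ?s5"
      proof (rule wp_For[where J = ?J2])
        show "vr ?s5 4 = L" using upd_vr[OF u5, of 4] pars_simps(4)[OF p] by simp
        show "?J2 0 ?s5" using s4 fl5 by (simp add: mult.commute)
        fix k and s' :: ast assume k: "k < L" and J: "?J2 k s'"
        have "?name k \<notin> fl s'" using J no[OF k] by auto
        then show "wp I (Op (VCoin 34 33) ;; Op (VAdd 32 32 32) ;; Op (VAdd 32 32 34) ;; Op (VInc 33))
          (\<lambda>s''. upd ?X {7} 5 0 s' s'' \<and> ?J2 (Suc k) s'') s'"
          using J by (auto simp: upd_def lessThan_Suc)
      qed auto
      show "wp I (Op (VConst 32 0)) (wp I (For 35 4 (Op (VCoin 34 33) ;; Op (VAdd 32 32 32) ;; Op (VAdd 32 32 34) ;; Op (VInc 33)))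
          (wp I (Op (VInc 32)) (wp I (Op (VStore 7 30 32)) ?post))) s4"
        unfolding wp_Op[of _ "VConst 32 0"] opx.simps
      proof (rule exI[of _ ?s5], rule conjI[OF refl], rule wp_mono[OF f2])
        fix s6 assume s6: "upd (insert 35 ?X) {7} (L * (5 + 4) + 2) (L * 0) ?s5 s6 \<and> ?J2 L s6"
        have u6: "upd {9, 32, 33, 34, 35} {7} (14 * L + 15) 0 s s6"
          by (rule upd_trans[OF u5 conjunct1[OF s6]]) auto
        let ?s7 = "(setv 2 32 (Suc (vr s6 32)) s6)"
        let ?s8 = "?s7\<lparr>ar := (ar ?s7)(7 := (ar ?s7 7)(w := Suc (vr s6 32))), tm := tm ?s7 + 7\<rparr>"
        have v6: "vr s6 30 = w" using upd_vr[OF u6, of 30] w by simp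
        have a6: "ar s6 7 = ar s 7" using s6 by blast
        have u8: "upd {9, 32, 33, 34, 35} {7} (40 * Z) 0 s ?s8"
          by (rule upd_trans[OF u6, of "{32}" "{7}" 9 0]) (use Z in \<open>auto simp: upd_def\<close>)
        have r: "vr s6 32 = vrank L \<omega> w" using s6 by (simp add: vrank_def)
        have ci8: "coin_inv L \<omega> (ar ?s8 7) (fl ?s8)"
        proof -
          have "{w' * L + i |w' i. ((ar s 7)(w := Suc (vrank L \<omega> w))) w' \<noteq> 0 \<and> i < L} =
             {w' * L + i |w' i. ar s 7 w' \<noteq> 0 \<and> i < L} \<union> (\<lambda>k. w * L + k) ` {..<L}"
            using True by auto
          moreover have "fl s6 = fl s \<union> (\<lambda>k. w * L + k) ` {..<L}" using s6 by blast
          ultimately show ?thesis using ci a6 r by (auto simp: coin_inv_def)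
        qed
        show "wp I (Op (VInc 32)) (wp I (Op (VStore 7 30 32)) ?post) s6"
          using u8 ci8 r v6 by (simp add: setv_def)
      qed
    qed
    then show ?thesis using True w unfolding rank_prog_def by simp
  qed
qed

lemma Sof_best:
  assumes w: "w \<in> V" shows "is_best (fam w) (Sof w)"
proof -
  have ne: "set_encode ` fam w \<noteq> {}" by (simp add: fam_def)
  have fin: "finite (set_encode ` fam w)" using fam_finite(1)[OF w] by simp
  have "Max (set_encode ` fam w) \<in> set_encode ` fam w" using fin ne by (rule Max_in)
  then obtain S where S: "S \<in> fam w" "set_encode S = Max (set_encode ` fam w)" by auto
  have "set_encode T \<le> set_encode S" if "T \<in> fam w" for T
    unfolding S(2) using fin that by (intro Max_ge) auto
  then have "is_best (fam w) S" using S(1) by (auto simp: is_best_def)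
  then show ?thesis using Sof_eq[OF w] by metis
qed

lemma Sof_props:
  assumes w: "w \<in> V" shows "w \<in> Sof w" "Sof w \<subseteq> V" "Sof w = {w} \<or> isolated E K t \<Delta> (Sof w)"
proof -
  have m: "Sof w \<in> fam w" using Sof_best[OF w] by (simp add: is_best_def)
  show "w \<in> Sof w" "Sof w \<subseteq> V" using fam_finite(2)[OF w m] by auto
  show "Sof w = {w} \<or> isolated E K t \<Delta> (Sof w)" using m by (auto simp: fam_def)
qed

definition own_cands :: "nat \<Rightarrow> nat list set \<Rightarrow> nat set" where
  "own_cands u X = insert u {w \<in> V. u \<in> Sof w \<and> w \<in> (\<Union>ds\<in>X. set (take B (fst (bfs nbr (set ds) u B))))}"

text \<open>If \<open>u\<close> lies in \<open>Sof w\<close> and this set is isolated, the search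
  from \<open>u\<close> with the right digits discovers all of the set, including \<open>w\<close>.
  If the set is \<open>{w}\<close>, then \<open>w = u\<close>, which is a candidate from the
  beginning.\<close>

lemma own_cands_all:
  assumes u: "u \<in> V" shows "own_cands u (dlists B t) = {w \<in> V. u \<in> Sof w}"
proof (intro equalityI subsetI)
  fix w assume "w \<in> own_cands u (dlists B t)"
  then show "w \<in> {w \<in> V. u \<in> Sof w}" using Sof_props(1)[OF u] u by (auto simp: own_cands_def)
next
  fix w assume w: "w \<in> {w \<in> V. u \<in> Sof w}"
  then have wV: "w \<in> V" "u \<in> Sof w" by auto
  show "w \<in> own_cands u (dlists B t)"
  proof (cases "Sof w = {w}")
    case True
    then show ?thesis using wV by (simp add: own_cands_def)
  next
    case False
    then have "isolated E K t \<Delta> (Sof w)" using Sof_props(3)[OF wV(1)] by blast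
    from bfs_digits[OF wV(2) Sof_props(2)[OF wV(1)] this]
    obtain ds qs e cs where ds: "ds \<in> dlists B t" "bfs nbr (set ds) u B = (qs, e, cs)"
      "length qs \<le> B" "Sof w \<subseteq> set qs" by (elim exE conjE)
    have "w \<in> set (take B (fst (bfs nbr (set ds) u B)))"
      using ds Sof_props(1)[OF wV(1)] by auto
    then show ?thesis using wV ds(1) unfolding own_cands_def by blast
  qed
qed

definition owner_inv :: "nat \<Rightarrow> nat set \<Rightarrow> ast \<Rightarrow> bool" where
  "owner_inv u C s \<longleftrightarrow> pars s \<and> vr s 42 = u \<and> coin_inv L \<omega> (ar s 7) (fl s) \<and>
     vr s 44 = Suc (vrank L \<omega> (vr s 43)) \<and> lex_min (vrank L \<omega>) C (vr s 43)"

lemma owner_inv_cong: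
  assumes "owner_inv u C s" "\<And>x. x \<in> {1..5} \<union> {42, 43, 44} \<Longrightarrow> vr s' x = vr s x"
    "coin_inv L \<omega> (ar s' 7) (fl s')"
  shows "owner_inv u C s'"
proof -
  have "pars s'" using assms(1,2) by (simp add: owner_inv_def pars_def)
  then show ?thesis using assms by (simp add: owner_inv_def)
qed

lemma wp_owner_compare:
  assumes inv: "owner_inv u C s" and w: "vr s 30 = w"
  shows "wp I owner_compare (\<lambda>s'. upd {9, 32, 33, 34, 35, 43, 44} {7} (40 * Z + 20) 0 s s' \<and>
    owner_inv u (if vr s 46 < vr s 31 then insert w C else C) s') s"
proof -
  let ?post = "\<lambda>s'. upd {9, 32, 33, 34, 35, 43, 44} {7} (40 * Z + 20) 0 s s' \<and>
    owner_inv u (if vr s 46 < vr s 31 then insert w C else C) s'"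
  have p: "pars s" and ci: "coin_inv L \<omega> (ar s 7) (fl s)" using inv by (auto simp: owner_inv_def)
  show ?thesis
  proof (cases "vr s 46 < vr s 31")
    case False
    have "owner_inv u C (tick 1 s)" by (rule owner_inv_cong[OF inv]) (use ci in auto)
    moreover have "upd {9, 32, 33, 34, 35, 43, 44} {7} (40 * Z + 20) 0 s (tick 1 s)" by (simp add: upd_def)
    ultimately show ?thesis using False unfolding owner_compare_def by simp
  next
    case True
    let ?s1 = "tick 1 s"
    let ?c = "IfLe 32 44 (IfLe 44 32 (IfLe 43 30 Skip take_owner) take_owner) Skip"
    have "pars ?s1" using p by (simp add: pars_def)
    from wp_rank[OF this, of w] w ci
    have rk: "wp I rank_prog (\<lambda>s'. upd {9, 32, 33, 34, 35} {7} (40 * Z) 0 ?s1 s' \<and>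
      vr s' 32 = Suc (vrank L \<omega> w) \<and> coin_inv L \<omega> (ar s' 7) (fl s')) ?s1" by simp
    have "wp I (rank_prog ;; ?c) (\<lambda>s'. ?post (tick 1 s')) ?s1"
    proof (rule wp_seqI[OF rk])
      fix s2 assume s2: "upd {9, 32, 33, 34, 35} {7} (40 * Z) 0 ?s1 s2 \<and>
        vr s2 32 = Suc (vrank L \<omega> w) \<and> coin_inv L \<omega> (ar s2 7) (fl s2)"
      have u2: "upd {9, 32, 33, 34, 35} {7} (40 * Z + 1) 0 s s2" using s2 by (auto simp: upd_def)
      have inv2: "owner_inv u C s2"
        by (rule owner_inv_cong[OF inv]) (use s2 upd_vr[OF u2] in auto)
      let ?o = "vr s2 43"
      have v2: "vr s2 44 = Suc (vrank L \<omega> ?o)" "vr s2 32 = Suc (vrank L \<omega> w)" "vr s2 30 = w"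
        using inv2 s2 upd_vr[OF u2, of 30] w by (auto simp: owner_inv_def)
      have lm: "lex_min (vrank L \<omega>) (insert w C)
         (if vrank L \<omega> w < vrank L \<omega> ?o \<or> (vrank L \<omega> w = vrank L \<omega> ?o \<and> w < ?o) then w else ?o)"
        by (rule lex_min_insert) (use inv2 in \<open>simp add: owner_inv_def\<close>)
      define post where "post = ?post"
      have "wp I ?c (\<lambda>s'. post (tick 1 s')) s2"
      proof (cases "vrank L \<omega> w < vrank L \<omega> ?o \<or> (vrank L \<omega> w = vrank L \<omega> ?o \<and> w < ?o)")
        case take: True
        have tk: "wp I take_owner (\<lambda>s'. post (tick 1 (tick 1 s'))) s3" if s3: "upd {} {} 3 0 s2 s3" for s3
        proof -
          have e: "vr s3 = vr s2" "ar s3 = ar s2" "fl s3 = fl s2" using s3 by (auto simp: upd_def)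
          let ?s = "tick 1 (tick 1 (setv 2 44 (Suc (vrank L \<omega> w)) (setv 2 43 w s3)))"
          have u: "upd {9, 32, 33, 34, 35, 43, 44} {7} (40 * Z + 20) 0 s ?s"
          proof (rule upd_trans[OF upd_trans[OF u2 s3, of "{9, 32, 33, 34, 35}" "{7}" "40 * Z + 4" 0]])
            show "upd {43, 44} {} 6 0 s3 ?s" by (simp add: upd_def)
          qed auto
          have "pars ?s" by (rule pars_upd[OF p u]) auto
          then have "post ?s"
            using True lm take inv2 u e unfolding owner_inv_def post_def by simp
          then show ?thesis unfolding take_owner_def using v2 e by simp
        qed
        show ?thesis
        proof (cases "vrank L \<omega> w = vrank L \<omega> ?o")
          case eq: True
          have "upd {} {} 3 0 s2 (tick 1 (tick 1 (tick 1 s2)))" by (simp add: upd_def)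
          from tk[OF this] show ?thesis using v2 take eq by simp
        next
          case False
          have "upd {} {} 3 0 s2 (tick 1 (tick 1 s2))" by (simp add: upd_def)
          from tk[OF this] show ?thesis using v2 take False by simp
        qed
      next
        case keep: False
        have pt: "post s3" if s3: "upd {} {} 4 0 s2 s3" for s3
        proof -
          have "owner_inv u (insert w C) s2" using inv2 lm keep by (simp add: owner_inv_def)
          then have "owner_inv u (insert w C) s3"
            by (rule owner_inv_cong) (use s2 s3 in \<open>auto simp: upd_def\<close>)
          moreover have "upd {9, 32, 33, 34, 35, 43, 44} {7} (40 * Z + 20) 0 s s3"
            by (rule upd_trans[OF u2 s3]) auto
          ultimately show ?thesis using True by (simp add: post_def)
        qed
        have "post (tick 1 (tick 1 s2))" "post (tick 1 (tick 1 (tick 1 s2)))"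
          "post (tick 1 (tick 1 (tick 1 (tick 1 s2))))" by (rule pt; simp add: upd_def)+
        then show ?thesis using v2 keep by auto
      qed
      then show "wp I ?c (\<lambda>s'. ?post (tick 1 s')) s2" unfolding post_def .
    qed
    then show ?thesis using True unfolding owner_compare_def by simp
  qed
qed

abbreviation R :: "nat \<Rightarrow> nat" where
  "R \<equiv> vrank L \<omega>"

definition best_time :: nat where
  "best_time = B ^ t * (122 * Z ^ 2)"

definition best_probes :: nat where
  "best_probes = B ^ t * (B * (d + 1))"

abbreviation step_vars :: "nat set" where
  "step_vars \<equiv> {9..<40} \<union> {41, 43, 44, 46} \<union> {x. 100 \<le> x \<and> odd x}"

lemma Z_pos: "100 * Z \<le> Z ^ 2" "10000 \<le> Z ^ 2"
  using Z(3) mult_le_mono[of 100 Z 100 Z] mult_le_mono1[of 100 Z Z] by (simp_all add: power2_eq_square)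

lemma wp_owner_step:
  assumes inv: "owner_inv u C s" and k: "vr s 45 = k" and qs: "lst s 2 (vr s 40) = qs" "set qs \<subseteq> V"
  shows "wp I (owner_step t) (\<lambda>s'. upd step_vars {3, 4, 5, 6, 7} (best_time + 100 * Z) best_probes s s' \<and>
    owner_inv u (C \<union> {w. k < length qs \<and> w = qs ! k \<and> u \<in> Sof w}) s') s"
proof -
  let ?C = "C \<union> {w. k < length qs \<and> w = qs ! k \<and> u \<in> Sof w}"
  have n: "vr s 40 = length qs" using qs(1) by (metis length_lst)
  have p: "pars s" and ci: "coin_inv L \<omega> (ar s 7) (fl s)" and u: "vr s 42 = u"
    using inv by (auto simp: owner_inv_def)
  define post where "post = (\<lambda>s'. upd step_vars {3, 4, 5, 6, 7} (best_time + 100 * Z) best_probes s s' \<and>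
    owner_inv u ?C s')"
  have "wp I (owner_step t) post s"
  proof (cases "k < length qs")
    case False
    have "owner_inv u ?C (tick 1 s)"
      by (rule owner_inv_cong[of _ _ s]) (use False inv ci in auto)
    moreover have "upd step_vars {3, 4, 5, 6, 7} (best_time + 100 * Z) best_probes s (tick 1 s)"
      using Z(3) by (simp add: upd_def)
    ultimately show ?thesis using False n k unfolding owner_step_def post_def by simp
  next
    case True
    let ?w = "qs ! k"
    let ?s1 = "setv 7 30 ?w (tick 1 s)"
    have w: "?w \<in> V" using True qs(2) nth_mem by blast
    have u1: "upd {30} {} 8 0 s ?s1" by (simp add: upd_def)
    have inv1: "owner_inv u C ?s1" by (rule owner_inv_cong[OF inv]) (use ci in auto)
    have p1: "pars ?s1" using inv1 by (simp add: owner_inv_def)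
    have "wp I (best_prog t ;; scan 6 31 42 46 ;; owner_compare) (\<lambda>s'. post (tick 1 s')) ?s1"
    proof (rule wp_seqI[OF wp_best[OF p1]])
      show "vr ?s1 30 = ?w" by simp
      show "?w \<in> V" by (rule w)
      fix s2 assume s2: "upd ({9..<30} \<union> {31, 41} \<union> {x. 100 \<le> x \<and> odd x}) {3, 4, 5, 6}
        (B ^ t * (122 * Z\<^sup>2)) (B ^ t * (B * (d + 1))) ?s1 s2 \<and>
        distinct (lst s2 6 (vr s2 31)) \<and> vr s2 31 \<le> B \<and> set (lst s2 6 (vr s2 31)) = Sof ?w"
      note us2 = conjunct1[OF s2]
      have u2: "upd ({9..<30} \<union> {30, 31, 41} \<union> {x. 100 \<le> x \<and> odd x}) {3, 4, 5, 6}
        (best_time + 8) best_probes s s2"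
        by (rule upd_trans[OF u1 us2]) (auto simp: best_time_def best_probes_def)
      have inv2: "owner_inv u C s2"
        by (rule owner_inv_cong[OF inv]) (use ci upd_vr[OF u2] upd_ar[OF u2] upd_fl[OF u2] in auto)
      have b31: "vr s2 31 \<le> Z" using s2 Z_bounds by linarith
      show "wp I (scan 6 31 42 46 ;; owner_compare) (\<lambda>s'. post (tick 1 s')) s2"
      proof (rule wp_seqI[OF wp_scan])
        fix s3 assume s3: "upd {10, 11, 46} {} (16 * vr s2 31 + 4) 0 s2 s3 \<and>
          (vr s3 46 < vr s2 31 \<and> ar s2 6 (vr s3 46) = vr s2 42 \<or>
           vr s3 46 = vr s2 31 \<and> vr s2 42 \<notin> ar s2 6 ` {..<vr s2 31})"
        note us3 = conjunct1[OF s3]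
        have "vr s3 46 < vr s2 31 \<longleftrightarrow> vr s2 42 \<in> ar s2 6 ` {..<vr s2 31}"
          using s3 by (intro scan_iff) simp
        moreover have "ar s2 6 ` {..<vr s2 31} = Sof ?w" using s2 by (simp add: set_lst)
        moreover have "vr s2 42 = u" using inv2 by (simp add: owner_inv_def)
        ultimately have in3: "vr s3 46 < vr s3 31 \<longleftrightarrow> u \<in> Sof ?w"
          using upd_vr[OF us3, of 31] by simp
        have u3: "upd ({9..<30} \<union> {30, 31, 41, 46} \<union> {x. 100 \<le> x \<and> odd x}) {3, 4, 5, 6}
          (best_time + 16 * Z + 12) best_probes s s3"
          by (rule upd_trans[OF u2 us3]) (use b31 in auto)
        have inv3: "owner_inv u C s3"
          by (rule owner_inv_cong[OF inv]) (use ci upd_vr[OF u3] upd_ar[OF u3] upd_fl[OF u3] in auto)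
        have w3: "vr s3 30 = ?w" using upd_vr[OF us3, of 30] upd_vr[OF us2, of 30] by simp
        show "wp I owner_compare (\<lambda>s'. post (tick 1 s')) s3"
        proof (rule wp_mono[OF wp_owner_compare[OF inv3 w3]])
          fix s4 assume s4: "upd {9, 32, 33, 34, 35, 43, 44} {7} (40 * Z + 20) 0 s3 s4 \<and>
            owner_inv u (if vr s3 46 < vr s3 31 then insert ?w C else C) s4"
          have u4: "upd step_vars {3, 4, 5, 6, 7} (best_time + 56 * Z + 32) best_probes s s4"
            by (rule upd_trans[OF u3 conjunct1[OF s4]]) auto
          have "upd step_vars {3, 4, 5, 6, 7} (best_time + 100 * Z) best_probes s (tick 1 s4)"
            by (rule upd_trans[OF u4, of "{}" "{}" 1 0]) (use Z(3) in \<open>auto simp: upd_def\<close>)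
          moreover have "(if vr s3 46 < vr s3 31 then insert ?w C else C) = ?C"
            unfolding in3 using True by auto
          then have "owner_inv u ?C s4" using conjunct2[OF s4] by simp
          then have "owner_inv u ?C (tick 1 s4)"
            by (rule owner_inv_cong) (use \<open>owner_inv u ?C s4\<close> in \<open>auto simp: owner_inv_def\<close>)
          ultimately show "post (tick 1 s4)" unfolding post_def by blast
        qed
      qed auto
    qed
    moreover have "ar s 2 k = ?w" using qs True n by (metis nth_lst)
    ultimately show ?thesis using True n k unfolding owner_step_def by simp
  qed
  then show ?thesis unfolding post_def .
qed

abbreviation owner_vars :: "nat set" where
  "owner_vars \<equiv> {9..<42} \<union> {43..<50} \<union> {100..}"

text \<open>One factor \<open>B ^ t\<close> comes from the searches around the vertex itself, the
  other from the searches that compute the set of each vertex they discover.\<close>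

definition owner_time :: nat where
  "owner_time = 200 * ((B ^ t) ^ 2 * Z ^ 3)"

definition owner_probes :: nat where
  "owner_probes = 2 * ((B ^ t) ^ 2 * Z ^ 2)"

lemma owner_time_le:
  "B ^ t * ((60 * Z ^ 2 + (B * (best_time + 100 * Z + 4) + 2)) + 30 * t) + (40 * Z + 6) \<le> owner_time"
proof -
  let ?q = "B ^ t"
  have q: "1 \<le> ?q" using B(2) by simp
  have z3: "100 * (Z * Z) \<le> Z ^ 3" "Z ^ 3 = Z * (Z * Z)" using Z(3) by (simp_all add: power3_eq_cube)
  have zz: "100 * Z \<le> Z * Z" "10000 \<le> Z * Z" using Z_pos by (simp_all add: power2_eq_square)
  have m: "?q * (100 * (Z * Z)) \<le> ?q ^ 2 * Z ^ 3"
    using mult_le_mono[of "?q * 1" "?q * ?q" "100 * (Z * Z)" "Z ^ 3"] q z3(1) by (simp add: power2_eq_square)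
  have a: "B * (best_time + 100 * Z + 4) \<le> Z * (best_time + 100 * Z + 4)"
    using Z_bounds by (intro mult_le_mono1) auto
  have "?q * ((60 * Z ^ 2 + (B * (best_time + 100 * Z + 4) + 2)) + 30 * t) + (40 * Z + 6)
     \<le> ?q * ((60 * Z ^ 2 + (Z * (best_time + 100 * Z + 4) + 2)) + 30 * Z) + ?q * (40 * Z + 6)"
    using a Z_bounds(2) q by (intro add_mono mult_le_mono2) auto
  also have "\<dots> = ?q * (Z * best_time) + ?q * (160 * (Z * Z) + 74 * Z + 8)"
    by (simp add: algebra_simps power2_eq_square)
  also have "?q * (Z * best_time) = 122 * (?q ^ 2 * Z ^ 3)"
    by (simp add: best_time_def power2_eq_square power3_eq_cube algebra_simps)
  also have "?q * (160 * (Z * Z) + 74 * Z + 8) \<le> ?q * (200 * (Z * Z))"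
    using zz by (intro mult_le_mono2) linarith
  also have "122 * (?q ^ 2 * Z ^ 3) + ?q * (200 * (Z * Z)) \<le> 200 * (?q ^ 2 * Z ^ 3)"
    using m by linarith
  finally show ?thesis unfolding owner_time_def by simp
qed

lemma owner_probes_le: "B ^ t * (B * (d + 1) + B * best_probes) \<le> owner_probes"
proof -
  let ?q = "B ^ t"
  have q: "1 \<le> ?q" using B(2) by simp
  have "best_probes \<le> ?q * Z" unfolding best_probes_def using Z(1) by (rule mult_le_mono2)
  then have 1: "B * best_probes \<le> Z * (?q * Z)" using Z_bounds by (intro mult_le_mono) auto
  have "1 \<le> ?q * Z" using mult_le_mono[OF q, of 1 Z] Z(3) by simp
  then have "Z * 1 \<le> Z * (?q * Z)" by (rule mult_le_mono2)
  then have "B * (d + 1) \<le> Z * (?q * Z)" using Z(1) by (metis le_trans mult_1_right)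
  then have "?q * (B * (d + 1) + B * best_probes) \<le> ?q * (Z * (?q * Z) + Z * (?q * Z))"
    using 1 by (intro mult_le_mono2 add_mono)
  also have "\<dots> = owner_probes" by (simp add: owner_probes_def power2_eq_square algebra_simps)
  finally show ?thesis .
qed

lemma wp_owner:
  assumes p: "pars s" and u: "vr s 42 = u" "u \<in> V" and ci: "coin_inv L \<omega> (ar s 7) (fl s)"
  shows "wp I (owner_prog t) (\<lambda>s'. upd owner_vars {1..7} owner_time owner_probes s s' \<and>
    coin_inv L \<omega> (ar s' 7) (fl s') \<and> lex_min R {w \<in> V. u \<in> Sof w} (vr s' 43)) s"
proof -
  define post where "post = (\<lambda>s'. upd owner_vars {1..7} owner_time owner_probes s s' \<and>
    coin_inv L \<omega> (ar s' 7) (fl s') \<and> lex_min R {w \<in> V. u \<in> Sof w} (vr s' 43))"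
  let ?s1 = "setv 2 30 u s"
  let ?body = "bfs_prog 1 2 42 40 ;; For 45 1 (owner_step t)"
  let ?Xb = "{9..<42} \<union> {43, 44, 45, 46} \<union> {x. 100 \<le> x \<and> odd x}" and ?Yb = "{2, 3, 4, 5, 6, 7}"
  let ?T = "60 * Z ^ 2 + (B * (best_time + 100 * Z + 4) + 2)" and ?p = "B * (d + 1) + B * best_probes"
  let ?J = "\<lambda>X. owner_inv u (own_cands u X)"
  have p1: "pars ?s1" using p by (simp add: pars_def)
  have rk: "wp I rank_prog (\<lambda>s'. upd {9, 32, 33, 34, 35} {7} (40 * Z) 0 ?s1 s' \<and>
    vr s' 32 = Suc (R u) \<and> coin_inv L \<omega> (ar s' 7) (fl s')) ?s1"
    by (rule wp_rank[OF p1]) (use ci in auto)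
  have "wp I (rank_prog ;; Op (VCopy 43 42) ;; Op (VCopy 44 32) ;; nest 1 100 t ?body) post ?s1"
  proof (rule wp_seqI[OF rk])
    fix s2 assume s2: "upd {9, 32, 33, 34, 35} {7} (40 * Z) 0 ?s1 s2 \<and>
      vr s2 32 = Suc (R u) \<and> coin_inv L \<omega> (ar s2 7) (fl s2)"
    let ?s3 = "setv 2 44 (Suc (R u)) (setv 2 43 u s2)"
    have u2: "upd {9, 30, 32, 33, 34, 35} {7} (40 * Z + 2) 0 s s2" using s2 by (auto simp: upd_def)
    have u3: "upd {9, 30, 32, 33, 34, 35, 43, 44} {7} (40 * Z + 6) 0 s ?s3" using u2 by (auto simp: upd_def)
    have p3: "pars ?s3" by (rule pars_upd[OF p u3]) auto
    have v42: "vr s2 42 = u" using upd_vr[OF u2, of 42] u by simp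
    have J3: "?J {} ?s3"
      using p3 v42 s2 by (auto simp: owner_inv_def own_cands_def lex_min_def)
    have "wp I (nest 1 100 t ?body)
      (\<lambda>s'. upd (?Xb \<union> {27, 28} \<union> {100 + 2 * i |i. i < t}) (insert 1 ?Yb) (B ^ t * (?T + 30 * t))
         (B ^ t * ?p) ?s3 s' \<and> ?J ({} \<union> {ds @ [] |ds. ds \<in> dlists B t}) s' \<and>
         (\<forall>i\<ge>t. ar s' 1 i = ar ?s3 1 i)) ?s3"
    proof (rule wp_nest[where J = ?J and B = B and t = t])
      show "vr s' 1 = B" if "?J X s'" for X s'
        using that pars_simps by (auto simp: owner_inv_def)
      show "?J X b" if J: "?J X a" and ab: "upd ({27, 28} \<union> {100 + 2 * i |i. True}) {1} T p a b"
        for X a b T p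
      proof (rule owner_inv_cong[OF J])
        show "vr b x = vr a x" if "x \<in> {1..5} \<union> {42, 43, 44}" for x
          using upd_vr[OF ab, of x] that by auto
        have "ar b 7 = ar a 7" "fl b = fl a" using upd_ar[OF ab, of 7] upd_fl[OF ab] by auto
        then show "coin_inv L \<omega> (ar b 7) (fl b)" using J by (simp add: owner_inv_def)
      qed
      show "[] \<in> dlists B (t - t)" by (simp add: dlists_def)
      fix ds X a assume ds: "ds \<in> dlists B t" "lst a 1 t = ds" and J: "?J X a"
      have pa: "pars a" and ua: "vr a 42 = u" and cia: "coin_inv L \<omega> (ar a 7) (fl a)"
        using J by (auto simp: owner_inv_def)
      have b: "wp I (bfs_prog 1 2 42 40) (\<lambda>s'. upd ({9..<22} \<union> {40}) {2, 5} (60 * Z ^ 2) (B * (d + 1)) a s' \<and>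
        bfs_st (set ds) u B 2 40 s') a"
        by (rule wp_bfs[OF pa]) (use ds dlists_set[OF ds(1)] u ua in auto)
      show "wp I ?body (\<lambda>s'. upd ?Xb ?Yb ?T ?p a s' \<and> ?J (insert ds X) s') a"
      proof (rule wp_seqI[OF b])
        fix b assume b: "upd ({9..<22} \<union> {40}) {2, 5} (60 * Z ^ 2) (B * (d + 1)) a b \<and>
          bfs_st (set ds) u B 2 40 b"
        note ub = conjunct1[OF b]
        obtain e where bf: "bfs nbr (set ds) u B = (lst b 2 (vr b 40), e, lst b 5 (vr b 21))"
          using conjunct2[OF b] unfolding bfs_st_def by (elim exE conjE)
        let ?qs = "lst b 2 (vr b 40)"
        have qV: "set ?qs \<subseteq> V"
          using bfs_invariant[OF u(2) conjunct1[OF dlists_set[OF ds(1)]] bf] unfolding bfs_inv_def by blast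
        have Jb: "?J X b"
        proof (rule owner_inv_cong[OF J])
          show "vr b x = vr a x" if "x \<in> {1..5} \<union> {42, 43, 44}" for x
            using upd_vr[OF ub, of x] that by auto
          have "ar b 7 = ar a 7" "fl b = fl a" using upd_ar[OF ub, of 7] upd_fl[OF ub] by auto
          then show "coin_inv L \<omega> (ar b 7) (fl b)" using cia by simp
        qed
        let ?C = "\<lambda>k. own_cands u X \<union> {w \<in> set (take k ?qs). u \<in> Sof w}"
        have "wp I (For 45 1 (owner_step t)) (\<lambda>s'. upd (insert 45 step_vars) {3, 4, 5, 6, 7}
           (B * ((best_time + 100 * Z) + 4) + 2) (B * best_probes) b s' \<and> owner_inv u (?C B) s') b"
        proof (rule wp_For[where J = "\<lambda>k. owner_inv u (?C k)"])
          show "vr b 1 = B" using Jb pars_simps by (simp add: owner_inv_def)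
          show "owner_inv u (?C 0) b" using Jb by simp
          show "owner_inv u (?C k) (setv m 45 v s')" if "owner_inv u (?C k) s'" for k s' m v
            by (rule owner_inv_cong[OF that]) (use that in \<open>auto simp: owner_inv_def\<close>)
          fix k s' assume k: "k < B" "vr s' 45 = k"
            and us: "upd (insert 45 step_vars) {3, 4, 5, 6, 7} (B * ((best_time + 100 * Z) + 4) + 2)
               (B * best_probes) b s'" and Jk: "owner_inv u (?C k) s'"
          have q': "lst s' 2 (vr s' 40) = ?qs" using upd_vr[OF us, of 40] upd_ar[OF us, of 2] by (simp add: lst_def)
          have Ck: "?C k \<union> {w. k < length ?qs \<and> w = ?qs ! k \<and> u \<in> Sof w} = ?C (Suc k)"
          proof (cases "k < length ?qs")
            case True
            then show ?thesis by (auto simp: take_Suc_conv_app_nth)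
          qed simp
          show "wp I (owner_step t) (\<lambda>s''. upd step_vars {3, 4, 5, 6, 7} (best_time + 100 * Z) best_probes s' s'' \<and>
             owner_inv u (?C (Suc k)) s'') s'"
            using wp_owner_step[OF Jk k(2) q' qV] unfolding Ck .
        qed auto
        then show "wp I (For 45 1 (owner_step t)) (\<lambda>s'. upd ?Xb ?Yb ?T ?p a s' \<and> ?J (insert ds X) s') b"
        proof (rule wp_mono, intro conjI)
          fix s' assume a': "upd (insert 45 step_vars) {3, 4, 5, 6, 7}
           (B * ((best_time + 100 * Z) + 4) + 2) (B * best_probes) b s' \<and> owner_inv u (?C B) s'"
          show "upd ?Xb ?Yb ?T ?p a s'" by (rule upd_trans[OF ub conjunct1[OF a']]) auto
          have "?C B = own_cands u (insert ds X)"
            unfolding own_cands_def using bf qV set_take_subset[of B ?qs] by auto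
          then show "?J (insert ds X) s'" using conjunct2[OF a'] by simp
        qed
      qed
    qed (use B(2) J3 in auto)
    then have n: "wp I (nest 1 100 t ?body) post ?s3"
    proof (rule wp_mono)
      fix s' assume a: "upd (?Xb \<union> {27, 28} \<union> {100 + 2 * i |i. i < t}) (insert 1 ?Yb) (B ^ t * (?T + 30 * t))
         (B ^ t * ?p) ?s3 s' \<and> ?J ({} \<union> {ds @ [] |ds. ds \<in> dlists B t}) s' \<and>
         (\<forall>i\<ge>t. ar s' 1 i = ar ?s3 1 i)"
      have "{} \<union> {ds @ [] |ds. ds \<in> dlists B t} = dlists B t" by auto
      then have J: "?J (dlists B t) s'" using a by metis
      have "upd owner_vars {1..7} owner_time owner_probes s s'"
        by (rule upd_trans[OF u3 conjunct1[OF a]]) (use owner_time_le owner_probes_le in auto)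
      then show "post s'"
        using J unfolding post_def owner_inv_def own_cands_all[OF u(2)] by blast
    qed
    show "wp I (Op (VCopy 43 42) ;; Op (VCopy 44 32) ;; nest 1 100 t ?body) post s2"
      using n v42 s2 by simp
  qed
  then show ?thesis using u unfolding owner_prog_def post_def by simp
qed

end

section \<open>Parameters and the answer to a query\<close>

definition mult_n :: "nat \<Rightarrow> com" where
  "mult_n x = Op (VConst 8 0) ;; For 7 6 (Op (VAdd 8 8 x)) ;; Op (VCopy x 8)"

lemma wp_mult_n:
  assumes x: "x \<le> 5" and n: "vr s 6 = n"
  shows "wp I (mult_n x) (\<lambda>s'. upd {7, 8, x} {} (5 * n + 5) 0 s s' \<and> vr s' x = vr s x * n) s"
proof -
  let ?s = "setv 1 8 0 s" and ?J = "\<lambda>k s'. vr s' 8 = k * vr s x"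
  have w: "wp I (For 7 6 (Op (VAdd 8 8 x)))
    (\<lambda>s'. upd (insert 7 {8}) {} (n * (1 + 4) + 2) (n * 0) ?s s' \<and> ?J n s') ?s"
  proof (rule wp_For[where J = ?J])
    show "?J 0 ?s" by simp
    show "vr ?s 6 = n" using n by simp
    fix k s' assume us: "upd (insert 7 {8}) {} (n * (1 + 4) + 2) (n * 0) ?s s'" and J: "?J k s'"
    have "vr s' x = vr s x" using upd_vr[OF us, of x] x by simp
    then show "wp I (Op (VAdd 8 8 x)) (\<lambda>s''. upd {8} {} 1 0 s' s'' \<and> ?J (Suc k) s'') s'"
      using J by (simp add: upd_def)
  qed auto
  have "wp I (For 7 6 (Op (VAdd 8 8 x)) ;; Op (VCopy x 8))
    (\<lambda>s'. upd {7, 8, x} {} (5 * n + 5) 0 s s' \<and> vr s' x = vr s x * n) ?s"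
    by (rule wp_seqI[OF w]) (auto simp: upd_def mult.commute)
  then show ?thesis unfolding mult_n_def by simp
qed

text \<open>The least natural number \<open>n\<close> with \<open>\<epsilon> * n > 1\<close>. It can
  be found by counting, because the machine sees \<open>\<epsilon>\<close> through comparisons
  only.\<close>

definition inv_eps :: "real \<Rightarrow> nat" where
  "inv_eps \<epsilon> = Suc (nat \<lfloor>1 / \<epsilon>\<rfloor>)"

lemma inv_eps_iff:
  assumes "\<epsilon> > 0" shows "\<epsilon> * real i \<le> 1 \<longleftrightarrow> i < inv_eps \<epsilon>"
proof -
  have "\<epsilon> * real i \<le> 1 \<longleftrightarrow> real i \<le> 1 / \<epsilon>" using assms by (simp add: field_simps)
  also have "\<dots> \<longleftrightarrow> int i \<le> \<lfloor>1 / \<epsilon>\<rfloor>" by (simp add: le_floor_iff)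
  also have "\<dots> \<longleftrightarrow> i < inv_eps \<epsilon>"
    unfolding inv_eps_def using assms by (simp add: less_Suc_eq_le nat_le_iff le_nat_iff)
  finally show ?thesis .
qed

definition get_n :: com where
  "get_n = Op (VConst 6 0) ;; Op (VConst 9 1) ;; WhileEps 6 9 (Op (VInc 6))"

lemma wp_get_n:
  assumes e: "eps I > 0"
  shows "wp I get_n (\<lambda>s'. upd {6, 9} {} (4 * inv_eps (eps I) + 4) 0 s s' \<and> vr s' 6 = inv_eps (eps I)) s"
proof -
  let ?N = "inv_eps (eps I)"
  let ?Q = "\<lambda>s'. upd {6, 9} {} (4 * ?N + 4) 0 s s' \<and> vr s' 6 = ?N"
  have "wp I (WhileEps 6 9 (Op (VInc 6))) ?Q s'"
    if "k \<le> ?N" "vr s' 6 = k" "vr s' 9 = 1" "upd {6, 9} {} (4 * k + 2) 0 s s'" for k s'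
    using that
  proof (induction "?N - k" arbitrary: k s')
    case 0
    then have k: "k = ?N" by simp
    show ?case
    proof (rule wp_WhileEps_exit)
      show "\<not> eps I * real (vr s' 6) \<le> real (vr s' 9)"
        using inv_eps_iff[OF e, of k] 0 k by simp
      show "?Q (tick 2 s')" using 0(5) 0(3) k by (auto simp: upd_def)
    qed
  next
    case (Suc m)
    show ?case
    proof (rule wp_WhileEps_step)
      show "eps I * real (vr s' 6) \<le> real (vr s' 9)" using inv_eps_iff[OF e, of k] Suc by simp
      have "wp I (WhileEps 6 9 (Op (VInc 6))) ?Q (tick 1 (setv 2 6 (Suc k) (tick 1 s')))"
      proof (rule Suc.hyps(1))
        show "m = ?N - Suc k" using Suc(2) by simp
        show "upd {6, 9} {} (4 * Suc k + 2) 0 s (tick 1 (setv 2 6 (Suc k) (tick 1 s')))"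
          using Suc(6) by (auto simp: upd_def)
      qed (use Suc in auto)
      then show "wp I (Op (VInc 6)) (\<lambda>s1. wp I (WhileEps 6 9 (Op (VInc 6))) ?Q (tick 1 s1)) (tick 1 s')"
        using Suc(4) by simp
    qed
  qed
  from this[of 0 "setv 1 9 1 (setv 1 6 0 s)"]
  have "wp I (WhileEps 6 9 (Op (VInc 6))) ?Q (setv 1 9 1 (setv 1 6 0 s))" by (simp add: upd_def)
  then show ?thesis unfolding get_n_def by simp
qed

text \<open>The parameters are computed anew for every query, as \<open>L = a * n\<close>,
  \<open>\<Delta> = b * n * n\<close> and \<open>K = c * n * n * n\<close>; thus only ranks have to
  survive between queries.\<close>

definition setup_prog :: "nat \<Rightarrow> nat \<Rightarrow> nat \<Rightarrow> nat \<Rightarrow> com" where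
  "setup_prog a b c t = get_n ;; Op (VConst 4 a) ;; mult_n 4 ;; Op (VConst 3 b) ;; mult_n 3 ;; mult_n 3 ;;
     Op (VConst 2 c) ;; mult_n 2 ;; mult_n 2 ;; mult_n 2 ;; Op (VConst 5 t) ;; Op (VAdd 1 2 5)"

lemma wp_setup:
  assumes e: "eps I > 0" and n: "n = inv_eps (eps I)"
  shows "wp I (setup_prog a b c t) (\<lambda>s'. upd {1..9} {} (34 * n + 40) 0 s s' \<and>
    vr s' 4 = a * n \<and> vr s' 3 = b * n * n \<and> vr s' 2 = c * n * n * n \<and> vr s' 5 = t \<and>
    vr s' 1 = c * n * n * n + t) s"
proof -
  have w: "wp I (mult_n x ;; c') Q s'" if "x \<le> 5" "vr s' 6 = n"
    "\<And>s''. upd {7, 8, x} {} (5 * n + 5) 0 s' s'' \<and> vr s'' x = vr s' x * n \<Longrightarrow> wp I c' Q s''" for x c' Q s'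
    by (rule wp_seqI[OF wp_mult_n[OF that(1,2)] that(3)])
  show ?thesis
    unfolding setup_prog_def
  proof (rule wp_seqI[OF wp_get_n[OF e]])
    fix s0 assume s0: "upd {6, 9} {} (4 * inv_eps (eps I) + 4) 0 s s0 \<and> vr s0 6 = inv_eps (eps I)"
    let ?Q = "\<lambda>s'. upd {1..9} {} (34 * n + 40) 0 s s' \<and>
      vr s' 4 = a * n \<and> vr s' 3 = b * n * n \<and> vr s' 2 = c * n * n * n \<and> vr s' 5 = t \<and>
      vr s' 1 = c * n * n * n + t"
    have "wp I (mult_n 4 ;; Op (VConst 3 b) ;; mult_n 3 ;; mult_n 3 ;;
     Op (VConst 2 c) ;; mult_n 2 ;; mult_n 2 ;; mult_n 2 ;; Op (VConst 5 t) ;; Op (VAdd 1 2 5)) ?Q (setv 1 4 a s0)"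
    proof (rule w)
      fix s1 assume s1: "upd {7, 8, 4} {} (5 * n + 5) 0 (setv 1 4 a s0) s1 \<and> vr s1 4 = vr (setv 1 4 a s0) 4 * n"
      have u1: "upd {4, 6, 7, 8, 9} {} (9 * n + 10) 0 s s1" "vr s1 6 = n" "vr s1 4 = a * n"
        using s0 s1 n by (auto simp: upd_def)
      have "wp I (mult_n 3 ;; mult_n 3 ;; Op (VConst 2 c) ;; mult_n 2 ;; mult_n 2 ;; mult_n 2 ;;
        Op (VConst 5 t) ;; Op (VAdd 1 2 5)) ?Q (setv 1 3 b s1)"
      proof (rule w)
        fix s2 assume s2: "upd {7, 8, 3} {} (5 * n + 5) 0 (setv 1 3 b s1) s2 \<and> vr s2 3 = vr (setv 1 3 b s1) 3 * n"
        have u2: "upd {3, 4, 6, 7, 8, 9} {} (14 * n + 16) 0 s s2" "vr s2 6 = n" "vr s2 4 = a * n" "vr s2 3 = b * n"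
          using u1 s2 by (auto simp: upd_def)
        show "wp I (mult_n 3 ;; Op (VConst 2 c) ;; mult_n 2 ;; mult_n 2 ;; mult_n 2 ;;
          Op (VConst 5 t) ;; Op (VAdd 1 2 5)) ?Q s2"
        proof (rule w)
          fix s3 assume s3: "upd {7, 8, 3} {} (5 * n + 5) 0 s2 s3 \<and> vr s3 3 = vr s2 3 * n"
          have u3: "upd {3, 4, 6, 7, 8, 9} {} (19 * n + 21) 0 s s3" "vr s3 6 = n" "vr s3 4 = a * n" "vr s3 3 = b * n * n"
            using u2 s3 by (auto simp: upd_def)
          have "wp I (mult_n 2 ;; mult_n 2 ;; mult_n 2 ;; Op (VConst 5 t) ;; Op (VAdd 1 2 5)) ?Q (setv 1 2 c s3)"
          proof (rule w)
            fix s4 assume s4: "upd {7, 8, 2} {} (5 * n + 5) 0 (setv 1 2 c s3) s4 \<and> vr s4 2 = vr (setv 1 2 c s3) 2 * n"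
            have u4: "upd {2, 3, 4, 6, 7, 8, 9} {} (24 * n + 27) 0 s s4" "vr s4 6 = n" "vr s4 4 = a * n"
              "vr s4 3 = b * n * n" "vr s4 2 = c * n"
              using u3 s4 by (auto simp: upd_def)
            show "wp I (mult_n 2 ;; mult_n 2 ;; Op (VConst 5 t) ;; Op (VAdd 1 2 5)) ?Q s4"
            proof (rule w)
              fix s5 assume s5: "upd {7, 8, 2} {} (5 * n + 5) 0 s4 s5 \<and> vr s5 2 = vr s4 2 * n"
              have u5: "upd {2, 3, 4, 6, 7, 8, 9} {} (29 * n + 32) 0 s s5" "vr s5 6 = n" "vr s5 4 = a * n"
                "vr s5 3 = b * n * n" "vr s5 2 = c * n * n"
                using u4 s5 by (auto simp: upd_def)
              show "wp I (mult_n 2 ;; Op (VConst 5 t) ;; Op (VAdd 1 2 5)) ?Q s5"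
              proof (rule w)
                fix s6 assume s6: "upd {7, 8, 2} {} (5 * n + 5) 0 s5 s6 \<and> vr s6 2 = vr s5 2 * n"
                have u6: "upd {2, 3, 4, 6, 7, 8, 9} {} (34 * n + 37) 0 s s6" "vr s6 4 = a * n"
                  "vr s6 3 = b * n * n" "vr s6 2 = c * n * n * n"
                  using u5 s6 by (auto simp: upd_def)
                have "upd {1..9} {} (34 * n + 40) 0 s (setv 1 1 (c * n * n * n + t) (setv 1 5 t s6))"
                  by (rule upd_trans[OF u6(1), of "{1, 5}" "{}" 2 0]) (auto simp: upd_def)
                then show "wp I (Op (VConst 5 t) ;; Op (VAdd 1 2 5)) ?Q s6"
                  using u6 by simp
              qed (use u5 in auto)
            qed (use u4 in auto)
          qed (use u3 in auto)
          then show "wp I (Op (VConst 2 c) ;; mult_n 2 ;; mult_n 2 ;; mult_n 2 ;;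
            Op (VConst 5 t) ;; Op (VAdd 1 2 5)) ?Q s3" by simp
        qed (use u2 in auto)
      qed (use u1 in auto)
      then show "wp I (Op (VConst 3 b) ;; mult_n 3 ;; mult_n 3 ;;
         Op (VConst 2 c) ;; mult_n 2 ;; mult_n 2 ;; mult_n 2 ;; Op (VConst 5 t) ;; Op (VAdd 1 2 5)) ?Q s1" by simp
    qed (use s0 n in auto)
    then show "wp I (Op (VConst 4 a) ;; mult_n 4 ;; Op (VConst 3 b) ;; mult_n 3 ;; mult_n 3 ;;
     Op (VConst 2 c) ;; mult_n 2 ;; mult_n 2 ;; mult_n 2 ;; Op (VConst 5 t) ;; Op (VAdd 1 2 5)) ?Q s0" by simp
  qed
qed

definition report_step :: "nat \<Rightarrow> com" where
  "report_step t = Op (VLoad 42 8 52) ;; owner_prog t ;;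
     IfLe 43 50 (IfLe 50 43 (Op (VEmit 42)) Skip) Skip"

text \<open>The part of \<open>v\<close> is contained in the set of its owner. So that set is
  computed again, and the members with the same owner are reported. It is moved to array 8 because
  the computation of owners overwrites array 6.\<close>

definition query_prog :: "nat \<Rightarrow> com" where
  "query_prog t = Op (VCopy 42 0) ;; owner_prog t ;; Op (VCopy 50 43) ;; Op (VCopy 30 50) ;;
     best_prog t ;; copy 6 31 8 ;; Op (VCopy 51 31) ;; For 52 51 (report_step t)"

definition main_prog :: "nat \<Rightarrow> nat \<Rightarrow> nat \<Rightarrow> nat \<Rightarrow> com" where
  "main_prog a b c t = setup_prog a b c t ;; query_prog t"

context machine
begin

definition own :: "(nat \<Rightarrow> nat) \<Rightarrow> nat \<Rightarrow> nat" where
  "own r u = lex_arg r {w \<in> V. u \<in> Sof w}"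

lemma lex_min_own:
  assumes u: "u \<in> V" shows "lex_min r {w \<in> V. u \<in> Sof w} (own r u)"
proof -
  have "finite {w \<in> V. u \<in> Sof w}" "{w \<in> V. u \<in> Sof w} \<noteq> {}"
    using finV u Sof_props(1)[OF u] by auto
  from lex_min_exists[OF this, of r] obtain x where "lex_min r {w \<in> V. u \<in> Sof w} x" ..
  then show ?thesis unfolding own_def using lex_arg_eq by metis
qed

lemma own_eq: "u \<in> V \<Longrightarrow> lex_min r {w \<in> V. u \<in> Sof w} x \<Longrightarrow> x = own r u"
  using lex_min_own lex_min_unique by blast

lemma wp_query:
  assumes p: "pars s" and v: "vr s 0 = v" "v \<in> V" and ci: "coin_inv L \<omega> (ar s 7) (fl s)" and an: "an s = {}"
  shows "wp I (query_prog t) (\<lambda>s'. coin_inv L \<omega> (ar s' 7) (fl s') \<and> an s' = {u \<in> V. own R u = own R v} \<and>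
    pr s' \<le> pr s + (Z + 1) * owner_probes + best_probes \<and>
    tm s' \<le> tm s + (Z + 1) * (owner_time + 30 * Z) + best_time) s"
proof -
  define post where "post = (\<lambda>s' :: ast. coin_inv L \<omega> (ar s' 7) (fl s') \<and> an s' = {u \<in> V. own R u = own R v} \<and>
    pr s' \<le> pr s + (Z + 1) * owner_probes + best_probes \<and>
    tm s' \<le> tm s + (Z + 1) * (owner_time + 30 * Z) + best_time)"
  let ?o = "own R v"
  let ?s1 = "setv 2 42 v s"
  have p1: "pars ?s1" using p by (simp add: pars_def)
  have oV: "?o \<in> V" "v \<in> Sof ?o" using lex_min_own[OF v(2), of R] by (auto simp: lex_min_def)
  have "wp I (owner_prog t ;; Op (VCopy 50 43) ;; Op (VCopy 30 50) ;;
     best_prog t ;; copy 6 31 8 ;; Op (VCopy 51 31) ;; For 52 51 (report_step t)) post ?s1"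
  proof (rule wp_seqI[OF wp_owner[OF p1 _ v(2)]])
    fix s2 assume s2: "upd owner_vars {1..7} owner_time owner_probes ?s1 s2 \<and>
      coin_inv L \<omega> (ar s2 7) (fl s2) \<and> lex_min R {w \<in> V. v \<in> Sof w} (vr s2 43)"
    have o2: "vr s2 43 = ?o" using own_eq[OF v(2)] s2 by blast
    let ?s3 = "setv 2 30 ?o (setv 2 50 ?o s2)"
    have u1: "upd {42} {} 2 0 s ?s1" by (simp add: upd_def)
    have u2: "upd (owner_vars \<union> {42}) {1..7} (owner_time + 2) owner_probes s s2"
      by (rule upd_trans[OF u1 conjunct1[OF s2]]) auto
    have u23: "upd {30, 50} {} 4 0 s2 ?s3" by (auto simp: upd_def)
    have u3: "upd (owner_vars \<union> {42, 50}) {1..7} (owner_time + 6) owner_probes s ?s3"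
      by (rule upd_trans[OF u2 u23]) auto
    have p3: "pars ?s3" by (rule pars_upd[OF p u3]) auto
    have "wp I (best_prog t ;; copy 6 31 8 ;; Op (VCopy 51 31) ;; For 52 51 (report_step t)) post ?s3"
    proof (rule wp_seqI[OF wp_best[OF p3 _ oV(1)]])
      fix s4 assume s4: "upd ({9..<30} \<union> {31, 41} \<union> {x. 100 \<le> x \<and> odd x}) {3, 4, 5, 6}
        (B ^ t * (122 * Z\<^sup>2)) (B ^ t * (B * (d + 1))) ?s3 s4 \<and>
        distinct (lst s4 6 (vr s4 31)) \<and> vr s4 31 \<le> B \<and> set (lst s4 6 (vr s4 31)) = Sof ?o"
      let ?N = "vr s4 31" and ?xs = "lst s4 6 (vr s4 31)"
      have u4: "upd (owner_vars \<union> {42, 50}) {1..7} (owner_time + 6 + best_time) (owner_probes + best_probes) s s4"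
        by (rule upd_trans[OF u3 conjunct1[OF s4]]) (auto simp: best_time_def best_probes_def)
      have v50: "vr s4 50 = ?o" using upd_vr[OF conjunct1[OF s4], of 50] by simp
      have ci4: "coin_inv L \<omega> (ar s4 7) (fl s4)"
        using upd_ar[OF conjunct1[OF s4], of 7] upd_fl[OF conjunct1[OF s4]] s2 by simp
      have NZ: "?N \<le> Z" using s4 Z_bounds by linarith
      show "wp I (copy 6 31 8 ;; Op (VCopy 51 31) ;; For 52 51 (report_step t)) post s4"
      proof (rule wp_seqI[OF wp_copy])
        fix s5 assume s5: "upd {22, 23} {8} (18 * vr s4 31 + 2) 0 s4 s5 \<and> lst s5 8 (vr s4 31) = lst s4 6 (vr s4 31)"
        let ?s6 = "setv 2 51 ?N s5"
        have v5: "vr s5 31 = ?N" using upd_vr[OF conjunct1[OF s5], of 31] by simp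
        have u56: "upd {51} {} 2 0 s5 ?s6" by (auto simp: upd_def)
        have u5: "upd (owner_vars \<union> {42, 50}) {1..8} (owner_time + best_time + 18 * Z + 8) (owner_probes + best_probes) s s5"
          by (rule upd_trans[OF u4 conjunct1[OF s5]]) (use NZ in auto)
        have u6: "upd (owner_vars \<union> {42, 50, 51}) {1..8} (owner_time + best_time + 18 * Z + 10) (owner_probes + best_probes) s ?s6"
          by (rule upd_trans[OF u5 u56]) auto
        have p6: "pars ?s6" by (rule pars_upd[OF p u6]) auto
        have v6: "vr ?s6 50 = ?o" using upd_vr[OF conjunct1[OF s5], of 50] v50 by simp
        have ci6: "coin_inv L \<omega> (ar ?s6 7) (fl ?s6)"
          using upd_ar[OF conjunct1[OF s5], of 7] upd_fl[OF conjunct1[OF s5]] ci4 by simp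
        have l6: "lst ?s6 8 ?N = ?xs" using s5 by simp
        define J where "J = (\<lambda>k (s' :: ast). vr s' 52 = k \<and> vr s' 51 = ?N \<and> vr s' 50 = ?o \<and> pars s' \<and>
           coin_inv L \<omega> (ar s' 7) (fl s') \<and> lst s' 8 ?N = ?xs \<and> an s' = {u \<in> set (take k ?xs). own R u = ?o} \<and>
           pr s' \<le> pr s + (owner_probes + best_probes) + k * owner_probes \<and>
           tm s' \<le> tm s + (owner_time + best_time + 18 * Z + 11) + k * (owner_time + 20))"
        have "wp I (For 52 51 (report_step t)) (\<lambda>s'. \<exists>s''. s' = tick 1 s'' \<and> J ?N s'') ?s6"
        proof (rule wp_For_gen)
          show "vr s' 52 = k \<and> vr s' 51 = ?N" if "J k s'" for k s' using that by (simp add: J_def)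
          have "an ?s6 = {}" using u6 an by (simp add: upd_def)
          moreover have "pr ?s6 \<le> pr s + (owner_probes + best_probes)"
            "tm ?s6 \<le> tm s + (owner_time + best_time + 18 * Z + 10)" using u6 unfolding upd_def by blast+
          moreover have "pars (setv 1 52 0 ?s6)" using p6 by (simp add: pars_def)
          ultimately show "J 0 (setv 1 52 0 ?s6)" using v6 ci6 l6 by (simp add: J_def)
          fix k s' assume k: "k < ?N" and Jk: "J k s'"
          let ?u = "?xs ! k" and ?s7 = "setv 7 42 (?xs ! k) (tick 1 s')"
          have uS: "?u \<in> Sof ?o" using s4 nth_mem[of k ?xs] k by auto
          have uV: "?u \<in> V" using uS Sof_props(2)[OF oV(1)] by blast
          have a8: "ar s' 8 k = ?u" using Jk k unfolding J_def by (metis nth_lst)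
          have k52: "vr s' 52 = k" using Jk by (simp add: J_def)
          have p7: "pars ?s7" using Jk by (simp add: J_def pars_def)
          have ci7: "coin_inv L \<omega> (ar ?s7 7) (fl ?s7)" using Jk by (simp add: J_def)
          let ?Q = "\<lambda>s''. vr s'' 52 = k \<and> J (Suc k) (tick 1 (setv 2 52 (Suc k) s''))"
          have "wp I (owner_prog t ;; IfLe 43 50 (IfLe 50 43 (Op (VEmit 42)) Skip) Skip) ?Q ?s7"
          proof (rule wp_seqI[OF wp_owner[OF p7 _ uV ci7]])
            fix s8 assume s8: "upd owner_vars {1..7} owner_time owner_probes ?s7 s8 \<and>
              coin_inv L \<omega> (ar s8 7) (fl s8) \<and> lex_min R {w \<in> V. ?u \<in> Sof w} (vr s8 43)"
            note u8 = conjunct1[OF s8]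
            have o8: "vr s8 43 = own R ?u" using own_eq[OF uV] s8 by blast
            have v8: "vr s8 50 = ?o" "vr s8 52 = k" "vr s8 51 = ?N" "vr s8 42 = ?u" "lst s8 8 ?N = ?xs"
              using upd_vr[OF u8, of 50] upd_vr[OF u8, of 52] upd_vr[OF u8, of 51] upd_vr[OF u8, of 42]
                upd_ar[OF u8, of 8] Jk by (auto simp: J_def lst_def)
            have p8: "pars s8" by (rule pars_upd[OF p7 u8]) auto
            have e8: "an s8 = an s'" "pr s8 \<le> pr s' + owner_probes" "tm s8 \<le> tm s' + 8 + owner_time"
              using u8 by (auto simp: upd_def)
            have fin: "?Q s9" if s9: "vr s9 = vr s8" "ar s9 = ar s8" "fl s9 = fl s8" "pr s9 = pr s8" "tm s9 \<le> tm s8 + 3"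
              "an s9 = (if own R ?u = ?o then insert ?u (an s8) else an s8)" for s9
            proof
              show "vr s9 52 = k" using s9 v8 by simp
              have "take (Suc k) ?xs = take k ?xs @ [?u]" using k by (simp add: take_Suc_conv_app_nth)
              then have "an s9 = {u \<in> set (take (Suc k) ?xs). own R u = ?o}"
                using s9(6) e8(1) Jk by (auto simp: J_def)
              moreover have "pars (tick 1 (setv 2 52 (Suc k) s9))" using p8 s9(1) by (simp add: pars_def)
              moreover have "lst s9 8 ?N = ?xs" using v8(5) s9(2) by (simp add: lst_def)
              moreover have "pr s9 \<le> pr s + (owner_probes + best_probes) + Suc k * owner_probes"
                using e8(2) s9(4) Jk by (simp add: J_def)
              moreover have "tm s9 + 3 \<le> tm s + (owner_time + best_time + 18 * Z + 11) + Suc k * (owner_time + 20)"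
                using e8(3) s9(5) Jk by (simp add: J_def)
              ultimately show "J (Suc k) (tick 1 (setv 2 52 (Suc k) s9))"
                using s9(1,2,3) v8 s8 by (simp add: J_def)
            qed
            define Q where "Q = ?Q"
            have "wp I (IfLe 43 50 (IfLe 50 43 (Op (VEmit 42)) Skip) Skip) Q s8"
            proof -
              consider "own R ?u = ?o" | "own R ?u < ?o" | "own R ?u > ?o" by linarith
              then show ?thesis
              proof cases
                case 1
                have "Q (s8\<lparr>an := insert ?u (an s8), tm := Suc (Suc (Suc (tm s8)))\<rparr>)"
                  unfolding Q_def by (rule fin) (use 1 in auto)
                then show ?thesis using 1 o8 v8 by (simp add: tick_def)
              next
                case 2
                have "Q (tick 1 (tick 1 (tick 1 s8)))" unfolding Q_def by (rule fin) (use 2 in auto)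
                then show ?thesis using 2 o8 v8 by simp
              next
                case 3
                have "Q (tick 1 (tick 1 s8))" unfolding Q_def by (rule fin) (use 3 in auto)
                then show ?thesis using 3 o8 v8 by simp
              qed
            qed
            then show "wp I (IfLe 43 50 (IfLe 50 43 (Op (VEmit 42)) Skip) Skip) ?Q s8" unfolding Q_def .
          qed simp
          then show "wp I (report_step t) ?Q (tick 1 s')"
            using a8 k52 unfolding report_step_def by simp
        qed
        then have "wp I (For 52 51 (report_step t)) post ?s6"
        proof (rule wp_mono, elim exE conjE)
          fix s' s'' assume e: "s' = tick 1 s''" and J: "J ?N s''"
          have S: "set ?xs = Sof ?o" using s4 by blast
          have "{u \<in> set ?xs. own R u = ?o} = {u \<in> V. own R u = ?o}"
          proof -
            have "u \<in> Sof ?o" if "u \<in> V" "own R u = ?o" for u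
              using lex_min_own[OF that(1), of R] that(2) by (auto simp: lex_min_def)
            then show ?thesis using S Sof_props(2)[OF oV(1)] by auto
          qed
          moreover have "pr s' \<le> pr s + (Z + 1) * owner_probes + best_probes"
          proof -
            have "?N * owner_probes \<le> Z * owner_probes" using NZ by (rule mult_le_mono1)
            moreover have "(Z + 1) * owner_probes = Z * owner_probes + owner_probes" by simp
            moreover have "pr s' \<le> pr s + (owner_probes + best_probes) + ?N * owner_probes"
              using J unfolding e J_def by simp
            ultimately show ?thesis by linarith
          qed
          moreover have "tm s' \<le> tm s + (Z + 1) * (owner_time + 30 * Z) + best_time"
          proof -
            have "?N * (owner_time + 20) \<le> Z * (owner_time + 20)" using NZ by (rule mult_le_mono1)
            moreover have "100 * Z \<le> Z * Z" using Z(3) by (rule mult_le_mono1)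
            moreover have "(Z + 1) * (owner_time + 30 * Z) = Z * owner_time + 30 * (Z * Z) + owner_time + 30 * Z"
              "Z * (owner_time + 20) = Z * owner_time + 20 * Z" by (simp_all add: algebra_simps)
            moreover have "tm s' \<le> tm s + (owner_time + best_time + 18 * Z + 12) + ?N * (owner_time + 20)"
              using J unfolding e J_def by simp
            ultimately show ?thesis using Z(3) by linarith
          qed
          ultimately show "post s'" using J unfolding e post_def J_def by simp
        qed
        then show "wp I (Op (VCopy 51 31) ;; For 52 51 (report_step t)) post s5" using v5 by simp
      qed auto
    qed auto
    then show "wp I (Op (VCopy 50 43) ;; Op (VCopy 30 50) ;;
     best_prog t ;; copy 6 31 8 ;; Op (VCopy 51 31) ;; For 52 51 (report_step t)) post s2"
      using o2 by simp
  qed (use ci in auto)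
  then show ?thesis using v unfolding query_prog_def post_def by simp
qed

lemma query_probes_le: "(Z + 1) * owner_probes + best_probes \<le> 5 * Z ^ (2 * t + 3)"
proof -
  have q: "B ^ t \<le> Z ^ t" using Z_bounds by (intro power_mono) auto
  have z: "1 \<le> Z" "1 \<le> Z ^ t" using Z(3) by auto
  have "owner_probes \<le> 2 * ((Z ^ t) ^ 2 * Z ^ 2)"
    unfolding owner_probes_def using power_mono[OF q, of 2] by (intro mult_le_mono2 mult_le_mono1) auto
  then have "(Z + 1) * owner_probes \<le> (2 * Z) * (2 * ((Z ^ t) ^ 2 * Z ^ 2))"
    using z by (intro mult_le_mono) auto
  also have "\<dots> = 4 * Z ^ (2 * t + 3)"
    by (simp add: power_add power_mult power2_eq_square power3_eq_cube algebra_simps)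
  finally have 1: "(Z + 1) * owner_probes \<le> 4 * Z ^ (2 * t + 3)" .
  have "best_probes \<le> Z ^ t * Z" unfolding best_probes_def using q Z(1) by (intro mult_le_mono)
  also have "\<dots> = Z ^ (t + 1)" by simp
  also have "\<dots> \<le> Z ^ (2 * t + 3)" using z by (intro power_increasing) auto
  finally show ?thesis using 1 by linarith
qed

lemma query_time_le: "(Z + 1) * (owner_time + 30 * Z) + best_time \<le> 600 * Z ^ (2 * t + 4)"
proof -
  have q: "B ^ t \<le> Z ^ t" using Z_bounds by (intro power_mono) auto
  have z: "1 \<le> Z" "1 \<le> Z ^ t" using Z(3) by auto
  have "owner_time \<le> 200 * ((Z ^ t) ^ 2 * Z ^ 3)"
    unfolding owner_time_def using power_mono[OF q, of 2] by (intro mult_le_mono2 mult_le_mono1) auto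
  also have "\<dots> = 200 * Z ^ (2 * t + 3)" by (simp add: power_add power_mult mult.commute)
  finally have o: "owner_time \<le> 200 * Z ^ (2 * t + 3)" .
  have "Z ^ 1 \<le> Z ^ (2 * t + 3)" using z by (intro power_increasing) auto
  then have "(Z + 1) * (owner_time + 30 * Z) \<le> (2 * Z) * (230 * Z ^ (2 * t + 3))"
    using o z by (intro mult_le_mono) auto
  also have "\<dots> = 460 * Z ^ (2 * t + 4)" by (subst power_eq_if[of Z "2 * t + 4"]) (simp add: add.commute)
  finally have 1: "(Z + 1) * (owner_time + 30 * Z) \<le> 460 * Z ^ (2 * t + 4)" .
  have "best_time \<le> Z ^ t * (122 * Z ^ 2)" unfolding best_time_def using q by (intro mult_le_mono1)
  also have "\<dots> = 122 * Z ^ (t + 2)" by (simp add: power_add power2_eq_square)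
  also have "Z ^ (t + 2) \<le> Z ^ (2 * t + 4)" using z by (intro power_increasing) auto
  finally show ?thesis using 1 by linarith
qed

lemma wp_main:
  assumes e: "\<epsilon> > 0" and n: "n = inv_eps \<epsilon>" "34 * n + 40 \<le> Z"
    and abc: "L = a * n" "\<Delta> = b * n * n" "K = c * n * n * n"
    and v: "vr s 0 = v" "v \<in> V" and ci: "coin_inv L \<omega> (ar s 7) (fl s)" and an: "an s = {}"
    and z: "pr s = 0" "tm s = 0"
  shows "wp I (main_prog a b c t) (\<lambda>s'. coin_inv L \<omega> (ar s' 7) (fl s') \<and>
    an s' = {u \<in> V. own R u = own R v} \<and> pr s' \<le> 5 * Z ^ (2 * t + 3) \<and> tm s' \<le> 601 * Z ^ (2 * t + 4)) s"
proof -
  have e': "eps I > 0" "n = inv_eps (eps I)" using e n by simp_all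
  show ?thesis
    unfolding main_prog_def
  proof (rule wp_seqI[OF wp_setup[OF e']])
    fix s1 assume s1: "upd {1..9} {} (34 * n + 40) 0 s s1 \<and>
      vr s1 4 = a * n \<and> vr s1 3 = b * n * n \<and> vr s1 2 = c * n * n * n \<and> vr s1 5 = t \<and>
      vr s1 1 = c * n * n * n + t"
    note u1 = conjunct1[OF s1]
    have p1: "pars s1" unfolding pars_def using s1 abc B(1) by presburger
    have v1: "vr s1 0 = v" using upd_vr[OF u1, of 0] v by simp
    have ci1: "coin_inv L \<omega> (ar s1 7) (fl s1)" using upd_ar[OF u1, of 7] upd_fl[OF u1] ci by simp
    have an1: "an s1 = {}" "pr s1 = 0" "tm s1 \<le> Z" using u1 an z n(2) by (auto simp: upd_def)
    have "Z ^ 1 \<le> Z ^ (2 * t + 4)" using Z(3) by (intro power_increasing) auto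
    then have zz: "Z \<le> Z ^ (2 * t + 4)" by simp
    show "wp I (query_prog t) (\<lambda>s'. coin_inv L \<omega> (ar s' 7) (fl s') \<and>
      an s' = {u \<in> V. own R u = own R v} \<and> pr s' \<le> 5 * Z ^ (2 * t + 3) \<and> tm s' \<le> 601 * Z ^ (2 * t + 4)) s1"
      by (rule wp_mono[OF wp_query[OF p1 v1 v(2) ci1 an1(1)]])
        (use an1 zz query_probes_le query_time_le in linarith)
  qed
qed

end

section \<open>Runs and the cut probability\<close>

lemma run_halted:
  assumes "halted P s1" "run I P n s1 = Some s2" shows "n = 0 \<and> s2 = s1"
  using assms by (cases n) (auto simp: halted_def step_def)

lemma run_halted_unique:
  assumes "run I P m s = Some s1" "halted P s1" "run I P n s = Some s2" "halted P s2"
  shows "s1 = s2"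
proof -
  have *: "s1 = s2" if r: "run I P m s = Some s1" "run I P (m + k) s = Some s2" and h: "halted P s1"
    for m k s1 s2
  proof -
    have "run I P k s1 = Some s2" using r by (simp add: run_add)
    from run_halted[OF h this] show ?thesis by simp
  qed
  show ?thesis
  proof (cases "m \<le> n")
    case True
    then show ?thesis using *[of m s1 "n - m" s2] assms by simp
  next
    case False
    then show ?thesis using *[of n s2 "m - n" s1] assms by simp
  qed
qed

text \<open>\<open>after_queries\<close> admits any halting run; determinism identifies it with the
  run that is known to preserve the coin invariant.\<close>

lemma answers_unique:
  "answers I P st v st' S q t \<Longrightarrow> answers I P st v st'' S' q' t' \<Longrightarrow> st' = st''"
  unfolding answers_def using run_halted_unique by blast

lemma code_at_prefix: "code_at (cs @ ds) 0 cs"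
  by (simp add: code_at_def nth_append)

definition partition_prog :: "nat \<Rightarrow> nat \<Rightarrow> nat \<Rightarrow> nat \<Rightarrow> program" where
  "partition_prog a b c t = compile 0 (main_prog a b c t) @ [Halt]"

text \<open>Of everything left in memory by earlier queries, only the stored ranks and the flipped
  coins matter.\<close>

definition store_inv :: "nat \<Rightarrow> (nat \<Rightarrow> bool) \<Rightarrow> store \<Rightarrow> bool" where
  "store_inv L \<omega> st \<longleftrightarrow> coin_inv L \<omega> (\<lambda>i. mem st (16 * i + 7)) (flipped st)"

definition init_state :: "store \<Rightarrow> nat \<Rightarrow> ast" where
  "init_state st v = \<lparr>vr = (\<lambda>x. mem (start st v) (16 * x)), ar = (\<lambda>j i. mem (start st v) (16 * i + j)),
     fl = flipped st, pr = 0, an = {}, tm = 0\<rparr>"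

lemma sim_init_state: "sim (start st v) (init_state st v)"
  by (simp add: sim_def init_state_def start_def)

lemma store_inv_fresh: "store_inv L \<omega> fresh_store"
  by (simp add: store_inv_def fresh_store_def coin_inv_def)

context machine
begin

lemma answers_main:
  assumes e: "\<epsilon> > 0" and n: "n = inv_eps \<epsilon>" "34 * n + 40 \<le> Z"
    and abc: "L = a * n" "\<Delta> = b * n * n" "K = c * n * n * n"
    and v: "v \<in> V" and st: "store_inv L \<omega> st"
  shows "\<exists>st' q T. answers I (partition_prog a b c t) st v st' {u \<in> V. own R u = own R v} q T \<and>
    q \<le> 5 * Z ^ (2 * t + 3) \<and> T \<le> 601 * Z ^ (2 * t + 4) \<and> store_inv L \<omega> st'"
proof -
  let ?a = "init_state st v" and ?s = "start st v" and ?P = "partition_prog a b c t"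
  have "wp I (main_prog a b c t) (\<lambda>s'. coin_inv L \<omega> (ar s' 7) (fl s') \<and>
    an s' = {u \<in> V. own R u = own R v} \<and> pr s' \<le> 5 * Z ^ (2 * t + 3) \<and> tm s' \<le> 601 * Z ^ (2 * t + 4)) ?a"
    by (rule wp_main[OF e n abc _ v])
      (use st in \<open>simp_all add: init_state_def start_def store_inv_def\<close>)
  then obtain a' where a': "bs I (main_prog a b c t) ?a a'" "coin_inv L \<omega> (ar a' 7) (fl a')"
    "an a' = {u \<in> V. own R u = own R v}" "pr a' \<le> 5 * Z ^ (2 * t + 3)" "tm a' \<le> 601 * Z ^ (2 * t + 4)"
    unfolding wp_def by (elim exE conjE)
  have pc0: "pc ?s = 0" by (simp add: start_def)
  have code: "code_at ?P (pc ?s) (compile (pc ?s) (main_prog a b c t))"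
    unfolding pc0 partition_prog_def by (rule code_at_prefix)
  from compile_correct[OF a'(1) sim_init_state code] obtain T s' where
    s': "run I ?P T ?s = Some s'" "sim s' a'" "pc s' = pc ?s + clen (main_prog a b c t)"
    "tm a' = tm ?a + T" by (elim exE conjE)
  have "halted ?P s'" using s'(3) pc0 by (simp add: halted_def partition_prog_def nth_append)
  moreover have "answer s' = {u \<in> V. own R u = own R v}" "probes s' = pr a'"
    using s'(2) a'(3) by (simp_all add: sim_def)
  moreover have "store_inv L \<omega> (store.truncate s')"
  proof -
    have "(\<lambda>i. mem s' (16 * i + 7)) = ar a' 7" "flipped s' = fl a'" using s'(2) by (auto simp: sim_def)
    then show ?thesis using a'(2) by (simp add: store_inv_def store.defs)
  qed
  moreover have "T \<le> 601 * Z ^ (2 * t + 4)" using s'(4) a'(5) by (simp add: init_state_def)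
  ultimately show ?thesis
    using s'(1) a'(4) unfolding answers_def
    by (intro exI[of _ "store.truncate s'"] exI[of _ "probes s'"] exI[of _ T] conjI exI[of _ s']) auto
qed

lemma after_queries_inv:
  assumes e: "\<epsilon> > 0" and n: "n = inv_eps \<epsilon>" "34 * n + 40 \<le> Z"
    and abc: "L = a * n" "\<Delta> = b * n * n" "K = c * n * n * n"
    and "after_queries I (partition_prog a b c t) Q st"
  shows "store_inv L \<omega> st"
  using assms(7)
proof (induction rule: after_queries.induct)
  case 1
  show ?case by (rule store_inv_fresh)
next
  case (2 Q st v st' S q T)
  have v: "v \<in> V" using 2 by simp
  from answers_main[OF e n abc v 2(4)] obtain st2 S2 q2 T2 where
    "answers I (partition_prog a b c t) st v st2 S2 q2 T2" "store_inv L \<omega> st2" by blast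
  then show ?case using answers_unique[OF 2(3)] by blast
qed

lemma own_restrict:
  assumes "u \<in> V" shows "own (restrict r V) u = own r u"
proof -
  have "lex_min (restrict r V) {w \<in> V. u \<in> Sof w} (own r u)"
    using lex_min_own[OF assms, of r] by (simp add: lex_min_def)
  then show ?thesis using own_eq[OF assms] by metis
qed

lemma card_own_le:
  assumes "v \<in> V" "K \<ge> 1" shows "card {u \<in> V. own r u = own r v} \<le> K"
proof -
  let ?o = "own r v"
  have o: "?o \<in> V" using lex_min_own[OF assms(1), of r] by (simp add: lex_min_def)
  have "{u \<in> V. own r u = ?o} \<subseteq> Sof ?o"
  proof
    fix u assume "u \<in> {u \<in> V. own r u = ?o}"
    then show "u \<in> Sof ?o" using lex_min_own[of u r] by (simp add: lex_min_def)
  qed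
  moreover have "finite (Sof ?o)" using Sof_props(2)[OF o] finV finite_subset by blast
  ultimately have "card {u \<in> V. own r u = ?o} \<le> card (Sof ?o)" by (intro card_mono)
  also have "\<dots> \<le> K" using Sof_props(3)[OF o] assms(2) by (auto simp: isolated_def)
  finally show ?thesis .
qed

text \<open>Every finite set that contains \<open>w\<close> has at least the encoding of
  \<open>{w}\<close>, so the maximum falls on the default \<open>{w}\<close> only if that set is
  itself isolated.\<close>

lemma Sof_isolated:
  assumes w: "w \<in> V" and S: "S \<subseteq> V" "w \<in> S" "isolated E K t \<Delta> S"
  shows "isolated E K t \<Delta> (Sof w)"
proof -
  have "finite S" using S(1) finV finite_subset by blast
  have "set_encode S \<le> set_encode (Sof w)"
    using Sof_best[OF w] S by (auto simp: is_best_def fam_def)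
  moreover have "set_encode {w} \<le> set_encode S"
    unfolding set_encode_def using S(2) \<open>finite S\<close> by (intro sum_mono2) auto
  ultimately have "Sof w = {w} \<Longrightarrow> set_encode S = set_encode (Sof w)" by simp
  moreover have "finite (Sof w)" using Sof_props(2)[OF w] finV finite_subset by blast
  ultimately have "Sof w = {w} \<Longrightarrow> S = Sof w" using \<open>finite S\<close> set_encode_eq by blast
  then show ?thesis using Sof_props(3)[OF w] S(3) by auto
qed

lemma cut_edges_restrict:
  "cut_edges E (\<lambda>v. {u \<in> V. own (restrict r V) u = own (restrict r V) v}) =
   cut_edges E (\<lambda>v. {u \<in> V. own r u = own r v})"
proof -
  have "{u \<in> V. own (restrict r V) u = own (restrict r V) v} = {u \<in> V. own r u = own r v}" if "v \<in> V" for v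
    using own_restrict that by auto
  then show ?thesis unfolding cut_edges_def using fin_graph_edge[OF G]
    by (intro Collect_cong ex_cong1 conj_cong) auto
qed

text \<open>The hypotheses on \<open>\<Delta>\<close> and \<open>K\<close> make each of the two
  contributions to the mean number of cut edges at most \<open>\<epsilon> / 20\<close> per vertex.
  The mean is then at most \<open>\<epsilon> / 10\<close> per vertex, a tenth of what is allowed,
  and Markov's inequality gives probability \<open>9 / 10\<close>.\<close>

lemma prob_few_cut_edges:
  assumes tw: "treewidth V E \<le> int h" and t': "t = 2 * h + 1" and N: "fact (Suc t) * K \<le> 2 ^ L"
    and pos: "\<epsilon> \<ge> 0" "\<Delta> \<ge> 1" "K \<ge> 1"
    and \<Delta>: "40 * fact (Suc t) * (1 + real L) \<le> real \<Delta> * \<epsilon>"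
    and K: "40 * real (Suc h) * (1 + real d * real \<Delta>) * real d \<le> real K * \<epsilon>"
  shows "measure coin_space {\<omega>. real (card (cut_edges E (\<lambda>v. {u \<in> V. own (vrank L \<omega>) u = own (vrank L \<omega>) v})))
    \<le> \<epsilon> * real (card V)} \<ge> 9 / 10"
proof -
  define \<Omega> where "\<Omega> = PiE V (\<lambda>_. {..<(2::nat) ^ L})"
  define X where "X = (\<lambda>g. real (card (cut_edges E (\<lambda>v. {u \<in> V. own g u = own g v}))))"
  define good where "good = {v \<in> V. \<exists>S\<subseteq>V. v \<in> S \<and> isolated E K t \<Delta> S}"
  define n where "n = real (card V)"
  have fin: "finite \<Omega>" unfolding \<Omega>_def using finV by (intro finite_PiE) auto
  have "card \<Omega> = (2 ^ L) ^ card V" unfolding \<Omega>_def using finV by (simp add: card_PiE)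
  then have card: "real (card \<Omega>) > 0" by simp
  have "real \<Delta> * (\<Sum>g\<in>\<Omega>. X g) \<le> (2 * fact (Suc t) * (\<Sum>r<2 ^ L. 1 / real (Suc r)) * real (card V)
        + real \<Delta> * real d * real (card (V - good))) * real (card \<Omega>)"
    unfolding \<Omega>_def X_def
  proof (rule sum_cut_edges_le[OF G deg, where S = Sof and t = t and K = K])
    show "w \<in> Sof w \<and> Sof w \<subseteq> V" if "w \<in> V" for w using Sof_props[OF that] by simp
    show "good \<subseteq> V" by (auto simp: good_def)
    show "isolated E K t \<Delta> (Sof w)" if "w \<in> good" for w
      using that Sof_isolated unfolding good_def by blast
    show "Sof w = {w}" if "w \<in> V - good" for w
      using that Sof_props[of w] unfolding good_def by blast
    show "owner_of Sof V g x (own g x)" if "x \<in> V" for g x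
      using lex_min_own[OF that, of g] unfolding owner_of_def lex_min_def by blast
  qed (use N in auto)
  also have "\<dots> \<le> (\<epsilon> / 10 * real \<Delta> * n) * real (card \<Omega>)"
  proof (rule mult_right_mono)
    have "2 * fact (Suc t) * (\<Sum>r<2 ^ L. 1 / real (Suc r)) * n \<le> 2 * fact (Suc t) * (1 + real L) * n"
      unfolding n_def by (intro mult_right_mono mult_left_mono harmonic_power2_le) auto
    also have "\<dots> \<le> real \<Delta> * \<epsilon> / 20 * n"
      unfolding n_def using \<Delta> by (intro mult_right_mono) auto
    finally have 1: "2 * fact (Suc t) * (\<Sum>r<2 ^ L. 1 / real (Suc r)) * n \<le> real \<Delta> * \<epsilon> / 20 * n" .
    have "V - good = {v \<in> V. \<not> (\<exists>S\<subseteq>V. v \<in> S \<and> isolated E K (2 * h + 1) \<Delta> S)}"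
      unfolding good_def t' by blast
    then have "K * card (V - good) \<le> 2 * Suc h * (1 + d * \<Delta>) * card V"
      using few_not_isolated[OF G deg tw, of K \<Delta>] by simp
    then have "real (K * card (V - good)) \<le> real (2 * Suc h * (1 + d * \<Delta>) * card V)"
      by (rule of_nat_mono)
    then have "real K * real (card (V - good)) \<le> 2 * real (Suc h) * (1 + real d * real \<Delta>) * n"
      unfolding n_def by (simp only: of_nat_mult of_nat_add of_nat_numeral of_nat_1)
    then have "(20 * real d) * (real K * real (card (V - good))) \<le>
        (20 * real d) * (2 * real (Suc h) * (1 + real d * real \<Delta>) * n)"
      by (rule mult_left_mono) simp
    also have "\<dots> = 40 * real (Suc h) * (1 + real d * real \<Delta>) * real d * n" by simp
    also have "\<dots> \<le> real K * \<epsilon> * n" using K by (intro mult_right_mono) (auto simp: n_def)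
    finally have "real K * (20 * real d * real (card (V - good))) \<le> real K * (\<epsilon> * n)" by (simp add: mult_ac)
    then have "20 * real d * real (card (V - good)) \<le> \<epsilon> * n" using pos(3) by simp
    then have "real \<Delta> * (20 * real d * real (card (V - good))) \<le> real \<Delta> * (\<epsilon> * n)" by (rule mult_left_mono) simp
    then have 2: "real \<Delta> * real d * real (card (V - good)) \<le> real \<Delta> * \<epsilon> / 20 * n" by simp
    show "2 * fact (Suc t) * (\<Sum>r<2 ^ L. 1 / real (Suc r)) * real (card V)
        + real \<Delta> * real d * real (card (V - good)) \<le> \<epsilon> / 10 * real \<Delta> * n"
    proof -
      have "\<epsilon> / 10 * real \<Delta> * n = real \<Delta> * \<epsilon> / 20 * n + real \<Delta> * \<epsilon> / 20 * n" by simp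
      then show ?thesis using add_mono[OF 1 2] unfolding n_def by presburger
    qed
  qed simp
  finally have "real \<Delta> * (\<Sum>g\<in>\<Omega>. X g) \<le> real \<Delta> * (\<epsilon> / 10 * n * real (card \<Omega>))" by (simp add: mult_ac)
  then have "(\<Sum>g\<in>\<Omega>. X g) \<le> \<epsilon> / 10 * n * real (card \<Omega>)" using pos(2) by simp
  then have "10 * (\<Sum>g\<in>\<Omega>. X g) \<le> (\<epsilon> * n) * real (card \<Omega>)" by simp
  from markov_counting[OF fin _ _ this]
  have "9 / 10 * real (card \<Omega>) \<le> real (card {g \<in> \<Omega>. X g \<le> \<epsilon> * n})"
    using pos(1) by (simp add: X_def n_def)
  also have "\<dots> = measure coin_space {\<omega>. X (restrict (vrank L \<omega>) V) \<le> \<epsilon> * n} * real (card \<Omega>)"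
    unfolding \<Omega>_def by (rule vrank_distribution[OF finV, symmetric])
  finally have "9 / 10 \<le> measure coin_space {\<omega>. X (restrict (vrank L \<omega>) V) \<le> \<epsilon> * n}"
    using card by simp
  then show ?thesis unfolding X_def n_def cut_edges_restrict .
qed

end

section \<open>Choice of the parameters\<close>

lemma cube_le_power2: "10 \<le> x \<Longrightarrow> x ^ 3 \<le> 2 ^ x" for x :: nat
proof (induction x rule: nat_induct_at_least)
  case base
  show ?case by simp
next
  case (Suc x)
  have "3 * (x * x) + 3 * x + 1 \<le> x * (x * x)"
  proof -
    have "10 * (x * x) \<le> x * (x * x)" "10 * x \<le> x * x" using Suc(1) by (auto intro: mult_le_mono1)
    then show ?thesis using Suc(1) by linarith
  qed
  moreover have "Suc x ^ 3 = x * (x * x) + (3 * (x * x) + 3 * x + 1)"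
    by (simp add: power3_eq_cube algebra_simps)
  ultimately show ?case using Suc by (simp add: power3_eq_cube)
qed

lemma four_power_le: "1 \<le> h \<Longrightarrow> (4::nat) ^ (2 * h) \<le> 16 * h ^ (4 * h)"
proof (cases "h = 1")
  case False
  assume "1 \<le> h"
  then have "2 ^ 2 \<le> h ^ 2" using False by (intro power_mono) auto
  then have "4 ^ (2 * h) \<le> (h ^ 2) ^ (2 * h)" by (intro power_mono) auto
  also have "\<dots> = h ^ (4 * h)" by (simp add: power_mult[symmetric])
  finally show ?thesis by simp
qed simp

text \<open>For \<open>h = 1\<close> every power of \<open>h\<close> is 1, so a constant factor in
  front is unavoidable; it absorbs the exceptional case of \<open>four_power_le\<close>.\<close>

lemma fact_le_base_power:
  assumes "1 \<le> h" shows "fact (2 * h + 2) \<le> 256 * h ^ (8 * h)"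
proof -
  have "fact (2 * h + 2) \<le> (2 * h + 2) ^ (2 * h + 2)" using fact_le_power[of "2 * h + 2", where 'a = nat] by (simp only: of_nat_id)
  also have "\<dots> \<le> (4 * h) ^ (2 * h + 2)" using assms by (intro power_mono) auto
  also have "\<dots> = 16 * 4 ^ (2 * h) * h ^ (2 * h + 2)" by (simp add: power_mult_distrib power_add)
  also have "\<dots> \<le> 16 * (16 * h ^ (4 * h)) * h ^ (4 * h)"
    using four_power_le[OF assms] assms by (intro mult_le_mono power_increasing) auto
  also have "\<dots> = 256 * h ^ (8 * h)" by (simp add: power_add[symmetric])
  finally show ?thesis .
qed

text \<open>The expected number of cut edges is at most \<open>2 c (1 + L) / \<Delta> + 2 d (h + 1) (1 + d \<Delta>) / K\<close> per vertex,
  and ranks below \<open>2 ^ L\<close> need \<open>c K \<le> 2 ^ L\<close>. The machine computes \<open>L\<close>, \<open>\<Delta>\<close> and \<open>K\<close> by multiplying constants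
  with \<open>n\<close>, which is roughly \<open>1 / \<epsilon>\<close>.\<close>

locale partition_params =
  fixes d h :: nat and \<epsilon> :: real
  assumes d: "1 \<le> d" and h: "1 \<le> h" and \<epsilon>: "0 < \<epsilon>" "\<epsilon> < 1/2"
begin

definition c :: nat where "c = fact (2 * h + 2)"
text \<open>The constants are found backwards. \<open>\<rho>\<close> is such that
  \<open>K = 80 * d\<^sup>2 * (h + 1) * \<Delta> * n\<close>, as the bound on vertices without
  isolated set demands. Then \<open>\<gamma>\<close> is chosen with
  \<open>c * \<rho> = \<gamma>\<^sup>2\<close>, so that \<open>c * K\<close> is
  \<open>\<gamma>\<^sup>2 * n ^ 3\<close>, which is below \<open>L ^ 3\<close> and hence below
  \<open>2 ^ L\<close>.\<close>

definition \<gamma> :: nat where "\<gamma> = 6400 * c\<^sup>2 * d\<^sup>2 * (h + 1)"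
definition \<rho> :: nat where "\<rho> = 6400 * c * d\<^sup>2 * (h + 1) * \<gamma>"
abbreviation n :: nat where "n \<equiv> inv_eps \<epsilon>"
definition L :: nat where "L = \<gamma> * n"
definition \<Delta> :: nat where "\<Delta> = 80 * c * \<gamma> * n * n"
definition K :: nat where "K = \<rho> * n * n * n"
text \<open>This is the final \<open>k\<close>. Parts have at most \<open>K\<close> vertices; the
  factor \<open>4 * d\<close> covers \<open>(K + t) * (d + 1)\<close> and raises the power of
  \<open>d\<close> from 4 to 5.\<close>

definition Z :: nat where "Z = 4 * d * K"

text \<open>\<open>n - 1\<close> is still at most \<open>1 / \<epsilon>\<close>, and adding one more
  \<open>\<epsilon> < 1/2\<close> gives \<open>3/2\<close>.\<close>

lemma n_bounds: "1 \<le> n" "1 \<le> \<epsilon> * n" "\<epsilon> * n \<le> 3/2"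
proof -
  show "1 \<le> n" by (simp add: inv_eps_def)
  show "1 \<le> \<epsilon> * n" using inv_eps_iff[OF \<epsilon>(1), of n] by simp
  have "\<epsilon> * real (n - 1) \<le> 1" using inv_eps_iff[OF \<epsilon>(1), of "n - 1"] by (simp add: inv_eps_def)
  moreover have "real (n - 1) = real n - 1" by (simp add: inv_eps_def)
  ultimately show "\<epsilon> * n \<le> 3/2" using \<epsilon>(2) by (simp add: right_diff_distrib)
qed

lemma c_ge: "1 \<le> c"
  unfolding c_def by (rule fact_ge_1)

lemma rho_ge: "6400 * (h + 1) \<le> \<rho>" "\<gamma> \<le> \<rho>" "6400 \<le> \<gamma>"
proof -
  show "6400 \<le> \<gamma>" using mult_le_mono2[of 1 "c\<^sup>2 * d\<^sup>2 * (h + 1)" 6400] c_ge d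
    by (simp add: \<gamma>_def Suc_le_eq mult.assoc del: mult_le_cancel1)
  then have "1 \<le> \<gamma>" by simp
  then have "1 \<le> c * d\<^sup>2 * \<gamma>" using c_ge d by simp
  then have "6400 * (h + 1) * 1 \<le> 6400 * (h + 1) * (c * d\<^sup>2 * \<gamma>)" by (rule mult_le_mono2)
  then show "6400 * (h + 1) \<le> \<rho>" unfolding \<rho>_def by (simp only: mult_ac mult_1_right)
  have "1 \<le> 6400 * c * d\<^sup>2 * (h + 1)" using c_ge d by (simp add: Suc_le_eq)
  from mult_le_mono1[OF this, of \<gamma>] show "\<gamma> \<le> \<rho>" unfolding \<rho>_def by simp
qed

lemma K_eq: "K = 80 * d\<^sup>2 * (h + 1) * \<Delta> * n"
  unfolding K_def \<Delta>_def \<rho>_def by algebra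

lemma K_ge: "\<rho> * n \<le> K" "12800 * n \<le> K" "\<gamma> * n \<le> K" "2 * h + 1 \<le> K"
proof -
  have "1 \<le> n * n" using n_bounds(1) by simp
  from mult_le_mono2[OF this, of "\<rho> * n"]
  show 1: "\<rho> * n \<le> K" by (simp add: K_def mult_ac)
  have "12800 \<le> 6400 * (h + 1)" using h by simp
  then have "12800 \<le> \<rho>" using rho_ge(1) by linarith
  from mult_le_mono1[OF this] show "12800 * n \<le> K" using 1 le_trans by blast
  from mult_le_mono1[OF rho_ge(2)] show "\<gamma> * n \<le> K" using 1 le_trans by blast
  have "2 * h + 1 \<le> 6400 * (h + 1)" by simp
  also have "\<dots> \<le> \<rho>" by (rule rho_ge)
  also have "\<dots> \<le> \<rho> * n" using n_bounds(1) by simp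
  finally show "2 * h + 1 \<le> K" using 1 by linarith
qed

lemma K_le_Z: "4 * K \<le> Z"
  using d by (simp add: Z_def)

lemma Z_conditions: "(K + (2 * h + 1)) * (d + 1) \<le> Z" "L \<le> Z" "100 \<le> Z" "34 * n + 40 \<le> Z"
proof -
  have "(K + (2 * h + 1)) * (d + 1) \<le> (2 * K) * (2 * d)" using K_ge(4) d by (intro mult_le_mono) auto
  also have "\<dots> = Z" by (simp add: Z_def)
  finally show "(K + (2 * h + 1)) * (d + 1) \<le> Z" .
  show "L \<le> Z" "100 \<le> Z" "34 * n + 40 \<le> Z" using K_ge(2,3) K_le_Z n_bounds(1) unfolding L_def by linarith+
qed

lemma rank_range: "fact (Suc (2 * h + 1)) * K \<le> 2 ^ L"
proof -
  have "fact (Suc (2 * h + 1)) * K = c * K" by (simp add: c_def del: fact_Suc)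
  also have "\<dots> = \<gamma> * \<gamma> * (n * n * n)"
    unfolding K_def \<rho>_def \<gamma>_def by (simp only: power2_eq_square mult_ac)
  also have "\<dots> \<le> \<gamma> * \<gamma> * \<gamma> * (n * n * n)" using rho_ge(3) by (intro mult_le_mono1) simp
  also have "\<dots> = L ^ 3" unfolding L_def by (simp only: power3_eq_cube mult_ac)
  also have "\<dots> \<le> 2 ^ L"
  proof (rule cube_le_power2)
    have "1 * 6400 \<le> n * \<gamma>" using rho_ge(3) n_bounds(1) by (intro mult_le_mono)
    then show "10 \<le> L" unfolding L_def by (simp add: mult.commute)
  qed
  finally show ?thesis .
qed

lemma L_ge: "1 \<le> L"
proof -
  have "1 * 1 \<le> \<gamma> * n" using rho_ge(3) n_bounds(1) by (intro mult_le_mono) auto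
  then show ?thesis by (simp add: L_def)
qed

lemma Delta_ge: "1 \<le> \<Delta>"
proof -
  have "1 \<le> (80 * c) * (\<gamma> * n) * n" using L_ge c_ge n_bounds(1) unfolding L_def by simp
  then show ?thesis by (simp add: \<Delta>_def mult_ac)
qed

lemma Delta_bound: "40 * fact (Suc (2 * h + 1)) * (1 + real L) \<le> real \<Delta> * \<epsilon>"
proof -
  have "40 * fact (Suc (2 * h + 1)) * (1 + real L) \<le> 40 * real c * (2 * real L)"
    using L_ge by (intro mult_mono) (auto simp: c_def simp del: fact_Suc)
  also have "\<dots> = 80 * real c * real L * 1" by simp
  also have "\<dots> \<le> 80 * real c * real L * (\<epsilon> * n)" using n_bounds(2) by (intro mult_left_mono) auto
  also have "\<dots> = real \<Delta> * \<epsilon>" unfolding \<Delta>_def L_def by (simp only: of_nat_mult of_nat_numeral mult_ac)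
  finally show ?thesis .
qed

lemma K_bound: "40 * real (Suc h) * (1 + real d * real \<Delta>) * real d \<le> real K * \<epsilon>"
proof -
  have "1 \<le> d * \<Delta>" using d Delta_ge by simp
  then have "1 \<le> real d * real \<Delta>" by (metis of_nat_1 of_nat_le_iff of_nat_mult)
  then have "40 * real (Suc h) * (1 + real d * real \<Delta>) * real d \<le> 40 * real (Suc h) * (2 * (real d * real \<Delta>)) * real d"
    by (intro mult_right_mono mult_left_mono) auto
  also have "\<dots> = 80 * (real d)\<^sup>2 * real (h + 1) * real \<Delta> * 1" by (simp add: power2_eq_square)
  also have "\<dots> \<le> 80 * (real d)\<^sup>2 * real (h + 1) * real \<Delta> * (\<epsilon> * n)"
    using n_bounds(2) by (intro mult_left_mono) auto
  also have "\<dots> = real K * \<epsilon>" unfolding K_eq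
    by (simp only: of_nat_mult of_nat_numeral of_nat_power mult_ac)
  finally show ?thesis .
qed

text \<open>\<open>Z\<close> is a constant times \<open>c ^ 3 * d ^ 5 * (h + 1) ^ 2 * n ^ 3\<close>.
  The exponent \<open>26 * h\<close> is \<open>24 * h\<close> from the cube of \<open>c\<close> plus
  \<open>2 * h\<close> from \<open>(h + 1) ^ 2\<close>. The logarithm is at least
  \<open>1/2\<close>, as \<open>d / \<epsilon> \<ge> 2\<close>, and is inserted at the cost of a
  factor 2.\<close>

lemma Z_bound:
  "real Z \<le> 2 ^ 60 * (real d ^ 5 * real h ^ (26 * h) * ln (real d / \<epsilon>) / \<epsilon> ^ 3)"
proof -
  let ?x = "real h ^ (8 * h)"
  have monomial: "4 * d * (6400 * c * d\<^sup>2 * g * (6400 * c\<^sup>2 * d\<^sup>2 * g) * n * n * n) =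
      4 * 6400\<^sup>2 * c ^ 3 * d ^ 5 * g\<^sup>2 * n ^ 3" for d c g n :: nat
    by algebra
  have "Z = 4 * 6400\<^sup>2 * c ^ 3 * d ^ 5 * (h + 1)\<^sup>2 * n ^ 3"
    unfolding Z_def K_def \<rho>_def \<gamma>_def
    using monomial[of d c "h + 1" n] by (simp only: mult_ac)
  then have Z: "real Z = 4 * 6400\<^sup>2 * (real c ^ 3 * real d ^ 5 * real (h + 1) ^ 2 * real n ^ 3)"
    by (simp only: of_nat_mult of_nat_power of_nat_numeral mult_ac)
  have "real c \<le> real (256 * h ^ (8 * h))" using fact_le_base_power[OF h] unfolding c_def by (rule of_nat_mono)
  then have "real c ^ 3 \<le> (256 * ?x) ^ 3" by (intro power_mono) auto
  also have "\<dots> = 2 ^ 24 * real h ^ (24 * h)" by (simp add: power_mult_distrib power_mult[symmetric])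
  finally have 1: "real c ^ 3 \<le> 2 ^ 24 * real h ^ (24 * h)" .
  have "real (h + 1) ^ 2 \<le> (2 * real h) ^ 2" using h by (intro power_mono) auto
  also have "\<dots> \<le> 4 * real h ^ (2 * h)" using h power_increasing[of 2 "2 * h" "real h"] by (simp add: power_mult_distrib)
  finally have 2: "real (h + 1) ^ 2 \<le> 4 * real h ^ (2 * h)" .
  have "real n \<le> (3/2) / \<epsilon>" using n_bounds(3) \<epsilon>(1) by (simp add: field_simps)
  then have "real n ^ 3 \<le> ((3/2) / \<epsilon>) ^ 3" by (intro power_mono) auto
  also have "\<dots> = (27/8) / \<epsilon> ^ 3" by (simp add: power_divide)
  also have "\<dots> \<le> 4 / \<epsilon> ^ 3" using \<epsilon>(1) by (intro divide_right_mono) auto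
  finally have 3: "real n ^ 3 \<le> 4 / \<epsilon> ^ 3" .
  have "1 / 2 \<le> ln (2::real)" using ln2_ge_two_thirds by simp
  also have "\<dots> \<le> ln (real d / \<epsilon>)"
  proof -
    have "2 * \<epsilon> \<le> 1" using \<epsilon>(2) by simp
    also have "1 \<le> real d" using d by simp
    finally have "2 \<le> real d / \<epsilon>" using \<epsilon>(1) by (simp add: pos_le_divide_eq)
    then show ?thesis by simp
  qed
  finally have 4: "1 \<le> 2 * ln (real d / \<epsilon>)" by simp
  let ?y = "real d ^ 5 * real h ^ (26 * h) / \<epsilon> ^ 3"
  have y: "?y \<ge> 0" using \<epsilon>(1) by simp
  have "real c ^ 3 * real d ^ 5 * real (h + 1) ^ 2 * real n ^ 3 \<le>
    (2 ^ 24 * real h ^ (24 * h)) * real d ^ 5 * (4 * real h ^ (2 * h)) * (4 / \<epsilon> ^ 3)"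
    using 1 2 3 by (intro mult_mono) auto
  also have "\<dots> = 2 ^ 28 * (real d ^ 5 * (real h ^ (24 * h) * real h ^ (2 * h)) / \<epsilon> ^ 3)" by simp
  also have "real h ^ (24 * h) * real h ^ (2 * h) = real h ^ (26 * h)" by (simp add: power_add[symmetric])
  finally have "real Z \<le> 4 * 6400\<^sup>2 * (2 ^ 28 * ?y)" unfolding Z by (intro mult_left_mono) auto
  also have "\<dots> \<le> 2 ^ 59 * (?y * 1)" using y by simp
  also have "\<dots> \<le> 2 ^ 59 * (?y * (2 * ln (real d / \<epsilon>)))" using 4 y by (intro mult_left_mono) auto
  also have "\<dots> = 2 ^ 60 * (real d ^ 5 * real h ^ (26 * h) * ln (real d / \<epsilon>) / \<epsilon> ^ 3)" by simp
  finally show ?thesis .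
qed

end

lemma neighbor_lists_exist:
  assumes "fin_graph V E" shows "\<exists>nbr. neighbor_lists V E nbr"
proof -
  have "finite (neighbors E v)" for v
  proof (rule finite_subset)
    show "neighbors E v \<subseteq> V" using fin_graph_edge[OF assms] by (auto simp: neighbors_def)
    show "finite V" using assms by (simp add: fin_graph_def)
  qed
  then show ?thesis
    by (intro exI[of _ "\<lambda>v. sorted_list_of_set (neighbors E v)"]) (simp add: neighbor_lists_def)
qed

section \<open>The partition as a function of graph and coins\<close>

context partition_params
begin

text \<open>Outside its locale \<open>own\<close> takes the graph and the numbers \<open>K\<close>,
  \<open>\<Delta>\<close> and \<open>t\<close> only. One partition therefore serves all neighbour
  lists and all histories of queries.\<close>

abbreviation own_part :: "nat set \<Rightarrow> nat set set \<Rightarrow> (nat \<Rightarrow> nat) \<Rightarrow> nat \<Rightarrow> nat" where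
  "own_part V E \<equiv> machine.own V E K \<Delta> (2 * h + 1)"

lemma machine:
  assumes "fin_graph V E" "max_degree_le V E d" "neighbor_lists V E nbr"
  shows "machine V E nbr d (K + (2 * h + 1)) K L (2 * h + 1) Z"
  by unfold_locales (use assms Z_conditions K_ge in auto)

definition part :: "nat set \<Rightarrow> nat set set \<Rightarrow> (nat \<Rightarrow> bool) \<Rightarrow> nat \<Rightarrow> nat set" where
  "part V E \<omega> v = {u \<in> V. own_part V E (vrank L \<omega>) u = own_part V E (vrank L \<omega>) v}"

definition prog :: program where
  "prog = partition_prog \<gamma> (80 * c * \<gamma>) \<rho> (2 * h + 1)"

lemma part_equiv: "v \<in> V \<Longrightarrow> v \<in> part V E \<omega> v" "w \<in> part V E \<omega> v \<Longrightarrow> part V E \<omega> v = part V E \<omega> w"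
  by (simp_all add: part_def)

context
  fixes V :: "nat set" and E :: "nat set set"
  assumes G: "fin_graph V E" and deg: "max_degree_le V E d"
begin

lemma card_part: assumes "v \<in> V" shows "card (part V E \<omega> v) \<le> Z"
proof -
  from neighbor_lists_exist[OF G] obtain nbr where nbr: "neighbor_lists V E nbr" ..
  interpret machine V E nbr d \<epsilon> \<omega> "K + (2 * h + 1)" K \<Delta> L "2 * h + 1" Z
    by (rule machine[OF G deg nbr])
  have "1 \<le> K" using K_ge(4) by simp
  from card_own_le[OF assms this] have "card (part V E \<omega> v) \<le> K" unfolding part_def .
  then show ?thesis using K_le_Z by linarith
qed

lemma prob_cut_edges_part:
  assumes "treewidth V E \<le> int h"
  shows "9/10 \<le> measure coin_space {\<omega> \<in> space coin_space. real (card (cut_edges E (part V E \<omega>))) \<le> \<epsilon> * real (card V)}"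
proof -
  from neighbor_lists_exist[OF G] obtain nbr where nbr: "neighbor_lists V E nbr" ..
  interpret machine V E nbr d \<epsilon> undefined "K + (2 * h + 1)" K \<Delta> L "2 * h + 1" Z
    by (rule machine[OF G deg nbr])
  have "1 \<le> K" using K_ge(4) by simp
  have "part V E \<omega> = (\<lambda>v. {u \<in> V. own (vrank L \<omega>) u = own (vrank L \<omega>) v})" for \<omega>
    by (rule ext) (simp add: part_def)
  then show ?thesis
    using prob_few_cut_edges[OF assms refl rank_range _ Delta_ge \<open>1 \<le> K\<close> Delta_bound K_bound] \<epsilon>
    by simp
qed

lemma answers_part:
  assumes nbr: "neighbor_lists V E nbr" and v: "v \<in> V"
    and aq: "after_queries \<lparr>eps = \<epsilon>, verts = V, nbrs = nbr, coins = \<omega>\<rparr> prog Q st"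
  shows "\<exists>st' q T. answers \<lparr>eps = \<epsilon>, verts = V, nbrs = nbr, coins = \<omega>\<rparr> prog st v st' (part V E \<omega> v) q T \<and>
    q \<le> 5 * Z ^ (4 * h + 5) \<and> T \<le> 601 * Z ^ (4 * h + 6)"
proof -
  interpret machine V E nbr d \<epsilon> \<omega> "K + (2 * h + 1)" K \<Delta> L "2 * h + 1" Z
    by (rule machine[OF G deg nbr])
  note pars = \<epsilon>(1) refl Z_conditions(4) L_def \<Delta>_def K_def
  have "store_inv L \<omega> st"
    by (rule after_queries_inv[OF pars aq[unfolded prog_def]])
  from answers_main[OF pars v this]
  obtain st' q T where "answers I prog st v st' (part V E \<omega> v) q T"
    "q \<le> 5 * Z ^ (2 * (2 * h + 1) + 3)" "T \<le> 601 * Z ^ (2 * (2 * h + 1) + 4)"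
    unfolding prog_def[symmetric] part_def[symmetric] by blast
  moreover have "2 * (2 * h + 1) + 3 = 4 * h + 5" "2 * (2 * h + 1) + 4 = 4 * h + 6" by simp_all
  ultimately show ?thesis by metis
qed

text \<open>Stored ranks are addressed directly by the label of the vertex, so the time bound is the
  same after any number of queries; \<open>log 2 (real Q + 2)\<close> is at least 1.\<close>

lemma query_bounds:
  assumes "neighbor_lists V E nbr" and "v \<in> V"
    and "after_queries \<lparr>eps = \<epsilon>, verts = V, nbrs = nbr, coins = \<omega>\<rparr> prog Q st"
  shows "\<exists>st' q t. answers \<lparr>eps = \<epsilon>, verts = V, nbrs = nbr, coins = \<omega>\<rparr> prog st v st' (part V E \<omega> v) q t \<and>
    real q \<le> 5 * (real d * real Z ^ (4 * h + 7)) \<and>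
    (let B = real Z ^ (4 * h + 6) * log 2 (real Q + 2) in real t \<le> 601 * (B * log 2 (B + 2) ^ 0))"
proof -
  from answers_part[OF assms] obtain st' q T where
    a: "answers \<lparr>eps = \<epsilon>, verts = V, nbrs = nbr, coins = \<omega>\<rparr> prog st v st' (part V E \<omega> v) q T"
    and q: "q \<le> 5 * Z ^ (4 * h + 5)" and T: "T \<le> 601 * Z ^ (4 * h + 6)" by (elim exE conjE)
  have Z1: "1 \<le> real Z" using Z_conditions(3) by simp
  have "real q \<le> real (5 * Z ^ (4 * h + 5))" using q by (rule of_nat_mono)
  also have "\<dots> = 5 * (1 * real Z ^ (4 * h + 5))" by simp
  also have "\<dots> \<le> 5 * (real d * real Z ^ (4 * h + 7))"
    using d Z1 by (intro mult_left_mono mult_mono power_increasing) auto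
  finally have q': "real q \<le> 5 * (real d * real Z ^ (4 * h + 7))" .
  have "1 = log 2 (2::real)" by simp
  also have "\<dots> \<le> log 2 (real Q + 2)" by (subst log_le_cancel_iff) auto
  finally have "real Z ^ (4 * h + 6) * 1 \<le> real Z ^ (4 * h + 6) * log 2 (real Q + 2)"
    by (intro mult_left_mono) auto
  moreover have "real T \<le> real (601 * Z ^ (4 * h + 6))" using T by (rule of_nat_mono)
  ultimately have "real T \<le> 601 * (real Z ^ (4 * h + 6) * log 2 (real Q + 2))" by simp
  then show ?thesis using a q' unfolding Let_def power_0 mult_1_right by blast
qed

lemma partition_spec:
  "\<exists>f. (\<forall>\<omega>. \<forall>v\<in>V. f \<omega> v \<subseteq> V) \<and> (\<forall>\<omega>. \<forall>v\<in>V. v \<in> f \<omega> v) \<and>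
    (\<forall>\<omega>. \<forall>v\<in>V. \<forall>w\<in>f \<omega> v. f \<omega> v = f \<omega> w) \<and>
    (treewidth V E \<le> int h \<longrightarrow>
      measure coin_space {\<omega> \<in> space coin_space. real (card (cut_edges E (f \<omega>))) \<le> \<epsilon> * real (card V)} \<ge> 9/10) \<and>
    (\<forall>\<omega>. \<forall>v\<in>V. card (f \<omega> v) \<le> Z) \<and>
    (\<forall>nbr \<omega> Q st v.
      neighbor_lists V E nbr \<longrightarrow>
      (let I = \<lparr>eps = \<epsilon>, verts = V, nbrs = nbr, coins = \<omega>\<rparr> in
        after_queries I prog Q st \<longrightarrow> v \<in> V \<longrightarrow>
        (\<exists>st' q t. answers I prog st v st' (f \<omega> v) q t \<and>
          real q \<le> 5 * (real d * real Z ^ (4 * h + 7)) \<and>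
          (let B = real Z ^ (4 * h + 6) * log 2 (real Q + 2)
           in real t \<le> 601 * (B * log 2 (B + 2) ^ 0)))))"
proof (rule exI[of _ "part V E"], intro conjI allI ballI impI)
  show "part V E \<omega> v \<subseteq> V" for \<omega> v by (auto simp: part_def)
  fix nbr \<omega> Q st v assume "neighbor_lists V E nbr"
  then show "let I = \<lparr>eps = \<epsilon>, verts = V, nbrs = nbr, coins = \<omega>\<rparr> in
      after_queries I prog Q st \<longrightarrow> v \<in> V \<longrightarrow>
      (\<exists>st' q t. answers I prog st v st' (part V E \<omega> v) q t \<and>
        real q \<le> 5 * (real d * real Z ^ (4 * h + 7)) \<and>
        (let B = real Z ^ (4 * h + 6) * log 2 (real Q + 2)
         in real t \<le> 601 * (B * log 2 (B + 2) ^ 0)))"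
    unfolding Let_def[of "\<lparr>eps = \<epsilon>, verts = V, nbrs = nbr, coins = \<omega>\<rparr>"]
    using query_bounds by blast
qed (erule part_equiv card_part prob_cut_edges_part)+

end

end

theorem theorem1:
  shows "\<exists>(C\<^sub>1::real) (c\<^sub>1::nat) (C\<^sub>2::real) (C\<^sub>3::real) (c\<^sub>3::nat) (p\<^sub>3::nat).
    C\<^sub>1 > 0 \<and> C\<^sub>2 > 0 \<and> C\<^sub>3 > 0 \<and>
    (\<forall>(d::nat) (h::nat). d \<ge> 1 \<longrightarrow> h \<ge> 1 \<longrightarrow>
      (\<exists>(P::program) (k::real \<Rightarrow> nat).
        \<forall>\<epsilon>::real. 0 < \<epsilon> \<longrightarrow> \<epsilon> < 1/2 \<longrightarrow>
          real (k \<epsilon>) \<le> C\<^sub>1 * (real d ^ 5 * real h ^ (c\<^sub>1 * h) * ln (real d / \<epsilon>) / \<epsilon> ^ 3) \<and>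
          (\<forall>(V::nat set) (E::nat set set). fin_graph V E \<longrightarrow> max_degree_le V E d \<longrightarrow>
            (\<exists>f::(nat \<Rightarrow> bool) \<Rightarrow> nat \<Rightarrow> nat set.
              (\<forall>\<omega>. \<forall>v\<in>V. f \<omega> v \<subseteq> V) \<and>
              (\<forall>\<omega>. \<forall>v\<in>V. v \<in> f \<omega> v) \<and>
              (\<forall>\<omega>. \<forall>v\<in>V. \<forall>w\<in>f \<omega> v. f \<omega> v = f \<omega> w) \<and>
              (treewidth V E \<le> int h \<longrightarrow>
                measure coin_space
                  {\<omega> \<in> space coin_space. real (card (cut_edges E (f \<omega>))) \<le> \<epsilon> * real (card V)}
                  \<ge> 9/10) \<and>
              (\<forall>\<omega>. \<forall>v\<in>V. card (f \<omega> v) \<le> k \<epsilon>) \<and>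
              (\<forall>nbr \<omega> Q st v.
                neighbor_lists V E nbr \<longrightarrow>
                (let I = \<lparr>eps = \<epsilon>, verts = V, nbrs = nbr, coins = \<omega>\<rparr> in
                  after_queries I P Q st \<longrightarrow> v \<in> V \<longrightarrow>
                  (\<exists>st' q t. answers I P st v st' (f \<omega> v) q t \<and>
                    real q \<le> C\<^sub>2 * (real d * real (k \<epsilon>) ^ (4 * h + 7)) \<and>
                    (let B = real (k \<epsilon>) ^ (4 * h + c\<^sub>3) * log 2 (real Q + 2)
                     in real t \<le> C\<^sub>3 * (B * log 2 (B + 2) ^ p\<^sub>3)))))))))"
  apply (rule exI[of _ "2 ^ 60"], rule exI[of _ 26], rule exI[of _ 5], rule exI[of _ 601], rule exI[of _ 6],
      rule exI[of _ 0])
  apply (intro conjI allI impI)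
     apply simp_all[3]
  subgoal for d h
    by (rule exI[of _ "partition_params.prog d h"], rule exI[of _ "partition_params.Z d h"])
      (intro allI impI conjI partition_params.Z_bound partition_params.partition_spec partition_params.intro;
        assumption)
  done

end
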